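(* Let $\Phi=\{f_i(x)=r_iO_ix+t_i\}_{i=1}^n$ be a self-similar IFS on $\mathbb R^d$, $d\ge3$ (with $0<|r_i|<1$, $O_i\in\mathrm{SO}(d)$, $t_i\in\mathbb R^d$), let $\mathbf p$ be a strictly positive probability vector, and let $\nu=\nu_{\mathbf p}$ be the corresponding self-similar measure. Let $\mathcal A:=\{|r_i|:1\le i\le n\}$ be the set of contraction moduli. Fix $1\le k<d$ and $V\in G_{d,k}$. Let $G=\overline{\langle O_1,\dots,O_n\rangle}\subseteq\mathrm{SO}(d)$ and consider the orbit $\mathcal O_V=G\cdot V$, with its normalized $G$-invariant probability measure $m_V$. For $a\in\mathcal A$ set $I_a:=\{i:|r_i|=a\}$, $\widetilde p_a:=\sum_{i\in I_a}p_i$, and define the Markov operator on $L^2(\mathcal O_V,m_V)$ $$P_{a,V}F(W)=\sum_{i\in I_a}\frac{p_i}{\widetilde p_a}F(O_i^{-1}W).$$ Suppose $\dim_2^V\nu>k$ and that there exist $\sigma>\frac12\dim\mathcal O_V$ and $k\le s<\dim_2^V\nu$ such that $$\frac{-\log\Big(\sum_{a\in\mathcal A}\widetilde p_a\,\|P_{a,V}\|_{L^2_0(\mathcal O_V,m_V)}\Big)}{\max_i(-\log|r_i|)}>\frac{s(\dim_2^V\nu+\sigma)}{\dim_2^V\nu-s}.$$ Then $\pi_V\nu\ll\mathrm{Leb}_V$ and furthermore $\pi_V\nu\in H^{\frac{s-k}{2}}(V)$.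
   Context: $\nu_{\mathbf p}$ is the unique Borel probability measure with $\nu=\sum_ip_if_i\nu$ (push-forwards). $G_{d,k}$ is the Grassmannian of $k$-dimensional linear subspaces of $\mathbb R^d$, $\pi_V$ the orthogonal projection onto $V$, $\pi_V\nu$ the push-forward. $\mathcal O_V$ is a compact homogeneous submanifold of $G_{d,k}$ and $\dim\mathcal O_V$ is its dimension as a manifold. $L^2_0(\mathcal O_V,m_V)$ is the space of zero-mean functions in $L^2(\mathcal O_V,m_V)$; $\|P_{a,V}\|_{L^2_0}$ is the operator norm of $P_{a,V}$ restricted to it. Convention: $-\log0=+\infty$. For $W\in G_{d,k}$ let $S(W)=\{\theta\in W:|\theta|=1\}$ with normalized surface measure $\sigma_W$. With $\mathcal F_\xi(\nu)=\int e^{-2\pi i\langle x,\xi\rangle}d\nu(x)$, define for $R>0$ $$\mathcal S_{\nu,V}(R):=\int_{\mathcal O_V}\int_{S(W)}|\mathcal F_{R\theta}(\nu)|^2\,d\sigma_W(\theta)\,dm_V(W),$$ $$\dim_2^V\nu:=\sup\Big\{0\le t\le d:\int_1^\infty R^{t-1}\mathcal S_{\nu,V}(R)\,dR<\infty\Big\}.$$ (Here $G$ is always the closed group generated by the rotations of the IFS.) $H^t(V)$ is the $L^2$-Sobolev space of order $t\ge0$ on $V$. *)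

theory Defs
  imports
    "HOL-Probability.Probability"
    "HOL-Algebra.Generated_Groups"
begin

section \<open>Measures and Sobolev spaces on linear subspaces\<close>

text \<open>
  Measures on a linear subspace \<open>W\<close>, or on its unit sphere, are represented as Borel measures on the
  ambient space that are concentrated there; likewise functions on \<open>W\<close> are functions on the ambient
  space, of which only the restriction to \<open>W\<close> matters.
\<close>

definition orth_proj :: "'a::euclidean_space set \<Rightarrow> 'a \<Rightarrow> 'a" where
  "orth_proj W x = (THE y. y \<in> W \<and> (\<forall>z\<in>W. orthogonal (x - y) z))"

definition orthonormal_basis :: "'a::euclidean_space set \<Rightarrow> 'a set \<Rightarrow> bool" where
  "orthonormal_basis W B \<longleftrightarrow> pairwise orthogonal B \<and> (\<forall>b\<in>B. norm b = 1) \<and> span B = W"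

text \<open>
  The library's construction of \<^const>\<open>lborel\<close>, with the standard basis replaced by an
  orthonormal basis of \<open>W\<close>; the measure does not depend on which one is chosen.
\<close>

definition leb_on :: "'a::euclidean_space set \<Rightarrow> 'a measure" where
  "leb_on W =
     (let B = (SOME B. orthonormal_basis W B)
      in distr (\<Pi>\<^sub>M b\<in>B. lborel) borel (\<lambda>c. \<Sum>b\<in>B. c b *\<^sub>R b))"

text \<open>
  Normalized surface measure of the unit sphere of \<open>W\<close>, as defined by polar coordinates: the mass of
  \<open>A\<close> is the proportion of the unit ball of \<open>W\<close> occupied by the cone over \<open>A\<close>. Here \<open>sgn x\<close> is
  \<open>x / norm x\<close>. If \<open>W\<close> is a line, the two unit vectors get mass \<open>1/2\<close> each.
\<close>

definition sphere_measure :: "'a::euclidean_space set \<Rightarrow> 'a measure" where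
  "sphere_measure W = distr (uniform_measure (leb_on W) (cball 0 1)) borel sgn"

definition fourier :: "'a::euclidean_space measure \<Rightarrow> 'a \<Rightarrow> complex" where
  "fourier \<nu> \<xi> = (LINT x|\<nu>. exp (- 2 * pi * \<i> * (x \<bullet> \<xi>)))"

definition square_integrable :: "'b measure \<Rightarrow> ('b \<Rightarrow> complex) \<Rightarrow> bool" where
  "square_integrable M F \<longleftrightarrow> F \<in> borel_measurable M \<and> integrable M (\<lambda>x. (cmod (F x))\<^sup>2)"

definition l2norm :: "'b measure \<Rightarrow> ('b \<Rightarrow> complex) \<Rightarrow> real" where
  "l2norm M F = sqrt (LINT x|M. (cmod (F x))\<^sup>2)"

text \<open>
  \<open>g\<close> is (a version of) the Fourier--Plancherel transform of \<open>f \<in> L\<^sup>2(W)\<close>: the limit in \<open>L\<^sup>2(W)\<close> of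
  the Fourier integrals of the truncations of \<open>f\<close> to the balls of radius \<open>N\<close>.
\<close>

definition plancherel_transform ::
  "'a::euclidean_space set \<Rightarrow> ('a \<Rightarrow> complex) \<Rightarrow> ('a \<Rightarrow> complex) \<Rightarrow> bool" where
  "plancherel_transform W f g \<longleftrightarrow>
     square_integrable (leb_on W) g \<and>
     (\<lambda>N::nat. \<integral>\<^sup>+\<xi>. ennreal ((cmod (
         (LINT x|leb_on W. indicator (cball 0 (real N)) x * (exp (- 2 * pi * \<i> * (x \<bullet> \<xi>)) * f x))
         - g \<xi>))\<^sup>2) \<partial>leb_on W) \<longlonglongrightarrow> 0"

definition sobolev :: "real \<Rightarrow> 'a::euclidean_space set \<Rightarrow> ('a \<Rightarrow> complex) set" where
  "sobolev t W = {f. square_integrable (leb_on W) f \<and>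
     (\<exists>g. plancherel_transform W f g \<and>
          integrable (leb_on W) (\<lambda>\<xi>. (1 + (norm \<xi>)\<^sup>2) powr t * (cmod (g \<xi>))\<^sup>2))}"

text \<open>A measure belongs to a space of functions if it has a density belonging to it.\<close>

definition measure_in_sobolev :: "real \<Rightarrow> 'a::euclidean_space set \<Rightarrow> 'a measure \<Rightarrow> bool" where
  "measure_in_sobolev t W \<mu> \<longleftrightarrow>
     (\<exists>f. (\<forall>x. 0 \<le> f x) \<and> (\<lambda>x. complex_of_real (f x)) \<in> sobolev t W \<and>
          \<mu> = density (leb_on W) (\<lambda>x. ennreal (f x)))"


section \<open>Grassmannians, orbits and invariant measures\<close>

definition SO :: "(real^'d^'d) monoid" where
  "SO = \<lparr>carrier = {Q. rotation_matrix Q}, monoid.mult = (**), one = mat 1\<rparr>"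

definition closed_group :: "(real^'d^'d) set \<Rightarrow> (real^'d^'d) set" where
  "closed_group S = closure (generate SO S)"

definition rotate_set :: "real^'d^'d \<Rightarrow> (real^'d) set \<Rightarrow> (real^'d) set" where
  "rotate_set Q W = (\<lambda>x. Q *v x) ` W"

definition orbit_of :: "(real^'d^'d) set \<Rightarrow> (real^'d) set \<Rightarrow> (real^'d) set set" where
  "orbit_of G V = (\<lambda>Q. rotate_set Q V) ` G"

text \<open>
  The topology of the Grassmannian is the one making \<open>W \<mapsto> orth_proj W\<close> an embedding into the space
  of matrices.
\<close>

definition grassmannian :: "nat \<Rightarrow> (real^'d) set topology" where
  "grassmannian k =
     pullback_topology {W. subspace W \<and> dim W = k} (\<lambda>W. matrix (orth_proj W)) euclidean"

definition orbit_topology :: "(real^'d^'d) set \<Rightarrow> (real^'d) set \<Rightarrow> (real^'d) set topology" where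
  "orbit_topology G V = subtopology (grassmannian (dim V)) (orbit_of G V)"

definition locally_euclidean :: "nat \<Rightarrow> 'b topology \<Rightarrow> bool" where
  "locally_euclidean m X \<longleftrightarrow>
     (\<forall>x\<in>topspace X. \<exists>U U'. openin X U \<and> x \<in> U \<and> openin (Euclidean_space m) U' \<and>
        subtopology X U homeomorphic_space subtopology (Euclidean_space m) U')"

text \<open>By invariance of domain, a nonempty manifold has only one dimension.\<close>

definition manifold_dim :: "'b topology \<Rightarrow> nat" where
  "manifold_dim X = (THE m. locally_euclidean m X)"

definition invariant_prob ::
  "(real^'d^'d) set \<Rightarrow> (real^'d) set \<Rightarrow> (real^'d) set measure \<Rightarrow> bool" where
  "invariant_prob G V m \<longleftrightarrow>
     prob_space m \<and>
     sets m = sets (sigma (orbit_of G V) {U. openin (orbit_topology G V) U}) \<and>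
     (\<forall>Q\<in>G. distr m m (rotate_set Q) = m)"

definition L2_0 :: "'b measure \<Rightarrow> ('b \<Rightarrow> complex) set" where
  "L2_0 M = {F. square_integrable M F \<and> (LINT x|M. F x) = 0}"

text \<open>The infimum is \<open>0\<close> if \<open>L\<^sup>2\<^sub>0\<close> is trivial.\<close>

definition opnorm_L2_0 :: "'b measure \<Rightarrow> (('b \<Rightarrow> complex) \<Rightarrow> 'b \<Rightarrow> complex) \<Rightarrow> real" where
  "opnorm_L2_0 M T = Inf {C. 0 \<le> C \<and> (\<forall>F\<in>L2_0 M. l2norm M (T F) \<le> C * l2norm M F)}"


section \<open>Self-similar measures\<close>

definition self_similar_measure ::
  "nat \<Rightarrow> (nat \<Rightarrow> real) \<Rightarrow> (nat \<Rightarrow> 'a \<Rightarrow> 'a) \<Rightarrow> 'a::euclidean_space measure \<Rightarrow> bool" where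
  "self_similar_measure n p f \<nu> \<longleftrightarrow>
     prob_space \<nu> \<and> sets \<nu> = sets borel \<and>
     (\<forall>A\<in>sets borel. emeasure \<nu> A =
        (\<Sum>i=1..n. ennreal (p i) * emeasure (distr \<nu> borel (f i)) A))"

definition level_set :: "nat \<Rightarrow> (nat \<Rightarrow> real) \<Rightarrow> real \<Rightarrow> nat set" where
  "level_set n r a = {i\<in>{1..n}. \<bar>r i\<bar> = a}"

definition level_prob :: "nat \<Rightarrow> (nat \<Rightarrow> real) \<Rightarrow> (nat \<Rightarrow> real) \<Rightarrow> real \<Rightarrow> real" where
  "level_prob n r p a = (\<Sum>i\<in>level_set n r a. p i)"

definition markov_op ::
  "nat \<Rightarrow> (nat \<Rightarrow> real) \<Rightarrow> (nat \<Rightarrow> real) \<Rightarrow> (nat \<Rightarrow> real^'d^'d) \<Rightarrow> real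
     \<Rightarrow> ((real^'d) set \<Rightarrow> complex) \<Rightarrow> (real^'d) set \<Rightarrow> complex" where
  "markov_op n r p Q a F W =
     (\<Sum>i\<in>level_set n r a.
        complex_of_real (p i / level_prob n r p a) * F (rotate_set (matrix_inv (Q i)) W))"

text \<open>
  In the next two definitions \<open>m\<close> is the invariant probability measure of the orbit of \<open>V\<close>; it
  determines the orbit, on which the integral is taken.
\<close>

definition sphere_average :: "(real^'d) measure \<Rightarrow> (real^'d) set measure \<Rightarrow> real \<Rightarrow> real" where
  "sphere_average \<nu> m R =
     (LINT W|m. LINT \<theta>|sphere_measure W. (cmod (fourier \<nu> (R *\<^sub>R \<theta>)))\<^sup>2)"

text \<open>The supremum is taken within \<open>[0, d]\<close>, so that of the empty set is \<open>0\<close>.\<close>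

definition dim2 :: "(real^'d) measure \<Rightarrow> (real^'d) set measure \<Rightarrow> real" where
  "dim2 \<nu> m = Sup (insert 0 {t. 0 \<le> t \<and> t \<le> real CARD('d) \<and>
     (\<integral>\<^sup>+R\<in>{1..}. ennreal (R powr (t - 1) * sphere_average \<nu> m R) \<partial>lborel) < \<infinity>})"

definition neg_log :: "real \<Rightarrow> ereal" where
  "neg_log x = (if x = 0 then \<infinity> else ereal (- ln x))"

end

theory Submission
  imports Defs "HOL-Homology.Homology"
begin

text \<open>
Write \<open>F\<^sub>R(W)\<close> for the average of \<open>\<bar>\<F>\<^sub>\<xi>(\<nu>)\<bar>\<^sup>2\<close> over the sphere of radius \<open>R\<close> in \<open>W\<close>
(\<open>sphere_energy\<close>). In polar coordinates the Sobolev norm of the projection to \<open>V\<close> is, up to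
constants, \<open>\<integral> R\<^sup>s\<^sup>-\<^sup>1 F\<^sub>R(V) dR\<close>, so the theorem asserts that this integral is finite. The hypothesis
on the dimension controls the mean of \<open>F\<^sub>R\<close> over the orbit \<open>\<O>\<close> of \<open>V\<close>; the spectral hypothesis has to
transfer this to the single point \<open>V\<close> of \<open>\<O>\<close>.

Self-similarity and convexity give \<open>F\<^sub>R(W) \<le> \<Sum>\<^sub>a p\<^sub>a (P\<^sub>a F\<^sub>a\<^sub>R)(W)\<close>, where \<open>a\<close> runs through the contraction
moduli and \<open>p\<^sub>a\<close> is the weight of the level \<open>a\<close> (\<open>sphere_energy_recursion\<close>). Iterate this inequality
and stop along every branch as soon as the frequency is at most a threshold \<open>T \<le> R\<close>. The result is a
majorant of \<open>F\<^sub>R\<close> on \<open>\<O>\<close>, called \<open>stopped\<close> below, with three properties.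

The fluctuation of the majorant about its mean is small in \<open>L\<^sup>2(\<O>)\<close>: if
\<open>\<Sum>\<^sub>a p\<^sub>a \<parallel>P\<^sub>a\<parallel> \<le> r_min\<^sup>L\<close> with \<open>r_min\<close> the least modulus, every step of the iteration gains a factor
\<open>r_min\<^sup>L\<close> while the frequency is multiplied by a factor not smaller than \<open>r_min\<close>, so that the \<open>L\<^sup>2\<close> norm is at
most \<open>(T/R)\<^sup>L\<close> (\<open>fluctuation_decay\<close>).

The majorant is a convex combination of rotated copies of functions \<open>F\<^sub>u\<close> with \<open>u \<le> T\<close>. Because \<open>\<nu>\<close> has
compact support, these oscillate at scale \<open>1/T\<close> in the strong sense that all their derivatives along
the orbit are controlled. For such functions a Bernstein--Nikolskii argument bounds the supremum by
\<open>T\<^sup>\<sigma>\<close> times the \<open>L\<^sup>2\<close> norm, up to an arbitrarily high negative power of \<open>T\<close>, whenever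
\<open>\<sigma> > dim \<O> / 2\<close> (\<open>orbit_smooth_sup_bound\<close>). Hence
\<open>F\<^sub>R(V) \<le> mean + T\<^sup>-\<^sup>A + C T\<^sup>\<sigma> (T/R)\<^sup>L\<close>.

The means satisfy the same recursion without the rotations, which is a scalar renewal inequality;
integrated against a weight \<open>R\<^sup>-\<^sup>\<beta>\<^sup>-\<^sup>1\<close> with \<open>\<beta> > 0\<close> it is a geometric series, and the integral of the
means is controlled by \<open>T\<^sup>-\<^sup>\<beta>\<^sup>-\<^sup>t \<integral> R\<^sup>t\<^sup>-\<^sup>1 \<S>(R) dR\<close> (\<open>mean_integral_bound\<close>).

It remains to take \<open>T = A\<^sup>y\<close> on the block \<open>A \<le> R \<le> 2A\<close>. The means contribute a negative power of \<open>A\<close> if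
\<open>s < yt\<close>, and the fluctuations do if \<open>y(\<sigma> + L) < L - s\<close>. Such a \<open>y\<close> exists for some \<open>t < dim\<^sub>2 \<nu>\<close>
exactly because \<open>L > s(dim\<^sub>2 \<nu> + \<sigma>)/(dim\<^sub>2 \<nu> - s)\<close> (\<open>obtain_exponents\<close>); summing over dyadic blocks finishes
the estimate.

Two general ingredients take up most of the space. The first is that the orbit of a compact group of
isometries is locally Euclidean, with an explicit bound on its covering numbers in terms of its
dimension; this is what makes the manifold dimension enter the supremum bound. The tangent space
is the set of \<open>Xp\<close> with \<open>X\<close> in the Lie algebra, and the chart is the orthogonal projection to it. The
second is that a compactly supported probability measure on \<open>V\<close> with square integrable Fourier
transform has a density in \<open>L\<^sup>2\<close>, obtained by mollifying with Gaussians.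

Derivatives along the orbit are replaced throughout by finite differences along
\<open>W, QW, Q\<^sup>2W, \<dots>\<close> for rotations \<open>Q\<close> close to the identity, so that no differentiation on manifolds is
needed.
\<close>

section \<open>Iterated differences of sequences\<close>

definition fdiff :: "(nat \<Rightarrow> 'a::real_normed_vector) \<Rightarrow> nat \<Rightarrow> 'a" where
  "fdiff f = (\<lambda>k. f (Suc k) - f k)"

abbreviation fdiffs :: "nat \<Rightarrow> (nat \<Rightarrow> 'a::real_normed_vector) \<Rightarrow> nat \<Rightarrow> 'a" where
  "fdiffs j f \<equiv> (fdiff ^^ j) f"

lemma fdiffs_Suc': "fdiffs (Suc j) f = fdiffs j (fdiff f)"
  by (simp add: funpow_swap1)

lemma fdiffs_shift: "fdiffs j (\<lambda>k. f (Suc k)) k = fdiffs j f (Suc k)"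
  by (induction j arbitrary: k) (simp_all add: fdiff_def)

lemma fdiffs_add: "fdiffs j (\<lambda>k. f k + g k) k = fdiffs j f k + fdiffs j g k"
  by (induction j arbitrary: k) (simp_all add: fdiff_def)

lemma fdiffs_diff_const:
  assumes "1 \<le> j" shows "fdiffs j (\<lambda>k. f k - c) = fdiffs j f"
proof -
  obtain i where j: "j = Suc i" using assms by (cases j) auto
  have "fdiff (\<lambda>k. f k - c) = fdiff f" by (auto simp: fdiff_def)
  then show ?thesis unfolding j fdiffs_Suc' by simp
qed

lemma fdiffs_mult_left:
  fixes f :: "nat \<Rightarrow> 'a::real_normed_algebra"
  shows "fdiffs j (\<lambda>k. c * f k) k = c * fdiffs j f k"
  by (induction j arbitrary: k) (simp_all add: fdiff_def algebra_simps)

lemma fdiffs_sum: "fdiffs j (\<lambda>k. \<Sum>i\<in>I. f i k) k = (\<Sum>i\<in>I. fdiffs j (f i) k)"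
  by (induction j arbitrary: k) (simp_all add: fdiff_def sum_subtractf)

lemma fdiffs_bounded_linear:
  assumes "bounded_linear l"
  shows "fdiffs j (\<lambda>k. l (f k)) k = l (fdiffs j f k)"
  by (induction j arbitrary: k) (simp_all add: fdiff_def linear_diff[OF bounded_linear.linear[OF assms]])

lemma integral_fdiffs:
  fixes f :: "nat \<Rightarrow> 'b \<Rightarrow> 'a::{banach, second_countable_topology}"
  assumes "\<And>k. integrable M (f k)"
  shows "integrable M (\<lambda>x. fdiffs j (\<lambda>k. f k x) k)"
    and "fdiffs j (\<lambda>k. LINT x|M. f k x) k = (LINT x|M. fdiffs j (\<lambda>k. f k x) k)"
  by (induction j arbitrary: k) (simp_all add: fdiff_def assms)

text \<open>The Leibniz rule for a geometric scale \<open>l\<close>: each of the \<open>2\<^sup>J\<close> terms of \<open>\<Delta>\<^sup>J(fg)\<close> is at most \<open>a b l\<^sup>J\<close>, because the shift in the discrete product rule does not affect uniform bounds.\<close>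

lemma fdiffs_mult_bound:
  fixes f g :: "nat \<Rightarrow> 'a::real_normed_algebra"
  assumes "\<And>j k. j \<le> J \<Longrightarrow> norm (fdiffs j f k) \<le> a * l ^ j"
    and "\<And>j k. j \<le> J \<Longrightarrow> norm (fdiffs j g k) \<le> b * l ^ j"
    and "0 \<le> a" "0 \<le> b" "0 \<le> l"
  shows "norm (fdiffs J (\<lambda>k. f k * g k) k) \<le> a * b * (2 * l) ^ J"
  using assms
proof (induction J arbitrary: f g a b k)
  case 0
  have "norm (f k * g k) \<le> norm (f k) * norm (g k)" by (rule norm_mult_ineq)
  also have "\<dots> \<le> a * b" using 0(1)[of 0 k] 0(2)[of 0 k] 0(3) by (intro mult_mono) auto
  finally show ?case by simp
next
  case (Suc J)
  have split: "fdiff (\<lambda>k. f k * g k) = (\<lambda>k. fdiff f k * g (Suc k) + f k * fdiff g k)"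
    by (auto simp: fdiff_def algebra_simps)
  have 1: "norm (fdiffs J (\<lambda>k. fdiff f k * g (Suc k)) k) \<le> (a * l) * b * (2 * l) ^ J"
  proof (rule Suc.IH)
    show "norm (fdiffs j (fdiff f) k) \<le> a * l * l ^ j" if "j \<le> J" for j k
      using Suc.prems(1)[of "Suc j" k] that by (simp add: fdiffs_Suc'[symmetric] mult.assoc del: funpow.simps)
    show "norm (fdiffs j (\<lambda>k. g (Suc k)) k) \<le> b * l ^ j" if "j \<le> J" for j k
      unfolding fdiffs_shift using Suc.prems(2)[of j "Suc k"] that by simp
  qed (use Suc.prems in auto)
  have 2: "norm (fdiffs J (\<lambda>k. f k * fdiff g k) k) \<le> a * (b * l) * (2 * l) ^ J"
  proof (rule Suc.IH)
    show "norm (fdiffs j (fdiff g) k) \<le> b * l * l ^ j" if "j \<le> J" for j k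
      using Suc.prems(2)[of "Suc j" k] that by (simp add: fdiffs_Suc'[symmetric] mult.assoc del: funpow.simps)
    show "norm (fdiffs j f k) \<le> a * l ^ j" if "j \<le> J" for j k
      using Suc.prems(1)[of j k] that by simp
  qed (use Suc.prems in auto)
  have "norm (fdiffs (Suc J) (\<lambda>k. f k * g k) k) \<le> (a * l) * b * (2 * l) ^ J + a * (b * l) * (2 * l) ^ J"
    unfolding fdiffs_Suc' split fdiffs_add using 1 2 norm_triangle_mono by blast
  then show ?case by (simp add: algebra_simps)
qed

text \<open>The constants in \<open>fdiffs_cis_bound\<close>. The recursion is the one that the induction there produces. What matters is that they depend on the order \<open>J\<close> only.\<close>

fun cis_const :: "nat \<Rightarrow> real" where
  "cis_const 0 = 1"
| "cis_const (Suc J) = cis_const J + (cis_const J)\<^sup>2 * 2 ^ J"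

lemma cis_const_ge_1: "cis_const J \<ge> 1"
  by (induction J) (auto intro: add_increasing2)

lemma cis_const_mono: "i \<le> j \<Longrightarrow> cis_const i \<le> cis_const j"
  by (rule lift_Suc_mono_le[of cis_const]) auto

lemma norm_cis_diff: "norm (cis x - 1) \<le> \<bar>x\<bar>"
proof -
  have "norm (iexp x - (\<Sum>k \<le> 0. (\<i> * x)^k / fact k)) \<le> \<bar>x\<bar>^(Suc 0) / fact (Suc 0)"
    by (rule iexp_approx1)
  then show ?thesis by (simp add: cis_conv_exp)
qed

text \<open>A phase that varies slowly at scale \<open>l\<close> to all orders yields an exponential that does so too. Since \<open>\<Delta> e\<^sup>i\<^sup>u = e\<^sup>i\<^sup>u (e\<^sup>i\<^sup>\<Delta>\<^sup>u - 1)\<close>, a bound for \<open>e\<^sup>i\<^sup>u\<close> to order \<open>J + 1\<close> follows from bounds to order \<open>J\<close> for \<open>u\<close> and for \<open>\<Delta>u\<close>, the latter with \<open>m l\<close> in place of \<open>m\<close>.\<close>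

lemma fdiffs_cis_bound:
  assumes "\<And>j k. 1 \<le> j \<Longrightarrow> j \<le> J \<Longrightarrow> \<bar>fdiffs j u k\<bar> \<le> m * l ^ j"
    and "0 \<le> m" "m \<le> 1" "0 \<le> l" "l \<le> 1" "1 \<le> i" "i \<le> J"
  shows "norm (fdiffs i (\<lambda>k. cis (u k)) k) \<le> cis_const J * m * l ^ i"
  using assms
proof (induction J arbitrary: u m i k)
  case 0
  then show ?case by simp
next
  case (Suc J)
  show ?case
  proof (cases "i \<le> J")
    case True
    have "norm (fdiffs i (\<lambda>k. cis (u k)) k) \<le> cis_const J * m * l ^ i"
      using Suc.prems True by (intro Suc.IH) auto
    also have "\<dots> \<le> cis_const (Suc J) * m * l ^ i"
      using Suc.prems by (intro mult_right_mono cis_const_mono) auto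
    finally show ?thesis .
  next
    case False
    then have i: "i = Suc J" using Suc.prems by simp
    \<comment> \<open>subtracting \<open>1\<close> makes the difference of order \<open>0\<close> small as well, so the product rule gains the factor \<open>m l\<close>\<close>
    define w where "w = (\<lambda>k. cis (fdiff u k) - 1)"
    have split: "fdiff (\<lambda>k. cis (u k)) = (\<lambda>k. cis (u k) * w k)"
      by (auto simp: fdiff_def w_def algebra_simps cis_mult)
    have u': "\<bar>fdiffs j (fdiff u) k\<bar> \<le> (m * l) * l ^ j" if "j \<le> J" for j k
      using Suc.prems(1)[of "Suc j" k] that by (simp add: fdiffs_Suc'[symmetric] mult.assoc del: funpow.simps)
    have ml: "m * l \<le> 1" using Suc.prems by (simp add: mult_le_one)
    have w: "norm (fdiffs j w k) \<le> (cis_const J * (m * l)) * l ^ j" if "j \<le> J" for j k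
    proof (cases "j = 0")
      case True
      have "norm (w k) \<le> \<bar>fdiff u k\<bar>" unfolding w_def by (rule norm_cis_diff)
      also have "\<dots> \<le> m * l" using u'[of 0 k] by simp
      also have "\<dots> \<le> cis_const J * (m * l)"
        using cis_const_ge_1[of J] Suc.prems mult_right_mono[of 1 "cis_const J" "m * l"] by simp
      finally show ?thesis using True by simp
    next
      case False
      have "norm (fdiffs j (\<lambda>k. cis (fdiff u k)) k) \<le> cis_const J * (m * l) * l ^ j"
        using Suc.prems ml u' False that by (intro Suc.IH) auto
      then show ?thesis unfolding w_def using False by (subst fdiffs_diff_const) auto
    qed
    have c: "norm (fdiffs j (\<lambda>k. cis (u k)) k) \<le> cis_const J * l ^ j" if "j \<le> J" for j k
    proof (cases "j = 0")
      case True
      then show ?thesis using cis_const_ge_1[of J] by simp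
    next
      case False
      have "norm (fdiffs j (\<lambda>k. cis (u k)) k) \<le> cis_const J * m * l ^ j"
        using Suc.prems False that by (intro Suc.IH) auto
      also have "\<dots> \<le> cis_const J * 1 * l ^ j"
        using Suc.prems cis_const_ge_1[of J] by (intro mult_right_mono mult_left_mono) auto
      finally show ?thesis by simp
    qed
    have "norm (fdiffs J (\<lambda>k. cis (u k) * w k) k) \<le> cis_const J * (cis_const J * (m * l)) * (2 * l) ^ J"
      by (rule fdiffs_mult_bound) (use w c cis_const_ge_1[of J] Suc.prems in auto)
    also have "\<dots> = (cis_const J)\<^sup>2 * 2 ^ J * m * l ^ Suc J"
      by (simp add: power2_eq_square power_mult_distrib)
    also have "\<dots> \<le> cis_const (Suc J) * m * l ^ Suc J"
      using cis_const_ge_1[of J] Suc.prems by (intro mult_right_mono) auto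
    finally show ?thesis unfolding i fdiffs_Suc' split .
  qed
qed

text \<open>Over \<open>K\<close> steps the first difference changes by at most \<open>K b\<close>, so it accounts for \<open>f(k + K) - f(k)\<close> up to \<open>K\<^sup>2 b\<close>. This is the discrete form of Landau's inequality between a function and its first two derivatives.\<close>

lemma landau_difference_step:
  fixes f :: "nat \<Rightarrow> 'a::real_normed_vector"
  assumes "\<And>k. norm (f k) \<le> a" "\<And>k. norm (fdiffs 2 f k) \<le> b"
  shows "real K * norm (fdiff f k) \<le> 2 * a + (real K)\<^sup>2 * b"
proof -
  have b0: "0 \<le> b" using assms(2)[of 0] norm_ge_zero order_trans by blast
  have d1: "norm (fdiff f (k + i) - fdiff f k) \<le> i * b" for i :: nat
  proof (induction i)
    case (Suc i)
    have "norm (fdiff f (k + Suc i) - fdiff f k)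
       \<le> norm (fdiffs 2 f (k + i)) + norm (fdiff f (k + i) - fdiff f k)"
      by (rule order_trans[OF _ norm_triangle_ineq]) (simp add: numeral_2_eq_2 fdiff_def algebra_simps)
    also have "\<dots> \<le> b + i * b" using assms(2) Suc by (intro add_mono) auto
    finally show ?case by (simp add: algebra_simps)
  qed simp
  have tel: "f (k + K) - f k = (\<Sum>i<K. fdiff f (k + i))" for K
    by (induction K) (simp_all add: fdiff_def algebra_simps)
  have "real K *\<^sub>R fdiff f k = (f (k + K) - f k) - (\<Sum>i<K. fdiff f (k + i) - fdiff f k)"
    unfolding tel sum_subtractf by (simp add: scaleR_conv_of_real sum_constant_scaleR)
  then have "norm (real K *\<^sub>R fdiff f k)
      \<le> norm (f (k + K) - f k) + norm (\<Sum>i<K. fdiff f (k + i) - fdiff f k)"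
    using norm_triangle_ineq4 by metis
  also have "\<dots> \<le> (a + a) + (\<Sum>i<K. real K * b)"
  proof (intro add_mono sum_norm_le)
    show "norm (f (k + K) - f k) \<le> a + a"
      using norm_triangle_ineq4[of "f (k+K)" "f k"] assms(1)[of k] assms(1)[of "k+K"] by linarith
    show "norm (fdiff f (k + i) - fdiff f k) \<le> real K * b" if "i \<in> {..<K}" for i
      using d1[of i] that mult_right_mono[of "real i" K b] b0 by auto
  qed
  finally show ?thesis by (simp add: power2_eq_square)
qed

text \<open>A discrete Landau--Kolmogorov inequality, by induction on the order: the induction hypothesis for \<open>\<Delta>f\<close> makes the second differences small compared with the supremum of the first ones, and Landau's inequality with a suitable number of steps \<open>K\<close> compares the latter with \<open>f\<close>.\<close>

lemma small_high_difference_imp_small_difference: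
  assumes "1 \<le> J"
  shows "\<exists>\<kappa>>0. \<forall>f::nat \<Rightarrow> 'a::real_normed_vector. \<forall>M>0.
     (\<forall>k. norm (f k) \<le> M) \<longrightarrow> (\<forall>k. norm (fdiffs J f k) \<le> \<kappa> * M) \<longrightarrow> (\<forall>k. norm (fdiff f k) \<le> M / 2)"
proof -
  have *: "\<exists>\<kappa>>0. \<forall>f::nat \<Rightarrow> 'a. \<forall>M>0.
     (\<forall>k. norm (f k) \<le> M) \<longrightarrow> (\<forall>k. norm (fdiffs J f k) \<le> \<kappa> * M) \<longrightarrow> (\<forall>k. norm (fdiff f k) \<le> M / c)"
    if "c \<ge> 1" for c :: nat
    using assms that
  proof (induction J arbitrary: c rule: nat_induct_at_least)
    case base
    show ?case by (rule exI[of _ "1 / c"]) (use base in auto)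
  next
    case (Suc J)
    have "1 \<le> 16 * c" using Suc by simp
    from Suc.IH[OF this] obtain \<kappa> where k: "\<kappa> > 0"
      "\<And>f::nat \<Rightarrow> 'a. \<And>M k. M > 0 \<Longrightarrow> (\<And>k. norm (f k) \<le> M) \<Longrightarrow> (\<And>k. norm (fdiffs J f k) \<le> \<kappa> * M) \<Longrightarrow> norm (fdiff f k) \<le> M / (16 * c)"
      by auto
    show ?case
    proof (intro exI[of _ "\<kappa> / c"] conjI allI impI)
      show "0 < \<kappa> / c" using k Suc by simp
      fix f :: "nat \<Rightarrow> 'a" and M k
      assume M: "M > 0" and f: "\<forall>k. norm (f k) \<le> M" and fJ: "\<forall>k. norm (fdiffs (Suc J) f k) \<le> \<kappa> / c * M"
      define a where "a = (SUP k. norm (fdiff f k))"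
      have bdd: "bdd_above (range (\<lambda>k. norm (fdiff f k)))"
      proof (rule bdd_aboveI2)
        show "norm (fdiff f k) \<le> M + M" for k
          using norm_triangle_ineq4[of "f (Suc k)" "f k"] f by (simp add: fdiff_def) (smt (verit))
      qed
      have le_a: "norm (fdiff f k) \<le> a" for k unfolding a_def by (rule cSUP_upper[OF _ bdd]) simp
      have "a \<le> M / c"
      proof (rule ccontr)
        assume n: "\<not> a \<le> M / c"
        have c0: "0 < real c" using Suc by simp
        then have a0: "0 < a" using n M by (meson divide_pos_pos not_le order_less_trans)
        have Ma: "M < a * c" using n c0 by (simp add: field_simps)
        have "norm (fdiff (fdiff f) k) \<le> a / (16 * c)" for k
        proof (rule k(2)[OF a0 le_a])
          show "norm (fdiffs J (fdiff f) k) \<le> \<kappa> * a" for k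
          proof -
            have "norm (fdiffs (Suc J) f k) \<le> \<kappa> / c * M" using fJ by blast
            also have "\<dots> \<le> \<kappa> / c * (a * c)" using Ma k(1) c0 by (intro mult_left_mono) auto
            finally show ?thesis using c0 by (simp add: fdiffs_Suc' del: funpow.simps)
          qed
        qed
        then have 2: "norm (fdiffs 2 f k) \<le> a / (16 * c)" for k by (simp add: numeral_2_eq_2)
        have "norm (fdiff f k) \<le> 3 / 4 * a" for k
        proof -
          have "real (4 * c) * norm (fdiff f k) \<le> 2 * M + (real (4 * c))\<^sup>2 * (a / (16 * c))"
            by (rule landau_difference_step) (use f 2 in auto)
          also have "(real (4 * c))\<^sup>2 * (a / (16 * c)) = c * a" using c0 by (simp add: power2_eq_square field_simps)
          also have "2 * M + c * a \<le> 4 * c * (3 / 4 * a)" using Ma by (simp add: algebra_simps)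
          finally show ?thesis using c0 by simp
        qed
        then have "a \<le> 3 / 4 * a" unfolding a_def by (intro cSUP_least) auto
        then show False using a0 by simp
      qed
      then show "norm (fdiff f k) \<le> M / c" using le_a[of k] by linarith
    qed
  qed
  show ?thesis using *[of 2] by simp
qed

section \<open>Orthogonal projections and orthonormal bases\<close>

lemma orth_proj_unique:
  assumes "subspace W" "y \<in> W" "\<And>z. z \<in> W \<Longrightarrow> orthogonal (x - y) z"
  shows "orth_proj W x = y"
  unfolding orth_proj_def
proof (rule the_equality)
  show "y \<in> W \<and> (\<forall>z\<in>W. orthogonal (x - y) z)" using assms by blast
  fix y' assume y': "y' \<in> W \<and> (\<forall>z\<in>W. orthogonal (x - y') z)"
  have "y - y' \<in> W" using assms(1,2) y' by (simp add: subspace_diff)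
  then have "orthogonal (x - y) (y - y')" "orthogonal (x - y') (y - y')"
    using assms(3) y' by auto
  then have "(y - y') \<bullet> (y - y') = 0"
    by (simp add: orthogonal_def algebra_simps)
  then show "y' = y" by simp
qed

lemma orth_proj_exists:
  fixes x :: "'a::euclidean_space"
  assumes "subspace W" obtains y where "y \<in> W" "\<And>z. z \<in> W \<Longrightarrow> orthogonal (x - y) z"
proof -
  obtain y z where "y \<in> span W" "\<And>w. w \<in> span W \<Longrightarrow> orthogonal z w" "x = y + z"
    using orthogonal_subspace_decomp_exists[of W x] by metis
  moreover have "span W = W" using assms by (simp add: span_eq_iff)
  ultimately show ?thesis using that[of y] by simp
qed

lemma orth_proj_mem: "subspace W \<Longrightarrow> orth_proj W x \<in> W"
  and orthogonal_orth_proj: "subspace W \<Longrightarrow> z \<in> W \<Longrightarrow> orthogonal (x - orth_proj W x) z"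
  using orth_proj_exists orth_proj_unique by metis+

lemma orth_proj_inner:
  assumes "subspace W" "z \<in> W" shows "orth_proj W x \<bullet> z = x \<bullet> z"
  using orthogonal_orth_proj[OF assms, of x] by (simp add: orthogonal_def algebra_simps)

lemma orth_proj_id: "subspace W \<Longrightarrow> x \<in> W \<Longrightarrow> orth_proj W x = x"
  by (rule orth_proj_unique) (auto simp: orthogonal_def)

lemma linear_orth_proj:
  assumes W: "subspace W" shows "linear (orth_proj W)"
proof
  fix x y and c :: real
  show "orth_proj W (x + y) = orth_proj W x + orth_proj W y"
  proof (rule orth_proj_unique[OF W])
    show "orth_proj W x + orth_proj W y \<in> W" using W by (simp add: orth_proj_mem subspace_add)
    show "orthogonal (x + y - (orth_proj W x + orth_proj W y)) z" if "z \<in> W" for z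
      using orth_proj_inner[OF W that] by (simp add: orthogonal_def algebra_simps)
  qed
  show "orth_proj W (c *\<^sub>R x) = c *\<^sub>R orth_proj W x"
  proof (rule orth_proj_unique[OF W])
    show "c *\<^sub>R orth_proj W x \<in> W" using W by (simp add: orth_proj_mem subspace_scale)
    show "orthogonal (c *\<^sub>R x - c *\<^sub>R orth_proj W x) z" if "z \<in> W" for z
      using orth_proj_inner[OF W that] by (simp add: orthogonal_def algebra_simps)
  qed
qed

lemma bounded_linear_orth_proj: "subspace W \<Longrightarrow> bounded_linear (orth_proj W)"
  using linear_orth_proj linear_conv_bounded_linear by blast

lemma norm_orth_proj_le:
  assumes W: "subspace W" shows "norm (orth_proj W x) \<le> norm x"
proof -
  have "(norm (orth_proj W x))\<^sup>2 = x \<bullet> orth_proj W x"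
    using orth_proj_inner[OF W orth_proj_mem[OF W], of x x] by (simp add: power2_norm_eq_inner)
  also have "\<dots> \<le> norm x * norm (orth_proj W x)" by (rule norm_cauchy_schwarz)
  finally show ?thesis by (simp add: power2_eq_square mult_le_cancel_right)
     (metis norm_ge_zero order_antisym_conv norm_le_zero_iff linorder_le_cases)
qed

lemma orthonormal_basis_ex:
  assumes "subspace W" shows "\<exists>B. orthonormal_basis W B"
proof -
  obtain B where "B \<subseteq> W" "pairwise orthogonal B" "\<And>x. x \<in> B \<Longrightarrow> norm x = 1" "span B = W"
    by (metis orthonormal_basis_subspace[OF assms])
  then show ?thesis unfolding orthonormal_basis_def by blast
qed

lemma orthonormal_basisD:
  assumes "orthonormal_basis W B"
  shows "finite B" "independent B" "subspace W" "B \<subseteq> W" "card B = dim W" "span B = W"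
    "\<And>b c. b \<in> B \<Longrightarrow> c \<in> B \<Longrightarrow> b \<bullet> c = (if b = c then 1 else 0)"
proof -
  have B: "pairwise orthogonal B" "\<forall>b\<in>B. norm b = 1" "span B = W"
    using assms by (auto simp: orthonormal_basis_def)
  show fin: "finite B" using B(1) by (rule pairwise_orthogonal_imp_finite)
  show ind: "independent B" using B by (intro pairwise_orthogonal_independent) auto
  show "subspace W" "B \<subseteq> W" "span B = W" using B(3) span_superset by auto
  show "card B = dim W" using B(3) ind dim_span_eq_card_independent by metis
  show "b \<bullet> c = (if b = c then 1 else 0)" if "b \<in> B" "c \<in> B" for b c
  proof (cases "b = c")
    case True then show ?thesis using B(2) that by (simp add: norm_eq_1)
  next
    case False then show ?thesis using B(1) that by (auto simp: pairwise_def orthogonal_def)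
  qed
qed

lemma orthonormal_basis_inner_sum:
  assumes "orthonormal_basis W B" "b \<in> B"
  shows "(\<Sum>c\<in>B. f c *\<^sub>R c) \<bullet> b = f b"
proof -
  have "(\<Sum>c\<in>B. f c *\<^sub>R c) \<bullet> b = (\<Sum>c\<in>B. if c = b then f c else 0)"
    unfolding inner_sum_left using assms by (intro sum.cong) (auto simp: orthonormal_basisD)
  also have "\<dots> = f b" using assms(2) orthonormal_basisD(1)[OF assms(1)] by simp
  finally show ?thesis .
qed

text \<open>Coordinates with respect to an orthonormal basis of \<open>W\<close> compute the projection to \<open>W\<close> for vectors of the whole space.\<close>

lemma orthonormal_basis_expansion:
  assumes "orthonormal_basis W B"
  shows "orth_proj W x = (\<Sum>b\<in>B. (x \<bullet> b) *\<^sub>R b)"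
proof (rule orth_proj_unique)
  show W: "subspace W" using assms by (rule orthonormal_basisD)
  show "(\<Sum>b\<in>B. (x \<bullet> b) *\<^sub>R b) \<in> W"
    using orthonormal_basisD(4)[OF assms] W by (intro subspace_sum) (auto intro: subspace_scale)
  fix z assume "z \<in> W"
  then have "z \<in> span B" using assms by (simp add: orthonormal_basisD)
  moreover have "orthogonal (x - (\<Sum>b\<in>B. (x \<bullet> b) *\<^sub>R b)) b" if "b \<in> B" for b
    using orthonormal_basis_inner_sum[OF assms that] by (simp add: orthogonal_def inner_diff_left)
  ultimately show "orthogonal (x - (\<Sum>b\<in>B. (x \<bullet> b) *\<^sub>R b)) z"
    using orthogonal_to_span by blast
qed

section \<open>The Banach algebra of endomorphisms\<close>

text \<open>A copy of the type of bounded linear operators on which multiplication can be composition, so that the exponential series of real Banach algebras applies.\<close>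

typedef (overloaded) 'a endo = "UNIV :: ('a::euclidean_space \<Rightarrow>\<^sub>L 'a) set"
  morphisms blinfun_of_endo Endo ..

setup_lifting type_definition_endo

instantiation endo :: (euclidean_space) real_normed_algebra_1
begin

lift_definition zero_endo :: "'a endo" is 0 .
lift_definition one_endo :: "'a endo" is id_blinfun .
lift_definition plus_endo :: "'a endo \<Rightarrow> 'a endo \<Rightarrow> 'a endo" is "(+)" .
lift_definition minus_endo :: "'a endo \<Rightarrow> 'a endo \<Rightarrow> 'a endo" is "(-)" .
lift_definition uminus_endo :: "'a endo \<Rightarrow> 'a endo" is "uminus" .
lift_definition times_endo :: "'a endo \<Rightarrow> 'a endo \<Rightarrow> 'a endo" is "(o\<^sub>L)" .
lift_definition scaleR_endo :: "real \<Rightarrow> 'a endo \<Rightarrow> 'a endo" is "scaleR" .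
lift_definition norm_endo :: "'a endo \<Rightarrow> real" is norm .

definition dist_endo :: "'a endo \<Rightarrow> 'a endo \<Rightarrow> real" where
  "dist_endo a b = norm (a - b)"
definition sgn_endo :: "'a endo \<Rightarrow> 'a endo" where
  "sgn_endo x = inverse (norm x) *\<^sub>R x"
definition uniformity_endo :: "('a endo \<times> 'a endo) filter" where
  "uniformity_endo = (INF e\<in>{0 <..}. principal {(x, y). dist x y < e})"
definition open_endo :: "'a endo set \<Rightarrow> bool" where
  "open_endo U = (\<forall>x\<in>U. eventually (\<lambda>(x', y). x' = x \<longrightarrow> y \<in> U) uniformity)"

instance
proof
  fix a b c :: "'a endo" and r s :: real
  show "a + b + c = a + (b + c)" by transfer simp
  show "a + b = b + a" by transfer simp
  show "0 + a = a" by transfer simp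
  show "- a + a = 0" by transfer simp
  show "a - b = a + - b" by transfer simp
  show "r *\<^sub>R (a + b) = r *\<^sub>R a + r *\<^sub>R b" by transfer (simp add: scaleR_add_right)
  show "(r + s) *\<^sub>R a = r *\<^sub>R a + s *\<^sub>R a" by transfer (simp add: scaleR_add_left)
  show "r *\<^sub>R s *\<^sub>R a = (r * s) *\<^sub>R a" by transfer simp
  show "1 *\<^sub>R a = a" by transfer simp
  show "a * b * c = a * (b * c)" by transfer (rule blinfun_eqI, simp)
  show "(a + b) * c = a * c + b * c" by transfer (rule blinfun_eqI, simp add: blinfun.bilinear_simps)
  show "a * (b + c) = a * b + a * c" by transfer (rule blinfun_eqI, simp add: blinfun.bilinear_simps)
  show "r *\<^sub>R a * b = r *\<^sub>R (a * b)" by transfer (rule blinfun_eqI, simp add: blinfun.bilinear_simps)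
  show "a * r *\<^sub>R b = r *\<^sub>R (a * b)" by transfer (rule blinfun_eqI, simp add: blinfun.bilinear_simps)
  show "1 * a = a" by transfer (rule blinfun_eqI, simp)
  show "a * 1 = a" by transfer (rule blinfun_eqI, simp)
  show "(0::'a endo) \<noteq> 1"
  proof (transfer, rule notI)
    assume eq: "(0::'a \<Rightarrow>\<^sub>L 'a) = id_blinfun"
    obtain b :: 'a where "b \<in> Basis" using nonempty_Basis by blast
    moreover have "blinfun_apply id_blinfun b = blinfun_apply 0 b" using eq by simp
    ultimately show False by (simp add: nonzero_Basis)
  qed
  show "dist a b = norm (a - b)" by (rule dist_endo_def)
  show "sgn a = inverse (norm a) *\<^sub>R a" by (rule sgn_endo_def)
  show "uniformity = (INF e\<in>{0 <..}. principal {(x, y::'a endo). dist x y < e})"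
    by (rule uniformity_endo_def)
  show "open U \<longleftrightarrow> (\<forall>x\<in>U. eventually (\<lambda>(x', y). x' = x \<longrightarrow> y \<in> U) uniformity)" for U :: "'a endo set"
    by (rule open_endo_def)
  show "norm a = 0 \<longleftrightarrow> a = 0" by transfer simp
  show "norm (a + b) \<le> norm a + norm b" by transfer (rule norm_triangle_ineq)
  show "norm (r *\<^sub>R a) = \<bar>r\<bar> * norm a" by transfer simp
  show "norm (a * b) \<le> norm a * norm b" by transfer (rule norm_blinfun_compose)
  show "norm (1::'a endo) = 1" by transfer simp
qed

end

lemma bounded_endo_imp_convergent_subsequence:
  fixes X :: "nat \<Rightarrow> 'a::euclidean_space endo"
  assumes "\<And>n. norm (X n) \<le> C"
  obtains l r where "strict_mono r" "(X \<circ> r) \<longlonglongrightarrow> l"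
proof -
  have "bounded (range (\<lambda>n. blinfun_of_endo (X n)))"
    using assms by (auto simp: bounded_iff norm_endo.rep_eq)
  then obtain l r where r: "strict_mono r" "((\<lambda>n. blinfun_of_endo (X n)) \<circ> r) \<longlonglongrightarrow> l"
    using bounded_imp_convergent_subsequence by blast
  have "(X \<circ> r) \<longlonglongrightarrow> Endo l"
  proof (rule metric_LIMSEQ_I)
    fix e :: real assume "e > 0"
    then obtain N where "\<And>n. n \<ge> N \<Longrightarrow> dist (blinfun_of_endo (X (r n))) l < e"
      using metric_LIMSEQ_D[OF r(2), of e] by auto
    then show "\<exists>N. \<forall>n\<ge>N. dist ((X \<circ> r) n) (Endo l) < e"
      by (auto simp: dist_norm norm_endo.rep_eq minus_endo.rep_eq Endo_inverse)
  qed
  then show ?thesis using that r by blast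
qed

instance endo :: (euclidean_space) banach
proof
  fix X :: "nat \<Rightarrow> 'a endo" assume X: "Cauchy X"
  then have "bounded (range X)" by (rule cauchy_imp_bounded)
  then obtain C where "\<And>n. norm (X n) \<le> C" by (auto simp: bounded_iff)
  then obtain l r where "strict_mono r" "(X \<circ> r) \<longlonglongrightarrow> l"
    by (rule bounded_endo_imp_convergent_subsequence)
  with X have "X \<longlonglongrightarrow> l" by (metis Cauchy_converges_subseq)
  then show "convergent X" by (auto simp: convergent_def)
qed

lift_definition app :: "'a::euclidean_space endo \<Rightarrow> 'a \<Rightarrow> 'a" is blinfun_apply .

lemma bounded_bilinear_app: "bounded_bilinear app"
proof (rule bounded_bilinear.intro)
  show "\<exists>K. \<forall>a b. norm (app a b) \<le> norm a * norm b * K"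
    by (rule exI[of _ 1]) (transfer, simp add: norm_blinfun)
qed (transfer, simp add: blinfun.bilinear_simps)+

interpretation app: bounded_bilinear app by (rule bounded_bilinear_app)

lemma norm_app_le: "norm (app a x) \<le> norm a * norm x"
  by transfer (rule norm_blinfun)

lemma app_1 [simp]: "app 1 x = x" by transfer simp
lemma app_mult: "app (a * b) x = app a (app b x)" by transfer simp

lemma endo_eqI: "(\<And>x. app a x = app b x) \<Longrightarrow> a = b"
  by transfer (rule blinfun_eqI)

lemma endo_norm_bound: "0 \<le> C \<Longrightarrow> (\<And>x. norm (app a x) \<le> C * norm x) \<Longrightarrow> norm a \<le> C"
  by transfer (rule norm_blinfun_bound)

lemma endo_of_linear:
  assumes "linear f" obtains a where "app a = f"
proof
  show "app (Endo (Blinfun f)) = f"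
    using assms by (simp add: app.rep_eq Endo_inverse bounded_linear_Blinfun_apply linear_conv_bounded_linear)
qed

text \<open>Termwise comparison with the real exponential series.\<close>

lemma norm_exp_diff_first_order:
  fixes x :: "'a::{real_normed_algebra_1, banach}"
  assumes "norm x \<le> 1"
  shows "norm (exp x - 1 - x) \<le> (norm x)\<^sup>2"
proof -
  have eq: "exp x - 1 - x = suminf (\<lambda>n. inverse (fact (n + 2)) *\<^sub>R (x ^ (n + 2)))"
    by (simp add: exp_first_two_terms)
  have sm: "summable (\<lambda>n. inverse (fact (n + 2)) *\<^sub>R (norm x ^ (n + 2)))"
    using summable_exp_generic[of "norm x"] by (subst summable_iff_shift) auto
  have "norm (suminf (\<lambda>n. inverse (fact (n + 2)) *\<^sub>R (x ^ (n + 2)))) \<le> suminf (\<lambda>n. inverse (fact (n + 2)) *\<^sub>R (norm x ^ (n + 2)))"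
    by (rule norm_suminf_le[OF _ sm]) (auto intro!: mult_left_mono norm_power_ineq simp del: power_Suc power_add)
  also have "\<dots> = exp (norm x) - 1 - norm x" by (simp add: exp_first_two_terms[of "norm x"])
  also have "\<dots> \<le> (norm x)\<^sup>2" using exp_bound[of "norm x"] assms by simp
  finally show ?thesis unfolding eq .
qed

lemma continuous_on_exp_banach_algebra:
  "continuous_on UNIV (exp :: 'a::{real_normed_algebra_1, banach} \<Rightarrow> 'a)"
proof -
  have "continuous_on (ball 0 r) (exp :: 'a \<Rightarrow> 'a)" for r :: real
  proof -
    have "uniform_limit (ball 0 r) (\<lambda>n x. \<Sum>i<n. inverse (fact i) *\<^sub>R (x ^ i)) (\<lambda>x::'a. suminf (\<lambda>i. inverse (fact i) *\<^sub>R (x ^ i))) sequentially"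
    proof (rule Weierstrass_m_test)
      show "summable (\<lambda>i. inverse (fact i) * \<bar>r\<bar> ^ i)" using summable_exp[of "\<bar>r\<bar>"] by simp
      fix n and x :: 'a assume "x \<in> ball 0 r"
      then have "norm (x ^ n) \<le> \<bar>r\<bar> ^ n"
        by (intro order_trans[OF norm_power_ineq] power_mono) auto
      then show "norm (inverse (fact n) *\<^sub>R (x ^ n)) \<le> inverse (fact n) * \<bar>r\<bar> ^ n" by (simp add: mult_left_mono)
    qed
    then show ?thesis unfolding exp_def
      by (rule uniform_limit_theorem[rotated]) (auto intro!: always_eventually continuous_intros)
  qed
  then have "continuous_on (\<Union>r\<in>(UNIV::real set). ball 0 r) (exp :: 'a \<Rightarrow> 'a)"
    by (intro continuous_on_open_UN) auto
  moreover have "(\<Union>r\<in>(UNIV::real set). ball (0::'a) r) = UNIV" by (auto intro: gt_ex)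
  ultimately show ?thesis by simp
qed

lemma app_exp_fixed:
  assumes "app X p = 0" shows "app (exp X) p = p"
proof -
  have sm: "summable (\<lambda>n. inverse (fact (Suc n)) *\<^sub>R X ^ Suc n)"
    using summable_exp_generic[of X] by (subst summable_Suc_iff)
  have "app (X ^ Suc n) p = 0" for n
    using assms by (simp add: power_Suc2 app_mult app.zero_right del: power_Suc)
  then have "app (suminf (\<lambda>n. inverse (fact (Suc n)) *\<^sub>R X ^ Suc n)) p = 0"
    by (subst bounded_linear.suminf[OF app.bounded_linear_left sm]) (simp add: app.scaleR_left del: power_Suc)
  then show ?thesis using exp_first_term[of X] by (simp add: app.add_left del: power_Suc)
qed

section \<open>Compact groups of isometries and their Lie algebras\<close>

text \<open>Telescoping. The point is that the bound is linear in \<open>n\<close>: one factor is a contraction and the powers of the other are bounded uniformly.\<close>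

lemma norm_power_diff_le:
  fixes a b :: "'a::real_normed_algebra_1"
  assumes "norm a \<le> 1" "\<And>k. k \<le> n \<Longrightarrow> norm (b ^ k) \<le> C"
  shows "norm (a ^ n - b ^ n) \<le> n * C * norm (a - b)"
  using assms(2)
proof (induction n)
  case (Suc n)
  have C: "0 \<le> C" using Suc.prems[of 0] by simp
  have "a ^ Suc n - b ^ Suc n = a * (a ^ n - b ^ n) + (a - b) * b ^ n"
    by (simp add: algebra_simps)
  also have "norm \<dots> \<le> norm a * norm (a ^ n - b ^ n) + norm (a - b) * norm (b ^ n)"
    using norm_triangle_mono norm_mult_ineq by blast
  also have "\<dots> \<le> 1 * (n * C * norm (a - b)) + norm (a - b) * C"
    using assms(1) Suc C by (intro add_mono mult_mono) auto
  finally show ?case by (simp add: algebra_simps)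
qed simp

lemma exp_scaleR_of_nat:
  fixes x :: "'a::{real_normed_algebra_1, banach}"
  shows "exp (real k *\<^sub>R x) = exp x ^ k"
proof (induction k)
  case (Suc k)
  have "exp (x + real k *\<^sub>R x) = exp x * exp (real k *\<^sub>R x)"
    by (rule exp_add_commuting) simp
  then show ?case using Suc by (simp add: algebra_simps)
qed simp

locale compact_isometry_group =
  fixes K :: "'a::euclidean_space endo set"
  assumes compact: "compact K"
    and one: "1 \<in> K"
    and mult: "a \<in> K \<Longrightarrow> b \<in> K \<Longrightarrow> a * b \<in> K"
    and inverse: "a \<in> K \<Longrightarrow> \<exists>b\<in>K. b * a = 1 \<and> a * b = 1"
    and isometry: "a \<in> K \<Longrightarrow> norm (app a x) = norm x"
begin

lemma norm_le_1: "a \<in> K \<Longrightarrow> norm a \<le> 1"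
  by (rule endo_norm_bound) (auto simp: isometry)

lemma closed: "closed K" using compact by (rule compact_imp_closed)

lemma power: "a \<in> K \<Longrightarrow> a ^ n \<in> K"
  by (induction n) (auto intro: one mult)

text \<open>The engine of Cartan's closed subgroup theorem: if \<open>c\<^sub>j(r\<^sub>j - 1) \<rightarrow> X\<close> with \<open>c\<^sub>j \<rightarrow> \<infinity>\<close>, then \<open>r\<^sub>j\<close> raised to the integer part of \<open>c\<^sub>j\<close> tends to \<open>exp X\<close>, and these powers stay in the closed set \<open>K\<close>.\<close>

lemma exp_of_scaled_limit:
  assumes r: "\<And>j. r j \<in> K" and c: "filterlim c at_top sequentially"
    and X: "(\<lambda>j. c j *\<^sub>R (r j - 1)) \<longlonglongrightarrow> X"
  shows "exp X \<in> K"
proof -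
  define n where "n j = nat \<lfloor>c j\<rfloor>" for j
  have c0: "eventually (\<lambda>j. c j \<ge> 1) sequentially"
    using c by (simp add: filterlim_at_top)
  have n_c: "eventually (\<lambda>j. real (n j) \<le> c j \<and> c j \<le> real (n j) + 1 \<and> n j \<noteq> 0) sequentially"
    using c0
  proof eventually_elim
    case (elim j)
    then have "real (n j) = of_int \<lfloor>c j\<rfloor>" "1 \<le> \<lfloor>c j\<rfloor>" by (auto simp: n_def le_floor_iff)
    then show ?case by linarith
  qed
  have n_top: "filterlim (\<lambda>j. real (n j)) at_top sequentially"
  proof (rule filterlim_at_top_mono)
    show "filterlim (\<lambda>j. - 1 + c j) at_top sequentially"
      using c by (rule filterlim_tendsto_add_at_top[OF tendsto_const])
    show "eventually (\<lambda>j. - 1 + c j \<le> real (n j)) sequentially"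
      using n_c by eventually_elim auto
  qed
  have ic: "(\<lambda>j. 1 / c j) \<longlonglongrightarrow> 0"
    using c by (simp add: inverse_eq_divide[symmetric] tendsto_inverse_0_at_top)
  have "(\<lambda>j. (1 / c j) *\<^sub>R (c j *\<^sub>R (r j - 1))) \<longlonglongrightarrow> 0 *\<^sub>R X"
    by (intro tendsto_scaleR ic X)
  then have "(\<lambda>j. (1 / c j) *\<^sub>R (c j *\<^sub>R (r j - 1))) \<longlonglongrightarrow> 0" by simp
  then have r1: "(\<lambda>j. r j - 1) \<longlonglongrightarrow> 0"
    by (rule Lim_transform_eventually) (use c0 in \<open>auto elim!: eventually_mono\<close>)
  have "(\<lambda>j. (c j - real (n j)) *\<^sub>R (r j - 1)) \<longlonglongrightarrow> 0"
  proof (rule Lim_null_comparison)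
    show "eventually (\<lambda>j. norm ((c j - real (n j)) *\<^sub>R (r j - 1)) \<le> norm (r j - 1)) sequentially"
      using n_c by eventually_elim (auto intro!: mult_left_le_one_le)
    show "(\<lambda>j. norm (r j - 1)) \<longlonglongrightarrow> 0" using r1 by (rule tendsto_norm_zero)
  qed
  from tendsto_diff[OF X this] have nX: "(\<lambda>j. real (n j) *\<^sub>R (r j - 1)) \<longlonglongrightarrow> X"
    by (simp add: algebra_simps)
  define Y where "Y j = (1 / real (n j)) *\<^sub>R X" for j
  have "(\<lambda>j. r j ^ n j - exp X) \<longlonglongrightarrow> 0"
  proof (rule Lim_null_comparison)
    have "eventually (\<lambda>j. norm X + 1 \<le> real (n j)) sequentially"
      using n_top by (simp add: filterlim_at_top)
    then show "eventually (\<lambda>j. norm (r j ^ n j - exp X)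
       \<le> exp (norm X) * norm (real (n j) *\<^sub>R (r j - 1) - X) + exp (norm X) * ((norm X)\<^sup>2 * (1 / real (n j)))) sequentially"
    proof eventually_elim
      case (elim j)
      then have nj: "real (n j) > 0" using norm_ge_zero[of X] by linarith
      have exp_Y: "exp (real k *\<^sub>R Y j) = exp (Y j) ^ k" for k
        by (rule exp_scaleR_of_nat)
      have "norm (r j ^ n j - exp (Y j) ^ n j) \<le> n j * exp (norm X) * norm (r j - exp (Y j))"
      proof (rule norm_power_diff_le)
        show "norm (r j) \<le> 1" using r by (rule norm_le_1)
        fix k assume k: "k \<le> n j"
        have "norm (exp (Y j) ^ k) \<le> exp (norm (real k *\<^sub>R Y j))" unfolding exp_Y[symmetric] by (rule norm_exp)
        also have "\<dots> \<le> exp (norm X)"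
          using nj k mult_right_mono[of "real k" "real (n j)" "norm X"] by (simp add: Y_def divide_simps mult.commute)
        finally show "norm (exp (Y j) ^ k) \<le> exp (norm X)" .
      qed
      also have "norm (r j - exp (Y j)) \<le> norm (r j - 1 - Y j) + norm (exp (Y j) - 1 - Y j)"
        using norm_triangle_ineq4[of "r j - 1 - Y j" "exp (Y j) - 1 - Y j"] by simp
      also have "norm (exp (Y j) - 1 - Y j) \<le> (norm (Y j))\<^sup>2"
        by (rule norm_exp_diff_first_order) (use elim nj in \<open>simp add: Y_def\<close>)
      also have "real (n j) * exp (norm X) * (norm (r j - 1 - Y j) + (norm (Y j))\<^sup>2)
         = exp (norm X) * (real (n j) * norm (r j - 1 - Y j)) + exp (norm X) * (real (n j) * (norm (Y j))\<^sup>2)"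
        by (simp add: distrib_left mult.assoc mult.left_commute)
      also have "real (n j) * (norm (Y j))\<^sup>2 = (norm X)\<^sup>2 * (1 / real (n j))"
        using nj by (simp add: Y_def power2_eq_square field_simps)
      also have "real (n j) * norm (r j - 1 - Y j) = norm (real (n j) *\<^sub>R (r j - 1 - Y j))" by simp
      also have "real (n j) *\<^sub>R (r j - 1 - Y j) = real (n j) *\<^sub>R (r j - 1) - X"
        using nj by (simp add: Y_def algebra_simps)
      also have "exp (Y j) ^ n j = exp X"
        unfolding exp_Y[symmetric] using nj by (simp add: Y_def)
      finally show ?case using nj by (simp add: mult_left_mono)
    qed
    have a: "(\<lambda>j. 1 / real (n j)) \<longlonglongrightarrow> 0"
      using n_top by (simp add: inverse_eq_divide[symmetric] tendsto_inverse_0_at_top)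
    have b: "(\<lambda>j. norm (real (n j) *\<^sub>R (r j - 1) - X)) \<longlonglongrightarrow> 0"
      using nX by (simp add: LIM_zero_iff tendsto_norm_zero_iff)
    have "(\<lambda>j. exp (norm X) * norm (real (n j) *\<^sub>R (r j - 1) - X)
        + exp (norm X) * ((norm X)\<^sup>2 * (1 / real (n j)))) \<longlonglongrightarrow> exp (norm X) * 0 + exp (norm X) * ((norm X)\<^sup>2 * 0)"
      by (rule tendsto_add[OF tendsto_mult[OF tendsto_const b] tendsto_mult[OF tendsto_const tendsto_mult[OF tendsto_const a]]])
    then show "(\<lambda>j. exp (norm X) * norm (real (n j) *\<^sub>R (r j - 1) - X)
        + exp (norm X) * ((norm X)\<^sup>2 * (1 / real (n j)))) \<longlonglongrightarrow> 0" by simp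
  qed
  then have "(\<lambda>j. r j ^ n j) \<longlonglongrightarrow> exp X" by (simp add: LIM_zero_iff)
  then show ?thesis by (rule closed_sequentially[OF closed power[OF r]])
qed

definition lie_algebra :: "'a endo set" where
  "lie_algebra = {X. \<forall>t. exp (t *\<^sub>R X) \<in> K}"

text \<open>All positive multiples of \<open>X\<close> are limits of the same kind; negative multiples are covered by inverses in \<open>K\<close>.\<close>

lemma lie_algebra_of_scaled_limit:
  assumes r: "\<And>j. r j \<in> K" and c: "filterlim c at_top sequentially"
    and X: "(\<lambda>j. c j *\<^sub>R (r j - 1)) \<longlonglongrightarrow> X"
  shows "X \<in> lie_algebra"
proof -
  have pos: "exp (t *\<^sub>R X) \<in> K" if "t > 0" for t
  proof (rule exp_of_scaled_limit[OF r])
    show "filterlim (\<lambda>j. t * c j) at_top sequentially"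
      using c that by (rule filterlim_tendsto_pos_mult_at_top[OF tendsto_const, rotated])
    show "(\<lambda>j. (t * c j) *\<^sub>R (r j - 1)) \<longlonglongrightarrow> t *\<^sub>R X"
      using tendsto_scaleR[OF tendsto_const X, of t] by simp
  qed
  have "exp (t *\<^sub>R X) \<in> K" for t
  proof -
    consider "t > 0" | "t = 0" | "t < 0" by linarith
    then show ?thesis
    proof cases
      case 3
      then have "exp (- t *\<^sub>R X) \<in> K" using pos[of "- t"] by simp
      then obtain b where b: "b \<in> K" "b * exp (- t *\<^sub>R X) = 1" using inverse by blast
      have "b = b * (exp (- t *\<^sub>R X) * exp (t *\<^sub>R X))"
        using exp_minus_inverse[of "- t *\<^sub>R X"] by simp
      also have "\<dots> = exp (t *\<^sub>R X)" using b(2) by (simp add: mult.assoc[symmetric])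
      finally show ?thesis using b(1) by simp
    qed (use pos one in auto)
  qed
  then show ?thesis by (simp add: lie_algebra_def)
qed

lemma lie_algebra_exp_derivative:
  "(\<lambda>n. real (Suc n) *\<^sub>R (exp ((1 / real (Suc n)) *\<^sub>R X) - 1)) \<longlonglongrightarrow> (X::'a endo)"
proof -
  have "(\<lambda>n. real (Suc n) *\<^sub>R (exp ((1 / real (Suc n)) *\<^sub>R X) - 1) - X) \<longlonglongrightarrow> 0"
  proof (rule Lim_null_comparison)
    have "eventually (\<lambda>n. norm X \<le> real n) sequentially"
      using filterlim_real_sequentially by (simp add: filterlim_at_top)
    then show "eventually (\<lambda>n. norm (real (Suc n) *\<^sub>R (exp ((1 / real (Suc n)) *\<^sub>R X) - 1) - X)
        \<le> (norm X)\<^sup>2 * (1 / real (Suc n))) sequentially"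
    proof eventually_elim
      case (elim n)
      let ?Y = "(1 / real (Suc n)) *\<^sub>R X"
      have "norm (exp ?Y - 1 - ?Y) \<le> (norm ?Y)\<^sup>2"
        by (rule norm_exp_diff_first_order) (use elim in \<open>simp add: divide_simps\<close>)
      then have "real (Suc n) * norm (exp ?Y - 1 - ?Y) \<le> real (Suc n) * (norm ?Y)\<^sup>2"
        by (rule mult_left_mono) simp
      also have "\<dots> = (norm X)\<^sup>2 * (1 / real (Suc n))" by (simp add: power2_eq_square del: of_nat_Suc)
      also have "real (Suc n) * norm (exp ?Y - 1 - ?Y) = norm (real (Suc n) *\<^sub>R (exp ?Y - 1 - ?Y))" by simp
      also have "real (Suc n) *\<^sub>R (exp ?Y - 1 - ?Y) = real (Suc n) *\<^sub>R (exp ?Y - 1) - X"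
        by (simp add: scaleR_diff_right del: of_nat_Suc)
      finally show ?case .
    qed
    have "(\<lambda>n. 1 / real (Suc n)) \<longlonglongrightarrow> 0" using LIMSEQ_inverse_real_of_nat by (simp add: inverse_eq_divide)
    from tendsto_mult[OF tendsto_const this] show "(\<lambda>n. (norm X)\<^sup>2 * (1 / real (Suc n))) \<longlonglongrightarrow> 0" by (metis mult_zero_right)
  qed
  then show ?thesis by (simp add: LIM_zero_iff)
qed

text \<open>Closure under addition: \<open>exp(X/n) exp(Y/n)\<close> lies in \<open>K\<close> and differs from \<open>1\<close> by \<open>(X + Y)/n\<close> to first order, so \<open>X + Y\<close> is a scaled limit.\<close>

lemma subspace_lie_algebra: "subspace lie_algebra"
proof (rule subspaceI)
  show "0 \<in> lie_algebra" by (simp add: lie_algebra_def one)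
  show "c *\<^sub>R X \<in> lie_algebra" if "X \<in> lie_algebra" for c X
    using that by (simp add: lie_algebra_def)
  fix X Y assume XY: "X \<in> lie_algebra" "Y \<in> lie_algebra"
  let ?e = "\<lambda>(X::'a endo) n. exp ((1 / real (Suc n)) *\<^sub>R X)"
  let ?c = "\<lambda>n. real (Suc n)"
  have Y1: "(\<lambda>n. ?e Y n) \<longlonglongrightarrow> 1"
  proof -
    have "(\<lambda>n. 1 / real (Suc n)) \<longlonglongrightarrow> 0" using LIMSEQ_inverse_real_of_nat by (simp add: inverse_eq_divide)
    from tendsto_scaleR[OF this lie_algebra_exp_derivative[of Y]]
    have "(\<lambda>n. ?e Y n - 1) \<longlonglongrightarrow> 0" by (simp del: of_nat_Suc)
    then show ?thesis by (simp add: LIM_zero_iff)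
  qed
  show "X + Y \<in> lie_algebra"
  proof (rule lie_algebra_of_scaled_limit)
    show "?e X n * ?e Y n \<in> K" for n using XY by (auto simp: lie_algebra_def intro!: mult)
    show "filterlim ?c at_top sequentially"
      using filterlim_real_sequentially filterlim_sequentially_Suc[of real at_top] by blast
    have "(\<lambda>n. (?c n *\<^sub>R (?e X n - 1)) * ?e Y n + ?c n *\<^sub>R (?e Y n - 1)) \<longlonglongrightarrow> X * 1 + Y"
      by (intro tendsto_add tendsto_mult lie_algebra_exp_derivative Y1)
    then show "(\<lambda>n. ?c n *\<^sub>R (?e X n * ?e Y n - 1)) \<longlonglongrightarrow> X + Y"
      by (simp add: algebra_simps del: of_nat_Suc)
  qed
qed

definition orbit :: "'a \<Rightarrow> 'a set" where "orbit p = (\<lambda>a. app a p) ` K"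

lemma compact_orbit: "compact (orbit p)"
  unfolding orbit_def
  by (intro compact_continuous_image compact bounded_linear.continuous_on[OF app.bounded_linear_left] continuous_on_id)

lemma orbit_closed: "A \<in> orbit p \<Longrightarrow> a \<in> K \<Longrightarrow> app a A \<in> orbit p"
  unfolding orbit_def by (auto simp: app_mult[symmetric] intro: mult)

lemma minimal_lift:
  assumes "A \<in> orbit p"
  obtains a where "a \<in> K" "app a p = A" "\<And>b. b \<in> K \<Longrightarrow> app b p = A \<Longrightarrow> norm (a - 1) \<le> norm (b - 1)"
proof -
  let ?S = "K \<inter> (\<lambda>a. app a p) -` {A}"
  have "closed ((\<lambda>a. app a p) -` {A})"
    by (intro continuous_closed_vimage closed_singleton)
       (simp add: bounded_linear.isCont[OF app.bounded_linear_left])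
  then have "compact ?S" by (rule compact_Int_closed[OF compact])
  moreover have "?S \<noteq> {}" using assms by (auto simp: orbit_def)
  ultimately obtain a where "a \<in> ?S" "\<forall>b\<in>?S. norm (a - 1) \<le> norm (b - 1)"
    using continuous_attains_inf[OF _ _ continuous_on_norm[OF continuous_on_diff[OF continuous_on_id continuous_on_const]]]
    by metis
  then show ?thesis using that by auto
qed

text \<open>Nearby points of an orbit are connected by nearby group elements. Otherwise choose for \<open>A\<^sub>n \<rightarrow> p\<close> the group elements \<open>R\<^sub>n\<close> closest to \<open>1\<close> with \<open>R\<^sub>n p = A\<^sub>n\<close>, and let \<open>e\<^sub>n = \<parallel>R\<^sub>n - 1\<parallel>\<close>. A limit \<open>X\<close> of the directions \<open>(R\<^sub>n - 1)/e\<^sub>n\<close> lies in the Lie algebra and, as \<open>\<parallel>A\<^sub>n - p\<parallel>/e\<^sub>n \<rightarrow> 0\<close>, kills \<open>p\<close>. Then \<open>R\<^sub>n exp(-e\<^sub>n X)\<close> also carries \<open>p\<close> to \<open>A\<^sub>n\<close> but is closer to \<open>1\<close>, which contradicts the choice of \<open>R\<^sub>n\<close>.\<close>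

lemma orbit_lipschitz_lift:
  shows "\<exists>C>0. \<forall>A\<in>orbit p. \<exists>a\<in>K. app a p = A \<and> norm (a - 1) \<le> C * norm (A - p)"
proof (rule ccontr)
  assume no: "\<not> ?thesis"
  have "\<exists>A\<in>orbit p. \<forall>a\<in>K. app a p = A \<longrightarrow> norm (a - 1) > real (Suc n) * norm (A - p)" for n
    using no of_nat_0_less_iff[of "Suc n"] by (meson not_le zero_less_Suc)
  then obtain A where A: "\<And>n. A n \<in> orbit p"
    "\<And>n a. a \<in> K \<Longrightarrow> app a p = A n \<Longrightarrow> norm (a - 1) > real (Suc n) * norm (A n - p)" by metis
  have "\<exists>a. a \<in> K \<and> app a p = A n \<and> (\<forall>b. b \<in> K \<longrightarrow> app b p = A n \<longrightarrow> norm (a - 1) \<le> norm (b - 1))" for n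
    using minimal_lift[OF A(1)[of n]] by metis
  then obtain R where R: "\<And>n. R n \<in> K" "\<And>n. app (R n) p = A n"
    "\<And>n b. b \<in> K \<Longrightarrow> app b p = A n \<Longrightarrow> norm (R n - 1) \<le> norm (b - 1)" by metis
  define e where "e n = norm (R n - 1)" for n
  have e_gt: "e n > real (Suc n) * norm (A n - p)" for n using A(2)[OF R(1,2)] by (simp add: e_def)
  have e_pos: "e n > 0" for n using e_gt[of n] by (meson le_less_trans mult_nonneg_nonneg norm_ge_zero of_nat_0_le_iff)
  obtain f L where f: "strict_mono f" "(R \<circ> f) \<longlonglongrightarrow> L" "L \<in> K"
    using compact R(1) unfolding compact_def by metis
  define U where "U n = (1 / e n) *\<^sub>R (R n - 1)" for n
  have "norm (U n) = 1" for n using e_pos[of n] by (simp add: U_def e_def)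
  then have "\<And>n. norm ((U \<circ> f) n) \<le> 1" by simp
  then obtain X g where g: "strict_mono g" "((U \<circ> f) \<circ> g) \<longlonglongrightarrow> X"
    by (rule bounded_endo_imp_convergent_subsequence)
  define h where "h = f \<circ> g"
  have h: "strict_mono h" using f g by (simp add: h_def strict_mono_o)
  have Rh: "(\<lambda>n. R (h n)) \<longlonglongrightarrow> L" using LIMSEQ_subseq_LIMSEQ[OF f(2) g(1)] by (simp add: h_def comp_def)
  have Uh: "(\<lambda>n. U (h n)) \<longlonglongrightarrow> X" using g(2) by (simp add: h_def comp_def)
  have nX: "norm X = 1"
    using tendsto_norm[OF Uh] \<open>\<And>n. norm (U n) = 1\<close> by (simp add: LIMSEQ_const_iff)
  have small: "norm (A (h n) - p) / e (h n) \<le> 1 / real (Suc n)" for n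
  proof -
    have "real (Suc n) * norm (A (h n) - p) \<le> real (Suc (h n)) * norm (A (h n) - p)"
      using seq_suble[OF h, of n] by (intro mult_right_mono) auto
    also have "\<dots> \<le> e (h n)" using e_gt[of "h n"] by simp
    finally show ?thesis using e_pos[of "h n"] by (simp add: field_simps)
  qed
  have inv0: "(\<lambda>n. 1 / real (Suc n)) \<longlonglongrightarrow> 0" using LIMSEQ_inverse_real_of_nat by (simp add: inverse_eq_divide)
  have "0 \<le> norm (A (h n) - p) / e (h n)" for n using e_pos[of "h n"] by simp
  then have small0: "(\<lambda>n. norm (A (h n) - p) / e (h n)) \<longlonglongrightarrow> 0"
    by (intro tendsto_sandwich[OF _ _ tendsto_const inv0])
       (use small in \<open>auto intro!: always_eventually simp del: of_nat_Suc\<close>)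
  have e_le: "e n \<le> 2" for n
    using norm_triangle_ineq4[of "R n" 1] norm_le_1[OF R(1)[of n]] by (simp add: e_def)
  have "(\<lambda>n. A (h n) - p) \<longlonglongrightarrow> 0"
  proof (rule Lim_null_comparison)
    show "eventually (\<lambda>n. norm (A (h n) - p) \<le> 2 * (norm (A (h n) - p) / e (h n))) sequentially"
      using e_le e_pos by (auto intro!: always_eventually simp: field_simps mult_right_mono)
    show "(\<lambda>n. 2 * (norm (A (h n) - p) / e (h n))) \<longlonglongrightarrow> 0"
      using tendsto_mult[OF tendsto_const small0, of 2] by simp
  qed
  then have Ah: "(\<lambda>n. A (h n)) \<longlonglongrightarrow> p" by (simp add: LIM_zero_iff)
  have Lp: "app L p = p"
  proof (rule LIMSEQ_unique)
    show "(\<lambda>n. A (h n)) \<longlonglongrightarrow> app L p"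
      using bounded_linear.tendsto[OF app.bounded_linear_left Rh, of p] R(2) by simp
  qed (rule Ah)
  obtain L' where L': "L' \<in> K" "L' * L = 1" "L * L' = 1" using inverse[OF f(3)] by blast
  \<comment> \<open>the limit \<open>L\<close> of the lifts fixes \<open>p\<close>, so multiplying by its inverse gives competing lifts; by minimality \<open>e\<close> tends to \<open>0\<close>\<close>
  have L'p: "app L' p = p" using L'(2) Lp by (metis app_1 app_mult)
  have e0: "(\<lambda>n. e (h n)) \<longlonglongrightarrow> 0"
  proof (rule tendsto_sandwich)
    show "eventually (\<lambda>n. 0 \<le> e (h n)) sequentially" using e_pos less_imp_le by (auto intro!: always_eventually)
    show "eventually (\<lambda>n. e (h n) \<le> norm (R (h n) * L' - 1)) sequentially"
      by (intro always_eventually allI)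
         (auto simp: e_def app_mult L'p R intro!: R(3) mult L'(1))
    have "(\<lambda>n. norm (R (h n) * L' - 1)) \<longlonglongrightarrow> norm (L * L' - 1)"
      by (intro tendsto_intros Rh)
    then show "(\<lambda>n. norm (R (h n) * L' - 1)) \<longlonglongrightarrow> 0" using L' by simp
  qed simp
  have c_top: "filterlim (\<lambda>n. 1 / e (h n)) at_top sequentially"
    using e0 e_pos by (simp add: inverse_eq_divide[symmetric] filterlim_inverse_at_top)
  have XL: "X \<in> lie_algebra"
    by (rule lie_algebra_of_scaled_limit[OF R(1) c_top]) (use Uh in \<open>simp add: U_def\<close>)
  have "app X p = 0"
  proof (rule LIMSEQ_unique)
    show "(\<lambda>n. app (U (h n)) p) \<longlonglongrightarrow> app X p"
      by (rule bounded_linear.tendsto[OF app.bounded_linear_left Uh])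
    show "(\<lambda>n. app (U (h n)) p) \<longlonglongrightarrow> 0"
    proof (rule Lim_null_comparison[OF _ small0])
      show "eventually (\<lambda>n. norm (app (U (h n)) p) \<le> norm (A (h n) - p) / e (h n)) sequentially"
        by (auto intro!: always_eventually simp: U_def app.scaleR_left app.diff_left R(2) abs_of_pos[OF e_pos])
    qed
  qed
  then have fixed: "app (exp (t *\<^sub>R X)) p = p" for t
    by (intro app_exp_fixed) (simp add: app.scaleR_left)
  have "(\<lambda>n. norm (U (h n) - X) + e (h n)) \<longlonglongrightarrow> norm (X - X) + 0"
    by (intro tendsto_intros Uh e0)
  then have "eventually (\<lambda>n. norm (U (h n) - X) + e (h n) < 1) sequentially"
    by (intro order_tendstoD) auto
  then obtain n where n: "norm (U (h n) - X) + e (h n) < 1" by (auto simp: eventually_sequentially)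
  let ?e = "e (h n)" and ?R = "R (h n)"
  have eK: "exp (t *\<^sub>R X) \<in> K" for t using XL by (simp add: lie_algebra_def)
  have "?e \<le> norm (?R * exp (- ?e *\<^sub>R X) - 1)"
    unfolding e_def by (rule R(3)) (auto intro!: mult R(1) eK simp: app_mult fixed R(2)
       simp del: scaleR_minus_left)
  also have "?R * exp (- ?e *\<^sub>R X) - 1 = (?R - exp (?e *\<^sub>R X)) * exp (- ?e *\<^sub>R X)"
    using exp_minus_inverse[of "?e *\<^sub>R X"] by (simp add: algebra_simps)
  also have "norm \<dots> \<le> norm (?R - exp (?e *\<^sub>R X)) * 1"
    by (rule order_trans[OF norm_mult_ineq]) (intro mult_left_mono norm_le_1 eK norm_ge_zero)
  also have "?R - exp (?e *\<^sub>R X) = ?e *\<^sub>R (U (h n) - X) - (exp (?e *\<^sub>R X) - 1 - ?e *\<^sub>R X)"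
    using e_pos[of "h n"] by (simp add: U_def algebra_simps)
  also have "norm \<dots> * 1 \<le> ?e * norm (U (h n) - X) + norm (exp (?e *\<^sub>R X) - 1 - ?e *\<^sub>R X)"
    using e_pos[of "h n"] norm_triangle_ineq4[of "?e *\<^sub>R (U (h n) - X)" "exp (?e *\<^sub>R X) - 1 - ?e *\<^sub>R X"] by simp
  also have "norm (exp (?e *\<^sub>R X) - 1 - ?e *\<^sub>R X) \<le> (norm (?e *\<^sub>R X))\<^sup>2"
  proof (rule norm_exp_diff_first_order)
    have "?e < 1" using n norm_ge_zero[of "U (h n) - X"] by linarith
    then show "norm (?e *\<^sub>R X) \<le> 1" using e_pos[of "h n"] nX by simp
  qed
  also have "(norm (?e *\<^sub>R X))\<^sup>2 = ?e * ?e" using nX by (simp add: power2_eq_square)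
  finally have "?e \<le> ?e * (norm (U (h n) - X) + ?e)" by (simp add: algebra_simps)
  also have "\<dots> < ?e * 1" using n e_pos[of "h n"] by (intro mult_strict_left_mono) auto
  finally show False by simp
qed

end

section \<open>The tangent space of an orbit\<close>

context compact_isometry_group
begin

definition tangent :: "'a \<Rightarrow> 'a set" where "tangent p = (\<lambda>X. app X p) ` lie_algebra"

lemma subspace_tangent: "subspace (tangent p)"
  unfolding tangent_def
  by (intro linear_subspace_image subspace_lie_algebra bounded_linear.linear app.bounded_linear_left)

text \<open>Directions of short secants of the orbit near \<open>p\<close> accumulate only at tangent vectors: after moving one endpoint to \<open>p\<close> by a group element close to \<open>1\<close>, the secant has a lift of comparable length by the Lipschitz lifting property, and the limiting direction of the lifts lies in the Lie algebra. A secant violating the inequality would give a unit tangent vector whose projection to the tangent space has norm at most \<open>1/2\<close>.\<close>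

lemma orbit_secants_near_tangent:
  shows "\<exists>\<delta>>0. \<forall>A\<in>orbit p \<inter> ball p \<delta>. \<forall>B\<in>orbit p \<inter> ball p \<delta>.
           norm (A - B) \<le> 2 * norm (orth_proj (tangent p) (A - B))"
proof (rule ccontr)
  let ?\<pi> = "orth_proj (tangent p)"
  assume no: "\<not> ?thesis"
  have "\<exists>A B. A \<in> orbit p \<and> B \<in> orbit p \<and> dist p A < 1 / real (Suc n) \<and> dist p B < 1 / real (Suc n)
      \<and> norm (A - B) > 2 * norm (?\<pi> (A - B))" for n
  proof -
    have "(0::real) < 1 / real (Suc n)" by simp
    with no have "\<exists>A\<in>orbit p \<inter> ball p (1 / real (Suc n)). \<exists>B\<in>orbit p \<inter> ball p (1 / real (Suc n)).
        \<not> norm (A - B) \<le> 2 * norm (?\<pi> (A - B))" by blast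
    then show ?thesis unfolding not_le Int_iff mem_ball Bex_def by blast
  qed
  then obtain A B where A: "\<And>n. A n \<in> orbit p" and B: "\<And>n. B n \<in> orbit p"
    and Ad: "\<And>n. dist p (A n) < 1 / real (Suc n)" and Bd: "\<And>n. dist p (B n) < 1 / real (Suc n)"
    and bad: "\<And>n. norm (A n - B n) > 2 * norm (?\<pi> (A n - B n))" by metis
  have inv0: "(\<lambda>n. 1 / real (Suc n)) \<longlonglongrightarrow> 0" using LIMSEQ_inverse_real_of_nat by (simp add: inverse_eq_divide)
  have lim_p: "Z \<longlonglongrightarrow> p" if "\<And>n. dist p (Z n) < 1 / real (Suc n)" for Z :: "nat \<Rightarrow> 'a"
  proof -
    have "(\<lambda>n. Z n - p) \<longlonglongrightarrow> 0"
      by (rule Lim_null_comparison[OF _ inv0])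
         (use that less_imp_le in \<open>auto intro!: always_eventually simp: dist_norm norm_minus_commute simp del: of_nat_Suc\<close>)
    then show ?thesis by (simp add: LIM_zero_iff)
  qed
  have Ap: "A \<longlonglongrightarrow> p" and Bp: "B \<longlonglongrightarrow> p" using Ad Bd by (auto intro: lim_p)
  obtain C where C: "C > 0" "\<And>A. A \<in> orbit p \<Longrightarrow> \<exists>a\<in>K. app a p = A \<and> norm (a - 1) \<le> C * norm (A - p)"
    using orbit_lipschitz_lift[of p] by metis
  obtain S where S: "\<And>n. S n \<in> K" "\<And>n. app (S n) p = B n" "\<And>n. norm (S n - 1) \<le> C * norm (B n - p)"
    using C(2)[OF B] by metis
  have S1: "S \<longlonglongrightarrow> 1"
  proof -
    have "(\<lambda>n. S n - 1) \<longlonglongrightarrow> 0"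
    proof (rule Lim_null_comparison)
      show "(\<lambda>n. C * norm (B n - p)) \<longlonglongrightarrow> 0"
        using Bp by (auto intro!: tendsto_eq_intros)
    qed (use S(3) in auto)
    then show ?thesis by (simp add: LIM_zero_iff)
  qed
  obtain S' where S': "\<And>n. S' n \<in> K" "\<And>n. S' n * S n = 1" "\<And>n. S n * S' n = 1" using inverse[OF S(1)] by metis
  define A' where "A' n = app (S' n) (A n)" for n
  define e where "e n = norm (A n - B n)" for n
  have e_pos: "e n > 0" for n using bad[of n] by (smt (verit) e_def norm_ge_zero)
  have A'B: "A n - B n = app (S n) (A' n - p)" for n
    by (simp add: A'_def app.diff_right app_mult[symmetric] S'(3) S(2))
  then have e_A': "e n = norm (A' n - p)" for n by (simp add: e_def isometry S)
  have e0: "e \<longlonglongrightarrow> 0" unfolding e_def using Ap Bp by (auto intro!: tendsto_eq_intros)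
  have A'_orbit: "A' n \<in> orbit p" for n unfolding A'_def by (intro orbit_closed A S')
  obtain R where R: "\<And>n. R n \<in> K" "\<And>n. app (R n) p = A' n" "\<And>n. norm (R n - 1) \<le> C * norm (A' n - p)"
    using C(2)[OF A'_orbit] by metis
  define U where "U n = (1 / e n) *\<^sub>R (R n - 1)" for n
  have "norm (U n) \<le> C" for n
  proof -
    have "norm (U n) = norm (R n - 1) / e n" using e_pos[of n] by (simp add: U_def)
    also have "\<dots> \<le> C" using R(3)[of n] e_pos[of n] e_A'[of n] by (simp add: pos_divide_le_eq)
    finally show ?thesis .
  qed
  then obtain X h where h: "strict_mono h" "(U \<circ> h) \<longlonglongrightarrow> X"
    by (rule bounded_endo_imp_convergent_subsequence)
  have Uh: "(\<lambda>n. U (h n)) \<longlonglongrightarrow> X" using h(2) by (simp add: comp_def)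
  have eh: "(\<lambda>n. e (h n)) \<longlonglongrightarrow> 0" using LIMSEQ_subseq_LIMSEQ[OF e0 h(1)] by (simp add: comp_def)
  have Sh: "(\<lambda>n. S (h n)) \<longlonglongrightarrow> 1" using LIMSEQ_subseq_LIMSEQ[OF S1 h(1)] by (simp add: comp_def)
  have c_top: "filterlim (\<lambda>n. 1 / e (h n)) at_top sequentially"
    using eh e_pos by (simp add: inverse_eq_divide[symmetric] filterlim_inverse_at_top)
  have XL: "X \<in> lie_algebra"
    by (rule lie_algebra_of_scaled_limit[OF R(1) c_top]) (use Uh in \<open>simp add: U_def\<close>)
  define D where "D n = (1 / e (h n)) *\<^sub>R (A (h n) - B (h n))" for n
  have D_eq: "D n = app (S (h n)) (app (U (h n)) p)" for n
    by (simp add: D_def A'B U_def app.scaleR_left app.scaleR_right app.diff_left R(2))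
  have "(\<lambda>n. app (S (h n)) (app (U (h n)) p)) \<longlonglongrightarrow> app 1 (app X p)"
    by (intro app.tendsto Sh Uh tendsto_const)
  then have D: "D \<longlonglongrightarrow> app X p" by (simp add: D_eq[symmetric])
  have nD: "norm (D n) = 1" for n using e_pos[of "h n"] by (simp add: D_def e_def)
  have nX: "norm (app X p) = 1" using tendsto_norm[OF D] by (simp add: nD LIMSEQ_const_iff)
  have XT: "app X p \<in> tangent p" using XL by (auto simp: tangent_def)
  have blp: "bounded_linear ?\<pi>" by (rule bounded_linear_orth_proj[OF subspace_tangent])
  have "(\<lambda>n. ?\<pi> (D n)) \<longlonglongrightarrow> ?\<pi> (app X p)" by (rule bounded_linear.tendsto[OF blp D])
  then have lim1: "(\<lambda>n. norm (?\<pi> (D n))) \<longlonglongrightarrow> 1"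
    using tendsto_norm nX orth_proj_id[OF subspace_tangent XT] by metis
  have half: "norm (?\<pi> (D n)) \<le> 1 / 2" for n
  proof -
    have "?\<pi> (D n) = (1 / e (h n)) *\<^sub>R ?\<pi> (A (h n) - B (h n))"
      unfolding D_def by (rule linear_scale[OF bounded_linear.linear[OF blp]])
    then show ?thesis using bad[of "h n"] e_pos[of "h n"] by (simp add: e_def field_simps)
  qed
  have "(1::real) \<le> 1 / 2" by (rule LIMSEQ_le_const2[OF lim1]) (use half in auto)
  then show False by simp
qed

text \<open>Parametrize the orbit near \<open>p\<close> by \<open>v \<mapsto> exp(g v) p\<close> with \<open>g\<close> a linear right inverse of \<open>X \<mapsto> Xp\<close>. Composed with the projection, and extended by the identity on the orthogonal complement, this has the identity as derivative at \<open>0\<close>, so Sussmann's open mapping theorem applies; it needs differentiability at the single point \<open>0\<close> only.\<close>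

lemma tangent_projection_covers:
  assumes "\<delta> > 0"
  shows "\<exists>\<rho>>0. tangent p \<inter> ball (orth_proj (tangent p) p) \<rho> \<subseteq> orth_proj (tangent p) ` (orbit p \<inter> ball p \<delta>)"
proof -
  let ?T = "tangent p"
  let ?\<pi> = "orth_proj ?T"
  have T: "subspace ?T" by (rule subspace_tangent)
  have blp: "bounded_linear ?\<pi>" by (rule bounded_linear_orth_proj[OF T])
  have lin: "linear (\<lambda>X::'a endo. app X p)" by (rule bounded_linear.linear[OF app.bounded_linear_left])
  obtain g where g: "range g \<subseteq> lie_algebra" "linear g" "\<And>v. v \<in> ?T \<Longrightarrow> app (g v) p = v"
    using linear_exists_right_inverse_on[OF lin subspace_lie_algebra] unfolding tangent_def by blast
  have blg: "bounded_linear g" using g(2) linear_conv_bounded_linear by blast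
  define Z where "Z v = g (?\<pi> v)" for v
  have blZ: "bounded_linear Z" unfolding Z_def by (rule bounded_linear_compose[OF blg blp])
  define \<phi> where "\<phi> v = app (exp (Z v)) p" for v
  define f where "f v = ?\<pi> (\<phi> v) + (v - ?\<pi> v)" for v
  have \<phi>_orbit: "\<phi> v \<in> orbit p" for v
  proof -
    have "Z v \<in> lie_algebra" using g(1) by (auto simp: Z_def)
    then have "exp (1 *\<^sub>R Z v) \<in> K" unfolding lie_algebra_def by blast
    then show ?thesis by (auto simp: \<phi>_def orbit_def)
  qed
  have cont\<phi>: "continuous_on UNIV \<phi>"
    unfolding \<phi>_def
    by (intro bounded_linear.continuous_on[OF app.bounded_linear_left]
          continuous_on_compose2[OF continuous_on_exp_banach_algebra] bounded_linear.continuous_on[OF blZ] continuous_on_id) auto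
  have contf: "continuous_on UNIV f"
    unfolding f_def by (intro continuous_intros bounded_linear.continuous_on[OF blp] cont\<phi>)
  have \<phi>0: "\<phi> 0 = p" using linear_0[OF bounded_linear.linear[OF blZ]] by (simp add: \<phi>_def)
  have p0: "?\<pi> 0 = 0" by (rule linear_0[OF bounded_linear.linear[OF blp]])
  have f0: "f 0 = ?\<pi> p" by (simp add: f_def \<phi>0 p0)
  obtain C where C: "C > 0" "\<And>v. norm (Z v) \<le> norm v * C" using bounded_linear.pos_bounded[OF blZ] by auto
  have der: "(f has_derivative id) (at 0)"
    unfolding has_derivative_at
  proof (intro conjI)
    show "bounded_linear (id::'a\<Rightarrow>'a)" by (simp add: id_def bounded_linear_ident)
    show "(\<lambda>h. norm (f (0 + h) - f 0 - id h) / norm h) \<midarrow>0\<rightarrow> 0"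
    proof (rule Lim_null_comparison)
      have "eventually (\<lambda>h. dist h 0 < 1 / C) (at 0)" using C unfolding eventually_at by (intro exI[of _ "1 / C"]) auto
      then show "eventually (\<lambda>h. norm (norm (f (0 + h) - f 0 - id h) / norm h) \<le> C\<^sup>2 * norm p * norm h) (at 0)"
      proof eventually_elim
        case (elim h)
        then have Z1: "norm (Z h) \<le> 1" using C(2)[of h] C(1) by (simp add: dist_norm field_simps)
        have "app (Z h) p = ?\<pi> h" unfolding Z_def by (rule g(3)) (rule orth_proj_mem[OF T])
        moreover have "?\<pi> (app (Z h) p) = app (Z h) p"
          unfolding calculation by (rule orth_proj_id[OF T orth_proj_mem[OF T]])
        ultimately have "f (0 + h) - f 0 - id h = ?\<pi> (app (exp (Z h) - 1 - Z h) p)"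
          using linear_diff[OF bounded_linear.linear[OF blp]]
          by (simp add: f_def \<phi>0 p0 app.diff_left) (simp add: \<phi>_def)
        then have "norm (f (0 + h) - f 0 - id h) \<le> norm (app (exp (Z h) - 1 - Z h) p)"
          by (simp add: norm_orth_proj_le[OF T])
        also have "\<dots> \<le> norm (exp (Z h) - 1 - Z h) * norm p" by (rule norm_app_le)
        also have "\<dots> \<le> (norm (Z h))\<^sup>2 * norm p"
          by (intro mult_right_mono norm_exp_diff_first_order Z1) auto
        also have "\<dots> \<le> (norm h * C)\<^sup>2 * norm p" by (intro mult_right_mono power_mono C) auto
        finally show ?case by (cases "h = 0") (auto simp: field_simps power2_eq_square)
      qed
      show "(\<lambda>h. C\<^sup>2 * norm p * norm h) \<midarrow>0\<rightarrow> 0" by (auto intro!: tendsto_eq_intros)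
    qed
  qed
  have "isCont \<phi> 0" using cont\<phi> by (simp add: continuous_on_eq_continuous_at)
  then obtain \<epsilon> where \<epsilon>: "\<epsilon> > 0" "\<And>v. dist v 0 < \<epsilon> \<Longrightarrow> dist (\<phi> v) p < \<delta>"
    using assms unfolding continuous_at_eps_delta \<phi>0 by (metis dist_commute)
  have "f 0 \<in> interior (f ` ball 0 \<epsilon>)"
    by (rule sussmann_open_mapping[OF open_UNIV contf _ der, of id]) (use \<epsilon> bounded_linear_ident in \<open>auto simp: id_def\<close>)
  then obtain \<rho> where \<rho>: "\<rho> > 0" "ball (?\<pi> p) \<rho> \<subseteq> f ` ball 0 \<epsilon>" unfolding f0 by (auto simp: mem_interior)
  show ?thesis
  proof (intro exI[of _ \<rho>] conjI subsetI)
    fix y assume y: "y \<in> ?T \<inter> ball (?\<pi> p) \<rho>"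
    then obtain v where v: "v \<in> ball 0 \<epsilon>" "y = f v" using \<rho>(2) by auto
    have "v - ?\<pi> v = y - ?\<pi> (\<phi> v)" using v(2) by (simp add: f_def)
    then have "v - ?\<pi> v \<in> ?T" using y T by (simp add: orth_proj_mem subspace_diff)
    then have "(v - ?\<pi> v) \<bullet> (v - ?\<pi> v) = 0" using orthogonal_orth_proj[OF T] by (simp add: orthogonal_def)
    then have "y = ?\<pi> (\<phi> v)" using v(2) by (simp add: f_def)
    moreover have "\<phi> v \<in> orbit p \<inter> ball p \<delta>" using \<phi>_orbit \<epsilon>(2)[of v] v(1) by (auto simp: dist_commute)
    ultimately show "y \<in> ?\<pi> ` (orbit p \<inter> ball p \<delta>)" by blast
  qed (rule \<rho>(1))
qed

end

section \<open>Orbits as manifolds: dimension and covering numbers\<close>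

text \<open>If \<open>m < n\<close>, a nonempty open subset of \<open>n\<close>-space would embed continuously into \<open>m\<close>-space, seen as a subspace of \<open>n\<close>-space with empty interior. Invariance of domain forbids this.\<close>

lemma locally_euclidean_dim_le:
  assumes X: "locally_euclidean m X" and Y: "locally_euclidean n X" and x: "x \<in> topspace X"
  shows "n \<le> m"
proof (rule ccontr)
  assume "\<not> n \<le> m"
  then have mn: "m < n" by simp
  obtain U U' where U: "openin X U" "x \<in> U" "openin (Euclidean_space m) U'"
    "subtopology X U homeomorphic_space subtopology (Euclidean_space m) U'"
    using X x unfolding locally_euclidean_def by metis
  obtain W W' where W: "openin X W" "x \<in> W" "openin (Euclidean_space n) W'"
    "subtopology X W homeomorphic_space subtopology (Euclidean_space n) W'"
    using Y x unfolding locally_euclidean_def by metis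
  obtain f where f: "homeomorphic_map (subtopology X U) (subtopology (Euclidean_space m) U') f"
    using U(4) homeomorphic_space by blast
  obtain g where g: "homeomorphic_map (subtopology (Euclidean_space n) W') (subtopology X W) g"
    using W(4) homeomorphic_space_sym homeomorphic_space by blast
  have top_g: "g ` W' = W"
    using homeomorphic_imp_surjective_map[OF g] openin_subset[OF W(1)] openin_subset[OF W(3)]
    by (simp add: inf_absorb2)
  define Z where "Z = {z \<in> W'. g z \<in> U}"
  have cont_g: "continuous_map (subtopology (Euclidean_space n) W') (subtopology X W) g"
    using g by (rule homeomorphic_imp_continuous_map)
  have W't: "topspace (subtopology (Euclidean_space n) W') = W'"
    using openin_subset[OF W(3)] by (simp add: inf_absorb2)
  have "openin (subtopology (Euclidean_space n) W') {z \<in> W'. g z \<in> U}"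
    using openin_continuous_map_preimage[OF continuous_map_into_fulltopology[OF cont_g] U(1)] unfolding W't .
  then have Z: "openin (Euclidean_space n) Z"
    unfolding Z_def using W(3) openin_trans_full by blast
  have cont_fg: "continuous_map (subtopology (Euclidean_space n) Z) (subtopology (Euclidean_space m) U') (f \<circ> g)"
  proof (rule continuous_map_compose)
    have "continuous_map (subtopology (Euclidean_space n) Z) X g"
      using continuous_map_into_fulltopology[OF cont_g] continuous_map_from_subtopology_mono[of _ W' X g Z] by (auto simp: Z_def)
    then show "continuous_map (subtopology (Euclidean_space n) Z) (subtopology X U) g"
      by (auto simp: continuous_map_in_subtopology Z_def)
    show "continuous_map (subtopology X U) (subtopology (Euclidean_space m) U') f"
      using f by (rule homeomorphic_imp_continuous_map)
  qed
  then have cont_m: "continuous_map (subtopology (Euclidean_space n) Z) (Euclidean_space m) (f \<circ> g)"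
    by (rule continuous_map_into_fulltopology)
  \<comment> \<open>\<open>m\<close>-space is the set of points of \<open>n\<close>-space whose last coordinates vanish\<close>
  have cont: "continuous_map (subtopology (Euclidean_space n) Z) (Euclidean_space n) (f \<circ> g)"
  proof -
    have "{x::nat \<Rightarrow> real. \<forall>i\<ge>m. x i = 0} \<subseteq> {x. \<forall>i\<ge>n. x i = 0}" using mn by auto
    then show ?thesis using cont_m unfolding Euclidean_space_def continuous_map_in_subtopology by blast
  qed
  have inj: "inj_on (f \<circ> g) Z"
  proof (rule comp_inj_on)
    show "inj_on g Z"
      using homeomorphic_imp_injective_map[OF g] unfolding W't by (rule inj_on_subset) (auto simp: Z_def)
    show "inj_on f (g ` Z)"
      using homeomorphic_imp_injective_map[OF f]
      by (rule inj_on_subset) (use openin_subset[OF U(1)] in \<open>auto simp: Z_def\<close>)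
  qed
  have op: "openin (Euclidean_space n) ((f \<circ> g) ` Z)"
    by (rule invariance_of_domain_Euclidean_space[OF Z cont inj])
  obtain z where z: "z \<in> Z" using top_g W(2) U(2) unfolding Z_def by force
  define y where "y = f (g z)"
  have y0: "v m = 0" if "v \<in> (f \<circ> g) ` Z" for v
  proof -
    have "v \<in> topspace (Euclidean_space m)"
      using that continuous_map_image_subset_topspace[OF cont_m] openin_subset[OF Z] by (auto simp: inf_absorb2)
    then show ?thesis by (simp add: topspace_Euclidean_space)
  qed
  define h where "h t = y(m := t)" for t :: real
  have y_n: "\<forall>i\<ge>n. y i = 0"
    using openin_subset[OF op] z by (auto simp: y_def topspace_Euclidean_space)
  have "continuous_map euclideanreal (Euclidean_space n) h"
    unfolding Euclidean_space_def continuous_map_in_subtopology continuous_map_componentwise_UNIV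
    using y_n mn by (auto simp: h_def)
  then have "open {t. h t \<in> (f \<circ> g) ` Z}"
    using openin_continuous_map_preimage[OF _ op] by fastforce
  moreover have "h 0 = y" using y0[of y] z by (auto simp: h_def y_def)
  then have "0 \<in> {t. h t \<in> (f \<circ> g) ` Z}" using z by (auto simp: y_def)
  ultimately obtain e where e: "e > 0" "ball 0 e \<subseteq> {t. h t \<in> (f \<circ> g) ` Z}"
    by (meson open_contains_ball)
  moreover have "e / 2 \<in> ball 0 e" using e(1) by simp
  ultimately have "e / 2 \<in> {t. h t \<in> (f \<circ> g) ` Z}" by blast
  then have "h (e / 2) m = 0" using y0 by blast
  then show False using e by (simp add: h_def)
qed

lemma manifold_dim_eq:
  assumes "locally_euclidean m X" "topspace X \<noteq> {}"
  shows "manifold_dim X = m"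
  unfolding manifold_dim_def
proof (rule the_equality)
  obtain x where x: "x \<in> topspace X" using assms(2) by blast
  show "n = m" if "locally_euclidean n X" for n
    using locally_euclidean_dim_le[OF assms(1) that x] locally_euclidean_dim_le[OF that assms(1) x] by simp
qed (rule assms(1))

lemma locally_euclidean_homeomorphic:
  assumes "X homeomorphic_space Y" "locally_euclidean m X"
  shows "locally_euclidean m Y"
  unfolding locally_euclidean_def
proof
  fix y assume y: "y \<in> topspace Y"
  obtain f g where fg: "homeomorphic_maps X Y f g" using assms(1) homeomorphic_space_def by blast
  then have f: "homeomorphic_map X Y f" and gy: "g y \<in> topspace X" "f (g y) = y"
    using y by (auto simp: homeomorphic_map_maps) (auto simp: homeomorphic_maps_def continuous_map_def)
  obtain U U' where U: "openin X U" "g y \<in> U" "openin (Euclidean_space m) U'"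
    "subtopology X U homeomorphic_space subtopology (Euclidean_space m) U'"
    using assms(2) gy(1) unfolding locally_euclidean_def by metis
  have fU: "openin Y (f ` U)" using U(1) f by (meson homeomorphic_map_openness_eq)
  have "homeomorphic_map (subtopology X U) (subtopology Y (f ` U)) f"
    by (rule homeomorphic_map_subtopologies[OF f])
       (use openin_subset[OF U(1)] openin_subset[OF fU] in \<open>simp add: inf_absorb2\<close>)
  then have "subtopology Y (f ` U) homeomorphic_space subtopology (Euclidean_space m) U'"
    using U(4) homeomorphic_map_imp_homeomorphic_space homeomorphic_space_sym homeomorphic_space_trans by blast
  moreover have "y \<in> f ` U" using gy U(2) by force
  ultimately show "\<exists>U U'. openin Y U \<and> y \<in> U \<and> openin (Euclidean_space m) U' \<and>
        subtopology Y U homeomorphic_space subtopology (Euclidean_space m) U'"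
    using fU U(3) by blast
qed

context compact_isometry_group
begin

text \<open>Near \<open>p\<close> the orthogonal projection to the tangent space is injective with Lipschitz inverse by the secant estimate, and its image contains a neighbourhood of the projection of \<open>p\<close>.\<close>

lemma orbit_chart:
  shows "\<exists>U. openin (top_of_set (orbit p)) U \<and> p \<in> U \<and>
     (\<exists>U'. openin (Euclidean_space (dim (tangent p))) U' \<and>
        top_of_set U homeomorphic_space subtopology (Euclidean_space (dim (tangent p))) U')"
proof -
  let ?T = "tangent p"
  let ?\<pi> = "orth_proj ?T"
  let ?m = "dim ?T"
  have blp: "bounded_linear ?\<pi>" by (rule bounded_linear_orth_proj[OF subspace_tangent])
  obtain \<delta> where \<delta>: "\<delta> > 0" "\<And>A B. A \<in> orbit p \<inter> ball p \<delta> \<Longrightarrow> B \<in> orbit p \<inter> ball p \<delta> \<Longrightarrow>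
      norm (A - B) \<le> 2 * norm (?\<pi> (A - B))"
    using orbit_secants_near_tangent[of p] by blast
  obtain \<rho> where \<rho>: "\<rho> > 0" "?T \<inter> ball (?\<pi> p) \<rho> \<subseteq> ?\<pi> ` (orbit p \<inter> ball p \<delta>)"
    using tangent_projection_covers[OF \<delta>(1)] by blast
  define U where "U = {A \<in> orbit p \<inter> ball p \<delta>. ?\<pi> A \<in> ball (?\<pi> p) \<rho>}"
  have contp: "continuous_on UNIV ?\<pi>" by (rule bounded_linear.continuous_on[OF blp continuous_on_id])
  have "open (?\<pi> -` ball (?\<pi> p) \<rho> \<inter> ball p \<delta>)"
    by (intro open_Int open_vimage open_ball contp)
  then have U_open: "openin (top_of_set (orbit p)) U"
    unfolding U_def openin_open by (intro exI[of _ "?\<pi> -` ball (?\<pi> p) \<rho> \<inter> ball p \<delta>"]) auto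
  have p: "p \<in> orbit p" using one by (auto simp: orbit_def intro: rev_image_eqI)
  have pU: "p \<in> U" using p \<delta>(1) \<rho>(1) by (simp add: U_def)
  have lip: "norm (A - B) \<le> 2 * norm (?\<pi> A - ?\<pi> B)" if "A \<in> U" "B \<in> U" for A B
    using \<delta>(2)[of A B] that linear_diff[OF bounded_linear.linear[OF blp]] by (simp add: U_def)
  define g where "g = the_inv_into U ?\<pi>"
  have inj: "inj_on ?\<pi> U" by (rule inj_onI) (use lip in force)
  have im: "?\<pi> ` U = ?T \<inter> ball (?\<pi> p) \<rho>"
  proof (intro equalityI subsetI)
    fix y assume y: "y \<in> ?T \<inter> ball (?\<pi> p) \<rho>"
    then obtain A where "A \<in> orbit p \<inter> ball p \<delta>" "y = ?\<pi> A" using \<rho>(2) by blast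
    then show "y \<in> ?\<pi> ` U" using y unfolding U_def by blast
  next
    fix y assume "y \<in> ?\<pi> ` U"
    then show "y \<in> ?T \<inter> ball (?\<pi> p) \<rho>"
      using orth_proj_mem[OF subspace_tangent] unfolding U_def by blast
  qed
  have "homeomorphism U (?T \<inter> ball (?\<pi> p) \<rho>) ?\<pi> g"
  proof (rule homeomorphismI)
    show "continuous_on U ?\<pi>" using contp continuous_on_subset by blast
    show "continuous_on (?T \<inter> ball (?\<pi> p) \<rho>) g"
      unfolding im[symmetric]
    proof (rule continuous_onI)
      fix y :: 'a and e :: real assume "y \<in> ?\<pi> ` U" "e > 0"
      then show "\<exists>d>0. \<forall>y'\<in>?\<pi> ` U. dist y' y < d \<longrightarrow> dist (g y') (g y) \<le> e"
        using lip by (intro exI[of _ "e / 2"]) (fastforce simp: g_def the_inv_into_f_f[OF inj] dist_norm)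
    qed
    show "?\<pi> ` U \<subseteq> ?T \<inter> ball (?\<pi> p) \<rho>" using im by blast
    show "g ` (?T \<inter> ball (?\<pi> p) \<rho>) \<subseteq> U" unfolding im[symmetric] by (auto simp: g_def the_inv_into_f_f[OF inj])
    show "g (?\<pi> x) = x" if "x \<in> U" for x using that by (simp add: g_def the_inv_into_f_f[OF inj])
    show "?\<pi> (g y) = y" if "y \<in> ?T \<inter> ball (?\<pi> p) \<rho>" for y
      using that unfolding im[symmetric] by (auto simp: g_def the_inv_into_f_f[OF inj])
  qed
  then have hom1: "top_of_set U homeomorphic_space top_of_set (?T \<inter> ball (?\<pi> p) \<rho>)"
    by (auto simp: homeomorphic_def)
  have "top_of_set ?T homeomorphic_space Euclidean_space ?m"
    by (subst homeomorphic_subspace_Euclidean_space[OF subspace_tangent]) simp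
  then obtain h where h: "homeomorphic_map (top_of_set ?T) (Euclidean_space ?m) h"
    using homeomorphic_space by blast
  let ?W = "?T \<inter> ball (?\<pi> p) \<rho>"
  have W: "openin (top_of_set ?T) ?W" by (simp add: openin_open_Int)
  have hW: "openin (Euclidean_space ?m) (h ` ?W)" using W h by (meson homeomorphic_map_openness_eq)
  have "homeomorphic_map (subtopology (top_of_set ?T) ?W) (subtopology (Euclidean_space ?m) (h ` ?W)) h"
    by (rule homeomorphic_map_subtopologies[OF h])
       (use openin_subset[OF hW] in \<open>simp add: inf_absorb2\<close>)
  moreover have "subtopology (top_of_set ?T) ?W = top_of_set ?W" by (simp add: subtopology_subtopology)
  ultimately have "top_of_set ?W homeomorphic_space subtopology (Euclidean_space ?m) (h ` ?W)"
    using homeomorphic_map_imp_homeomorphic_space by metis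
  then show ?thesis using U_open pU hW hom1 homeomorphic_space_trans by blast
qed

lemma orbit_app: "a \<in> K \<Longrightarrow> app a ` orbit p = orbit p"
proof (intro equalityI subsetI)
  fix x assume a: "a \<in> K" and x: "x \<in> orbit p"
  obtain b where b: "b \<in> K" "b * a = 1" "a * b = 1" using inverse a by blast
  then have "x = app a (app b x)" by (simp add: app_mult[symmetric])
  then show "x \<in> app a ` orbit p" using orbit_closed[OF x b(1)] by blast
qed (auto intro: orbit_closed)

text \<open>The chart at \<open>p\<close> is transported to every other point by the group.\<close>

lemma locally_euclidean_orbit: "locally_euclidean (dim (tangent p)) (top_of_set (orbit p))"
  unfolding locally_euclidean_def
proof
  let ?m = "dim (tangent p)"
  fix x assume "x \<in> topspace (top_of_set (orbit p))"
  then obtain a where a: "a \<in> K" "x = app a p" by (auto simp: orbit_def)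
  obtain b where b: "b \<in> K" "b * a = 1" "a * b = 1" using inverse a by blast
  obtain U U' where U: "openin (top_of_set (orbit p)) U" "p \<in> U" "openin (Euclidean_space ?m) U'"
    "top_of_set U homeomorphic_space subtopology (Euclidean_space ?m) U'"
    using orbit_chart[of p] by blast
  have bij: "app b (app a z) = z" "app a (app b z) = z" for z using b by (simp_all add: app_mult[symmetric])
  have conta: "continuous_on S (app c)" for S c
    by (intro bounded_linear.continuous_on[OF app.bounded_linear_right] continuous_on_id)
  have hom: "homeomorphism S (app a ` S) (app a) (app b)" for S
    by (rule homeomorphismI) (auto simp: bij conta)
  have "openin (top_of_set (app a ` orbit p)) (app a ` U)"
    by (rule homeomorphism_imp_open_map[OF hom U(1)])
  then have 1: "openin (top_of_set (orbit p)) (app a ` U)" using orbit_app[OF a(1)] by simp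
  have "top_of_set (app a ` U) homeomorphic_space top_of_set U"
    unfolding homeomorphic_space_iff_homeomorphic homeomorphic_sym[of "app a ` U"]
    using hom[of U] unfolding homeomorphic_def by blast
  then have "top_of_set (app a ` U) homeomorphic_space subtopology (Euclidean_space ?m) U'"
    using U(4) homeomorphic_space_trans by blast
  moreover have "subtopology (top_of_set (orbit p)) (app a ` U) = top_of_set (app a ` U)"
    using openin_imp_subset[OF 1] by (simp add: subtopology_subtopology inf_absorb2)
  ultimately show "\<exists>U U'. openin (top_of_set (orbit p)) U \<and> x \<in> U \<and> openin (Euclidean_space ?m) U' \<and>
        subtopology (top_of_set (orbit p)) U homeomorphic_space subtopology (Euclidean_space ?m) U'"
    using 1 U(2,3) a(2) by (intro exI[of _ "app a ` U"] exI[of _ U']) auto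
qed

text \<open>Near \<open>p\<close> the tangent projection distorts distances by at most a factor \<open>2\<close>, so a grid of mesh comparable to \<open>\<eta>\<close> in the tangent space, with one point of the orbit chosen over each occupied cell, is an \<open>\<eta>\<close>-net. Finitely many translates of this neighbourhood cover the compact orbit, and the group acts by isometries.\<close>

lemma orbit_covering_number:
  shows "\<exists>C>0. \<forall>\<eta>. 0 < \<eta> \<and> \<eta> \<le> 1 \<longrightarrow>
     (\<exists>F. finite F \<and> F \<subseteq> orbit p \<and> real (card F) \<le> C * (1 / \<eta>) ^ dim (tangent p) \<and>
          orbit p \<subseteq> (\<Union>A\<in>F. ball A \<eta>))"
proof -
  let ?T = "tangent p"
  let ?\<pi> = "orth_proj ?T"
  let ?m = "dim ?T"
  obtain \<delta> where \<delta>: "\<delta> > 0" "\<And>A B. A \<in> orbit p \<inter> ball p \<delta> \<Longrightarrow> B \<in> orbit p \<inter> ball p \<delta> \<Longrightarrow>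
      norm (A - B) \<le> 2 * norm (?\<pi> (A - B))"
    using orbit_secants_near_tangent[of p] by blast
  obtain B where B: "orthonormal_basis ?T B" using orthonormal_basis_ex[OF subspace_tangent] by blast
  have finB: "finite B" and cB: "card B = ?m" using orthonormal_basisD[OF B] by auto
  define c where "c = 2 * real ?m + 1"
  have c: "c > 0" by (simp add: c_def)
  obtain I where I: "finite I" "I \<subseteq> K" "orbit p \<subseteq> (\<Union>a\<in>I. ball (app a p) \<delta>)"
  proof -
    have "orbit p \<subseteq> (\<Union>a\<in>K. ball (app a p) \<delta>)" using \<delta>(1) by (force simp: orbit_def)
    then obtain I where "I \<subseteq> K" "finite I" "orbit p \<subseteq> (\<Union>a\<in>I. ball (app a p) \<delta>)"
      using compactE_image[OF compact_orbit, of K "\<lambda>a. ball (app a p) \<delta>" p] by auto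
    then show ?thesis using that by blast
  qed
  define C where "C = real (card I) * (2 * (c * norm p + 1) + 1) ^ ?m + 1"
  have local: "\<exists>F. finite F \<and> F \<subseteq> orbit p \<and> real (card F) \<le> ((2 * (c * norm p + 1) + 1) / \<eta>) ^ ?m \<and>
          orbit p \<inter> ball p \<delta> \<subseteq> (\<Union>A\<in>F. ball A \<eta>)" if \<eta>: "0 < \<eta>" "\<eta> \<le> 1" for \<eta>
  proof -
    \<comment> \<open>the grid cell of the tangent projection of \<open>A\<close>; the mesh \<open>\<eta>/c\<close> with \<open>c > 2 m\<close> makes points over the same cell closer than \<open>\<eta>\<close>\<close>
    define q where "q A = (\<lambda>b\<in>B. \<lfloor>(A \<bullet> b) * c / \<eta>\<rfloor>)" for A
    define L where "L = \<lfloor>c * norm p / \<eta>\<rfloor> + 1"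
    have Lb: "real_of_int L \<le> c * norm p / \<eta> + 1" unfolding L_def by linarith
    have L0: "0 \<le> L" unfolding L_def using c \<eta> by (simp add: add_increasing2)
    let ?M = "orbit p \<inter> ball p \<delta>"
    have q_range: "q ` ?M \<subseteq> (B \<rightarrow>\<^sub>E {-L..L})"
    proof (intro image_subsetI PiE_I)
      fix A b assume A: "A \<in> ?M" and b: "b \<in> B"
      have "norm A = norm p" using A isometry by (auto simp: orbit_def)
      moreover have "norm b = 1" using B b by (simp add: orthonormal_basis_def)
      ultimately have "\<bar>A \<bullet> b\<bar> \<le> norm p" using Cauchy_Schwarz_ineq2[of A b] by simp
      then have "\<bar>(A \<bullet> b) * c / \<eta>\<bar> \<le> c * norm p / \<eta>"
        using c \<eta> by (simp add: abs_mult divide_right_mono mult.commute mult_left_mono)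
      then have "\<lfloor>(A \<bullet> b) * c / \<eta>\<rfloor> \<le> L" "- L \<le> \<lfloor>(A \<bullet> b) * c / \<eta>\<rfloor>" unfolding L_def by linarith+
      then show "q A b \<in> {-L..L}" using b by (simp add: q_def)
    qed (auto simp: q_def)
    have fin: "finite (B \<rightarrow>\<^sub>E {-L..L})" using finB by (intro finite_PiE) auto
    define F where "F = inv_into ?M q ` q ` ?M"
    have "card F \<le> card (q ` ?M)" unfolding F_def
      by (rule card_image_le) (rule finite_subset[OF q_range fin])
    also have "\<dots> \<le> card (B \<rightarrow>\<^sub>E {-L..L})" by (rule card_mono[OF fin q_range])
    also have "\<dots> = nat (2 * L + 1) ^ ?m" using finB cB L0 by (simp add: card_PiE algebra_simps)
    finally have "real (card F) \<le> real (nat (2 * L + 1) ^ ?m)" by (rule of_nat_mono)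
    also have "\<dots> = (2 * real_of_int L + 1) ^ ?m" using L0 by simp
    also have "\<dots> \<le> ((2 * (c * norm p + 1) + 1) / \<eta>) ^ ?m"
    proof (rule power_mono)
      have "2 * real_of_int L + 1 \<le> 2 * (c * norm p / \<eta>) + 3" using Lb by simp
      also have "\<dots> \<le> 2 * (c * norm p / \<eta>) + 3 / \<eta>" using \<eta> by (simp add: field_simps)
      finally show "2 * real_of_int L + 1 \<le> (2 * (c * norm p + 1) + 1) / \<eta>" by (simp add: field_simps add_divide_distrib)
    qed (use L0 in auto)
    finally have cardF: "real (card F) \<le> ((2 * (c * norm p + 1) + 1) / \<eta>) ^ ?m" .
    have FM: "F \<subseteq> ?M" unfolding F_def by (intro image_subsetI inv_into_into)
    have "\<exists>A'\<in>F. A \<in> ball A' \<eta>" if A: "A \<in> ?M" for A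
    proof
      let ?A' = "inv_into ?M q (q A)"
      show A'F: "?A' \<in> F" using A unfolding F_def by blast
      then have A'M: "?A' \<in> ?M" using FM by blast
      have qA': "q ?A' = q A" using A by (intro f_inv_into_f) blast
      have coord: "\<bar>(?A' - A) \<bullet> b\<bar> \<le> \<eta> / c" if b: "b \<in> B" for b
      proof -
        have "\<lfloor>(?A' \<bullet> b) * c / \<eta>\<rfloor> = \<lfloor>(A \<bullet> b) * c / \<eta>\<rfloor>" using fun_cong[OF qA', of b] b by (simp add: q_def)
        then have "\<bar>(?A' \<bullet> b) * c / \<eta> - (A \<bullet> b) * c / \<eta>\<bar> \<le> 1" by linarith
        also have "(?A' \<bullet> b) * c / \<eta> - (A \<bullet> b) * c / \<eta> = ((?A' - A) \<bullet> b) * c / \<eta>"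
          by (simp add: inner_diff_left diff_divide_distrib algebra_simps)
        finally show ?thesis using c \<eta> by (simp add: abs_mult field_simps)
      qed
      have "norm (?\<pi> (?A' - A)) \<le> (\<Sum>b\<in>B. \<eta> / c)"
        unfolding orthonormal_basis_expansion[OF B]
        by (rule sum_norm_le) (use coord B in \<open>auto simp: orthonormal_basis_def\<close>)
      also have "\<dots> = ?m * \<eta> / c" using cB by simp
      finally have "norm (?A' - A) \<le> 2 * (?m * \<eta> / c)" using \<delta>(2)[OF A'M A] by linarith
      also have "\<dots> < \<eta>" using \<eta> by (simp add: c_def field_simps)
      finally show "A \<in> ball ?A' \<eta>" by (simp add: dist_norm)
    qed
    then show ?thesis using cardF FM finite_subset[OF q_range fin] by (intro exI[of _ F]) (auto simp: F_def)
  qed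
  show ?thesis
  proof (intro exI[of _ C] conjI allI impI)
    show "C > 0" unfolding C_def using c by (intro add_nonneg_pos mult_nonneg_nonneg zero_le_power) auto
    fix \<eta> :: real assume \<eta>: "0 < \<eta> \<and> \<eta> \<le> 1"
    then obtain F where F: "finite F" "F \<subseteq> orbit p" "real (card F) \<le> ((2 * (c * norm p + 1) + 1) / \<eta>) ^ ?m"
       "orbit p \<inter> ball p \<delta> \<subseteq> (\<Union>A\<in>F. ball A \<eta>)"
      using local[of \<eta>] by blast
    let ?F = "\<Union>a\<in>I. app a ` F"
    have "card ?F \<le> (\<Sum>a\<in>I. card (app a ` F))" by (rule card_UN_le[OF I(1)])
    also have "\<dots> \<le> card I * card F" using sum_bounded_above[of I "\<lambda>a. card (app a ` F)" "card F"] F(1) card_image_le by auto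
    finally have "real (card ?F) \<le> real (card I) * real (card F)" by (metis of_nat_mono of_nat_mult)
    also have "\<dots> \<le> real (card I) * ((2 * (c * norm p + 1) + 1) / \<eta>) ^ ?m" using F(3) by (rule mult_left_mono) simp
    also have "\<dots> \<le> C * (1 / \<eta>) ^ ?m"
    proof -
      have "((2 * (c * norm p + 1) + 1) / \<eta>) ^ ?m = (2 * (c * norm p + 1) + 1) ^ ?m * (1 / \<eta>) ^ ?m"
        by (simp add: power_divide)
      then show ?thesis using \<eta> unfolding C_def distrib_right by (simp only: mult.assoc) simp
    qed
    finally have card: "real (card ?F) \<le> C * (1 / \<eta>) ^ ?m" .
    have "\<exists>A\<in>?F. x \<in> ball A \<eta>" if x: "x \<in> orbit p" for x
    proof -
      obtain a where a: "a \<in> I" "dist (app a p) x < \<delta>" using I(3) x by auto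
      then have aK: "a \<in> K" using I(2) by blast
      obtain b where b: "b \<in> K" "b * a = 1" "a * b = 1" using inverse aK by blast
      have iso: "dist (app k u) (app k v) = dist u v" if "k \<in> K" for k u v
        using isometry[OF that] by (simp add: dist_norm app.diff_right[symmetric])
      have bap: "app b (app a p) = p" and abx: "app a (app b x) = x" using b by (simp_all add: app_mult[symmetric])
      have "app b x \<in> orbit p \<inter> ball p \<delta>"
        using orbit_closed[OF x b(1)] iso[OF b(1), of "app a p" x] a(2) by (simp add: bap)
      then obtain A where A: "A \<in> F" "dist A (app b x) < \<eta>" using F(4) by auto
      then have "dist (app a A) x < \<eta>" using iso[OF aK, of A "app b x"] by (simp add: abx)
      then show ?thesis using a(1) A(1) by auto
    qed
    then have "orbit p \<subseteq> (\<Union>A\<in>?F. ball A \<eta>)" by blast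
    moreover have "?F \<subseteq> orbit p" using F(2) I(2) orbit_closed by blast
    moreover have "finite ?F" using F(1) I(1) by blast
    ultimately show "\<exists>F. finite F \<and> F \<subseteq> orbit p \<and> real (card F) \<le> C * (1 / \<eta>) ^ ?m \<and> orbit p \<subseteq> (\<Union>A\<in>F. ball A \<eta>)"
      using card by (intro exI[of _ ?F] conjI)
  qed
qed

end

section \<open>Lebesgue measure on a subspace\<close>

text \<open>The measure in the definition of \<open>leb_on\<close>, with the basis as a parameter: this allows to transport it along linear maps before it is known to be independent of the basis.\<close>

definition leb_basis :: "'a::euclidean_space set \<Rightarrow> 'a measure" where
  "leb_basis B = distr (\<Pi>\<^sub>M b\<in>B. lborel) borel (\<lambda>c. \<Sum>b\<in>B. c b *\<^sub>R b)"

interpretation lborels: product_sigma_finite "\<lambda>_. lborel :: real measure"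
  by (rule product_sigma_finite.intro) (rule sigma_finite_lborel)

lemma measurable_coordinate_sum [measurable]:
  "(\<lambda>c. \<Sum>b\<in>B. c b *\<^sub>R f b) \<in> (\<Pi>\<^sub>M b\<in>B. lborel :: real measure) \<rightarrow>\<^sub>M (borel :: 'a::euclidean_space measure)"
  by measurable

lemma sets_leb_basis [simp, measurable_cong]: "sets (leb_basis B) = sets borel"
  by (simp add: leb_basis_def)

lemma space_leb_basis [simp]: "space (leb_basis B) = UNIV"
  by (simp add: leb_basis_def)

lemma distr_PiM_lborel_affine:
  assumes B: "finite B" and r: "r > 0"
  shows "distr (\<Pi>\<^sub>M b\<in>B. lborel) (\<Pi>\<^sub>M b\<in>B. lborel) (\<lambda>c. \<lambda>b\<in>B. w b + r * c b)
     = scale_measure (ennreal (1 / r ^ card B)) (\<Pi>\<^sub>M b\<in>B. lborel :: real measure)"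
proof -
  let ?P = "\<Pi>\<^sub>M b\<in>B. lborel :: real measure"
  let ?T = "\<lambda>c. \<lambda>b\<in>B. w b + r * c b"
  have T[measurable]: "?T \<in> ?P \<rightarrow>\<^sub>M ?P" by measurable
  have "scale_measure (ennreal (r ^ card B)) (distr ?P ?P ?T) = ?P"
  proof (rule lborels.PiM_eqI[OF B])
    show "sets (scale_measure (ennreal (r ^ card B)) (distr ?P ?P ?T)) = sets ?P" by simp
    fix A :: "_ \<Rightarrow> real set" assume A: "\<And>b. b \<in> B \<Longrightarrow> A b \<in> sets lborel"
    have pre: "?T -` (Pi\<^sub>E B A) \<inter> space ?P = Pi\<^sub>E B (\<lambda>b. (\<lambda>x. w b + r * x) -` A b)"
      by (auto simp: space_PiM PiE_iff extensional_def)
    have meas: "(\<lambda>x. w b + r * x) -` A b \<in> sets lborel" if "b \<in> B" for b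
      using measurable_sets_borel[of "\<lambda>x. w b + r * x" borel "A b"] A[OF that] by simp
    have one: "ennreal r * emeasure lborel ((\<lambda>x. w b + r * x) -` A b) = emeasure lborel (A b)" if "b \<in> B" for b
    proof -
      have "emeasure lborel (A b) = emeasure (density (distr lborel borel (\<lambda>x. w b + r * x)) (\<lambda>_. ennreal \<bar>r\<bar>)) (A b)"
        using lborel_real_affine[of r "w b"] r by simp
      also have "\<dots> = ennreal r * emeasure lborel ((\<lambda>x. w b + r * x) -` A b)"
        using A[OF that] r by (subst emeasure_density_const) (simp_all add: emeasure_distr)
      finally show ?thesis by simp
    qed
    have "emeasure (scale_measure (ennreal (r ^ card B)) (distr ?P ?P ?T)) (Pi\<^sub>E B A)
      = ennreal (r ^ card B) * emeasure ?P (Pi\<^sub>E B (\<lambda>b. (\<lambda>x. w b + r * x) -` A b))"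
      using A B by (simp add: emeasure_distr pre sets_PiM_I_finite)
    also have "\<dots> = (\<Prod>b\<in>B. ennreal r) * (\<Prod>b\<in>B. emeasure lborel ((\<lambda>x. w b + r * x) -` A b))"
      using meas r by (simp add: lborels.emeasure_PiM[OF B] ennreal_power)
    also have "\<dots> = (\<Prod>b\<in>B. emeasure lborel (A b))"
      unfolding prod.distrib[symmetric] using one by (intro prod.cong) auto
    finally show "emeasure (scale_measure (ennreal (r ^ card B)) (distr ?P ?P ?T)) (Pi\<^sub>E B A) = (\<Prod>b\<in>B. emeasure lborel (A b))" .
  qed
  then have "scale_measure (ennreal (1 / r ^ card B)) ?P
     = scale_measure (ennreal (1 / r ^ card B)) (scale_measure (ennreal (r ^ card B)) (distr ?P ?P ?T))" by simp
  also have "\<dots> = distr ?P ?P ?T"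
    using r by (simp add: ennreal_mult[symmetric])
  finally show ?thesis by simp
qed

lemma leb_basis_linear_image:
  assumes L: "linear L" and inj: "inj_on L B" and B: "finite B"
  shows "leb_basis (L ` B) = distr (leb_basis B) borel L"
proof -
  let ?P = "\<Pi>\<^sub>M b\<in>B. lborel :: real measure" and ?P' = "\<Pi>\<^sub>M b\<in>L ` B. lborel :: real measure"
  let ?T = "\<lambda>f. \<lambda>b\<in>B. f (L b)"
  have T[measurable]: "?T \<in> ?P' \<rightarrow>\<^sub>M ?P"
    by (rule measurable_restrict) (auto intro: measurable_component_singleton)
  have P: "distr ?P' ?P ?T = ?P"
  proof (rule lborels.PiM_eqI[OF B])
    fix A :: "_ \<Rightarrow> real set" assume A: "\<And>b. b \<in> B \<Longrightarrow> A b \<in> sets lborel"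
    have pre: "?T -` (Pi\<^sub>E B A) \<inter> space ?P' = Pi\<^sub>E (L ` B) (\<lambda>b. A (the_inv_into B L b))"
      by (auto simp: space_PiM PiE_iff extensional_def the_inv_into_f_f[OF inj])
    have "emeasure (distr ?P' ?P ?T) (Pi\<^sub>E B A) = (\<Prod>b\<in>L ` B. emeasure lborel (A (the_inv_into B L b)))"
      using A B by (simp add: emeasure_distr sets_PiM_I_finite pre)
        (subst lborels.emeasure_PiM, auto simp: the_inv_into_f_f[OF inj])
    also have "\<dots> = (\<Prod>b\<in>B. emeasure lborel (A b))"
      by (subst prod.reindex[OF inj]) (simp add: the_inv_into_f_f[OF inj])
    finally show "emeasure (distr ?P' ?P ?T) (Pi\<^sub>E B A) = (\<Prod>b\<in>B. emeasure lborel (A b))" .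
  qed simp
  have Lm[measurable]: "L \<in> borel \<rightarrow>\<^sub>M borel"
    using L by (intro borel_measurable_continuous_onI linear_continuous_on) (simp add: linear_conv_bounded_linear)
  have "distr (leb_basis B) borel L = distr (distr ?P' ?P ?T) borel (L \<circ> (\<lambda>c. \<Sum>b\<in>B. c b *\<^sub>R b))"
    unfolding leb_basis_def P by (rule distr_distr) measurable
  also have "\<dots> = distr ?P' borel ((L \<circ> (\<lambda>c. \<Sum>b\<in>B. c b *\<^sub>R b)) \<circ> ?T)"
    by (rule distr_distr[OF measurable_comp[OF measurable_coordinate_sum Lm] T])
  also have "(L \<circ> (\<lambda>c. \<Sum>b\<in>B. c b *\<^sub>R b)) \<circ> ?T = (\<lambda>c. \<Sum>b\<in>L ` B. c b *\<^sub>R b)"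
    by (auto simp: fun_eq_iff sum.reindex[OF inj] linear_sum[OF L] linear_scale[OF L])
  finally show ?thesis by (simp add: leb_basis_def)
qed

lemma AE_leb_basis_span: "finite B \<Longrightarrow> AE x in leb_basis B. x \<in> span B"
  unfolding leb_basis_def
  by (subst AE_distr_iff) (auto simp: closed_subspace intro!: AE_I2 span_sum borel_closed intro: span_scale span_base)

lemma norm_coordinate_sum:
  assumes "orthonormal_basis W B"
  shows "(norm (\<Sum>b\<in>B. c b *\<^sub>R b))\<^sup>2 = (\<Sum>b\<in>B. (c b)\<^sup>2)"
proof -
  have "(norm (\<Sum>b\<in>B. c b *\<^sub>R b))\<^sup>2 = (\<Sum>b\<in>B. c b * ((\<Sum>b\<in>B. c b *\<^sub>R b) \<bullet> b))"
    unfolding power2_norm_eq_inner by (subst inner_sum_right) simp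
  also have "\<dots> = (\<Sum>b\<in>B. (c b)\<^sup>2)"
    by (intro sum.cong) (auto simp: orthonormal_basis_inner_sum[OF assms] power2_eq_square)
  finally show ?thesis .
qed

lemma abs_coordinate_le:
  assumes "orthonormal_basis W B" "b \<in> B"
  shows "\<bar>c b\<bar> \<le> norm (\<Sum>b\<in>B. c b *\<^sub>R b)"
proof -
  have "(c b)\<^sup>2 \<le> (norm (\<Sum>b\<in>B. c b *\<^sub>R b))\<^sup>2"
    unfolding norm_coordinate_sum[OF assms(1)] using assms orthonormal_basisD(1)[OF assms(1)]
    by (intro member_le_sum) auto
  then show ?thesis by (rule power2_le_imp_le[where x = "\<bar>c b\<bar>", simplified]) simp
qed

lemma emeasure_leb_basis_cball:
  assumes B: "orthonormal_basis W B"
  shows "emeasure (leb_basis B) (cball 0 r) < \<infinity>" and "emeasure (leb_basis B) (cball 0 1) > 0"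
proof -
  let ?P = "\<Pi>\<^sub>M b\<in>B. lborel :: real measure"
  have fin: "finite B" using B by (rule orthonormal_basisD)
  have em: "emeasure (leb_basis B) (cball 0 r) = emeasure ?P {c \<in> space ?P. norm (\<Sum>b\<in>B. c b *\<^sub>R b) \<le> r}" for r
    unfolding leb_basis_def by (subst emeasure_distr) (auto intro!: arg_cong[where f = "emeasure ?P"])
  have "emeasure (leb_basis B) (cball 0 r) \<le> emeasure ?P (Pi\<^sub>E B (\<lambda>_. {-r..r}))"
    unfolding em
  proof (rule emeasure_mono)
    show "{c \<in> space ?P. norm (\<Sum>b\<in>B. c b *\<^sub>R b) \<le> r} \<subseteq> Pi\<^sub>E B (\<lambda>_. {-r..r})"
    proof
      fix c assume c: "c \<in> {c \<in> space ?P. norm (\<Sum>b\<in>B. c b *\<^sub>R b) \<le> r}"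
      then have "\<bar>c b\<bar> \<le> r" if "b \<in> B" for b
        using abs_coordinate_le[OF B that, of c] by simp
      then show "c \<in> Pi\<^sub>E B (\<lambda>_. {-r..r})" using c by (auto simp: space_PiM PiE_iff abs_le_iff minus_le_iff)
    qed
  qed (auto intro!: sets_PiM_I_finite fin)
  also have "\<dots> < \<infinity>" by (subst lborels.emeasure_PiM[OF fin]) (auto simp: power_less_top_ennreal emeasure_lborel_Icc_eq)
  finally show "emeasure (leb_basis B) (cball 0 r) < \<infinity>" .
  define d where "d = 1 / (real (card B) + 1)"
  have d: "d > 0" by (simp add: d_def)
  have "0 < ennreal ((2 * d) ^ card B)" using d by simp
  also have "\<dots> = emeasure ?P (Pi\<^sub>E B (\<lambda>_. {-d..d}))"
    using d by (subst lborels.emeasure_PiM[OF fin]) (auto simp: emeasure_lborel_Icc_eq ennreal_power)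
  also have "\<dots> \<le> emeasure (leb_basis B) (cball 0 1)"
    unfolding em
  proof (rule emeasure_mono)
    have "norm (\<Sum>b\<in>B. c b *\<^sub>R b) \<le> 1" if "c \<in> Pi\<^sub>E B (\<lambda>_. {-d..d})" for c
    proof -
      have "norm (\<Sum>b\<in>B. c b *\<^sub>R b) \<le> (\<Sum>b\<in>B. d)"
      proof (rule sum_norm_le)
        fix b assume b: "b \<in> B"
        then have "norm b = 1" using B by (simp add: orthonormal_basis_def)
        moreover have "\<bar>c b\<bar> \<le> d" using that b by (auto simp: PiE_iff abs_le_iff)
        ultimately show "norm (c b *\<^sub>R b) \<le> d" by simp
      qed
      also have "\<dots> \<le> 1" by (simp add: d_def field_simps)
      finally show ?thesis .
    qed
    then show "Pi\<^sub>E B (\<lambda>_. {-d..d}) \<subseteq> {c \<in> space ?P. norm (\<Sum>b\<in>B. c b *\<^sub>R b) \<le> 1}"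
      by (auto simp: space_PiM PiE_iff)
  qed measurable
  finally show "emeasure (leb_basis B) (cball 0 1) > 0" .
qed

lemma sigma_finite_leb_basis:
  assumes B: "orthonormal_basis W B" shows "sigma_finite_measure (leb_basis B)"
proof
  show "\<exists>A. countable A \<and> A \<subseteq> sets (leb_basis B) \<and> \<Union> A = space (leb_basis B) \<and> (\<forall>a\<in>A. emeasure (leb_basis B) a \<noteq> \<infinity>)"
  proof (intro exI[of _ "range (\<lambda>n::nat. cball 0 (real n))"] conjI)
    show "\<Union> (range (\<lambda>n::nat. cball (0::'a) (real n))) = space (leb_basis B)"
      by (auto simp: real_arch_simple)
  qed (use emeasure_leb_basis_cball(1)[OF B] in \<open>auto simp: less_top\<close>)
qed

lemma leb_basis_affine:
  assumes B: "orthonormal_basis W B" and w: "w \<in> W" and r: "r > 0"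
  shows "distr (leb_basis B) borel (\<lambda>x. w + r *\<^sub>R x) = scale_measure (ennreal (1 / r ^ card B)) (leb_basis B)"
proof -
  let ?P = "\<Pi>\<^sub>M b\<in>B. lborel :: real measure"
  let ?s = "\<lambda>c. \<Sum>b\<in>B. c b *\<^sub>R b"
  let ?T = "\<lambda>c. \<lambda>b\<in>B. w \<bullet> b + r * c b"
  have fin: "finite B" using B by (rule orthonormal_basisD)
  have weq: "(\<Sum>b\<in>B. (w \<bullet> b) *\<^sub>R b) = w"
    using orthonormal_basis_expansion[OF B, of w] orth_proj_id[OF _ w] orthonormal_basisD[OF B] by simp
  have "distr (leb_basis B) borel (\<lambda>x. w + r *\<^sub>R x) = distr ?P borel ((\<lambda>x. w + r *\<^sub>R x) \<circ> ?s)"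
    unfolding leb_basis_def by (rule distr_distr) measurable
  also have "(\<lambda>x. w + r *\<^sub>R x) \<circ> ?s = (\<lambda>c. \<Sum>b\<in>B. (w \<bullet> b + r * c b) *\<^sub>R b)"
    by (auto simp: fun_eq_iff scaleR_sum_right sum.distrib weq scaleR_add_left)
  also have "distr ?P borel \<dots> = distr ?P borel (?s \<circ> ?T)"
    by (rule distr_cong) (auto simp: comp_def)
  also have "\<dots> = distr (distr ?P ?P ?T) borel ?s"
    by (rule distr_distr[symmetric]) measurable
  also have "\<dots> = distr (scale_measure (ennreal (1 / r ^ card B)) ?P) borel ?s"
    using distr_PiM_lborel_affine[OF fin r, of "\<lambda>b. w \<bullet> b"] by simp
  also have "\<dots> = scale_measure (ennreal (1 / r ^ card B)) (leb_basis B)"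
    unfolding leb_basis_def
  proof (rule measure_eqI)
    fix A :: "'a set" assume A: "A \<in> sets (distr (scale_measure (ennreal (1 / r ^ card B)) ?P) borel ?s)"
    have "?s \<in> scale_measure (ennreal (1 / r ^ card B)) ?P \<rightarrow>\<^sub>M borel"
      unfolding measurable_cong_sets[OF sets_scale_measure refl] by measurable
    then show "emeasure (distr (scale_measure (ennreal (1 / r ^ card B)) ?P) borel ?s) A
      = emeasure (scale_measure (ennreal (1 / r ^ card B)) (distr ?P borel ?s)) A"
      using A by (simp add: emeasure_distr space_scale_measure)
  qed simp
  finally show ?thesis .
qed

text \<open>Uniqueness of Haar measure in cross-multiplied form, by the classical Fubini computation with \<open>A \<times> E\<close>. Symmetry of \<open>E\<close> avoids a reflection.\<close>

lemma translation_invariant_proportional: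
  fixes M N :: "'a::euclidean_space measure"
  assumes sf: "sigma_finite_measure M" "sigma_finite_measure N"
    and sets: "sets M = sets borel" "sets N = sets borel"
    and conc: "AE x in M. x \<in> W" "AE x in N. x \<in> W" and W: "subspace W"
    and inv: "\<And>w. w \<in> W \<Longrightarrow> distr M borel (\<lambda>x. w + x) = M" "\<And>w. w \<in> W \<Longrightarrow> distr N borel (\<lambda>x. w + x) = N"
    and A: "A \<in> sets borel" and E: "E \<in> sets borel" "\<And>x. x \<in> E \<longleftrightarrow> - x \<in> E"
  shows "emeasure M A * emeasure N E = emeasure M E * emeasure N A"
proof -
  note [measurable_cong] = sets
  note [measurable] = A E(1)
  interpret pair_sigma_finite M N using sf by (rule pair_sigma_finite.intro)
  have shN: "emeasure N {y. x - y \<in> E} = emeasure N E" if "x \<in> W" for x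
  proof -
    have "- x \<in> W" using W that by (simp add: subspace_neg)
    then have "emeasure N E = emeasure (distr N borel (\<lambda>y. - x + y)) E" using inv(2)[of "- x"] by simp
    also have "\<dots> = emeasure N {y. - x + y \<in> E}"
      using sets_eq_imp_space_eq[OF sets(2)] by (subst emeasure_distr) (auto simp: vimage_def)
    also have "{y. - x + y \<in> E} = {y. x - y \<in> E}"
      using E(2)[of "- x + y" for y] by simp
    finally show ?thesis by simp
  qed
  have shN': "emeasure N {y. x + y \<in> A} = emeasure N A" if "x \<in> W" for x
  proof -
    have "emeasure N A = emeasure (distr N borel (\<lambda>y. x + y)) A" using inv that by simp
    also have "\<dots> = emeasure N {y. x + y \<in> A}"
      using sets_eq_imp_space_eq[OF sets(2)] by (subst emeasure_distr) (auto simp: vimage_def)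
    finally show ?thesis by simp
  qed
  have "emeasure M A * emeasure N E = (\<integral>\<^sup>+x. emeasure N E * indicator A x \<partial>M)"
    by (subst nn_integral_cmult_indicator) (auto simp: sets mult.commute)
  also have "\<dots> = (\<integral>\<^sup>+x. \<integral>\<^sup>+y. indicator A x * indicator E (x - y) \<partial>N \<partial>M)"
    apply (rule nn_integral_cong_AE)
    using conc(1)
  proof eventually_elim
    case (elim x)
    then have x: "x \<in> W" .
    have "(\<integral>\<^sup>+y. indicator A x * indicator E (x - y) \<partial>N) = indicator A x * (\<integral>\<^sup>+y. indicator {y. x - y \<in> E} y \<partial>N)"
      by (subst nn_integral_cmult[symmetric]) (auto intro!: nn_integral_cong simp: indicator_def)
    also have "\<dots> = indicator A x * emeasure N E"
      using shN[OF x] by (subst nn_integral_indicator) (auto simp: sets)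
    finally show ?case by (simp add: mult.commute)
  qed
  also have "\<dots> = (\<integral>\<^sup>+y. \<integral>\<^sup>+x. indicator A x * indicator E (x - y) \<partial>M \<partial>N)"
    by (rule Fubini'[symmetric]) measurable
  also have "\<dots> = (\<integral>\<^sup>+y. \<integral>\<^sup>+x. indicator A (x + y) * indicator E x \<partial>M \<partial>N)"
    apply (rule nn_integral_cong_AE)
    using conc(2)
  proof eventually_elim
    case (elim y)
    then have y: "y \<in> W" .
    have "(\<integral>\<^sup>+x. indicator A x * indicator E (x - y) \<partial>M) = (\<integral>\<^sup>+x. indicator A x * indicator E (x - y) \<partial>distr M borel (\<lambda>x. y + x))"
      using inv y by simp
    also have "\<dots> = (\<integral>\<^sup>+x. indicator A (x + y) * indicator E x \<partial>M)"
      by (subst nn_integral_distr) (auto simp: add.commute)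
    finally show ?case .
  qed
  also have "\<dots> = (\<integral>\<^sup>+x. \<integral>\<^sup>+y. indicator A (x + y) * indicator E x \<partial>N \<partial>M)"
    by (rule Fubini') measurable
  also have "\<dots> = (\<integral>\<^sup>+x. emeasure N A * indicator E x \<partial>M)"
    apply (rule nn_integral_cong_AE)
    using conc(1)
  proof eventually_elim
    case (elim x)
    then have x: "x \<in> W" .
    have "(\<integral>\<^sup>+y. indicator A (x + y) * indicator E x \<partial>N) = indicator E x * (\<integral>\<^sup>+y. indicator {y. x + y \<in> A} y \<partial>N)"
      by (subst nn_integral_cmult[symmetric]) (auto intro!: nn_integral_cong simp: indicator_def)
    also have "\<dots> = indicator E x * emeasure N A"
      using shN'[OF x] by (subst nn_integral_indicator) (auto simp: sets)
    finally show ?case by (simp add: mult.commute)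
  qed
  also have "\<dots> = emeasure M E * emeasure N A"
    by (subst nn_integral_cmult_indicator) (auto simp: sets mult.commute)
  finally show ?thesis .
qed

text \<open>Both measures are translation invariant on \<open>W\<close>, hence proportional. The unit ball has the same mass for both, because the linear map that matches the bases preserves norms.\<close>

lemma leb_basis_unique:
  assumes B: "orthonormal_basis W B" and C: "orthonormal_basis W C"
  shows "leb_basis B = leb_basis C"
proof -
  have fin: "finite B" "finite C" and W: "subspace W" and sp: "span B = W" "span C = W"
    and card: "card B = card C"
    using orthonormal_basisD[OF B] orthonormal_basisD[OF C] by auto
  obtain \<phi> where \<phi>: "bij_betw \<phi> B C" using fin card by (metis finite_same_card_bij)
  define L where "L x = (\<Sum>b\<in>B. (x \<bullet> b) *\<^sub>R \<phi> b)" for x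
  have L: "linear L" unfolding L_def
    by (intro linear_compose_sum ballI) (simp add: linear_iff inner_add_left scaleR_add_left)
  have Lb: "L b = \<phi> b" if "b \<in> B" for b
  proof -
    have "L b = (\<Sum>b'\<in>B. if b' = b then \<phi> b' else 0)" unfolding L_def
      using that orthonormal_basisD(7)[OF B] by (intro sum.cong) auto
    then show ?thesis using that fin by simp
  qed
  have LB: "L ` B = C" "inj_on L B" using \<phi> Lb by (auto simp: bij_betw_def inj_on_def)
  have eq: "leb_basis C = distr (leb_basis B) borel L"
    using leb_basis_linear_image[OF L LB(2) fin(1)] LB(1) by simp
  have Lm[measurable]: "L \<in> borel \<rightarrow>\<^sub>M borel"
    using L by (intro borel_measurable_continuous_onI linear_continuous_on) (simp add: linear_conv_bounded_linear)
  have Ln: "norm (L x) = norm x" if "x \<in> W" for x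
  proof -
    have "x = (\<Sum>b\<in>B. (x \<bullet> b) *\<^sub>R b)"
      using orthonormal_basis_expansion[OF B, of x] orth_proj_id[OF W that] by simp
    then have "(norm x)\<^sup>2 = (\<Sum>b\<in>B. (x \<bullet> b)\<^sup>2)" using norm_coordinate_sum[OF B] by metis
    also have "\<dots> = (\<Sum>c\<in>C. (x \<bullet> the_inv_into B \<phi> c)\<^sup>2)"
      using \<phi> by (intro sum.reindex_bij_betw_not_neutral[symmetric, where S' = "{}" and T' = "{}"] sum.reindex_bij_witness[where i = "the_inv_into B \<phi>" and j = \<phi>])
        (auto simp: bij_betw_def the_inv_into_f_f f_the_inv_into_f intro: the_inv_into_into)
    also have "\<dots> = (norm (\<Sum>c\<in>C. (x \<bullet> the_inv_into B \<phi> c) *\<^sub>R c))\<^sup>2" using norm_coordinate_sum[OF C] by simp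
    also have "(\<Sum>c\<in>C. (x \<bullet> the_inv_into B \<phi> c) *\<^sub>R c) = L x"
      unfolding L_def using \<phi> by (intro sum.reindex_bij_witness[where j = "the_inv_into B \<phi>" and i = \<phi>])
        (auto simp: bij_betw_def the_inv_into_f_f f_the_inv_into_f intro: the_inv_into_into)
    finally show ?thesis by (simp add: power2_eq_iff_nonneg)
  qed
  have ball: "emeasure (leb_basis C) (cball 0 1) = emeasure (leb_basis B) (cball 0 1)"
  proof -
    have "emeasure (leb_basis C) (cball 0 1) = emeasure (leb_basis B) (L -` cball 0 1)"
      unfolding eq by (subst emeasure_distr) auto
    also have "\<dots> = emeasure (leb_basis B) (cball 0 1)"
    proof (rule emeasure_eq_AE)
      show "AE x in leb_basis B. (x \<in> L -` cball 0 1) = (x \<in> cball 0 1)"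
        using AE_leb_basis_span[OF fin(1)] by eventually_elim (simp add: sp Ln)
      show "L -` cball 0 1 \<in> sets (leb_basis B)" using measurable_sets_borel[OF Lm, of "cball 0 1"] by simp
    qed simp
    finally show ?thesis .
  qed
  have inv: "distr (leb_basis D) borel (\<lambda>x. w + x) = leb_basis D" if "orthonormal_basis W D" "w \<in> W" for D w
    using leb_basis_affine[OF that, of 1] by (simp add: scale_measure_1)
  show ?thesis
  proof (rule measure_eqI)
    fix A assume "A \<in> sets (leb_basis B)"
    then have "emeasure (leb_basis B) A * emeasure (leb_basis C) (cball 0 1) = emeasure (leb_basis B) (cball 0 1) * emeasure (leb_basis C) A"
      using AE_leb_basis_span[OF fin(1)] AE_leb_basis_span[OF fin(2)] W inv[OF B] inv[OF C] unfolding sp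
      by (intro translation_invariant_proportional[where W = W] sigma_finite_leb_basis[OF B] sigma_finite_leb_basis[OF C]) auto
    then show "emeasure (leb_basis B) A = emeasure (leb_basis C) A"
      using emeasure_leb_basis_cball(1)[OF B, of 1] emeasure_leb_basis_cball(2)[OF B] unfolding ball
      by (subst (asm) mult.commute) (auto simp: ennreal_mult_cancel_left)
  qed simp
qed

lemma leb_on_eq:
  assumes "orthonormal_basis W B" shows "leb_on W = leb_basis B"
proof -
  have "orthonormal_basis W (SOME B. orthonormal_basis W B)" using assms by (rule someI)
  then show ?thesis using leb_basis_unique[OF _ assms] by (simp add: leb_on_def leb_basis_def Let_def)
qed

section \<open>Spheres and polar coordinates in a subspace\<close>

lemma sets_leb_on [simp, measurable_cong]: "sets (leb_on W) = sets borel"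
  by (simp add: leb_on_def Let_def)

lemma space_leb_on [simp]: "space (leb_on W) = UNIV"
  by (simp add: leb_on_def Let_def)

lemma obtain_leb_basis:
  assumes "subspace W"
  obtains B where "orthonormal_basis W B" "leb_on W = leb_basis B" "card B = dim W"
  using orthonormal_basis_ex[OF assms] leb_on_eq orthonormal_basisD(5) by metis

lemma AE_leb_on:
  assumes "subspace W" shows "AE x in leb_on W. x \<in> W"
proof -
  obtain B where B: "orthonormal_basis W B" "leb_on W = leb_basis B" by (rule obtain_leb_basis[OF assms])
  show ?thesis
    using AE_leb_basis_span[OF orthonormal_basisD(1)[OF B(1)]]
    unfolding B(2) orthonormal_basisD(6)[OF B(1)] .
qed

lemma emeasure_leb_on_cball:
  assumes "subspace W"
  shows "emeasure (leb_on W) (cball 0 r) < \<infinity>" and "emeasure (leb_on W) (cball 0 1) > 0"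
  by (metis obtain_leb_basis[OF assms] emeasure_leb_basis_cball)+

lemma emeasure_leb_on_unit_ball:
  assumes "subspace W"
  obtains w where "emeasure (leb_on W) (cball 0 1) = ennreal w" "w > 0"
  using emeasure_leb_on_cball(1)[OF assms, of 1] emeasure_leb_on_cball(2)[OF assms]
  by (cases "emeasure (leb_on W) (cball 0 1)") auto

lemma sigma_finite_leb_on: "subspace W \<Longrightarrow> sigma_finite_measure (leb_on W)"
  by (metis obtain_leb_basis sigma_finite_leb_basis)

lemma leb_on_affine:
  assumes "subspace W" "w \<in> W" "r > 0"
  shows "distr (leb_on W) borel (\<lambda>x. w + r *\<^sub>R x) = scale_measure (ennreal (1 / r ^ dim W)) (leb_on W)"
  by (metis obtain_leb_basis[OF assms(1)] leb_basis_affine assms)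

text \<open>The image of an orthonormal basis is one, and any orthonormal basis computes the measure.\<close>

lemma leb_on_isometry:
  assumes W: "subspace W" and L: "linear L" and n: "\<And>x. norm (L x) = norm x"
  shows "leb_on (L ` W) = distr (leb_on W) borel L"
proof -
  obtain B where B: "orthonormal_basis W B" "leb_on W = leb_basis B" by (rule obtain_leb_basis[OF W])
  have inner: "L x \<bullet> L y = x \<bullet> y" for x y
    using L n by (metis orthogonal_transformation orthogonal_transformation_def)
  have inj: "inj L" using L n by (metis linear_injective_0 norm_eq_zero)
  have "orthonormal_basis (L ` W) (L ` B)"
    using B(1) n unfolding orthonormal_basis_def
    by (auto simp: pairwise_def orthogonal_def inner linear_span_image[OF L] inj_eq[OF inj])
  then have "leb_on (L ` W) = leb_basis (L ` B)" by (rule leb_on_eq)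
  also have "\<dots> = distr (leb_basis B) borel L"
    by (rule leb_basis_linear_image[OF L inj_on_subset[OF inj subset_UNIV] orthonormal_basisD(1)[OF B(1)]])
  finally show ?thesis using B(2) by simp
qed

lemma emeasure_leb_on_scale:
  assumes "subspace W" "r > 0" "A \<in> sets borel"
  shows "emeasure (leb_on W) A = ennreal (r ^ dim W) * emeasure (leb_on W) {x. r *\<^sub>R x \<in> A}"
proof -
  have "emeasure (leb_on W) {x. r *\<^sub>R x \<in> A} = emeasure (distr (leb_on W) borel (\<lambda>x. 0 + r *\<^sub>R x)) A"
    using assms by (subst emeasure_distr) (auto simp: vimage_def)
  also have "\<dots> = ennreal (1 / r ^ dim W) * emeasure (leb_on W) A"
    using leb_on_affine[OF assms(1) subspace_0[OF assms(1)] assms(2)] by simp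
  finally show ?thesis using assms(2) by (simp add: mult.assoc[symmetric] ennreal_mult[symmetric])
qed

lemma emeasure_leb_on_0:
  assumes "subspace W" "1 \<le> dim W" shows "emeasure (leb_on W) {0} = 0"
proof -
  let ?e = "emeasure (leb_on W) {0}"
  have "?e = ennreal (2 ^ dim W) * ?e"
    using emeasure_leb_on_scale[OF assms(1), of 2 "{0}"] by simp
  moreover have "?e < \<infinity>"
    using emeasure_mono[of "{0}" "cball 0 1" "leb_on W"] emeasure_leb_on_cball(1)[OF assms(1), of 1] by (simp add: le_less_trans)
  ultimately obtain x where x: "?e = ennreal x" "x \<ge> 0" "x = 2 ^ dim W * x"
    by (cases ?e) (auto simp: ennreal_mult[symmetric])
  have "(2::real) ^ dim W > 1" using assms(2) by (intro one_less_power) auto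
  then have "x = 0" using x(3) by simp
  then show ?thesis using x by simp
qed

lemma sets_sphere_measure [simp, measurable_cong]: "sets (sphere_measure W) = sets borel"
  by (simp add: sphere_measure_def)

lemma space_sphere_measure [simp]: "space (sphere_measure W) = UNIV"
  by (simp add: sphere_measure_def)

lemma measurable_sgn_vector [measurable]: "(sgn :: 'a::euclidean_space \<Rightarrow> 'a) \<in> borel \<rightarrow>\<^sub>M borel"
  unfolding sgn_div_norm by measurable

lemma measurable_sgn_uniform: "sgn \<in> uniform_measure (leb_on W) A \<rightarrow>\<^sub>M (borel :: 'a::euclidean_space measure)"
  by measurable

lemma prob_space_sphere_measure:
  assumes "subspace W" shows "prob_space (sphere_measure W)"
  unfolding sphere_measure_def
proof (rule prob_space.prob_space_distr)
  show "prob_space (uniform_measure (leb_on W) (cball 0 1))"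
    by (rule emeasure_leb_on_unit_ball[OF assms]) (intro prob_space_uniform_measure, auto)
qed (rule measurable_sgn_uniform)

lemma emeasure_sphere_measure:
  assumes "A \<in> sets borel"
  shows "emeasure (sphere_measure W) A
    = emeasure (leb_on W) {x \<in> cball 0 1. sgn x \<in> A} / emeasure (leb_on W) (cball 0 1)"
proof -
  have "{x. sgn x \<in> A} \<in> sets borel" using measurable_sets_borel[OF measurable_sgn_vector assms] by (simp add: vimage_def)
  then show ?thesis using assms unfolding sphere_measure_def
    by (subst emeasure_distr[OF measurable_sgn_uniform]) (auto simp: vimage_def emeasure_uniform_measure Int_def)
qed

lemma AE_sphere_measure:
  assumes W: "subspace W" "1 \<le> dim W"
  shows "AE x in sphere_measure W. x \<in> W \<and> norm x = 1"
proof -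
  obtain w where w: "emeasure (leb_on W) (cball 0 1) = ennreal w" "w > 0"
    by (rule emeasure_leb_on_unit_ball[OF W(1)])
  have "AE x in leb_on W. x \<noteq> 0"
    using emeasure_leb_on_0[OF W] by (intro AE_I[where N = "{0}"]) auto
  then have "AE x in leb_on W. x \<in> cball 0 1 \<longrightarrow> sgn x \<in> W \<and> norm (sgn x) = 1"
    using AE_leb_on[OF W(1)]
    by eventually_elim (auto simp: sgn_div_norm subspace_scale[OF W(1)])
  then have "AE x in uniform_measure (leb_on W) (cball 0 1). sgn x \<in> W \<and> norm (sgn x) = 1"
    using w by (subst AE_uniform_measure) auto
  then show ?thesis unfolding sphere_measure_def
    using borel_closed[OF closed_subspace[OF W(1)]]
    by (subst AE_distr_iff[OF measurable_sgn_uniform]) auto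
qed

lemma sphere_measure_isometry:
  assumes W: "subspace W" and L: "linear L" and n: "\<And>x. norm (L x) = norm x"
  shows "sphere_measure (L ` W) = distr (sphere_measure W) borel L"
proof (rule measure_eqI)
  have Lm[measurable]: "L \<in> borel \<rightarrow>\<^sub>M borel"
    using L by (intro borel_measurable_continuous_onI linear_continuous_on) (simp add: linear_conv_bounded_linear)
  have sgnL: "sgn (L x) = L (sgn x)" for x by (simp add: sgn_div_norm n linear_scale[OF L])
  fix A assume "A \<in> sets (sphere_measure (L ` W))"
  then have A[measurable]: "A \<in> sets borel" by simp
  have eq: "emeasure (leb_on (L ` W)) X = emeasure (leb_on W) {x. L x \<in> X}" if "X \<in> sets borel" for X
    unfolding leb_on_isometry[OF assms] using that by (subst emeasure_distr) (auto simp: vimage_def)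
  have "{x \<in> cball 0 1. sgn x \<in> A} \<in> sets borel" by measurable
  then have "emeasure (sphere_measure (L ` W)) A
    = emeasure (leb_on W) {x \<in> cball 0 1. sgn x \<in> {x. L x \<in> A}} / emeasure (leb_on W) (cball 0 1)"
    by (simp add: emeasure_sphere_measure eq n sgnL cball_def)
  also have "\<dots> = emeasure (sphere_measure W) {x. L x \<in> A}"
    by (rule emeasure_sphere_measure[symmetric]) measurable
  also have "\<dots> = emeasure (distr (sphere_measure W) borel L) A"
    by (subst emeasure_distr) (auto simp: vimage_def)
  finally show "emeasure (sphere_measure (L ` W)) A = emeasure (distr (sphere_measure W) borel L) A" .
qed simp

text \<open>The map \<open>x \<mapsto> (norm x, sgn x)\<close> carries Lebesgue measure on \<open>W\<close> to a product: on a set \<open>{..r} \<times> B\<close> both measures are given by the scaling law of Lebesgue measure and the definition of the surface measure through cones.\<close>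

lemma polar_coordinates:
  assumes W: "subspace W" "1 \<le> dim W"
  shows "\<exists>c>0. \<forall>h\<in>borel_measurable borel. (\<integral>\<^sup>+x. h x \<partial>leb_on W)
      = (\<integral>\<^sup>+R. ennreal (c * R ^ (dim W - 1)) * indicator {0..} R * (\<integral>\<^sup>+\<theta>. h (R *\<^sub>R \<theta>) \<partial>sphere_measure W) \<partial>lborel)"
proof -
  let ?\<mu> = "leb_on W" and ?\<sigma> = "sphere_measure W" and ?k = "dim W"
  obtain w where w: "emeasure ?\<mu> (cball 0 1) = ennreal w" "w > 0"
    by (rule emeasure_leb_on_unit_ball[OF W(1)])
  define c where "c = ?k * w"
  have c: "c > 0" using w W by (simp add: c_def)
  interpret \<sigma>: prob_space ?\<sigma> by (rule prob_space_sphere_measure[OF W(1)])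
  define M1 where "M1 = density lborel (\<lambda>R. ennreal (c * R ^ (?k - 1)) * indicator {0..} R)"
  have sM1[simp, measurable_cong]: "sets M1 = sets borel" by (simp add: M1_def)
  have spM1[simp]: "space M1 = UNIV" by (simp add: M1_def)
  have M1_atMost: "emeasure M1 {..r} = ennreal (w * (max 0 r) ^ ?k)" for r
  proof (cases "r \<ge> 0")
    case False
    have z: "ennreal (c * R ^ (?k - 1)) * indicator {0..} R * indicator {..r} R = 0" for R
      using False by (auto simp: indicator_def)
    have "emeasure M1 {..r} = (\<integral>\<^sup>+R. ennreal (c * R ^ (?k - 1)) * indicator {0..} R * indicator {..r} R \<partial>lborel)"
      unfolding M1_def by (rule emeasure_density) auto
    also have "\<dots> = (\<integral>\<^sup>+R. 0 \<partial>(lborel :: real measure))" by (intro nn_integral_cong z)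
    finally have "emeasure M1 {..r} = 0" by simp
    then show ?thesis using False W by (simp add: max_def zero_power)
  next
    case True
    have "emeasure M1 {..r} = (\<integral>\<^sup>+R. ennreal (c * R ^ (?k - 1)) * indicator {0..r} R \<partial>lborel)" unfolding M1_def
      by (subst emeasure_density) (auto intro!: nn_integral_cong simp: indicator_def)
    also have "\<dots> = ennreal (w * r ^ ?k - w * 0 ^ ?k)"
    proof (rule nn_integral_FTC_Icc)
      fix x :: real assume x: "x \<in> {0..r}"
      show "((\<lambda>R. w * R ^ ?k) has_real_derivative c * x ^ (?k - 1)) (at x)"
        unfolding c_def by (auto intro!: derivative_eq_intros)
      show "0 \<le> c * x ^ (?k - 1)" using c x by simp
    qed (use True in auto)
    finally show ?thesis using True W by (simp add: max_def zero_power)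
  qed
  have sf1: "sigma_finite_measure M1"
  proof
    show "\<exists>A. countable A \<and> A \<subseteq> sets M1 \<and> \<Union> A = space M1 \<and> (\<forall>a\<in>A. emeasure M1 a \<noteq> \<infinity>)"
    proof (intro exI[of _ "range (\<lambda>n::nat. {..real n})"] conjI)
      show "\<Union> (range (\<lambda>n::nat. {..real n})) = space M1" by (auto simp: real_arch_simple)
    qed (auto simp: M1_atMost)
  qed
  have sgnr: "sgn (r *\<^sub>R x) = sgn x" if "r > 0" for r and x :: 'a using that by (simp add: sgn_scaleR)
  have ball: "emeasure ?\<mu> {x. norm x \<le> r \<and> sgn x \<in> B} = ennreal (w * (max 0 r) ^ ?k) * emeasure ?\<sigma> B"
    if B[measurable]: "B \<in> sets borel" for r B
  proof (cases "r > 0")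
    case True
    have "emeasure ?\<mu> {x. norm x \<le> r \<and> sgn x \<in> B}
      = ennreal (r ^ ?k) * emeasure ?\<mu> {x. r *\<^sub>R x \<in> {x. norm x \<le> r \<and> sgn x \<in> B}}"
      by (rule emeasure_leb_on_scale[OF W(1) True]) measurable
    also have "{x. r *\<^sub>R x \<in> {x. norm x \<le> r \<and> sgn x \<in> B}} = {x \<in> cball 0 1. sgn x \<in> B}"
      using True by (auto simp: sgnr)
    also have "emeasure ?\<mu> \<dots> = ennreal w * emeasure ?\<sigma> B"
    proof -
      have "ennreal w * (X / ennreal w) = X" for X
        unfolding ennreal_times_divide mult.commute[of "ennreal w"]
        by (rule mult_divide_eq_ennreal) (use w(2) in auto)
      then show ?thesis unfolding emeasure_sphere_measure[OF B] w(1) by simp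
    qed
    finally show ?thesis using True w(2) by (simp add: mult.assoc[symmetric] ennreal_mult[symmetric] mult.commute)
  next
    case False
    have "emeasure ?\<mu> {x. norm x \<le> r \<and> sgn x \<in> B} \<le> emeasure ?\<mu> {0}"
      using False by (intro emeasure_mono) (auto simp: not_less, smt (verit) norm_le_zero_iff)
    then show ?thesis using False W emeasure_leb_on_0[OF W] by (simp add: max_def zero_power)
  qed
  have pair: "M1 \<Otimes>\<^sub>M ?\<sigma> = distr ?\<mu> (borel \<Otimes>\<^sub>M borel) (\<lambda>x. (norm x, sgn x))"
  proof (rule pair_measure_eqI[OF sf1 \<sigma>.sigma_finite_measure_axioms])
    show "sets (M1 \<Otimes>\<^sub>M ?\<sigma>) = sets (distr ?\<mu> (borel \<Otimes>\<^sub>M borel) (\<lambda>x. (norm x, sgn x)))"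
      by (simp cong: sets_pair_measure_cong)
    fix A B assume "A \<in> sets M1" "B \<in> sets ?\<sigma>"
    then have A: "A \<in> sets borel" and B[measurable]: "B \<in> sets borel" by auto
    define N1 where "N1 = scale_measure (emeasure ?\<sigma> B) M1"
    define N2 where "N2 = distr (density ?\<mu> (\<lambda>x. indicator B (sgn x))) borel norm"
    have N2: "emeasure N2 A = emeasure ?\<mu> {x. norm x \<in> A \<and> sgn x \<in> B}" if [measurable]: "A \<in> sets borel" for A
    proof -
      have "emeasure N2 A = (\<integral>\<^sup>+x. indicator B (sgn x) * indicator {x. norm x \<in> A} x \<partial>?\<mu>)"
        unfolding N2_def by (subst emeasure_distr) (auto simp: emeasure_density vimage_def)
      also have "\<dots> = (\<integral>\<^sup>+x. indicator {x. norm x \<in> A \<and> sgn x \<in> B} x \<partial>?\<mu>)"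
        by (intro nn_integral_cong) (auto simp: indicator_def)
      also have "\<dots> = emeasure ?\<mu> {x. norm x \<in> A \<and> sgn x \<in> B}" by (rule nn_integral_indicator) measurable
      finally show ?thesis .
    qed
    have "N1 = N2"
    proof (rule measure_eqI_generator_eq[where E = "range (\<lambda>a::real. {..a})" and \<Omega> = UNIV and A = "\<lambda>n. {..real n}"])
      show "Int_stable (range (\<lambda>a::real. {..a}))"
        by (auto simp: Int_stable_def)
      show "sets N1 = sigma_sets UNIV (range (\<lambda>a::real. {..a}))" "sets N2 = sigma_sets UNIV (range (\<lambda>a::real. {..a}))"
        by (simp_all add: N1_def N2_def borel_eq_atMost)
      show "emeasure N1 X = emeasure N2 X" if "X \<in> range (\<lambda>a::real. {..a})" for X
        using that ball[OF B] by (auto simp: N1_def N2 M1_atMost mult.commute)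
      show "(\<Union>n. {..real n}) = UNIV" by (auto simp: real_arch_simple)
      show "emeasure N1 {..real n} \<noteq> \<infinity>" for n
        by (simp add: N1_def M1_atMost ennreal_mult_eq_top_iff)
    qed auto
    then have "emeasure N1 A = emeasure N2 A" by simp
    then have "emeasure M1 A * emeasure ?\<sigma> B = emeasure ?\<mu> {x. norm x \<in> A \<and> sgn x \<in> B}"
      unfolding N2[OF A] by (simp add: N1_def mult.commute)
    also have "\<dots> = emeasure (distr ?\<mu> (borel \<Otimes>\<^sub>M borel) (\<lambda>x. (norm x, sgn x))) (A \<times> B)"
      using A by (subst emeasure_distr) (auto simp: vimage_def)
    finally show "emeasure M1 A * emeasure ?\<sigma> B = \<dots>" .
  qed
  show ?thesis
  proof (intro exI[of _ c] conjI ballI c)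
    fix h :: "'a \<Rightarrow> ennreal" assume h[measurable]: "h \<in> borel_measurable borel"
    have xs: "norm x *\<^sub>R sgn x = x" for x :: 'a by (cases "x = 0") (simp_all add: sgn_div_norm)
    have "(\<integral>\<^sup>+x. h x \<partial>?\<mu>) = (\<integral>\<^sup>+x. (\<lambda>(R, \<theta>). h (R *\<^sub>R \<theta>)) (norm x, sgn x) \<partial>?\<mu>)" by (simp add: xs)
    also have "\<dots> = (\<integral>\<^sup>+p. (\<lambda>(R, \<theta>). h (R *\<^sub>R \<theta>)) p \<partial>(M1 \<Otimes>\<^sub>M ?\<sigma>))"
      unfolding pair by (rule nn_integral_distr[symmetric]) measurable
    also have "\<dots> = (\<integral>\<^sup>+R. \<integral>\<^sup>+\<theta>. h (R *\<^sub>R \<theta>) \<partial>?\<sigma> \<partial>M1)"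
      by (subst \<sigma>.nn_integral_fst[symmetric]) auto
    also have "\<dots> = (\<integral>\<^sup>+R. ennreal (c * R ^ (?k - 1)) * indicator {0..} R * (\<integral>\<^sup>+\<theta>. h (R *\<^sub>R \<theta>) \<partial>?\<sigma>) \<partial>lborel)"
      unfolding M1_def by (rule nn_integral_density) measurable
    finally show "(\<integral>\<^sup>+x. h x \<partial>?\<mu>) = \<dots>" .
  qed
qed

section \<open>Fourier transforms and Gaussians\<close>

lemma fourier_cis: "fourier \<mu> \<xi> = (LINT x|\<mu>. cis (- (2 * pi * (x \<bullet> \<xi>))))"
  unfolding fourier_def by (intro Bochner_Integration.integral_cong) (simp_all add: cis_conv_exp mult_ac)

lemma measurable_cis_inner [measurable]:
  "(\<lambda>x. cis (f x)) \<in> borel_measurable M" if [measurable]: "f \<in> borel_measurable M" for f :: "'a \<Rightarrow> real"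
  unfolding cis_conv_exp by measurable

lemma borel_measurable_fourier [measurable]:
  assumes "sigma_finite_measure \<mu>" "sets \<mu> = sets borel"
  shows "fourier \<mu> \<in> borel_measurable borel"
proof -
  interpret sigma_finite_measure \<mu> by fact
  note [measurable_cong] = assms(2)
  show ?thesis unfolding fourier_cis[abs_def] by measurable
qed

text \<open>The Gaussian density with standard deviation \<open>s\<close> on the span of an orthonormal set \<open>B\<close>, as a product over coordinates.\<close>

definition gauss_density :: "'a::euclidean_space set \<Rightarrow> real \<Rightarrow> 'a \<Rightarrow> real" where
  "gauss_density B s x = (\<Prod>b\<in>B. normal_density 0 s (x \<bullet> b))"

lemma gauss_density_nonneg: "s > 0 \<Longrightarrow> 0 \<le> gauss_density B s x"
  unfolding gauss_density_def by (intro prod_nonneg) auto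

lemma borel_measurable_gauss_density [measurable]: "gauss_density B s \<in> borel_measurable borel"
  unfolding gauss_density_def[abs_def] by measurable

lemma normal_density_as_fourier_integral:
  assumes s: "s > 0"
  shows "has_bochner_integral lborel (\<lambda>t. cis (2 * pi * w * t) * of_real (exp (- 2 * (pi * s * t)\<^sup>2)))
           (of_real (normal_density 0 s w))"
proof -
  let ?n = std_normal_density
  have i1: "integrable lborel (\<lambda>t. cis (w / s * t) * of_real (?n t))"
  proof (rule Bochner_Integration.integrable_bound)
    show "integrable lborel ?n" by simp
  qed (auto simp: norm_mult)
  have "(LBINT t. cis (w / s * t) * of_real (?n t)) = char std_normal_distribution (w / s)"
    unfolding char_def by (subst integral_density) (auto simp: cis_conv_exp scaleR_conv_of_real mult_ac)
  also have "\<dots> = of_real (exp (- ((w / s)\<^sup>2) / 2))" by (simp add: char_std_normal_distribution)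
  finally have h1: "has_bochner_integral lborel (\<lambda>t. cis (w / s * t) * of_real (?n t)) (of_real (exp (- ((w / s)\<^sup>2) / 2)))"
    using i1 by (simp add: has_bochner_integral_iff)
  have c: "2 * pi * s > 0" using s by simp
  have "has_bochner_integral lborel (\<lambda>t. cis (w / s * (0 + (2 * pi * s) * t)) * of_real (?n (0 + (2 * pi * s) * t)))
     (of_real (exp (- ((w / s)\<^sup>2) / 2)) /\<^sub>R \<bar>2 * pi * s\<bar>)"
  proof -
    have "2 * pi * s \<noteq> 0" using s by simp
    from iffD1[OF lborel_has_bochner_integral_real_affine_iff[OF this, of "\<lambda>t. cis (w / s * t) * of_real (?n t)" _ 0] h1]
    show ?thesis .
  qed
  from has_bochner_integral_mult_left[OF this, of "of_real (sqrt (2 * pi))"] c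
  have "has_bochner_integral lborel (\<lambda>t. cis (w / s * (0 + (2 * pi * s) * t)) * of_real (?n (0 + (2 * pi * s) * t)) * of_real (sqrt (2 * pi)))
     ((of_real (exp (- ((w / s)\<^sup>2) / 2)) /\<^sub>R \<bar>2 * pi * s\<bar>) * of_real (sqrt (2 * pi)))" by blast
  also have "(\<lambda>t. cis (w / s * (0 + (2 * pi * s) * t)) * of_real (?n (0 + (2 * pi * s) * t)) * of_real (sqrt (2 * pi)))
     = (\<lambda>t. cis (2 * pi * w * t) * of_real (exp (- 2 * (pi * s * t)\<^sup>2)))"
  proof
    fix t
    have "w / s * (0 + (2 * pi * s) * t) = 2 * pi * w * t" using s by (simp add: field_simps)
    moreover have "?n (0 + (2 * pi * s) * t) * sqrt (2 * pi) = exp (- 2 * (pi * s * t)\<^sup>2)"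
      unfolding std_normal_density_def by (simp add: power_mult_distrib)
    then have "complex_of_real (?n (0 + (2 * pi * s) * t)) * of_real (sqrt (2 * pi)) = of_real (exp (- 2 * (pi * s * t)\<^sup>2))"
      by (metis of_real_mult)
    ultimately show "cis (w / s * (0 + (2 * pi * s) * t)) * of_real (?n (0 + (2 * pi * s) * t)) * of_real (sqrt (2 * pi))
     = cis (2 * pi * w * t) * of_real (exp (- 2 * (pi * s * t)\<^sup>2))" by (simp only: mult.assoc)
  qed
  also have "(of_real (exp (- ((w / s)\<^sup>2) / 2)) /\<^sub>R \<bar>2 * pi * s\<bar>) * of_real (sqrt (2 * pi)) = complex_of_real (normal_density 0 s w)"
  proof -
    have sq: "sqrt (2 * pi * s\<^sup>2) = sqrt (2 * pi) * s" using s by (simp add: real_sqrt_mult)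
    have "sqrt (2 * pi) * sqrt (2 * pi) = 2 * pi" by simp
    then have "exp (- ((w / s)\<^sup>2) / 2) / (2 * pi * s) * sqrt (2 * pi) = normal_density 0 s w"
      unfolding normal_density_def sq using s by (simp add: power_divide field_simps)
    then have "inverse \<bar>2 * pi * s\<bar> * exp (- ((w / s)\<^sup>2) / 2) * sqrt (2 * pi) = normal_density 0 s w"
      by (simp only: abs_of_pos[OF c] divide_inverse mult.commute[of "inverse (2 * pi * s)"])
    then show ?thesis by (simp only: scaleR_conv_of_real of_real_mult[symmetric])
  qed
  finally show ?thesis .
qed

lemma gauss_density_convolution:
  assumes B: "orthonormal_basis V B" and s: "s > 0"
  shows "(\<integral>\<^sup>+y. ennreal (gauss_density B s (y - x) * gauss_density B s (y - x')) \<partial>leb_basis B)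
     = ennreal (gauss_density B (sqrt 2 * s) (x - x'))"
proof -
  let ?n = "normal_density 0 s"
  have fin: "finite B" using B by (rule orthonormal_basisD)
  have sq: "sqrt (s\<^sup>2 + s\<^sup>2) = sqrt 2 * s" using s by (simp add: real_sqrt_mult flip: mult_2)
  have sym: "normal_density 0 r (- z) = normal_density 0 r z" for r z by (simp add: normal_density_def)
  have one: "(\<integral>\<^sup>+t. ennreal (?n (t - a) * ?n (t - a')) \<partial>lborel) = ennreal (normal_density 0 (sqrt 2 * s) (a - a'))" for a a'
  proof -
    have "(\<integral>\<^sup>+t. ennreal (?n (t - a) * ?n (t - a')) \<partial>lborel) = (\<integral>\<^sup>+t. ennreal (?n (t - a) * ?n (t - a')) \<partial>distr lborel borel (\<lambda>t. a' + t))"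
      by (simp add: lborel_distr_plus)
    also have "\<dots> = (\<integral>\<^sup>+t. ennreal (?n ((a - a') - t) * ?n t) \<partial>lborel)"
      using sym[of s "t - (a - a')" for t]
      by (subst nn_integral_distr) (auto intro!: nn_integral_cong simp: algebra_simps)
    also have "\<dots> = ennreal (normal_density 0 (sqrt (s\<^sup>2 + s\<^sup>2)) (a - a'))"
      using fun_cong[OF conv_normal_density_zero_mean[OF s s], of "a - a'"] by simp
    finally show ?thesis unfolding sq .
  qed
  have "(\<integral>\<^sup>+y. ennreal (gauss_density B s (y - x) * gauss_density B s (y - x')) \<partial>leb_basis B)
     = (\<integral>\<^sup>+c. ennreal (\<Prod>b\<in>B. ?n (c b - x \<bullet> b) * ?n (c b - x' \<bullet> b)) \<partial>(\<Pi>\<^sub>M b\<in>B. lborel))"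
    unfolding leb_basis_def
    by (subst nn_integral_distr) (auto intro!: nn_integral_cong prod.cong
        simp: gauss_density_def inner_diff_left orthonormal_basis_inner_sum[OF B] prod.distrib[symmetric])
  also have "\<dots> = (\<integral>\<^sup>+c. (\<Prod>b\<in>B. ennreal (?n (c b - x \<bullet> b) * ?n (c b - x' \<bullet> b))) \<partial>(\<Pi>\<^sub>M b\<in>B. lborel))"
    by (intro nn_integral_cong) (simp add: prod_ennreal)
  also have "\<dots> = (\<Prod>b\<in>B. ennreal (normal_density 0 (sqrt 2 * s) (x \<bullet> b - x' \<bullet> b)))"
    by (subst lborels.product_nn_integral_prod[OF fin]) (auto simp: one)
  also have "\<dots> = ennreal (gauss_density B (sqrt 2 * s) (x - x'))"
    using s by (simp add: gauss_density_def inner_diff_left prod_ennreal)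
  finally show ?thesis .
qed

text \<open>The Fourier transform of \<open>gauss_density B s\<close>.\<close>

definition gauss_weight :: "'a::euclidean_space set \<Rightarrow> real \<Rightarrow> 'a \<Rightarrow> real" where
  "gauss_weight B s \<xi> = (\<Prod>b\<in>B. exp (- 2 * (pi * s * (\<xi> \<bullet> b))\<^sup>2))"

lemma gauss_weight_bounds: "0 \<le> gauss_weight B s \<xi>" "gauss_weight B s \<xi> \<le> 1"
  unfolding gauss_weight_def by (auto intro!: prod_nonneg prod_le_1)

lemma borel_measurable_gauss_weight [measurable]: "gauss_weight B s \<in> borel_measurable borel"
  unfolding gauss_weight_def[abs_def] by measurable

lemma gauss_density_as_fourier_integral:
  assumes B: "orthonormal_basis V B" and s: "s > 0" and w: "w \<in> V"
  shows "has_bochner_integral (leb_basis B) (\<lambda>\<xi>. cis (2 * pi * (w \<bullet> \<xi>)) * of_real (gauss_weight B s \<xi>))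
     (of_real (gauss_density B s w))"
proof -
  have fin: "finite B" and V: "subspace V" using B by (auto dest: orthonormal_basisD)
  let ?P = "\<Pi>\<^sub>M b\<in>B. lborel :: real measure"
  let ?f = "\<lambda>b t. cis (2 * pi * (w \<bullet> b) * t) * complex_of_real (exp (- 2 * (pi * s * t)\<^sup>2))"
  let ?h = "\<lambda>\<xi>. cis (2 * pi * (w \<bullet> \<xi>)) * of_real (gauss_weight B s \<xi>)"
  have int: "integrable lborel (?f b)" and val: "(LBINT t. ?f b t) = of_real (normal_density 0 s (w \<bullet> b))" for b
    using normal_density_as_fourier_integral[OF s, of "w \<bullet> b"] by (auto simp: has_bochner_integral_iff)
  have cis_prod: "cis (\<Sum>b\<in>B. g b) = (\<Prod>b\<in>B. cis (g b))" for g :: "'a \<Rightarrow> real"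
    using fin by (induction B rule: finite_induct) (auto simp: cis_mult[symmetric])
  have eq: "?h (\<Sum>b\<in>B. c b *\<^sub>R b) = (\<Prod>b\<in>B. ?f b (c b))" for c
  proof -
    have "cis (2 * pi * (w \<bullet> (\<Sum>b\<in>B. c b *\<^sub>R b))) = (\<Prod>b\<in>B. cis (2 * pi * (w \<bullet> b) * c b))"
      unfolding cis_prod[symmetric] by (simp add: inner_sum_right sum_distrib_left mult_ac)
    then show ?thesis
      by (simp add: gauss_weight_def orthonormal_basis_inner_sum[OF B] prod.distrib of_real_prod cong: prod.cong)
  qed
  have "integrable ?P (\<lambda>c. \<Prod>b\<in>B. ?f b (c b))"
    by (rule lborels.product_integrable_prod[OF fin int])
  moreover have "integral\<^sup>L ?P (\<lambda>c. \<Prod>b\<in>B. ?f b (c b)) = (\<Prod>b\<in>B. of_real (normal_density 0 s (w \<bullet> b)))"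
    unfolding lborels.product_integral_prod[OF fin int] by (rule prod.cong[OF refl val])
  ultimately have "has_bochner_integral ?P (\<lambda>c. ?h (\<Sum>b\<in>B. c b *\<^sub>R b)) (of_real (gauss_density B s w))"
    unfolding eq has_bochner_integral_iff by (simp add: gauss_density_def of_real_prod)
  then show ?thesis unfolding leb_basis_def has_bochner_integral_iff
    by (subst integrable_distr_eq, simp_all) (subst integral_distr, simp_all)
qed

section \<open>Mollification by Gaussians\<close>

lemma (in prob_space) integrable_cis [simp]:
  "f \<in> borel_measurable M \<Longrightarrow> integrable M (\<lambda>x. cis (f x))"
  by (rule integrable_const_bound[where B = 1]) auto

lemma cmod_fourier_le_1:
  assumes "prob_space \<mu>" shows "cmod (fourier \<mu> \<xi>) \<le> 1"
proof -
  interpret prob_space \<mu> by fact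
  have "cmod (fourier \<mu> \<xi>) \<le> (LINT x|\<mu>. 1)"
    unfolding fourier_cis by (rule integral_norm_bound[THEN order_trans]) simp
  then show ?thesis by (simp add: prob_space)
qed

text \<open>The squared modulus of the transform is the transform of the distribution of the difference of two independent points. This makes it an average of exponentials, to which all estimates on exponentials transfer.\<close>

lemma cmod_fourier_squared:
  assumes P: "prob_space \<mu>" and S: "sets \<mu> = sets borel"
  shows "complex_of_real ((cmod (fourier \<mu> \<xi>))\<^sup>2) = (LINT p|(\<mu> \<Otimes>\<^sub>M \<mu>). cis (2 * pi * ((fst p - snd p) \<bullet> \<xi>)))"
proof -
  interpret prob_space \<mu> by fact
  interpret pair_prob_space \<mu> \<mu> ..
  note [measurable_cong] = S
  have "(LINT p|(\<mu> \<Otimes>\<^sub>M \<mu>). cis (2 * pi * ((fst p - snd p) \<bullet> \<xi>)))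
     = (LINT x|\<mu>. LINT y|\<mu>. cis (2 * pi * ((x - y) \<bullet> \<xi>)))"
    by (subst integral_fst'[symmetric]) auto
  also have "\<dots> = (LINT x|\<mu>. LINT y|\<mu>. cnj (cis (- (2 * pi * (x \<bullet> \<xi>)))) * cis (- (2 * pi * (y \<bullet> \<xi>))))"
    by (simp add: cis_cnj cis_mult inner_diff_left algebra_simps)
  also have "\<dots> = cnj (fourier \<mu> \<xi>) * fourier \<mu> \<xi>"
    unfolding fourier_cis by (simp add: integral_cnj[symmetric] del: cis_cnj)
  finally show ?thesis using complex_norm_square[of "fourier \<mu> \<xi>"] by (simp add: mult.commute)
qed

lemma AE_pair_subspace:
  fixes \<mu> :: "'a::euclidean_space measure"
  assumes P: "prob_space \<mu>" and S: "sets \<mu> = sets borel" and V: "subspace V" and conc: "AE x in \<mu>. x \<in> V"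
  shows "AE p in \<mu> \<Otimes>\<^sub>M \<mu>. fst p - snd p \<in> V"
proof -
  interpret prob_space \<mu> by fact
  interpret pair_prob_space \<mu> \<mu> ..
  note [measurable_cong] = S
  have [measurable]: "V \<in> sets borel" using closed_subspace[OF V] by simp
  have "AE x in \<mu>. AE y in \<mu>. x - y \<in> V"
    using conc
  proof eventually_elim
    case (elim x)
    show ?case using conc by eventually_elim (use elim V in \<open>simp add: subspace_diff\<close>)
  qed
  moreover have "{p \<in> space (\<mu> \<Otimes>\<^sub>M \<mu>). fst p - snd p \<in> V} \<in> sets (\<mu> \<Otimes>\<^sub>M \<mu>)" by measurable
  ultimately show ?thesis by (intro AE_pair_measure) simp_all
qed

text \<open>Expanding the square and convolving the two Gaussians turns the left side into the energy \<open>\<integral>\<integral> g(x - x') d\<mu> d\<mu>\<close> of another Gaussian. Writing this Gaussian as a Fourier integral of a weight that is at most \<open>1\<close> identifies the energy with \<open>\<integral> weight \<cdot> \<bar>\<F> \<mu>\<bar>\<^sup>2\<close>.\<close>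

lemma mollified_density_L2_bound:
  assumes P: "prob_space \<mu>" and S: "sets \<mu> = sets borel" and B: "orthonormal_basis V B"
    and conc: "AE x in \<mu>. x \<in> V" and s: "s > 0"
  shows "(\<integral>\<^sup>+y. (\<integral>\<^sup>+x. ennreal (gauss_density B s (y - x)) \<partial>\<mu>)\<^sup>2 \<partial>leb_basis B)
    \<le> (\<integral>\<^sup>+\<xi>. ennreal ((cmod (fourier \<mu> \<xi>))\<^sup>2) \<partial>leb_basis B)"
proof -
  let ?N = "leb_basis B" and ?g = "gauss_density B s" and ?s = "sqrt 2 * s"
  let ?g2 = "gauss_density B ?s" and ?w = "gauss_weight B ?s"
  have V: "subspace V" using B by (rule orthonormal_basisD)
  have s2: "?s > 0" using s by simp
  interpret prob_space \<mu> by fact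
  interpret PP: pair_prob_space \<mu> \<mu> ..
  interpret N: sigma_finite_measure ?N by (rule sigma_finite_leb_basis[OF B])
  interpret NP: pair_sigma_finite ?N "\<mu> \<Otimes>\<^sub>M \<mu>" ..
  note [measurable_cong] = S
  have m_f[measurable]: "fourier \<mu> \<in> borel_measurable borel"
    by (rule borel_measurable_fourier) (simp_all add: S sigma_finite_measure_axioms)
  have "(\<integral>\<^sup>+y. (\<integral>\<^sup>+x. ennreal (?g (y - x)) \<partial>\<mu>)\<^sup>2 \<partial>?N)
     = (\<integral>\<^sup>+y. \<integral>\<^sup>+p. ennreal (?g (y - fst p) * ?g (y - snd p)) \<partial>(\<mu> \<Otimes>\<^sub>M \<mu>) \<partial>?N)"
  proof (rule nn_integral_cong)
    fix y
    have "(\<integral>\<^sup>+p. ennreal (?g (y - fst p) * ?g (y - snd p)) \<partial>(\<mu> \<Otimes>\<^sub>M \<mu>))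
      = (\<integral>\<^sup>+x. \<integral>\<^sup>+x'. ennreal (?g (y - x)) * ennreal (?g (y - x')) \<partial>\<mu> \<partial>\<mu>)"
      by (subst nn_integral_fst[symmetric]) (auto simp: ennreal_mult gauss_density_nonneg[OF s])
    also have "\<dots> = (\<integral>\<^sup>+x. ennreal (?g (y - x)) \<partial>\<mu>)\<^sup>2"
      by (simp add: nn_integral_cmult nn_integral_multc power2_eq_square)
    finally show "(\<integral>\<^sup>+x. ennreal (?g (y - x)) \<partial>\<mu>)\<^sup>2 = (\<integral>\<^sup>+p. ennreal (?g (y - fst p) * ?g (y - snd p)) \<partial>(\<mu> \<Otimes>\<^sub>M \<mu>))" by simp
  qed
  also have "\<dots> = (\<integral>\<^sup>+p. \<integral>\<^sup>+y. ennreal (?g (y - fst p) * ?g (y - snd p)) \<partial>?N \<partial>(\<mu> \<Otimes>\<^sub>M \<mu>))"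
    by (rule NP.Fubini'[symmetric]) measurable
  also have "\<dots> = (\<integral>\<^sup>+p. ennreal (?g2 (fst p - snd p)) \<partial>(\<mu> \<Otimes>\<^sub>M \<mu>))"
    by (simp add: gauss_density_convolution[OF B s])
  also have "\<dots> = (\<integral>\<^sup>+\<xi>. ennreal (?w \<xi> * (cmod (fourier \<mu> \<xi>))\<^sup>2) \<partial>?N)"
  proof -
    have w0: "integrable ?N (\<lambda>\<xi>. complex_of_real (?w \<xi>))"
      using gauss_density_as_fourier_integral[OF B s2 subspace_0[OF V]] by (simp add: has_bochner_integral_iff)
    then have wi: "integrable ?N ?w" using integrable_Re by fastforce
    define \<Gamma> where "\<Gamma> = density ?N (\<lambda>\<xi>. ennreal (?w \<xi>))"
    have [simp, measurable_cong]: "sets \<Gamma> = sets borel" by (simp add: \<Gamma>_def)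
    have sp\<Gamma>[simp]: "space \<Gamma> = UNIV" by (simp add: \<Gamma>_def)
    interpret \<Gamma>: finite_measure \<Gamma>
    proof
      have "emeasure \<Gamma> (space \<Gamma>) = (\<integral>\<^sup>+\<xi>. ennreal (?w \<xi>) \<partial>?N)" by (simp add: \<Gamma>_def emeasure_density)
      also have "\<dots> < \<infinity>" using wi gauss_weight_bounds(1) by (subst nn_integral_eq_integral) auto
      finally show "emeasure \<Gamma> (space \<Gamma>) \<noteq> \<infinity>" by simp
    qed
    interpret G: pair_sigma_finite "\<mu> \<Otimes>\<^sub>M \<mu>" \<Gamma> ..
    have finG: "finite_measure ((\<mu> \<Otimes>\<^sub>M \<mu>) \<Otimes>\<^sub>M \<Gamma>)"
      by (intro finite_measure_pair_measure PP.P.finite_measure_axioms \<Gamma>.finite_measure_axioms)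
    have g2: "complex_of_real (?g2 v) = (LINT \<xi>|\<Gamma>. cis (2 * pi * (v \<bullet> \<xi>)))" if "v \<in> V" for v
      unfolding \<Gamma>_def using gauss_density_as_fourier_integral[OF B s2 that] gauss_weight_bounds(1)
      by (subst integral_density) (auto simp: has_bochner_integral_iff scaleR_conv_of_real mult.commute)
    have aeg2: "AE p in \<mu> \<Otimes>\<^sub>M \<mu>. complex_of_real (?g2 (fst p - snd p)) = (LINT \<xi>|\<Gamma>. cis (2 * pi * ((fst p - snd p) \<bullet> \<xi>)))"
      using AE_pair_subspace[OF P S V conc] by eventually_elim (rule g2)
    have intG: "integrable ((\<mu> \<Otimes>\<^sub>M \<mu>) \<Otimes>\<^sub>M \<Gamma>) (\<lambda>(p, \<xi>). cis (2 * pi * ((fst p - snd p) \<bullet> \<xi>)))"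
      by (rule finite_measure.integrable_const_bound[OF finG, where B = 1]) (auto simp: split_beta)
    have intg2: "integrable (\<mu> \<Otimes>\<^sub>M \<mu>) (\<lambda>p. complex_of_real (?g2 (fst p - snd p)))"
      using G.integrable_fst[OF intG] aeg2 by (subst integrable_cong_AE) auto
    have intg2': "integrable (\<mu> \<Otimes>\<^sub>M \<mu>) (\<lambda>p. ?g2 (fst p - snd p))"
      using integrable_Re[OF intg2] by simp
    have "complex_of_real (LINT p|(\<mu> \<Otimes>\<^sub>M \<mu>). ?g2 (fst p - snd p)) = (LINT p|(\<mu> \<Otimes>\<^sub>M \<mu>). complex_of_real (?g2 (fst p - snd p)))"
      by simp
    also have "\<dots> = (LINT p|(\<mu> \<Otimes>\<^sub>M \<mu>). LINT \<xi>|\<Gamma>. cis (2 * pi * ((fst p - snd p) \<bullet> \<xi>)))"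
      using aeg2 by (intro integral_cong_AE) auto
    also have "\<dots> = (LINT \<xi>|\<Gamma>. LINT p|(\<mu> \<Otimes>\<^sub>M \<mu>). cis (2 * pi * ((fst p - snd p) \<bullet> \<xi>)))"
      by (rule G.Fubini_integral[OF intG, symmetric])
    also have "\<dots> = (LINT \<xi>|\<Gamma>. complex_of_real ((cmod (fourier \<mu> \<xi>))\<^sup>2))"
      by (simp add: cmod_fourier_squared[OF P S] del: of_real_power)
    also have "\<dots> = complex_of_real (LINT \<xi>|\<Gamma>. (cmod (fourier \<mu> \<xi>))\<^sup>2)" by (simp del: of_real_power)
    finally have eq: "(LINT p|(\<mu> \<Otimes>\<^sub>M \<mu>). ?g2 (fst p - snd p)) = (LINT \<xi>|\<Gamma>. (cmod (fourier \<mu> \<xi>))\<^sup>2)"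
      using of_real_eq_iff by blast
    have intF: "integrable \<Gamma> (\<lambda>\<xi>. (cmod (fourier \<mu> \<xi>))\<^sup>2)"
      by (rule \<Gamma>.integrable_const_bound[where B = 1]) (auto simp: power_le_one cmod_fourier_le_1[OF P])
    have "(\<integral>\<^sup>+p. ennreal (?g2 (fst p - snd p)) \<partial>(\<mu> \<Otimes>\<^sub>M \<mu>)) = ennreal (LINT p|(\<mu> \<Otimes>\<^sub>M \<mu>). ?g2 (fst p - snd p))"
      using intg2' by (intro nn_integral_eq_integral) (auto simp: gauss_density_nonneg[OF s2])
    also have "\<dots> = (\<integral>\<^sup>+\<xi>. ennreal ((cmod (fourier \<mu> \<xi>))\<^sup>2) \<partial>\<Gamma>)"
      unfolding eq by (rule nn_integral_eq_integral[OF intF, symmetric]) simp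
    also have "\<dots> = (\<integral>\<^sup>+\<xi>. ennreal (?w \<xi> * (cmod (fourier \<mu> \<xi>))\<^sup>2) \<partial>?N)"
      unfolding \<Gamma>_def by (subst nn_integral_density) (auto simp: ennreal_mult gauss_weight_bounds(1))
    finally show ?thesis .
  qed
  also have "\<dots> \<le> (\<integral>\<^sup>+\<xi>. ennreal ((cmod (fourier \<mu> \<xi>))\<^sup>2) \<partial>?N)"
    by (intro nn_integral_mono ennreal_leI mult_left_le_one_le gauss_weight_bounds) auto
  finally show ?thesis .
qed

lemma nn_integral_gauss_density:
  assumes B: "orthonormal_basis V B" and s: "s > 0"
  shows "(\<integral>\<^sup>+z. ennreal (gauss_density B s z) \<partial>leb_basis B) = 1"
proof -
  have fin: "finite B" using B by (rule orthonormal_basisD)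
  have "(\<integral>\<^sup>+z. ennreal (gauss_density B s z) \<partial>leb_basis B)
     = (\<integral>\<^sup>+c. (\<Prod>b\<in>B. ennreal (normal_density 0 s (c b))) \<partial>(\<Pi>\<^sub>M b\<in>B. lborel))"
    unfolding leb_basis_def using s
    by (subst nn_integral_distr) (auto intro!: nn_integral_cong prod.cong
        simp: gauss_density_def orthonormal_basis_inner_sum[OF B] prod_ennreal)
  also have "\<dots> = (\<Prod>b\<in>B. \<integral>\<^sup>+t. ennreal (normal_density 0 s t) \<partial>lborel)"
    by (rule lborels.product_nn_integral_prod[OF fin]) auto
  also have "(\<integral>\<^sup>+t. ennreal (normal_density 0 s t) \<partial>lborel) = 1"
    using s by (subst nn_integral_eq_integral) auto
  finally show ?thesis by simp
qed

lemma gauss_density_scale: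
  assumes "orthonormal_basis V B" "s > 0"
  shows "gauss_density B s (s *\<^sub>R z) = gauss_density B 1 z / s ^ dim V"
proof -
  have "normal_density 0 s (s * t) = normal_density 0 1 t / s" for t
    using assms(2) by (simp add: normal_density_def real_sqrt_mult power_mult_distrib field_simps)
  then show ?thesis
    using orthonormal_basisD(5)[OF assms(1)] by (simp add: gauss_density_def prod_dividef)
qed

text \<open>The inequality \<open>\<integral> h d\<mu> \<le> \<parallel>\<F> \<mu>\<parallel>\<^sub>2 \<parallel>h\<parallel>\<^sub>2\<close> that Parseval's identity would give for functions, before \<open>\<mu>\<close> is known to have a density. For the mollified measures it is Cauchy--Schwarz; lower semicontinuity of \<open>h\<close> (along the segments used by the mollification) and Fatou's lemma pass it to \<open>\<mu>\<close>.\<close>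

lemma lower_semicontinuous_integral_bound:
  fixes h :: "'a::euclidean_space \<Rightarrow> ennreal"
  assumes P: "prob_space \<mu>" and S: "sets \<mu> = sets borel" and B: "orthonormal_basis V B"
    and conc: "AE x in \<mu>. x \<in> V"
    and h[measurable]: "h \<in> borel_measurable borel"
    and lsc: "\<And>x z. eventually (\<lambda>n. h x \<le> h (x + (1 / real (Suc n)) *\<^sub>R z)) sequentially"
  shows "(\<integral>\<^sup>+x. h x \<partial>\<mu>)\<^sup>2 \<le> (\<integral>\<^sup>+\<xi>. ennreal ((cmod (fourier \<mu> \<xi>))\<^sup>2) \<partial>leb_basis B) * (\<integral>\<^sup>+x. (h x)\<^sup>2 \<partial>leb_basis B)"
proof -
  let ?N = "leb_basis B" and ?e = "\<lambda>n. 1 / real (Suc n)"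
  let ?I = "\<integral>\<^sup>+\<xi>. ennreal ((cmod (fourier \<mu> \<xi>))\<^sup>2) \<partial>?N"
  interpret prob_space \<mu> by fact
  interpret N: sigma_finite_measure ?N by (rule sigma_finite_leb_basis[OF B])
  interpret NP: pair_sigma_finite ?N \<mu> ..
  note [measurable_cong] = S
  have dimV: "card B = dim V" using B by (rule orthonormal_basisD)
  define E where "E n = (\<integral>\<^sup>+x. \<integral>\<^sup>+z. h (x + ?e n *\<^sub>R z) * ennreal (gauss_density B 1 z) \<partial>?N \<partial>\<mu>)" for n
  have E_bound: "(E n)\<^sup>2 \<le> ?I * (\<integral>\<^sup>+x. (h x)\<^sup>2 \<partial>?N)" for n
  proof -
    have e: "?e n > 0" by simp
    have "E n = (\<integral>\<^sup>+x. \<integral>\<^sup>+y. h y * ennreal (gauss_density B (?e n) (y - x)) \<partial>?N \<partial>\<mu>)"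
      unfolding E_def
      apply (rule nn_integral_cong_AE)
      using conc
    proof eventually_elim
      case (elim x)
      have "(\<integral>\<^sup>+z. h (x + ?e n *\<^sub>R z) * ennreal (gauss_density B 1 z) \<partial>?N)
         = (\<integral>\<^sup>+z. ennreal (?e n ^ dim V) * (h (x + ?e n *\<^sub>R z) * ennreal (gauss_density B (?e n) ((x + ?e n *\<^sub>R z) - x))) \<partial>?N)"
      proof (rule nn_integral_cong)
        fix z
        have "ennreal (?e n ^ dim V) * ennreal (gauss_density B (?e n) (?e n *\<^sub>R z)) = ennreal (gauss_density B 1 z)"
          unfolding gauss_density_scale[OF B e] using e gauss_density_nonneg[of 1 B z]
          by (subst ennreal_mult[symmetric]) (auto simp del: of_nat_Suc)
        then show "h (x + ?e n *\<^sub>R z) * ennreal (gauss_density B 1 z)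
           = ennreal (?e n ^ dim V) * (h (x + ?e n *\<^sub>R z) * ennreal (gauss_density B (?e n) ((x + ?e n *\<^sub>R z) - x)))"
          unfolding add_diff_cancel_left' by (metis mult.left_commute)
      qed
      also have "\<dots> = ennreal (?e n ^ dim V) * (\<integral>\<^sup>+z. (h (x + ?e n *\<^sub>R z) * ennreal (gauss_density B (?e n) ((x + ?e n *\<^sub>R z) - x))) \<partial>?N)"
        by (rule nn_integral_cmult) measurable
      also have "\<dots> = ennreal (?e n ^ dim V) * (\<integral>\<^sup>+y. h y * ennreal (gauss_density B (?e n) (y - x)) \<partial>distr ?N borel (\<lambda>z. x + ?e n *\<^sub>R z))"
        by (subst nn_integral_distr) (auto simp del: of_nat_Suc)
      also have "\<dots> = (\<integral>\<^sup>+y. h y * ennreal (gauss_density B (?e n) (y - x)) \<partial>?N)"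
        unfolding leb_basis_affine[OF B elim e] dimV using e
        by (subst nn_integral_scale_measure) (auto simp: mult.assoc[symmetric] ennreal_mult[symmetric] simp del: of_nat_Suc)
      finally show ?case .
    qed
    also have "\<dots> = (\<integral>\<^sup>+y. \<integral>\<^sup>+x. h y * ennreal (gauss_density B (?e n) (y - x)) \<partial>\<mu> \<partial>?N)"
      by (rule NP.Fubini'[where f = "\<lambda>y x. h y * ennreal (gauss_density B (?e n) (y - x))"]) measurable
    also have "\<dots> = (\<integral>\<^sup>+y. h y * (\<integral>\<^sup>+x. ennreal (gauss_density B (?e n) (y - x)) \<partial>\<mu>) \<partial>?N)"
      by (intro nn_integral_cong nn_integral_cmult) measurable
    finally have "(E n)\<^sup>2 \<le> (\<integral>\<^sup>+y. (h y)\<^sup>2 \<partial>?N) * (\<integral>\<^sup>+y. (\<integral>\<^sup>+x. ennreal (gauss_density B (?e n) (y - x)) \<partial>\<mu>)\<^sup>2 \<partial>?N)"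
      by (simp only:) (rule Cauchy_Schwarz_nn_integral, measurable)
    also have "\<dots> \<le> (\<integral>\<^sup>+y. (h y)\<^sup>2 \<partial>?N) * ?I"
      by (intro mult_left_mono mollified_density_L2_bound[OF P S B conc e]) simp
    finally show ?thesis by (simp add: mult.commute)
  qed
  have "(\<integral>\<^sup>+x. h x \<partial>\<mu>) = (\<integral>\<^sup>+x. \<integral>\<^sup>+z. h x * ennreal (gauss_density B 1 z) \<partial>?N \<partial>\<mu>)"
    by (simp add: nn_integral_cmult nn_integral_gauss_density[OF B])
  also have "\<dots> \<le> (\<integral>\<^sup>+x. \<integral>\<^sup>+z. liminf (\<lambda>n. h (x + ?e n *\<^sub>R z) * ennreal (gauss_density B 1 z)) \<partial>?N \<partial>\<mu>)"
  proof (intro nn_integral_mono Liminf_bounded)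
    fix x z show "eventually (\<lambda>n. h x * ennreal (gauss_density B 1 z) \<le> h (x + ?e n *\<^sub>R z) * ennreal (gauss_density B 1 z)) sequentially"
      using lsc[of x z] by eventually_elim (rule mult_right_mono, auto)
  qed
  also have "\<dots> \<le> (\<integral>\<^sup>+x. liminf (\<lambda>n. \<integral>\<^sup>+z. h (x + ?e n *\<^sub>R z) * ennreal (gauss_density B 1 z) \<partial>?N) \<partial>\<mu>)"
    by (intro nn_integral_mono nn_integral_liminf) measurable
  also have "\<dots> \<le> liminf E"
    unfolding E_def[abs_def] by (intro nn_integral_liminf) measurable
  finally have le: "(\<integral>\<^sup>+x. h x \<partial>\<mu>) \<le> liminf E" .
  show ?thesis
  proof (cases "?I * (\<integral>\<^sup>+x. (h x)\<^sup>2 \<partial>?N)")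
    case (real K)
    have "E n \<le> ennreal (sqrt K)" for n
    proof (cases "E n")
      case (real x)
      have "ennreal (x\<^sup>2) \<le> ennreal K" using E_bound[of n] real \<open>?I * _ = ennreal K\<close> by (simp add: ennreal_power)
      then show ?thesis using real \<open>0 \<le> K\<close> by (auto intro!: ennreal_leI real_le_rsqrt)
    qed (use E_bound[of n] real in \<open>auto simp: top_unique\<close>)
    then have "liminf E \<le> ennreal (sqrt K)"
      by (intro Liminf_le) (auto intro: eventually_sequentiallyI)
    then have "(\<integral>\<^sup>+x. h x \<partial>\<mu>)\<^sup>2 \<le> (ennreal (sqrt K))\<^sup>2" using le by (intro power_mono) auto
    then show ?thesis using real by (simp add: ennreal_power)
  qed simp
qed

section \<open>Measures with square integrable Fourier transform\<close>

lemma outer_regular_leb_on: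
  assumes V: "subspace V" and A: "A \<in> sets borel" "A \<subseteq> ball 0 C" and e: "e > (0::real)"
  shows "\<exists>U. open U \<and> A \<subseteq> U \<and> emeasure (leb_on V) (U - A) \<le> ennreal e"
proof -
  let ?N = "leb_on V"
  define M where "M = density ?N (indicator (ball 0 C))"
  have sM: "sets M = sets borel" by (simp add: M_def)
  have MU: "emeasure M X = emeasure ?N (X \<inter> ball 0 C)" if "X \<in> sets borel" for X
    unfolding M_def using that by (subst emeasure_density) (auto intro!: borel_measurable_indicator simp: indicator_inter_arith[symmetric] Int_commute mult.commute)
  have fin: "emeasure M (space M) \<noteq> \<infinity>"
  proof -
    have "emeasure ?N (ball 0 C) \<le> emeasure ?N (cball 0 C)" by (intro emeasure_mono) auto
    then show ?thesis using emeasure_leb_on_cball(1)[OF V, of C] MU[of UNIV] by (auto simp: M_def)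
  qed
  have finA: "emeasure M A \<noteq> \<infinity>" using fin emeasure_space[of M A] by (auto simp: top_unique)
  have "emeasure M A = (INF U \<in> {U. A \<subseteq> U \<and> open U}. emeasure M U)"
    by (rule outer_regular[OF sM fin A(1)])
  moreover have "emeasure M A < emeasure M A + ennreal e" using finA e by (simp add: ennreal_add_left_cancel_less[of _ 0, simplified] less_top)
  ultimately obtain U where U: "A \<subseteq> U" "open U" "emeasure M U < emeasure M A + ennreal e"
    by (auto simp: INF_less_iff)
  let ?U = "U \<inter> ball 0 C"
  have UM: "emeasure M U = emeasure ?N ?U" using U(2) by (intro MU) auto
  have AM: "emeasure M A = emeasure ?N A" using MU[OF A(1)] A(2) by (simp add: inf_absorb1)
  have "emeasure ?N (?U - A) = emeasure ?N ?U - emeasure ?N A"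
    using A U finA unfolding AM by (intro emeasure_Diff) auto
  also have "\<dots> \<le> ennreal e"
    using U(3) finA unfolding UM AM by (intro ennreal_minus_le_iff[THEN iffD2]) (auto simp: add.commute)
  finally show ?thesis using U A(2) by (intro exI[of _ ?U]) auto
qed

text \<open>The same inequality for simple functions with bounded support: replacing each level set by a slightly larger open set makes the function lower semicontinuous at small cost in \<open>L\<^sup>2\<close>.\<close>

lemma simple_function_integral_bound:
  fixes \<phi> :: "'a::euclidean_space \<Rightarrow> ennreal"
  assumes P: "prob_space \<mu>" and S: "sets \<mu> = sets borel" and V: "subspace V"
    and conc: "AE x in \<mu>. x \<in> V"
    and fin: "(\<integral>\<^sup>+\<xi>. ennreal ((cmod (fourier \<mu> \<xi>))\<^sup>2) \<partial>leb_on V) < \<infinity>"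
    and \<phi>: "simple_function (leb_on V) \<phi>" "\<And>x. \<phi> x < \<infinity>" "\<And>x. x \<notin> ball 0 C \<Longrightarrow> \<phi> x = 0"
  shows "(\<integral>\<^sup>+x. \<phi> x \<partial>\<mu>)\<^sup>2 \<le> (\<integral>\<^sup>+\<xi>. ennreal ((cmod (fourier \<mu> \<xi>))\<^sup>2) \<partial>leb_on V) * (\<integral>\<^sup>+x. (\<phi> x)\<^sup>2 \<partial>leb_on V)"
proof -
  let ?N = "leb_on V"
  let ?I = "\<integral>\<^sup>+\<xi>. ennreal ((cmod (fourier \<mu> \<xi>))\<^sup>2) \<partial>?N"
  obtain B where B: "orthonormal_basis V B" "?N = leb_basis B" by (rule obtain_leb_basis[OF V])
  note [measurable_cong] = S
  define R where "R = \<phi> ` UNIV - {0}"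
  have finR: "finite R" using \<phi>(1) by (simp add: R_def simple_function_def)
  define A where "A r = \<phi> -` {r}" for r
  have A[measurable]: "A r \<in> sets borel" for r
    using simple_functionD(2)[OF \<phi>(1), of "{r}"] by (simp add: A_def)
  have A_ball: "A r \<subseteq> ball 0 C" if "r \<in> R" for r
  proof
    fix x assume "x \<in> A r"
    then have "\<phi> x \<noteq> 0" using that by (auto simp: A_def R_def)
    then show "x \<in> ball 0 C" using \<phi>(3) by blast
  qed
  have \<phi>_sum: "\<phi> x = (\<Sum>r\<in>R. r * indicator (A r) x)" for x
  proof (cases "\<phi> x = 0")
    case True
    then show ?thesis by (auto simp: A_def R_def intro!: sum.neutral[symmetric])
  next
    case False
    have "(\<Sum>r\<in>R. r * indicator (A r) x) = (\<Sum>r\<in>R. if r = \<phi> x then r else 0)"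
      by (intro sum.cong) (auto simp: A_def indicator_def)
    then show ?thesis using False finR by (simp add: R_def)
  qed
  have \<phi>m[measurable]: "\<phi> \<in> borel_measurable borel" using borel_measurable_simple_function[OF \<phi>(1)] by simp
  define T where "T = (\<Sum>r\<in>R. r)"
  have T: "T < \<infinity>"
  proof -
    have "(\<Sum>r\<in>X. r) < (\<infinity>::ennreal)" if "finite X" "\<And>r. r \<in> X \<Longrightarrow> r < \<infinity>" for X
      using that by (induction X rule: finite_induct) auto
    then show ?thesis unfolding T_def using finR \<phi>(2) by (auto simp: R_def)
  qed
  have main: "(\<integral>\<^sup>+x. \<phi> x \<partial>\<mu>)\<^sup>2 \<le> ?I * ((\<integral>\<^sup>+x. (\<phi> x)\<^sup>2 \<partial>?N) + T\<^sup>2 * ennreal (real (card R) * e))" if e: "e > 0" for e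
  proof -
    have "\<forall>r\<in>R. \<exists>U. open U \<and> A r \<subseteq> U \<and> emeasure ?N (U - A r) \<le> ennreal e"
      using outer_regular_leb_on[OF V A A_ball e] by blast
    then obtain U where U: "\<And>r. r \<in> R \<Longrightarrow> open (U r)" "\<And>r. r \<in> R \<Longrightarrow> A r \<subseteq> U r"
      "\<And>r. r \<in> R \<Longrightarrow> emeasure ?N (U r - A r) \<le> ennreal e" by metis
    have Um: "U r \<in> sets borel" if "r \<in> R" for r using U(1)[OF that] by simp
    define D where "D = (\<Union>r\<in>R. U r - A r)"
    have D[measurable]: "D \<in> sets borel" unfolding D_def using finR Um by auto
    have Dm: "emeasure ?N D \<le> ennreal (real (card R) * e)"
    proof -
      have "emeasure ?N D \<le> (\<Sum>r\<in>R. emeasure ?N (U r - A r))"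
        unfolding D_def using finR Um by (intro emeasure_subadditive_finite) auto
      also have "\<dots> \<le> (\<Sum>r\<in>R. ennreal e)" using U(3) by (rule sum_mono)
      also have "\<dots> = ennreal (real (card R) * e)" using e by (simp add: ennreal_mult ennreal_of_nat_eq_real_of_nat)
      finally show ?thesis .
    qed
    define h where "h x = (\<Sum>r\<in>R. r * indicator (U r) x)" for x
    have hm[measurable]: "h \<in> borel_measurable borel" unfolding h_def[abs_def] using Um by measurable
    have \<phi>h: "\<phi> x \<le> h x" for x
      unfolding \<phi>_sum h_def using U(2) by (intro sum_mono mult_left_mono) (auto simp: indicator_def)
    have hT: "h x \<le> T" for x unfolding h_def T_def
      by (intro sum_mono) (auto simp: indicator_def)
    have h\<phi>: "h x = \<phi> x" if "x \<notin> D" for x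
      unfolding \<phi>_sum h_def using that U(2) by (intro sum.cong) (auto simp: D_def indicator_def)
    have lsc: "eventually (\<lambda>n. h x \<le> h (x + (1 / real (Suc n)) *\<^sub>R z)) sequentially" for x z
    proof -
      have lim: "(\<lambda>n. x + (1 / real (Suc n)) *\<^sub>R z) \<longlonglongrightarrow> x"
        using tendsto_add[OF tendsto_const tendsto_scaleR[OF LIMSEQ_inverse_real_of_nat tendsto_const], of x z]
        by (simp add: inverse_eq_divide del: of_nat_Suc)
      have "eventually (\<lambda>n. \<forall>r\<in>R. x \<in> U r \<longrightarrow> x + (1 / real (Suc n)) *\<^sub>R z \<in> U r) sequentially"
      proof (intro eventually_ball_finite[OF finR] ballI)
        fix r assume r: "r \<in> R"
        show "eventually (\<lambda>n. x \<in> U r \<longrightarrow> x + (1 / real (Suc n)) *\<^sub>R z \<in> U r) sequentially"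
          using topological_tendstoD[OF lim U(1)[OF r]] by (cases "x \<in> U r") (auto elim: eventually_mono)
      qed
      then show ?thesis
        by eventually_elim (auto simp: h_def indicator_def intro!: sum_mono)
    qed
    have "(\<integral>\<^sup>+x. \<phi> x \<partial>\<mu>)\<^sup>2 \<le> (\<integral>\<^sup>+x. h x \<partial>\<mu>)\<^sup>2" by (intro power_mono nn_integral_mono \<phi>h) simp
    also have "\<dots> \<le> ?I * (\<integral>\<^sup>+x. (h x)\<^sup>2 \<partial>?N)"
      unfolding B(2) by (rule lower_semicontinuous_integral_bound[OF P S B(1) conc hm lsc])
    also have "(\<integral>\<^sup>+x. (h x)\<^sup>2 \<partial>?N) \<le> (\<integral>\<^sup>+x. (\<phi> x)\<^sup>2 + T\<^sup>2 * indicator D x \<partial>?N)"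
    proof (rule nn_integral_mono)
      fix x show "(h x)\<^sup>2 \<le> (\<phi> x)\<^sup>2 + T\<^sup>2 * indicator D x"
      proof (cases "x \<in> D")
        case True
        have "(h x)\<^sup>2 \<le> T\<^sup>2" using hT[of x] by (rule power_mono) simp
        then show ?thesis using True by (simp add: add_increasing)
      qed (simp add: h\<phi>)
    qed
    also have "\<dots> = (\<integral>\<^sup>+x. (\<phi> x)\<^sup>2 \<partial>?N) + T\<^sup>2 * emeasure ?N D"
      by (simp add: nn_integral_add nn_integral_cmult)
    also have "\<dots> \<le> (\<integral>\<^sup>+x. (\<phi> x)\<^sup>2 \<partial>?N) + T\<^sup>2 * ennreal (real (card R) * e)"
      by (intro add_left_mono mult_left_mono Dm) simp
    finally show ?thesis by (simp add: mult_left_mono)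
  qed
  show ?thesis
  proof (rule ennreal_le_epsilon)
    fix e :: real assume e: "0 < e"
    obtain t where t: "T = ennreal t" "t \<ge> 0" using T by (cases T) auto
    obtain i where i: "?I = ennreal i" "i \<ge> 0" using fin by (cases ?I) auto
    define q where "q = i * (t\<^sup>2 * real (card R)) + 1"
    have q: "q > 0" using i(2) by (simp add: q_def add_nonneg_pos)
    have "?I * (T\<^sup>2 * ennreal (real (card R) * (e / q))) = ennreal (i * (t\<^sup>2 * (real (card R) * (e / q))))"
    proof -
      have "ennreal i * ((ennreal t)\<^sup>2 * ennreal y) = ennreal (i * (t\<^sup>2 * y))" if "0 \<le> y" for y
        using that t(2) i(2) by (simp add: ennreal_mult ennreal_power)
      then show ?thesis unfolding t(1) i(1) using e q by simp
    qed
    also have "\<dots> \<le> ennreal e"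
    proof (rule ennreal_leI)
      have "i * (t\<^sup>2 * (real (card R) * (e / q))) = (i * (t\<^sup>2 * real (card R))) / q * e" by simp
      also have "\<dots> \<le> 1 * e" using q e by (intro mult_right_mono) (auto simp: q_def)
      finally show "i * (t\<^sup>2 * (real (card R) * (e / q))) \<le> e" by simp
    qed
    finally have "?I * ((\<integral>\<^sup>+x. (\<phi> x)\<^sup>2 \<partial>?N) + T\<^sup>2 * ennreal (real (card R) * (e / q)))
       \<le> ?I * (\<integral>\<^sup>+x. (\<phi> x)\<^sup>2 \<partial>?N) + ennreal e"
      unfolding distrib_left by (rule add_left_mono)
    then show "(\<integral>\<^sup>+x. \<phi> x \<partial>\<mu>)\<^sup>2 \<le> ?I * (\<integral>\<^sup>+x. (\<phi> x)\<^sup>2 \<partial>?N) + ennreal e"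
      using main[of "e / q"] e q by (meson divide_pos_pos order_trans)
  qed
qed

text \<open>Indicators of null sets in the inequality for simple functions give absolute continuity. Simple functions increasing to the density \<open>f\<close> give \<open>\<parallel>U\<parallel>\<^sub>2\<^sup>2 \<le> \<integral> U f \<le> \<parallel>\<F> \<mu>\<parallel>\<^sub>2 \<parallel>U\<parallel>\<^sub>2\<close>, hence a bound for \<open>\<parallel>f\<parallel>\<^sub>2\<close> by duality.\<close>

lemma square_integrable_fourier_imp_density:
  fixes \<mu> :: "'a::euclidean_space measure"
  assumes P: "prob_space \<mu>" and S: "sets \<mu> = sets borel" and V: "subspace V"
    and conc: "AE x in \<mu>. x \<in> V \<and> norm x < C"
    and fin: "(\<integral>\<^sup>+\<xi>. ennreal ((cmod (fourier \<mu> \<xi>))\<^sup>2) \<partial>leb_on V) < \<infinity>"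
  shows "\<exists>f. f \<in> borel_measurable borel \<and> (\<forall>x. 0 \<le> f x) \<and> (\<forall>x. C \<le> norm x \<longrightarrow> f x = 0)
     \<and> \<mu> = density (leb_on V) (\<lambda>x. ennreal (f x)) \<and> (\<integral>\<^sup>+x. ennreal ((f x)\<^sup>2) \<partial>leb_on V) < \<infinity>"
proof -
  let ?N = "leb_on V"
  let ?I = "\<integral>\<^sup>+\<xi>. ennreal ((cmod (fourier \<mu> \<xi>))\<^sup>2) \<partial>?N"
  interpret prob_space \<mu> by fact
  interpret N: sigma_finite_measure ?N by (rule sigma_finite_leb_on[OF V])
  note [measurable_cong] = S
  have concV: "AE x in \<mu>. x \<in> V" and concC: "AE x in \<mu>. x \<in> ball 0 C" using conc by (auto elim: eventually_mono)
  have ac: "absolutely_continuous ?N \<mu>"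
    unfolding absolutely_continuous_def
  proof
    fix A assume A: "A \<in> null_sets ?N"
    let ?A = "A \<inter> ball 0 C"
    have [measurable]: "A \<in> sets borel" using A by auto
    have "?A \<in> null_sets ?N" using A by (rule null_set_Int2) simp
    then have z: "emeasure ?N ?A = 0" by auto
    have sfi: "simple_function ?N (indicator ?A :: 'a \<Rightarrow> ennreal)" by (rule simple_function_indicator) simp
    have sq: "(indicator ?A x :: ennreal)\<^sup>2 = indicator ?A x" for x by (auto simp: indicator_def)
    have "(\<integral>\<^sup>+x. indicator ?A x \<partial>\<mu>)\<^sup>2 \<le> ?I * (\<integral>\<^sup>+x. (indicator ?A x)\<^sup>2 \<partial>?N)"
      by (rule simple_function_integral_bound[OF P S V concV fin sfi, where C = C]) (auto simp: indicator_def)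
    then have "(emeasure \<mu> ?A)\<^sup>2 \<le> 0" unfolding sq using z by (simp add: S)
    then have "emeasure \<mu> ?A = 0" by simp
    moreover have "emeasure \<mu> A = emeasure \<mu> ?A"
      by (rule emeasure_eq_AE) (use concC in \<open>auto simp: S elim: eventually_mono\<close>)
    ultimately show "A \<in> null_sets \<mu>" by (auto simp: S)
  qed
  obtain g where g[measurable]: "g \<in> borel_measurable ?N" and gd: "density ?N g = \<mu>"
    using N.Radon_Nikodym[OF ac] S by auto
  have gm[measurable]: "g \<in> borel_measurable borel" using g by simp
  have gfin: "AE x in ?N. g x \<noteq> \<infinity>"
  proof (rule nn_integral_noteq_infinite[OF g])
    have "(\<integral>\<^sup>+x. g x \<partial>?N) = emeasure (density ?N g) UNIV" by (subst emeasure_density) auto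
    also have "\<dots> = 1" unfolding gd using emeasure_space_1 sets_eq_imp_space_eq[OF S] by simp
    finally show "(\<integral>\<^sup>+x. g x \<partial>?N) \<noteq> \<infinity>" by simp
  qed
  define f where "f x = (if norm x < C then enn2real (g x) else 0)" for x
  have fm[measurable]: "f \<in> borel_measurable borel" unfolding f_def[abs_def] by measurable
  have f0: "f x \<ge> 0" for x by (simp add: f_def)
  have g0: "AE x in ?N. \<not> norm x < C \<longrightarrow> g x = 0"
  proof -
    have "AE x in density ?N g. x \<in> ball 0 C" unfolding gd by (rule concC)
    then have "AE x in ?N. 0 < g x \<longrightarrow> x \<in> ball 0 C" by (subst (asm) AE_density) auto
    then show ?thesis by eventually_elim (auto simp: zero_less_iff_neq_zero)
  qed
  have fg: "AE x in ?N. ennreal (f x) = g x"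
    using gfin g0 by eventually_elim (auto simp: f_def less_top)
  have fd: "\<mu> = density ?N (\<lambda>x. ennreal (f x))"
    unfolding gd[symmetric] using fg by (intro density_cong) (auto elim: eventually_mono)
  have "(\<integral>\<^sup>+x. ennreal ((f x)\<^sup>2) \<partial>?N) \<le> ?I"
  proof -
    obtain U where U: "\<And>i. simple_function ?N (U i)" "incseq U" "\<And>i x. U i x < \<infinity>"
      "\<And>x. (SUP i. U i x) = ennreal (f x)"
      using borel_measurable_implies_simple_function_sequence'[of "\<lambda>x. ennreal (f x)" ?N] by auto
    have Uf: "U i x \<le> ennreal (f x)" for i x unfolding U(4)[symmetric] by (rule SUP_upper) simp
    have Um[measurable]: "U i \<in> borel_measurable borel" for i using borel_measurable_simple_function[OF U(1)[of i]] by simp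
    have U0: "U i x = 0" if "x \<notin> ball 0 C" for i x using Uf[of i x] that by (simp add: f_def)
    have Ubound: "(\<integral>\<^sup>+x. (U i x)\<^sup>2 \<partial>?N) \<le> ?I" for i
    proof -
      let ?x = "\<integral>\<^sup>+x. (U i x)\<^sup>2 \<partial>?N"
      define T where "T = Max (range (U i))"
      have finU: "finite (range (U i))" using U(1)[of i] by (simp add: simple_function_def)
      have TU: "U i x \<le> T" for x unfolding T_def using finU by (intro Max_ge) auto
      have "T \<in> range (U i)" unfolding T_def using finU by (intro Max_in) auto
      then have Tt: "T < \<infinity>" using U(3) by auto
      have "?x \<le> (\<integral>\<^sup>+x. T\<^sup>2 * indicator (cball 0 C) x \<partial>?N)"
        by (intro nn_integral_mono) (use U0[of _ i] TU in \<open>force simp: indicator_def intro!: power_mono\<close>)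
      also have "\<dots> = T\<^sup>2 * emeasure ?N (cball 0 C)" by (subst nn_integral_cmult_indicator) auto
      also have "\<dots> < \<infinity>" using Tt emeasure_leb_on_cball(1)[OF V, of C] by (simp add: ennreal_mult_less_top power_less_top_ennreal)
      finally have xt: "?x < \<infinity>" .
      have "?x \<le> (\<integral>\<^sup>+x. ennreal (f x) * U i x \<partial>?N)"
        by (intro nn_integral_mono) (simp add: power2_eq_square mult_right_mono Uf)
      also have "\<dots> = (\<integral>\<^sup>+x. U i x \<partial>\<mu>)" unfolding fd by (subst nn_integral_density) auto
      finally have "?x\<^sup>2 \<le> (\<integral>\<^sup>+x. U i x \<partial>\<mu>)\<^sup>2" by (intro power_mono) auto
      also have "\<dots> \<le> ?I * ?x"
        by (rule simple_function_integral_bound[OF P S V concV fin U(1,3) U0])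
      finally have "?x * ?x \<le> ?I * ?x" by (simp add: power2_eq_square)
      then show ?thesis using xt by (cases "?x = 0") (auto simp: ennreal_mult_le_mult_iff mult.commute)
    qed
    have "(\<integral>\<^sup>+x. ennreal ((f x)\<^sup>2) \<partial>?N) = (\<integral>\<^sup>+x. (SUP i. (U i x)\<^sup>2) \<partial>?N)"
    proof (rule nn_integral_cong)
      fix x
      have inc: "incseq (\<lambda>i. U i x)" using U(2) by (auto simp: incseq_def le_fun_def)
      have "(\<lambda>i. U i x) \<longlonglongrightarrow> ennreal (f x)" using LIMSEQ_SUP[OF inc] U(4) by simp
      then have "(\<lambda>i. (U i x)\<^sup>2) \<longlonglongrightarrow> (ennreal (f x))\<^sup>2"
        unfolding power2_eq_square by (intro tendsto_mult_ennreal) (auto simp: )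
      moreover have "incseq (\<lambda>i. (U i x)\<^sup>2)" using inc by (auto simp: incseq_def intro!: power_mono)
      ultimately have "(SUP i. (U i x)\<^sup>2) = (ennreal (f x))\<^sup>2" using LIMSEQ_SUP LIMSEQ_unique by blast
      then show "ennreal ((f x)\<^sup>2) = (SUP i. (U i x)\<^sup>2)" using f0[of x] by (simp add: ennreal_power)
    qed
    also have "\<dots> = (SUP i. \<integral>\<^sup>+x. (U i x)\<^sup>2 \<partial>?N)"
      by (rule nn_integral_monotone_convergence_SUP) (use U(2) in \<open>auto simp: incseq_def le_fun_def intro!: power_mono\<close>)
    also have "\<dots> \<le> ?I" by (rule SUP_least) (rule Ubound)
    finally show ?thesis .
  qed
  then show ?thesis using fm f0 fd fin by (intro exI[of _ f]) (auto simp: f_def)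
qed

text \<open>For a density of bounded support the truncations in the definition of the Plancherel transform are eventually trivial, so this transform is the Fourier transform of the measure itself.\<close>

theorem measure_in_sobolev_criterion:
  fixes \<mu> :: "'a::euclidean_space measure"
  assumes P: "prob_space \<mu>" and S: "sets \<mu> = sets borel" and V: "subspace V"
    and conc: "AE x in \<mu>. x \<in> V \<and> norm x < C" and t: "t \<ge> 0"
    and fin: "(\<integral>\<^sup>+\<xi>. ennreal ((1 + (norm \<xi>)\<^sup>2) powr t * (cmod (fourier \<mu> \<xi>))\<^sup>2) \<partial>leb_on V) < \<infinity>"
  shows "absolutely_continuous (leb_on V) \<mu> \<and> measure_in_sobolev t V \<mu>"
proof -
  let ?N = "leb_on V"
  interpret prob_space \<mu> by fact
  note [measurable_cong] = S
  have m_f[measurable]: "fourier \<mu> \<in> borel_measurable borel"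
    by (rule borel_measurable_fourier) (simp_all add: S sigma_finite_measure_axioms)
  have one: "1 \<le> (1 + (norm \<xi>)\<^sup>2) powr t" for \<xi> :: 'a using t by (intro ge_one_powr_ge_zero) auto
  have "(\<integral>\<^sup>+\<xi>. ennreal ((cmod (fourier \<mu> \<xi>))\<^sup>2) \<partial>?N) \<le> (\<integral>\<^sup>+\<xi>. ennreal ((1 + (norm \<xi>)\<^sup>2) powr t * (cmod (fourier \<mu> \<xi>))\<^sup>2) \<partial>?N)"
    by (intro nn_integral_mono ennreal_leI) (use mult_right_mono[OF one] in \<open>fastforce\<close>)
  then have fin2: "(\<integral>\<^sup>+\<xi>. ennreal ((cmod (fourier \<mu> \<xi>))\<^sup>2) \<partial>?N) < \<infinity>" using fin by (rule le_less_trans)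
  obtain f where fm[measurable]: "f \<in> borel_measurable borel" and f0: "\<And>x. 0 \<le> f x"
    and fC: "\<And>x. C \<le> norm x \<Longrightarrow> f x = 0"
    and fd: "\<mu> = density ?N (\<lambda>x. ennreal (f x))" and f2: "(\<integral>\<^sup>+x. ennreal ((f x)\<^sup>2) \<partial>?N) < \<infinity>"
    using square_integrable_fourier_imp_density[OF P S V conc fin2] by blast
  have ac: "absolutely_continuous ?N \<mu>" unfolding fd by (rule absolutely_continuousI_density) simp
  have sqf: "square_integrable ?N (\<lambda>x. complex_of_real (f x))"
    unfolding square_integrable_def using f2 by (auto intro!: integrableI_bounded simp: f0)
  have sqg: "square_integrable ?N (fourier \<mu>)"
    unfolding square_integrable_def using fin2 by (auto intro!: integrableI_bounded)
  have trunc: "(LINT x|?N. indicator (cball 0 (real N)) x * (exp (- 2 * pi * \<i> * (x \<bullet> \<xi>)) * complex_of_real (f x))) = fourier \<mu> \<xi>"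
    if "C \<le> real N" for N \<xi>
  proof -
    have "fourier \<mu> \<xi> = (LINT x|?N. f x *\<^sub>R exp (- 2 * pi * \<i> * (x \<bullet> \<xi>)))"
      unfolding fourier_def fd by (rule integral_density) (auto simp: f0)
    also have "\<dots> = (LINT x|?N. indicator (cball 0 (real N)) x * (exp (- 2 * pi * \<i> * (x \<bullet> \<xi>)) * complex_of_real (f x)))"
      using that fC by (intro Bochner_Integration.integral_cong) (auto simp: indicator_def scaleR_conv_of_real)
    finally show ?thesis by simp
  qed
  obtain N0 :: nat where N0: "C \<le> real N0" using real_arch_simple by blast
  have pl: "plancherel_transform V (\<lambda>x. complex_of_real (f x)) (fourier \<mu>)"
    unfolding plancherel_transform_def
  proof (intro conjI sqg)
    have "eventually (\<lambda>N::nat. C \<le> real N) sequentially"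
      unfolding eventually_sequentially using N0 by (intro exI[of _ N0]) auto
    then have "eventually (\<lambda>N::nat. (\<integral>\<^sup>+\<xi>. ennreal ((cmod (
         (LINT x|?N. indicator (cball 0 (real N)) x * (exp (- 2 * pi * \<i> * (x \<bullet> \<xi>)) * complex_of_real (f x)))
         - fourier \<mu> \<xi>))\<^sup>2) \<partial>?N) = 0) sequentially"
      by eventually_elim (simp only: trunc, simp)
    then show "(\<lambda>N::nat. \<integral>\<^sup>+\<xi>. ennreal ((cmod (
         (LINT x|?N. indicator (cball 0 (real N)) x * (exp (- 2 * pi * \<i> * (x \<bullet> \<xi>)) * complex_of_real (f x)))
         - fourier \<mu> \<xi>))\<^sup>2) \<partial>?N) \<longlonglongrightarrow> 0"
      by (rule tendsto_eventually)
  qed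
  have "integrable ?N (\<lambda>\<xi>. (1 + (norm \<xi>)\<^sup>2) powr t * (cmod (fourier \<mu> \<xi>))\<^sup>2)"
    using fin by (intro integrableI_bounded) auto
  then have "measure_in_sobolev t V \<mu>"
    unfolding measure_in_sobolev_def sobolev_def using sqf pl f0 fd by blast
  with ac show ?thesis by blast
qed

section \<open>Spherical averages of the Fourier transform\<close>

lemma rotation_norm: "rotation_matrix Q \<Longrightarrow> norm (Q *v x) = norm (x :: real^'d)"
  unfolding rotation_matrix_def
  by (metis matrix_of_matrix_vector_mul matrix_vector_mul_linear orthogonal_transformation_matrix orthogonal_transformation_norm)

lemma rotation_transpose_mult:
  fixes Q :: "real^'d^'d"
  assumes "rotation_matrix Q"
  shows "transpose Q ** Q = mat 1" "Q ** transpose Q = mat 1" "matrix_inv Q = transpose Q"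
    "rotation_matrix (transpose Q)"
proof -
  have o: "orthogonal_matrix Q" and d: "det Q = 1" using assms by (auto simp: rotation_matrix_def)
  show 1: "transpose Q ** Q = mat 1" "Q ** transpose Q = mat 1" using o by (auto simp: orthogonal_matrix_def)
  have "Q ** matrix_inv Q = mat 1" unfolding matrix_inv_def by (rule someI2[of _ "transpose Q"]) (use 1 in auto)
  then show "matrix_inv Q = transpose Q" using 1(1) by (metis matrix_mul_assoc matrix_mul_lid matrix_mul_rid)
  show "rotation_matrix (transpose Q)"
    using o d by (simp add: rotation_matrix_def orthogonal_matrix_transpose det_transpose)
qed

lemma inner_matrix_left: "((Q :: real^'d^'d) *v x) \<bullet> y = x \<bullet> (transpose Q *v y)"
  by (metis dot_lmul_matrix inner_commute transpose_matrix_vector)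

text \<open>The function \<open>F\<^sub>R\<close> on subspaces that the proof is about; \<open>\<S>\<^sub>\<nu>\<^sub>,\<^sub>V(R)\<close> is its mean over the orbit.\<close>

definition sphere_energy :: "'a::euclidean_space measure \<Rightarrow> real \<Rightarrow> 'a set \<Rightarrow> real" where
  "sphere_energy \<nu> R W = (LINT \<theta>|sphere_measure W. (cmod (fourier \<nu> (R *\<^sub>R \<theta>)))\<^sup>2)"

lemma sphere_average_eq: "sphere_average \<nu> m R = (LINT W|m. sphere_energy \<nu> R W)"
  by (simp add: sphere_average_def sphere_energy_def)

lemma cmod_fourier_uminus: "cmod (fourier \<nu> (- \<xi>)) = cmod (fourier \<nu> \<xi>)"
proof -
  have "fourier \<nu> (- \<xi>) = (LINT x|\<nu>. cnj (cis (- (2 * pi * (x \<bullet> \<xi>)))))"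
    unfolding fourier_cis by (simp only: cis_cnj inner_minus_right mult_minus_right)
  also have "\<dots> = cnj (fourier \<nu> \<xi>)" unfolding fourier_cis by (rule Bochner_Integration.integral_cnj)
  finally have "fourier \<nu> (- \<xi>) = cnj (fourier \<nu> \<xi>)" .
  then show ?thesis by simp
qed

lemma (in prob_space) norm_integral_AE_le:
  fixes f :: "'a \<Rightarrow> 'b::{banach, second_countable_topology}"
  assumes "integrable M f" "AE x in M. norm (f x) \<le> c"
  shows "norm (LINT x|M. f x) \<le> c"
proof -
  have "norm (LINT x|M. f x) \<le> (LINT x|M. norm (f x))" by (rule integral_norm_bound)
  also have "\<dots> \<le> (LINT x|M. c)" using assms by (intro integral_mono_AE) auto
  finally show ?thesis by (simp add: prob_space)
qed

locale borel_prob = prob_space \<nu> for \<nu> :: "'a::euclidean_space measure" +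
  assumes sets_borel: "sets \<nu> = sets borel"
begin

lemma measurable_fourier [measurable]: "fourier \<nu> \<in> borel_measurable borel"
  by (rule borel_measurable_fourier) (simp_all add: sets_borel sigma_finite_measure_axioms)

lemma fourier_sq_le_1: "(cmod (fourier \<nu> \<xi>))\<^sup>2 \<le> 1"
  by (simp add: power_le_one cmod_fourier_le_1 prob_space_axioms)

lemma integrable_energy:
  assumes "subspace W" and [measurable]: "f \<in> borel_measurable borel"
  shows "integrable (sphere_measure W) (\<lambda>\<theta>. (cmod (fourier \<nu> (f \<theta>)))\<^sup>2)"
proof -
  interpret S: prob_space "sphere_measure W" by (rule prob_space_sphere_measure[OF assms(1)])
  show ?thesis by (rule S.integrable_const_bound[where B = 1]) (auto simp: fourier_sq_le_1)
qed

lemma sphere_energy_bounds: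
  assumes W: "subspace W" shows "0 \<le> sphere_energy \<nu> R W" "sphere_energy \<nu> R W \<le> 1"
proof -
  interpret S: prob_space "sphere_measure W" by (rule prob_space_sphere_measure[OF W])
  show "0 \<le> sphere_energy \<nu> R W" unfolding sphere_energy_def by simp
  have "sphere_energy \<nu> R W \<le> (LINT \<theta>|sphere_measure W. 1)"
    unfolding sphere_energy_def by (intro integral_mono integrable_energy[OF W]) (auto simp: fourier_sq_le_1)
  then show "sphere_energy \<nu> R W \<le> 1" using S.prob_space by simp
qed

lemma sphere_energy_isometry:
  assumes W: "subspace W" and L: "linear L" and n: "\<And>x. norm (L x) = norm x"
  shows "sphere_energy \<nu> R (L ` W) = (LINT \<theta>|sphere_measure W. (cmod (fourier \<nu> (R *\<^sub>R L \<theta>)))\<^sup>2)"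
proof -
  have Lm[measurable]: "L \<in> borel \<rightarrow>\<^sub>M borel"
    using L by (intro borel_measurable_continuous_onI linear_continuous_on) (simp add: linear_conv_bounded_linear)
  show ?thesis unfolding sphere_energy_def sphere_measure_isometry[OF assms]
    by (subst integral_distr) auto
qed

lemma sphere_energy_uminus:
  assumes W: "subspace W" shows "sphere_energy \<nu> (- R) W = sphere_energy \<nu> R W"
  unfolding sphere_energy_def by (simp add: cmod_fourier_uminus)

end

text \<open>Differencing along \<open>x, Lx, L\<^sup>2x, \<dots>\<close> applies \<open>L - 1\<close>, which commutes with the isometry \<open>L\<close>.\<close>

lemma fdiffs_linear_orbit:
  fixes L :: "'a::real_normed_vector \<Rightarrow> 'a"
  assumes L: "linear L" and h: "\<And>x. norm (L x - x) \<le> h * norm x" and n: "\<And>x. norm (L x) = norm x" and h0: "0 \<le> h"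
  shows "norm (fdiffs i (\<lambda>j. (L ^^ j) x) k) \<le> h ^ i * norm x"
proof (induction i arbitrary: x)
  case 0
  show ?case by (induction k) (simp_all add: n)
next
  case (Suc i)
  have pw: "(L ^^ j) (L x - x) = (L ^^ Suc j) x - (L ^^ j) x" for j
    by (induction j) (simp_all add: linear_diff[OF L])
  have "fdiff (\<lambda>j. (L ^^ j) x) = (\<lambda>j. (L ^^ j) (L x - x))"
    unfolding fdiff_def pw by simp
  then have "norm (fdiffs (Suc i) (\<lambda>j. (L ^^ j) x) k) \<le> h ^ i * norm (L x - x)"
    unfolding fdiffs_Suc' using Suc by simp
  also have "\<dots> \<le> h ^ i * (h * norm x)" using h h0 by (intro mult_left_mono) auto
  finally show ?case by (simp add: mult_ac)
qed

lemma image_funpow: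
  fixes L :: "'a \<Rightarrow> 'a"
  shows "((`) L ^^ j) W = (L ^^ j) ` W"
  by (induction j) (simp_all add: image_comp)

context borel_prob
begin

text \<open>The squared modulus of the transform is an average of exponentials with phases \<open>2\<pi> (x - y) \<bullet> R L\<^sup>j\<theta>\<close>, and \<open>x - y\<close> is bounded because \<open>\<nu>\<close> has bounded support. The \<open>i\<close>-th difference of the phase is at most \<open>4\<pi> C T h\<^sup>i \<le> (4\<pi> C T h)\<^sup>i\<close>, so \<open>fdiffs_cis_bound\<close> applies and survives averaging.\<close>

lemma sphere_energy_differences:
  assumes supp: "AE x in \<nu>. norm x < C" and C: "C \<ge> 1" and T: "T \<ge> 1" "0 \<le> R" "R \<le> T"
    and W: "subspace W" "1 \<le> dim W"
    and L: "linear L" and n: "\<And>x. norm (L x) = norm x"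
    and h: "\<And>x. norm (L x - x) \<le> h * norm x" "0 \<le> h" and small: "4 * pi * C * T * h \<le> 1" and J: "1 \<le> J"
  shows "\<bar>fdiffs J (\<lambda>j. sphere_energy \<nu> R (((`) L ^^ j) W)) k\<bar> \<le> cis_const J * (4 * pi * C * T * h) ^ J"
proof -
  interpret S: prob_space "sphere_measure W" by (rule prob_space_sphere_measure[OF W(1)])
  interpret PP: pair_prob_space \<nu> \<nu> ..
  note [measurable_cong] = sets_borel
  have P: "prob_space \<nu>" by (rule prob_space_axioms)
  let ?z = "4 * pi * C * T * h"
  have lin: "linear (L ^^ j)" for j
    by (induction j) (auto simp: linear_iff linear_add[OF L] linear_scale[OF L])
  have nj: "norm ((L ^^ j) x) = norm x" for j x by (induction j) (simp_all add: n)
  have Lm[measurable]: "(L ^^ j) \<in> borel \<rightarrow>\<^sub>M borel" for j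
    using lin[of j] by (intro borel_measurable_continuous_onI linear_continuous_on) (simp add: linear_conv_bounded_linear)
  have pt: "\<bar>fdiffs J (\<lambda>j. (cmod (fourier \<nu> (R *\<^sub>R (L ^^ j) \<theta>)))\<^sup>2) k\<bar> \<le> cis_const J * ?z ^ J" if \<theta>: "norm \<theta> = 1" for \<theta>
  proof -
    let ?e = "\<lambda>j p. cis (2 * pi * ((fst p - snd p) \<bullet> (R *\<^sub>R (L ^^ j) \<theta>)))"
    have inte: "integrable (\<nu> \<Otimes>\<^sub>M \<nu>) (?e j)" for j by (rule PP.P.integrable_cis) measurable
    have AEC: "AE p in \<nu> \<Otimes>\<^sub>M \<nu>. norm (fst p - snd p) \<le> 2 * C"
    proof (rule PP.AE_pair_measure)
      show "AE x in \<nu>. AE y in \<nu>. norm (fst (x, y) - snd (x, y)) \<le> 2 * C"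
        using supp
      proof eventually_elim
        case (elim x)
        show ?case using supp
          by eventually_elim (use elim norm_triangle_ineq4 in \<open>force intro: order_trans[OF norm_triangle_ineq4]\<close>)
      qed
    qed measurable
    have bound: "norm (fdiffs J (\<lambda>j. ?e j p) k) \<le> cis_const J * ?z ^ J" if p: "norm (fst p - snd p) \<le> 2 * C" for p
    proof -
      let ?u = "\<lambda>j. 2 * pi * ((fst p - snd p) \<bullet> (R *\<^sub>R (L ^^ j) \<theta>))"
      have "norm (fdiffs J (\<lambda>j. cis (?u j)) k) \<le> cis_const J * 1 * ?z ^ J"
      proof (rule fdiffs_cis_bound)
        fix i k assume i: "1 \<le> i" "i \<le> J"
        have bl: "bounded_linear (\<lambda>v. 2 * pi * ((fst p - snd p) \<bullet> (R *\<^sub>R v)))"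
          by (intro bounded_linear_const_mult bounded_linear_inner_right_comp bounded_linear_scaleR_right)
        have "fdiffs i ?u k = 2 * pi * ((fst p - snd p) \<bullet> (R *\<^sub>R fdiffs i (\<lambda>j. (L ^^ j) \<theta>) k))"
          by (rule fdiffs_bounded_linear[OF bl])
        also have "\<bar>\<dots>\<bar> = 2 * pi * \<bar>(fst p - snd p) \<bullet> (R *\<^sub>R fdiffs i (\<lambda>j. (L ^^ j) \<theta>) k)\<bar>"
          by (simp add: abs_mult)
        also have "\<dots> \<le> 2 * pi * (norm (fst p - snd p) * norm (R *\<^sub>R fdiffs i (\<lambda>j. (L ^^ j) \<theta>) k))"
          by (intro mult_left_mono Cauchy_Schwarz_ineq2) auto
        also have "\<dots> \<le> 2 * pi * ((2 * C) * (T * (h ^ i * 1)))"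
          using p T C \<theta> fdiffs_linear_orbit[OF L h(1) n h(2), of i \<theta> k]
          by (intro mult_left_mono mult_mono) (auto intro!: mult_mono)
        also have "\<dots> = (4 * pi * C * T) * h ^ i" by simp
        also have "\<dots> \<le> (4 * pi * C * T) ^ i * h ^ i"
        proof (intro mult_right_mono self_le_power)
          have "1 * 1 \<le> C * T" using C T by (intro mult_mono) auto
          moreover have "1 \<le> 4 * pi" using pi_gt3 by simp
          ultimately have "1 * 1 \<le> (4 * pi) * (C * T)" by (intro mult_mono) auto
          then show "1 \<le> 4 * pi * C * T" by (simp add: mult.assoc)
        qed (use i h in auto)
        finally show "\<bar>fdiffs i ?u k\<bar> \<le> 1 * ?z ^ i" by (simp add: power_mult_distrib)
      qed (use J small h C T in auto)
      then show ?thesis by simp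
    qed
    have cplx: "complex_of_real (fdiffs J (\<lambda>j. (cmod (fourier \<nu> (R *\<^sub>R (L ^^ j) \<theta>)))\<^sup>2) k)
       = (LINT p|(\<nu> \<Otimes>\<^sub>M \<nu>). fdiffs J (\<lambda>j. ?e j p) k)"
    proof -
      have "complex_of_real (fdiffs J (\<lambda>j. (cmod (fourier \<nu> (R *\<^sub>R (L ^^ j) \<theta>)))\<^sup>2) k)
        = fdiffs J (\<lambda>j. complex_of_real ((cmod (fourier \<nu> (R *\<^sub>R (L ^^ j) \<theta>)))\<^sup>2)) k"
        by (rule fdiffs_bounded_linear[OF bounded_linear_of_real, symmetric])
      also have "\<dots> = fdiffs J (\<lambda>j. LINT p|(\<nu> \<Otimes>\<^sub>M \<nu>). ?e j p) k"
        by (simp add: cmod_fourier_squared[OF P sets_borel] del: of_real_power)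
      also have "\<dots> = (LINT p|(\<nu> \<Otimes>\<^sub>M \<nu>). fdiffs J (\<lambda>j. ?e j p) k)"
        by (rule integral_fdiffs[OF inte])
      finally show ?thesis .
    qed
    have "norm (LINT p|(\<nu> \<Otimes>\<^sub>M \<nu>). fdiffs J (\<lambda>j. ?e j p) k) \<le> cis_const J * ?z ^ J"
      by (intro PP.P.norm_integral_AE_le integral_fdiffs(1)[OF inte] eventually_mono[OF AEC]) (rule bound)
    then show ?thesis unfolding cplx[symmetric] by simp
  qed
  have inte: "integrable (sphere_measure W) (\<lambda>\<theta>. (cmod (fourier \<nu> (R *\<^sub>R (L ^^ j) \<theta>)))\<^sup>2)" for j
    by (rule integrable_energy[OF W(1)]) measurable
  have "fdiffs J (\<lambda>j. sphere_energy \<nu> R (((`) L ^^ j) W)) k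
     = fdiffs J (\<lambda>j. LINT \<theta>|sphere_measure W. (cmod (fourier \<nu> (R *\<^sub>R (L ^^ j) \<theta>)))\<^sup>2) k"
    by (simp add: image_funpow sphere_energy_isometry[OF W(1) lin nj])
  also have "\<dots> = (LINT \<theta>|sphere_measure W. fdiffs J (\<lambda>j. (cmod (fourier \<nu> (R *\<^sub>R (L ^^ j) \<theta>)))\<^sup>2) k)"
    by (rule integral_fdiffs[OF inte])
  finally have eq: "fdiffs J (\<lambda>j. sphere_energy \<nu> R (((`) L ^^ j) W)) k
     = (LINT \<theta>|sphere_measure W. fdiffs J (\<lambda>j. (cmod (fourier \<nu> (R *\<^sub>R (L ^^ j) \<theta>)))\<^sup>2) k)" .
  have "norm (LINT \<theta>|sphere_measure W. fdiffs J (\<lambda>j. (cmod (fourier \<nu> (R *\<^sub>R (L ^^ j) \<theta>)))\<^sup>2) k) \<le> cis_const J * ?z ^ J"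
    by (intro S.norm_integral_AE_le integral_fdiffs(1)[OF inte] eventually_mono[OF AE_sphere_measure[OF W]])
       (simp add: pt)
  then show ?thesis unfolding eq real_norm_def .
qed

end

section \<open>Self-similar measures\<close>

lemma weighted_jensen_square:
  fixes a p :: "'i \<Rightarrow> real"
  assumes "finite I" "\<And>i. i \<in> I \<Longrightarrow> 0 \<le> p i" "(\<Sum>i\<in>I. p i) = 1"
  shows "(\<Sum>i\<in>I. p i * a i)\<^sup>2 \<le> (\<Sum>i\<in>I. p i * (a i)\<^sup>2)"
proof -
  define m where "m = (\<Sum>i\<in>I. p i * a i)"
  have "0 \<le> (\<Sum>i\<in>I. p i * (a i - m)\<^sup>2)" using assms by (intro sum_nonneg) auto
  also have "\<dots> = (\<Sum>i\<in>I. p i * (a i)\<^sup>2 - 2 * m * (p i * a i) + m\<^sup>2 * p i)"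
    by (intro sum.cong) (auto simp: power2_eq_square algebra_simps)
  also have "\<dots> = (\<Sum>i\<in>I. p i * (a i)\<^sup>2) - 2 * m * m + m\<^sup>2 * 1"
    using assms(3) by (simp add: sum.distrib sum_subtractf sum_distrib_left[symmetric] m_def)
  finally show ?thesis by (simp add: m_def power2_eq_square)
qed

locale self_similar =
  fixes n :: nat and r p :: "nat \<Rightarrow> real" and Q :: "nat \<Rightarrow> real^'d^'d" and t :: "nat \<Rightarrow> real^'d"
    and \<nu> :: "(real^'d) measure"
  assumes r: "\<And>i. i \<in> {1..n} \<Longrightarrow> 0 < \<bar>r i\<bar> \<and> \<bar>r i\<bar> < 1"
    and Q: "\<And>i. i \<in> {1..n} \<Longrightarrow> rotation_matrix (Q i)"
    and p: "\<And>i. i \<in> {1..n} \<Longrightarrow> 0 < p i" and p1: "(\<Sum>i=1..n. p i) = 1"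
    and ss: "self_similar_measure n p (\<lambda>i x. r i *\<^sub>R (Q i *v x) + t i) \<nu>"
begin

abbreviation "f i x \<equiv> r i *\<^sub>R (Q i *v x) + t i"

sublocale borel_prob \<nu>
  using ss by (auto simp: self_similar_measure_def borel_prob_def borel_prob_axioms_def)

declare sets_borel [measurable_cong]

lemma measurable_f [measurable]: "f i \<in> borel \<rightarrow>\<^sub>M borel"
  by (intro borel_measurable_continuous_onI continuous_intros linear_continuous_on)
     (simp add: matrix_vector_mul_bounded_linear)

lemma n_pos: "{1..n} \<noteq> {}" using p1 by (cases n) auto

lemma p0: "i \<in> {1..n} \<Longrightarrow> 0 \<le> p i" using p less_imp_le by blast

lemma emeasure_self_similar:
  assumes "A \<in> sets borel"
  shows "emeasure \<nu> A = (\<Sum>i=1..n. ennreal (p i) * emeasure \<nu> {x. f i x \<in> A})"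
proof -
  have "space \<nu> = UNIV" using sets_eq_imp_space_eq[OF sets_borel] by simp
  then have "emeasure (distr \<nu> borel (f i)) A = emeasure \<nu> {x. f i x \<in> A}" for i
    using assms by (subst emeasure_distr) (auto simp: vimage_def)
  then show ?thesis using ss assms by (simp add: self_similar_measure_def)
qed

lemma nn_integral_self_similar:
  assumes "h \<in> borel_measurable borel"
  shows "(\<integral>\<^sup>+x. h x \<partial>\<nu>) = (\<Sum>i=1..n. ennreal (p i) * (\<integral>\<^sup>+x. h (f i x) \<partial>\<nu>))"
proof -
  define D where "D = point_measure {1..n} (\<lambda>i. ennreal (p i))"
  interpret D: prob_space D
  proof
    have "(\<Sum>i=1..n. ennreal (p i)) = 1" using p0 p1 by (subst sum_ennreal) auto
    then show "emeasure D (space D) = 1" by (simp add: D_def space_point_measure emeasure_point_measure_finite)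
  qed
  interpret DP: pair_sigma_finite D \<nu> ..
  have meas: "(\<lambda>(i, x). f i x) \<in> D \<Otimes>\<^sub>M \<nu> \<rightarrow>\<^sub>M borel"
  proof -
    have "(\<lambda>(i, x). f i x) \<in> count_space {1..n} \<Otimes>\<^sub>M \<nu> \<rightarrow>\<^sub>M borel"
      unfolding split_beta by (rule measurable_pair_measure_countable1) (auto simp: sets_borel measurable_f)
    then show ?thesis unfolding D_def by (simp cong: measurable_cong_sets sets_pair_measure_cong add: sets_point_measure sets_borel)
  qed
  have int: "(\<integral>\<^sup>+i. g i \<partial>D) = (\<Sum>i=1..n. ennreal (p i) * g i)" for g
    unfolding D_def by (subst nn_integral_point_measure_finite) auto
  have "\<nu> = distr (D \<Otimes>\<^sub>M \<nu>) borel (\<lambda>(i, x). f i x)"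
  proof (rule measure_eqI)
    fix A assume "A \<in> sets \<nu>"
    then have A: "A \<in> sets borel" by (simp add: sets_borel)
    have "emeasure (distr (D \<Otimes>\<^sub>M \<nu>) borel (\<lambda>(i, x). f i x)) A = (\<integral>\<^sup>+y. indicator A y \<partial>distr (D \<Otimes>\<^sub>M \<nu>) borel (\<lambda>(i, x). f i x))"
      using A by (intro nn_integral_indicator[symmetric]) simp
    also have "\<dots> = (\<integral>\<^sup>+z. indicator A ((\<lambda>(i, x). f i x) z) \<partial>(D \<Otimes>\<^sub>M \<nu>))"
      using A by (intro nn_integral_distr[OF meas]) simp
    also have "\<dots> = (\<integral>\<^sup>+i. \<integral>\<^sup>+x. indicator A (f i x) \<partial>\<nu> \<partial>D)"
      using measurable_compose[OF meas borel_measurable_indicator[OF A]]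
      by (subst nn_integral_fst[symmetric]) auto
    also have "\<dots> = (\<Sum>i=1..n. ennreal (p i) * (\<integral>\<^sup>+x. indicator A (f i x) \<partial>\<nu>))" by (rule int)
    also have "\<dots> = emeasure \<nu> A" unfolding emeasure_self_similar[OF A]
    proof (intro sum.cong refl arg_cong2[where f = "(*)"])
      fix i
      have "{x. f i x \<in> A} \<in> sets \<nu>" using measurable_sets_borel[OF measurable_f A] by (simp add: vimage_def sets_borel)
      then have "(\<integral>\<^sup>+x. indicator {x. f i x \<in> A} x \<partial>\<nu>) = emeasure \<nu> {x. f i x \<in> A}"
        by (rule nn_integral_indicator)
      then show "(\<integral>\<^sup>+x. indicator A (f i x) \<partial>\<nu>) = emeasure \<nu> {x. f i x \<in> A}"
        by (simp add: indicator_def)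
    qed
    finally show "emeasure \<nu> A = emeasure (distr (D \<Otimes>\<^sub>M \<nu>) borel (\<lambda>(i, x). f i x)) A" by simp
  qed (simp add: sets_borel)
  then have "(\<integral>\<^sup>+x. h x \<partial>\<nu>) = (\<integral>\<^sup>+z. h ((\<lambda>(i, x). f i x) z) \<partial>(D \<Otimes>\<^sub>M \<nu>))"
    using nn_integral_distr[OF meas, of h] assms by simp
  also have "\<dots> = (\<integral>\<^sup>+i. \<integral>\<^sup>+x. h (f i x) \<partial>\<nu> \<partial>D)"
    using measurable_compose[OF meas assms] by (subst nn_integral_fst[symmetric]) auto
  finally show ?thesis unfolding int .
qed

lemma integral_self_similar_real:
  fixes g :: "real^'d \<Rightarrow> real"
  assumes [measurable]: "g \<in> borel_measurable borel" and b: "\<And>x. \<bar>g x\<bar> \<le> 1"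
  shows "(LINT x|\<nu>. g x) = (\<Sum>i=1..n. p i * (LINT x|\<nu>. g (f i x)))"
proof -
  have val: "(\<integral>\<^sup>+x. ennreal (h x + 1) \<partial>\<nu>) = ennreal ((LINT x|\<nu>. h x) + 1)" and ge: "0 \<le> (LINT x|\<nu>. h x) + 1"
    if [measurable]: "h \<in> borel_measurable borel" and "\<And>x. \<bar>h x\<bar> \<le> 1" for h
  proof -
    have i: "integrable \<nu> h" using that by (intro integrable_const_bound[where B = 1]) auto
    have nn: "0 \<le> h x + 1" for x using that(2)[of x] by (simp add: abs_le_iff)
    have "(LINT x|\<nu>. h x + 1) = (LINT x|\<nu>. h x) + 1" using i by (simp add: prob_space)
    then show "(\<integral>\<^sup>+x. ennreal (h x + 1) \<partial>\<nu>) = ennreal ((LINT x|\<nu>. h x) + 1)" "0 \<le> (LINT x|\<nu>. h x) + 1"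
      using i nn nn_integral_eq_integral[of \<nu> "\<lambda>x. h x + 1"] Bochner_Integration.integral_nonneg[of \<nu> "\<lambda>x. h x + 1"] by auto
  qed
  have gf: "(\<lambda>x. g (f i x)) \<in> borel_measurable borel" for i by measurable
  have "ennreal ((LINT x|\<nu>. g x) + 1) = (\<Sum>i=1..n. ennreal (p i) * ennreal ((LINT x|\<nu>. g (f i x)) + 1))"
    unfolding val[OF assms, symmetric] val[OF gf b, symmetric] by (rule nn_integral_self_similar) measurable
  also have "\<dots> = ennreal (\<Sum>i=1..n. p i * ((LINT x|\<nu>. g (f i x)) + 1))"
    using p0 ge[OF gf b] by (subst sum_ennreal[symmetric]) (auto simp: ennreal_mult intro!: mult_nonneg_nonneg sum.cong)
  finally have "(LINT x|\<nu>. g x) + 1 = (\<Sum>i=1..n. p i * ((LINT x|\<nu>. g (f i x)) + 1))"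
    using ge[OF assms] ge[OF gf b] p0
    by (subst (asm) ennreal_inj) (auto intro!: sum_nonneg mult_nonneg_nonneg)
  then show ?thesis using p1 by (simp add: distrib_left sum.distrib)
qed

lemma integral_self_similar_complex:
  fixes g :: "real^'d \<Rightarrow> complex"
  assumes [measurable]: "g \<in> borel_measurable borel" and b: "\<And>x. cmod (g x) \<le> 1"
  shows "(LINT x|\<nu>. g x) = (\<Sum>i=1..n. of_real (p i) * (LINT x|\<nu>. g (f i x)))"
proof -
  have i: "integrable \<nu> g" "integrable \<nu> (\<lambda>x. g (f j x))" for j
    by (rule integrable_const_bound[where B = 1]; use b in auto)+
  have bR: "\<bar>Re (g x)\<bar> \<le> 1" "\<bar>Im (g x)\<bar> \<le> 1" for x
    using abs_Re_le_cmod[of "g x"] abs_Im_le_cmod[of "g x"] b[of x] by linarith+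
  show ?thesis
    using integral_self_similar_real[of "\<lambda>x. Re (g x)"] integral_self_similar_real[of "\<lambda>x. Im (g x)"] bR i
    by (simp add: complex_eq_iff)
qed

text \<open>The transform of a self-similar measure is a convex combination of phases times dilated and rotated copies of itself; convexity of the square removes the phases.\<close>

lemma fourier_recursion:
  "(cmod (fourier \<nu> \<xi>))\<^sup>2 \<le> (\<Sum>i=1..n. p i * (cmod (fourier \<nu> (r i *\<^sub>R (transpose (Q i) *v \<xi>))))\<^sup>2)"
proof -
  have "fourier \<nu> \<xi> = (\<Sum>i=1..n. of_real (p i) * (LINT x|\<nu>. cis (- (2 * pi * (f i x \<bullet> \<xi>)))))"
    unfolding fourier_cis by (rule integral_self_similar_complex) auto
  also have "\<dots> = (\<Sum>i=1..n. of_real (p i) * (cis (- (2 * pi * (t i \<bullet> \<xi>))) * fourier \<nu> (r i *\<^sub>R (transpose (Q i) *v \<xi>))))"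
  proof (intro sum.cong refl arg_cong2[where f = "(*)"])
    fix i
    have "cis (- (2 * pi * (f i x \<bullet> \<xi>))) = cis (- (2 * pi * (t i \<bullet> \<xi>))) * cis (- (2 * pi * (x \<bullet> (r i *\<^sub>R (transpose (Q i) *v \<xi>)))))" for x
      by (simp add: cis_mult inner_add_left inner_matrix_left algebra_simps)
    then show "(LINT x|\<nu>. cis (- (2 * pi * (f i x \<bullet> \<xi>)))) = cis (- (2 * pi * (t i \<bullet> \<xi>))) * fourier \<nu> (r i *\<^sub>R (transpose (Q i) *v \<xi>))"
      unfolding fourier_cis by simp
  qed
  finally have "cmod (fourier \<nu> \<xi>) \<le> (\<Sum>i=1..n. p i * cmod (fourier \<nu> (r i *\<^sub>R (transpose (Q i) *v \<xi>))))"
    using p0 by (auto intro!: order_trans[OF norm_sum] sum_mono simp: norm_mult)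
  then have "(cmod (fourier \<nu> \<xi>))\<^sup>2 \<le> (\<Sum>i=1..n. p i * cmod (fourier \<nu> (r i *\<^sub>R (transpose (Q i) *v \<xi>))))\<^sup>2"
    by (rule power_mono) simp
  also have "\<dots> \<le> (\<Sum>i=1..n. p i * (cmod (fourier \<nu> (r i *\<^sub>R (transpose (Q i) *v \<xi>))))\<^sup>2)"
    by (rule weighted_jensen_square) (use p0 p1 in auto)
  finally show ?thesis .
qed

lemma sphere_energy_recursion:
  assumes W: "subspace W"
  shows "sphere_energy \<nu> R W \<le> (\<Sum>i=1..n. p i * sphere_energy \<nu> (\<bar>r i\<bar> * R) (rotate_set (transpose (Q i)) W))"
proof -
  interpret S: prob_space "sphere_measure W" by (rule prob_space_sphere_measure[OF W])
  have Lm[measurable]: "(\<lambda>x. transpose (Q i) *v x) \<in> borel \<rightarrow>\<^sub>M borel" for i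
    by (intro borel_measurable_continuous_onI linear_continuous_on matrix_vector_mul_bounded_linear)
  have int: "integrable (sphere_measure W) (\<lambda>\<theta>. (cmod (fourier \<nu> (r i *\<^sub>R (transpose (Q i) *v (R *\<^sub>R \<theta>)))))\<^sup>2)" for i
    by (rule integrable_energy[OF W]) measurable
  have "sphere_energy \<nu> R W \<le> (LINT \<theta>|sphere_measure W. (\<Sum>i=1..n. p i * (cmod (fourier \<nu> (r i *\<^sub>R (transpose (Q i) *v (R *\<^sub>R \<theta>)))))\<^sup>2))"
    unfolding sphere_energy_def using int by (intro integral_mono integrable_energy[OF W] fourier_recursion) auto
  also have "\<dots> = (\<Sum>i=1..n. p i * (LINT \<theta>|sphere_measure W. (cmod (fourier \<nu> (r i *\<^sub>R (transpose (Q i) *v (R *\<^sub>R \<theta>)))))\<^sup>2))"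
    using int by simp
  also have "\<dots> = (\<Sum>i=1..n. p i * sphere_energy \<nu> (\<bar>r i\<bar> * R) (rotate_set (transpose (Q i)) W))"
  proof (intro sum.cong refl arg_cong2[where f = "(*)"])
    fix i assume i: "i \<in> {1..n}"
    have rot: "rotation_matrix (transpose (Q i))" using Q[OF i] by (rule rotation_transpose_mult)
    have lin: "linear (\<lambda>x. transpose (Q i) *v x)" by (rule matrix_vector_mul_linear)
    have nrm: "norm (transpose (Q i) *v x) = norm x" for x using rot by (rule rotation_norm)
    have W': "subspace (rotate_set (transpose (Q i)) W)"
      unfolding rotate_set_def by (rule linear_subspace_image[OF lin W])
    have "(LINT \<theta>|sphere_measure W. (cmod (fourier \<nu> (r i *\<^sub>R (transpose (Q i) *v (R *\<^sub>R \<theta>)))))\<^sup>2)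
      = sphere_energy \<nu> (r i * R) (rotate_set (transpose (Q i)) W)"
      unfolding rotate_set_def sphere_energy_isometry[OF W lin nrm]
      by (simp add: matrix_vector_mult_scaleR)
    also have "\<dots> = sphere_energy \<nu> (\<bar>r i\<bar> * R) (rotate_set (transpose (Q i)) W)"
      using sphere_energy_uminus[OF W', of "r i * R"] by (cases "r i \<ge> 0") auto
    finally show "(LINT \<theta>|sphere_measure W. (cmod (fourier \<nu> (r i *\<^sub>R (transpose (Q i) *v (R *\<^sub>R \<theta>)))))\<^sup>2)
      = sphere_energy \<nu> (\<bar>r i\<bar> * R) (rotate_set (transpose (Q i)) W)" .
  qed
  finally show ?thesis .
qed

definition rmax where "rmax = Max ((\<lambda>i. \<bar>r i\<bar>) ` {1..n})"
definition rmin where "rmin = Min ((\<lambda>i. \<bar>r i\<bar>) ` {1..n})"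

lemma rmin_rmax: "0 < rmin" "rmax < 1" "0 < rmax" "\<And>i. i \<in> {1..n} \<Longrightarrow> rmin \<le> \<bar>r i\<bar> \<and> \<bar>r i\<bar> \<le> rmax"
  and rmin_less_1: "rmin < 1"
proof -
  let ?R = "(\<lambda>i. \<bar>r i\<bar>) ` {1..n}"
  have f: "finite ?R" "?R \<noteq> {}" using n_pos by auto
  have "rmax \<in> ?R" "rmin \<in> ?R" unfolding rmax_def rmin_def using f by (auto intro: Max_in Min_in)
  then show "0 < rmin" "rmax < 1" "0 < rmax" "rmin < 1" using r by auto
  show "rmin \<le> \<bar>r i\<bar> \<and> \<bar>r i\<bar> \<le> rmax" if "i \<in> {1..n}" for i
    unfolding rmax_def rmin_def using f that by (auto intro: Max_ge Min_le)
qed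

text \<open>For large \<open>R\<close> every preimage of the complement of the ball of radius \<open>R\<close> lies outside the ball of radius \<open>R + 1\<close>. Hence the mass outside the ball of radius \<open>R\<close> is at most the mass outside the ball of radius \<open>R + m\<close> for all \<open>m\<close>, which tends to \<open>0\<close>.\<close>

lemma bounded_support: "\<exists>C\<ge>1. AE x in \<nu>. norm x < C"
proof -
  define b where "b = (\<Sum>i=1..n. norm (t i))"
  have b: "norm (t i) \<le> b" if "i \<in> {1..n}" for i unfolding b_def using that by (intro member_le_sum) auto
  have b0: "b \<ge> 0" unfolding b_def by (intro sum_nonneg) auto
  define R0 where "R0 = (b + 1) / (1 - rmax)"
  have R0: "R0 > 0" using b0 rmin_rmax by (simp add: R0_def)
  define u where "u R = emeasure \<nu> {x. R < norm x}" for R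
  have meas[measurable]: "{x. R < norm x} \<in> sets borel" for R :: real by measurable
  have mono: "u R \<le> u R'" if "R' \<le> R" for R R'
    unfolding u_def using that by (intro emeasure_mono) (auto simp: sets_borel)
  have step: "u R \<le> u (R + 1)" if R: "R \<ge> R0" for R
  proof -
    have "u R = (\<Sum>i=1..n. ennreal (p i) * emeasure \<nu> {x. f i x \<in> {x. R < norm x}})"
      unfolding u_def by (rule emeasure_self_similar) measurable
    also have "\<dots> \<le> (\<Sum>i=1..n. ennreal (p i) * u (R + 1))"
    proof (intro sum_mono mult_left_mono)
      fix i assume i: "i \<in> {1..n}"
      show "emeasure \<nu> {x. f i x \<in> {x. R < norm x}} \<le> u (R + 1)"
        unfolding u_def
      proof (rule emeasure_mono)
        show "{x. f i x \<in> {x. R < norm x}} \<subseteq> {x. R + 1 < norm x}"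
        proof safe
          fix x assume "R < norm (f i x)"
          also have "\<dots> \<le> norm (r i *\<^sub>R (Q i *v x)) + norm (t i)" by (rule norm_triangle_ineq)
          also have "\<dots> \<le> rmax * norm x + b"
            using b[OF i] rmin_rmax(4)[OF i] rotation_norm[OF Q[OF i], of x] by (auto intro!: add_mono mult_right_mono)
          finally have 1: "R - b < rmax * norm x" by simp
          have "(b + 1) \<le> R * (1 - rmax)" using R rmin_rmax by (simp add: R0_def field_simps)
          then have "rmax * (R + 1) \<le> R - b" using rmin_rmax by (simp add: algebra_simps)
          then have "rmax * (R + 1) < rmax * norm x" using 1 by linarith
          then show "R + 1 < norm x" using rmin_rmax by simp
        qed
      qed (simp add: sets_borel)
    qed simp
    also have "\<dots> = u (R + 1)"
    proof -
      have "(\<Sum>i=1..n. ennreal (p i)) = 1" using p0 p1 by (subst sum_ennreal) auto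
      then show ?thesis by (simp add: sum_distrib_right[symmetric])
    qed
    finally show ?thesis .
  qed
  have iter: "u R0 \<le> u (R0 + real m)" for m
  proof (induction m)
    case (Suc m)
    then show ?case using step[of "R0 + real m"] by (simp add: add.assoc add.commute[of 1] order_trans)
  qed simp
  have lim: "(\<lambda>m. emeasure \<nu> {x. R0 + real m < norm x}) \<longlonglongrightarrow> emeasure \<nu> (\<Inter>m. {x. R0 + real m < norm x})"
    by (rule Lim_emeasure_decseq) (auto simp: decseq_def sets_borel emeasure_eq_measure)
  have "(\<Inter>m. {x::real^'d. R0 + real m < norm x}) = {}"
  proof safe
    fix x :: "real^'d" assume x: "x \<in> (\<Inter>m. {x. R0 + real m < norm x})"
    obtain m where "norm x - R0 \<le> real m" using real_arch_simple by blast
    then show "x \<in> {}" using x by (auto simp: not_less dest!: spec[of _ m])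
  qed
  with lim have "(\<lambda>m. u (R0 + real m)) \<longlonglongrightarrow> 0" unfolding u_def by simp
  then have "u R0 \<le> 0" by (rule LIMSEQ_le_const) (use iter in auto)
  then have u0: "emeasure \<nu> {x. R0 < norm x} = 0" by (simp add: u_def)
  have "AE x in \<nu>. norm x < R0 + 1"
    by (rule AE_I[OF _ u0]) (auto simp: sets_borel)
  then show ?thesis using R0 by (intro exI[of _ "R0 + 1"]) auto
qed

end

section \<open>Rotations and their action on subspaces\<close>

lemma tendsto_matrix_mult:
  fixes f g :: "'b \<Rightarrow> real^'d^'d"
  assumes "(f \<longlongrightarrow> A) F" "(g \<longlongrightarrow> B) F" shows "((\<lambda>x. f x ** g x) \<longlongrightarrow> A ** B) F"
  unfolding matrix_matrix_mult_def using assms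
  by (intro vec_tendstoI) (auto intro!: tendsto_intros)

lemma tendsto_transpose:
  fixes f :: "'b \<Rightarrow> real^'d^'d"
  assumes "(f \<longlongrightarrow> A) F" shows "((\<lambda>x. transpose (f x)) \<longlongrightarrow> transpose A) F"
  unfolding transpose_def using assms by (intro vec_tendstoI) (auto intro!: tendsto_intros)

lemma tendsto_det:
  fixes f :: "'b \<Rightarrow> real^'d^'d"
  assumes "(f \<longlongrightarrow> A) F" shows "((\<lambda>x. det (f x)) \<longlongrightarrow> det A) F"
  unfolding det_def using assms by (auto intro!: tendsto_intros)

lemma norm_matrix_squared: "(norm (A :: real^'d^'d))\<^sup>2 = (\<Sum>i\<in>UNIV. (norm (A $ i))\<^sup>2)"
  by (simp add: norm_vec_def L2_set_def sum_nonneg)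

lemma norm_transpose: "norm (transpose A) = norm (A :: real^'d^'d)"
proof -
  have sq: "(norm (x :: real^'d))\<^sup>2 = (\<Sum>j\<in>UNIV. (x $ j)\<^sup>2)" for x
    by (simp add: norm_vec_def L2_set_def sum_nonneg)
  have "(norm (transpose A))\<^sup>2 = (norm A)\<^sup>2"
    unfolding norm_matrix_squared sq by (subst sum.swap) (simp add: transpose_def)
  then show ?thesis by (simp add: power2_eq_iff_nonneg)
qed

lemma matrix_mult_linear:
  fixes A B C :: "real^'d^'d"
  shows "(A + B) ** C = A ** C + B ** C" "C ** (A + B) = C ** A + C ** B"
    "(A - B) ** C = A ** C - B ** C" "C ** (A - B) = C ** A - C ** B"
    "(c *\<^sub>R A) ** C = c *\<^sub>R (A ** C)" "C ** (c *\<^sub>R A) = c *\<^sub>R (C ** A)"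
  by (simp_all add: vec_eq_iff matrix_matrix_mult_def distrib_left distrib_right left_diff_distrib right_diff_distrib
      sum.distrib sum_subtractf sum_distrib_left mult_ac)

lemma matrix_mult_transpose_row: "((A :: real^'d^'d) ** transpose B) $ i = (B :: real^'d^'d) *v (A $ i)"
  by (simp add: vec_eq_iff matrix_matrix_mult_def matrix_vector_mult_def transpose_def mult.commute)

lemma norm_matrix_vector_le: "norm ((B :: real^'d^'d) *v x) \<le> norm B * norm x"
proof -
  have "(norm (B *v x))\<^sup>2 = (\<Sum>i\<in>UNIV. ((B $ i) \<bullet> x)\<^sup>2)"
    by (simp add: norm_vec_def L2_set_def sum_nonneg matrix_vector_mul_component)
  also have "\<dots> \<le> (\<Sum>i\<in>UNIV. (norm (B $ i))\<^sup>2 * (norm x)\<^sup>2)"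
    by (intro sum_mono) (simp add: Cauchy_Schwarz_ineq power2_norm_eq_inner)
  also have "\<dots> = (norm B * norm x)\<^sup>2"
    by (simp add: norm_matrix_squared sum_distrib_right power_mult_distrib)
  finally show ?thesis by (rule power2_le_imp_le) simp
qed

lemma norm_mult_transpose_le: "norm (A ** transpose B) \<le> norm (B :: real^'d^'d) * norm (A :: real^'d^'d)"
proof -
  have "(norm (A ** transpose B))\<^sup>2 \<le> (\<Sum>i\<in>UNIV. (norm B * norm (A $ i))\<^sup>2)"
    unfolding norm_matrix_squared[of "A ** transpose B"] matrix_mult_transpose_row
    by (intro sum_mono power_mono norm_matrix_vector_le) auto
  also have "\<dots> = (norm B * norm A)\<^sup>2"
    by (simp add: norm_matrix_squared[of A] sum_distrib_left power_mult_distrib)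
  finally show ?thesis by (rule power2_le_imp_le) simp
qed

lemma norm_mult_transpose_rotation:
  assumes "rotation_matrix B" shows "norm (A ** transpose B) = norm (A :: real^'d^'d)"
proof -
  have "(norm (A ** transpose B))\<^sup>2 = (norm A)\<^sup>2"
    unfolding norm_matrix_squared matrix_mult_transpose_row rotation_norm[OF assms] ..
  then show ?thesis by (simp add: power2_eq_iff_nonneg)
qed

lemma norm_mult_rotation:
  assumes "rotation_matrix B" shows "norm (B ** A) = norm (A :: real^'d^'d)"
proof -
  have "norm (B ** A) = norm (transpose A ** transpose B)"
    by (metis matrix_transpose_mul norm_transpose)
  then show ?thesis by (simp add: norm_mult_transpose_rotation[OF assms] norm_transpose)
qed

lemma norm_conjugate:
  assumes "rotation_matrix B" shows "norm (B ** A ** transpose B) = norm (A :: real^'d^'d)"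
  by (simp add: norm_mult_transpose_rotation[OF assms] norm_mult_rotation[OF assms])

lemma closed_rotations: "closed {Q :: real^'d^'d. rotation_matrix Q}"
  unfolding closed_sequential_limits
proof (intro allI impI, elim conjE)
  fix X :: "nat \<Rightarrow> real^'d^'d" and L
  assume X: "\<forall>n. X n \<in> {Q. rotation_matrix Q}" and lim: "X \<longlonglongrightarrow> L"
  have X': "transpose (X n) ** X n = mat 1" "det (X n) = 1" for n
    using X by (auto simp: rotation_matrix_def orthogonal_matrix_def)
  have "(\<lambda>n. transpose (X n) ** X n) \<longlonglongrightarrow> transpose L ** L" by (intro tendsto_matrix_mult tendsto_transpose lim)
  then have 1: "transpose L ** L = mat 1" by (simp add: X' LIMSEQ_const_iff)
  have "(\<lambda>n. det (X n)) \<longlonglongrightarrow> det L" by (rule tendsto_det[OF lim])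
  then have "det L = 1" by (simp add: X' LIMSEQ_const_iff)
  then show "L \<in> {Q. rotation_matrix Q}" using 1 by (simp add: rotation_matrix_def orthogonal_matrix)
qed

lemma rotation_matrix_mult: "rotation_matrix A \<Longrightarrow> rotation_matrix B \<Longrightarrow> rotation_matrix (A ** (B :: real^'d^'d))"
  by (simp add: rotation_matrix_def orthogonal_matrix_mul det_mul)

lemma inv_SO:
  assumes "rotation_matrix (Q :: real^'d^'d)" shows "inv\<^bsub>SO\<^esub> Q = transpose Q"
  unfolding m_inv_def
proof (rule the_equality)
  show "transpose Q \<in> carrier SO \<and> Q \<otimes>\<^bsub>SO\<^esub> transpose Q = \<one>\<^bsub>SO\<^esub> \<and> transpose Q \<otimes>\<^bsub>SO\<^esub> Q = \<one>\<^bsub>SO\<^esub>"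
    using rotation_transpose_mult[OF assms] by (simp add: SO_def)
  fix y assume "y \<in> carrier SO \<and> Q \<otimes>\<^bsub>SO\<^esub> y = \<one>\<^bsub>SO\<^esub> \<and> y \<otimes>\<^bsub>SO\<^esub> Q = \<one>\<^bsub>SO\<^esub>"
  then have "Q ** y = mat 1" by (simp add: SO_def)
  then show "y = transpose Q"
    using rotation_transpose_mult(1)[OF assms] by (metis matrix_mul_assoc matrix_mul_lid matrix_mul_rid)
qed

lemma generate_SO_closed:
  fixes S :: "(real^'d^'d) set"
  assumes S: "\<And>Q. Q \<in> S \<Longrightarrow> rotation_matrix Q" and x: "x \<in> generate SO S"
  shows "rotation_matrix x \<and> transpose x \<in> generate SO S"
  using x
proof (induction rule: generate.induct)
  case one
  have "rotation_matrix (mat 1 :: real^'d^'d)" by (simp add: rotation_matrix_def orthogonal_matrix_id)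
  moreover have "(mat 1 :: real^'d^'d) \<in> generate SO S" using generate.one[of SO S] by (simp add: SO_def)
  ultimately show ?case by (simp add: SO_def transpose_mat)
next
  case (incl h)
  then show ?case using S generate.inv[of h S SO] inv_SO by metis
next
  case (inv h)
  then show ?case using S generate.incl[of h S SO] inv_SO rotation_transpose_mult(4) transpose_transpose by metis
next
  case (eng h1 h2)
  have "transpose h2 \<otimes>\<^bsub>SO\<^esub> transpose h1 \<in> generate SO S" using eng by (intro generate.eng) auto
  then show ?case using eng by (simp add: SO_def rotation_matrix_mult matrix_transpose_mul)
qed

locale rotation_group =
  fixes G :: "(real^'d^'d) set"
  assumes rotation: "Q \<in> G \<Longrightarrow> rotation_matrix Q" and closed_G: "closed G"
    and one_G: "mat 1 \<in> G" and mult_G: "Q \<in> G \<Longrightarrow> R \<in> G \<Longrightarrow> Q ** R \<in> G"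
    and transpose_G: "Q \<in> G \<Longrightarrow> transpose Q \<in> G"

lemma rotation_group_closed_group:
  assumes S: "\<And>Q. Q \<in> S \<Longrightarrow> rotation_matrix (Q :: real^'d^'d)"
  shows "rotation_group (closed_group S)" "S \<subseteq> closed_group S"
proof -
  have sub: "generate SO S \<subseteq> {Q. rotation_matrix Q}" using generate_SO_closed[OF S] by auto
  show "S \<subseteq> closed_group S" unfolding closed_group_def using generate.incl[of _ S SO] closure_subset by blast
  show "rotation_group (closed_group S)"
  proof
    fix Q R :: "real^'d^'d"
    show "closed (closed_group S)" by (simp add: closed_group_def)
    show "mat 1 \<in> closed_group S" unfolding closed_group_def
      using generate.one[of SO S] closure_subset by (auto simp: SO_def)
    assume Q: "Q \<in> closed_group S"
    then show "rotation_matrix Q" unfolding closed_group_def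
      using closure_minimal[OF sub closed_rotations] by auto
    obtain X where X: "\<And>n. X n \<in> generate SO S" "X \<longlonglongrightarrow> Q"
      using Q unfolding closed_group_def closure_sequential by blast
    show "transpose Q \<in> closed_group S" unfolding closed_group_def closure_sequential
      using X generate_SO_closed[OF S] tendsto_transpose[OF X(2)] by (intro exI[of _ "\<lambda>n. transpose (X n)"]) auto
    assume "R \<in> closed_group S"
    then obtain Y where Y: "\<And>n. Y n \<in> generate SO S" "Y \<longlonglongrightarrow> R"
      unfolding closed_group_def closure_sequential by blast
    have "X n ** Y n \<in> generate SO S" for n using generate.eng[OF X(1) Y(1), of n n] by (simp add: SO_def)
    then show "Q ** R \<in> closed_group S" unfolding closed_group_def closure_sequential
      using tendsto_matrix_mult[OF X(2) Y(2)] by (intro exI[of _ "\<lambda>n. X n ** Y n"]) auto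
  qed
qed

definition proj_matrix :: "(real^'d) set \<Rightarrow> real^'d^'d" where "proj_matrix W = matrix (orth_proj W)"

lemma proj_matrix_vector: "subspace W \<Longrightarrow> proj_matrix W *v x = orth_proj W x"
  unfolding proj_matrix_def by (rule matrix_works) (simp add: linear_matrix_vector_mul_eq linear_orth_proj)

lemma proj_matrix_inj:
  assumes "subspace W" "subspace W'" "proj_matrix W = proj_matrix W'" shows "W = W'"
proof -
  have "X = {x. proj_matrix X *v x = x}" if "subspace X" for X :: "(real^'d) set"
    using that orth_proj_id[OF that] orth_proj_mem[OF that] by (auto simp: proj_matrix_vector) metis
  then show ?thesis using assms by metis
qed

lemma subspace_rotate_set: "subspace W \<Longrightarrow> subspace (rotate_set Q W)"
  unfolding rotate_set_def by (rule linear_subspace_image[OF matrix_vector_mul_linear])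

lemma rotate_set_mult: "rotate_set Q (rotate_set R W) = rotate_set (Q ** R) W"
  by (simp add: rotate_set_def image_image matrix_vector_mul_assoc)

lemma rotate_set_one [simp]: "rotate_set (mat 1) W = W"
  by (simp add: rotate_set_def)

lemma dim_rotate_set:
  assumes "rotation_matrix Q" shows "dim (rotate_set Q W) = dim W"
proof -
  have "inj ((*v) Q)" using rotation_transpose_mult(1)[OF assms]
    by (metis injI matrix_vector_mul_assoc matrix_vector_mul_lid)
  then show ?thesis unfolding rotate_set_def by (intro dim_image_eq matrix_vector_mul_linear) (auto intro: inj_on_subset)
qed

lemma proj_matrix_rotate_set:
  assumes Q: "rotation_matrix Q" and W: "subspace W"
  shows "proj_matrix (rotate_set Q W) = Q ** proj_matrix W ** transpose Q"
proof -
  note QW = subspace_rotate_set[OF W, of Q]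
  have "orth_proj (rotate_set Q W) x = Q *v orth_proj W (transpose Q *v x)" for x
  proof (rule orth_proj_unique[OF QW])
    show "Q *v orth_proj W (transpose Q *v x) \<in> rotate_set Q W"
      using orth_proj_mem[OF W] by (auto simp: rotate_set_def)
    fix z assume "z \<in> rotate_set Q W"
    then obtain y where y: "y \<in> W" "z = Q *v y" by (auto simp: rotate_set_def)
    have "(x - Q *v orth_proj W (transpose Q *v x)) \<bullet> z
       = (transpose Q *v x - transpose Q *v (Q *v orth_proj W (transpose Q *v x))) \<bullet> y"
      unfolding y(2) by (metis inner_commute inner_matrix_left matrix_vector_mult_diff_distrib)
    also have "\<dots> = (transpose Q *v x - orth_proj W (transpose Q *v x)) \<bullet> y"
      using rotation_transpose_mult(1)[OF Q] by (metis matrix_vector_mul_assoc matrix_vector_mul_lid)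
    finally show "orthogonal (x - Q *v orth_proj W (transpose Q *v x)) z"
      using orthogonal_orth_proj[OF W y(1)] by (simp add: orthogonal_def)
  qed
  then have "proj_matrix (rotate_set Q W) *v x = (Q ** proj_matrix W ** transpose Q) *v x" for x
    unfolding proj_matrix_vector[OF QW] matrix_vector_mul_assoc[symmetric] proj_matrix_vector[OF W] by blast
  then show ?thesis by (simp add: matrix_eq)
qed

text \<open>The action of a rotation on pairs of a vector and a matrix. Conjugation acts on orthogonal projections as the rotation acts on subspaces; the vector component is there to make the operator norm of \<open>conj_act Q - 1\<close> control the norm of \<open>Q - 1\<close>.\<close>

definition conj_act :: "real^'d^'d \<Rightarrow> ((real^'d) \<times> (real^'d^'d)) endo" where
  "conj_act Q = (SOME a. app a = (\<lambda>(x, A). (Q *v x, Q ** A ** transpose Q)))"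

lemma app_conj_act: "app (conj_act Q) (x, A) = (Q *v x, Q ** A ** transpose Q)"
proof -
  have "linear (\<lambda>(x, A). (Q *v x, Q ** A ** transpose Q))"
    by (auto simp: linear_iff matrix_vector_right_distrib matrix_vector_mult_scaleR matrix_mult_linear)
  then have "\<exists>a. app a = (\<lambda>(x, A). (Q *v x, Q ** A ** transpose Q))" by (metis endo_of_linear)
  from someI_ex[OF this] show ?thesis by (simp add: conj_act_def)
qed

section \<open>Orbits in the Grassmannian\<close>

context rotation_group
begin

lemma conj_act_mult: "conj_act (Q ** R) = conj_act Q * conj_act (R :: real^'d^'d)"
proof (rule endo_eqI)
  fix z :: "(real^'d) \<times> (real^'d^'d)"
  show "app (conj_act (Q ** R)) z = app (conj_act Q * conj_act R) z"
    by (cases z) (simp add: app_mult app_conj_act matrix_vector_mul_assoc matrix_mul_assoc matrix_transpose_mul)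
qed

lemma conj_act_one: "conj_act (mat 1 :: real^'d^'d) = 1"
proof (rule endo_eqI)
  fix z :: "(real^'d) \<times> (real^'d^'d)"
  show "app (conj_act (mat 1)) z = app 1 z"
    by (cases z) (simp add: app_conj_act transpose_mat)
qed

lemma norm_conj_act_diff:
  assumes Q: "rotation_matrix (Q :: real^'d^'d)" and R: "rotation_matrix R"
  shows "norm (conj_act Q - conj_act R) \<le> 3 * norm (Q - R)"
proof (rule endo_norm_bound)
  fix z :: "(real^'d) \<times> (real^'d^'d)"
  obtain x A where z: "z = (x, A)" by (cases z)
  have x: "norm x \<le> norm z" and A: "norm A \<le> norm z"
    unfolding z by (auto simp: norm_fst_le norm_snd_le intro: norm_fst_le[of "(x, A)", simplified] norm_snd_le[of "(x, A)", simplified])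
  have "Q ** A ** transpose Q - R ** A ** transpose R = (Q - R) ** A ** transpose Q + R ** A ** transpose (Q - R)"
    by (simp add: matrix_mult_linear transpose_def vec_eq_iff) (simp add: matrix_matrix_mult_def algebra_simps sum_subtractf)
  moreover have "norm ((Q - R) ** A ** transpose Q) \<le> norm (Q - R) * norm A"
  proof -
    have "norm ((Q - R) ** A ** transpose Q) = norm ((Q - R) ** A)" by (rule norm_mult_transpose_rotation[OF Q])
    also have "\<dots> = norm (transpose A ** transpose (Q - R))" by (metis matrix_transpose_mul norm_transpose)
    also have "\<dots> \<le> norm (Q - R) * norm A" using norm_mult_transpose_le[of "transpose A" "Q - R"] by (simp add: norm_transpose)
    finally show ?thesis .
  qed
  moreover have "norm (R ** A ** transpose (Q - R)) \<le> norm (Q - R) * norm A"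
    using norm_mult_transpose_le[of "R ** A" "Q - R"] by (simp add: norm_mult_rotation[OF R])
  ultimately have 2: "norm (Q ** A ** transpose Q - R ** A ** transpose R) \<le> 2 * norm (Q - R) * norm A"
    using norm_triangle_ineq[of "(Q - R) ** A ** transpose Q" "R ** A ** transpose (Q - R)"] by simp
  have 1: "norm (Q *v x - R *v x) \<le> norm (Q - R) * norm x"
    using norm_matrix_vector_le[of "Q - R" x] by (simp add: matrix_vector_mult_diff_rdistrib)
  have "norm (app (conj_act Q - conj_act R) z) = norm (Q *v x - R *v x, Q ** A ** transpose Q - R ** A ** transpose R)"
    by (simp add: z app.diff_left app_conj_act)
  also have "\<dots> \<le> norm (Q *v x - R *v x) + norm (Q ** A ** transpose Q - R ** A ** transpose R)"
    by (rule norm_Pair_le)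
  also have "\<dots> \<le> norm (Q - R) * norm z + 2 * norm (Q - R) * norm z"
    using 1 2 mult_left_mono[OF x, of "norm (Q - R)"] mult_left_mono[OF A, of "2 * norm (Q - R)"] by (intro add_mono) auto
  finally show "norm (app (conj_act Q - conj_act R) z) \<le> 3 * norm (Q - R) * norm z" by (simp add: algebra_simps)
qed simp

lemma compact_G: "compact G"
proof -
  have "norm Q \<le> norm (mat 1 :: real^'d^'d)" if "Q \<in> G" for Q
    using norm_mult_rotation[OF rotation[OF that], of "mat 1"] by simp
  then have "bounded G" by (auto simp: bounded_iff)
  then show ?thesis using closed_G by (simp add: compact_eq_bounded_closed)
qed

sublocale K: compact_isometry_group "conj_act ` G"
proof
  show "compact (conj_act ` G)"
  proof (rule compact_continuous_image[OF _ compact_G])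
    show "continuous_on G (conj_act :: real^'d^'d \<Rightarrow> _)"
    proof (rule continuous_onI)
      fix Q and e :: real assume "e > 0" "Q \<in> G"
      then show "\<exists>d>0. \<forall>Q'\<in>G. dist Q' Q < d \<longrightarrow> dist (conj_act Q') (conj_act Q) \<le> e"
        using norm_conj_act_diff[OF rotation rotation]
        by (intro exI[of _ "e / 3"]) (force simp: dist_norm)
    qed
  qed
  show "1 \<in> conj_act ` G" using one_G conj_act_one by (metis image_eqI)
  show "a * b \<in> conj_act ` G" if "a \<in> conj_act ` G" "b \<in> conj_act ` G" for a b
    using that mult_G by (auto simp: conj_act_mult[symmetric])
  show "\<exists>b\<in>conj_act ` G. b * a = 1 \<and> a * b = 1" if a: "a \<in> conj_act ` G" for a
  proof -
    obtain Q where Q: "Q \<in> G" "a = conj_act Q" using a by blast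
    then show ?thesis using transpose_G[OF Q(1)] rotation_transpose_mult(1,2)[OF rotation[OF Q(1)]]
      by (intro bexI[of _ "conj_act (transpose Q)"]) (auto simp: conj_act_mult[symmetric] conj_act_one)
  qed
  show "norm (app a z) = norm z" if a: "a \<in> conj_act ` G" for a z
  proof -
    obtain Q where Q: "Q \<in> G" "a = conj_act Q" using a by blast
    obtain x A where z: "z = (x, A)" by (cases z)
    show ?thesis unfolding z Q(2) app_conj_act
      by (simp add: norm_Pair rotation_norm[OF rotation[OF Q(1)]] norm_conjugate[OF rotation[OF Q(1)]])
  qed
qed

end

text \<open>The orbit of \<open>V\<close> in the Grassmannian corresponds to the orbit of \<open>base\<close> under the compact group of isometries \<open>conj_act ` G\<close>.\<close>

locale rotation_orbit = rotation_group G for G :: "(real^'d^'d) set" +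
  fixes V :: "(real^'d) set"
  assumes subspace_V: "subspace V"
begin

abbreviation "Orb \<equiv> orbit_of G V"

abbreviation "base \<equiv> (0 :: real^'d, proj_matrix V)"

lemma orbitD: assumes "W \<in> Orb" shows "subspace W" "dim W = dim V"
  using assms subspace_V by (auto simp: orbit_of_def subspace_rotate_set dim_rotate_set rotation)

lemma rotate_orbit: "W \<in> Orb \<Longrightarrow> Q \<in> G \<Longrightarrow> rotate_set Q W \<in> Orb"
  by (auto simp: orbit_of_def rotate_set_mult intro: mult_G)

lemma rotate_pow_orbit: "W \<in> Orb \<Longrightarrow> Q \<in> G \<Longrightarrow> (rotate_set Q ^^ j) W \<in> Orb"
  by (induction j) (auto intro: rotate_orbit)

lemma V_orbit: "V \<in> Orb" unfolding orbit_of_def using one_G by (intro image_eqI[of _ _ "mat 1"]) auto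

lemma rotate_inverse: "Q \<in> G \<Longrightarrow> rotate_set (transpose Q) (rotate_set Q W) = W" "Q \<in> G \<Longrightarrow> rotate_set Q (rotate_set (transpose Q) W) = W"
  using rotation_transpose_mult(1,2)[OF rotation] by (simp_all add: rotate_set_mult)

lemma proj_dist_rotate:
  assumes "Q \<in> G" "subspace W" "subspace W'"
  shows "norm (proj_matrix (rotate_set Q W') - proj_matrix (rotate_set Q W)) = norm (proj_matrix W' - proj_matrix W)"
proof -
  have "proj_matrix (rotate_set Q W') - proj_matrix (rotate_set Q W) = Q ** (proj_matrix W' - proj_matrix W) ** transpose Q"
    using assms by (simp add: proj_matrix_rotate_set rotation matrix_mult_linear)
  then show ?thesis by (simp add: norm_conjugate[OF rotation[OF assms(1)]])
qed

lemma orbit_eq: "K.orbit base = (\<lambda>W. (0, proj_matrix W)) ` Orb"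
  unfolding K.orbit_def orbit_of_def image_image
  by (intro image_cong refl) (simp add: app_conj_act proj_matrix_rotate_set rotation subspace_V)

lemma topspace_orbit_topology: "topspace (orbit_topology G V) = Orb"
  using orbitD by (auto simp: orbit_topology_def grassmannian_def topspace_pullback_topology)

lemma openin_orbit_topology:
  "openin (orbit_topology G V) X \<longleftrightarrow> (\<exists>U. open U \<and> X = {W \<in> Orb. proj_matrix W \<in> U})"
proof
  show "openin (orbit_topology G V) X \<Longrightarrow> \<exists>U. open U \<and> X = {W \<in> Orb. proj_matrix W \<in> U}"
  proof -
    assume "openin (orbit_topology G V) X"
    then obtain U where U: "open U" "X = ((\<lambda>W. matrix (orth_proj W)) -` U \<inter> {W. subspace W \<and> dim W = dim V}) \<inter> Orb"
      unfolding orbit_topology_def grassmannian_def openin_subtopology openin_pullback_topology by auto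
    have "X = {W \<in> Orb. proj_matrix W \<in> U}" unfolding U(2) proj_matrix_def using orbitD by auto
    then show ?thesis using U(1) by blast
  qed
next
  assume "\<exists>U. open U \<and> X = {W \<in> Orb. proj_matrix W \<in> U}"
  then obtain U where U: "open U" "X = {W \<in> Orb. proj_matrix W \<in> U}" by blast
  show "openin (orbit_topology G V) X"
    unfolding orbit_topology_def grassmannian_def openin_subtopology openin_pullback_topology
    using U orbitD
    by (intro exI[of _ "(\<lambda>W. matrix (orth_proj W)) -` U \<inter> {W. subspace W \<and> dim W = dim V}"] conjI exI[of _ U])
       (auto simp: proj_matrix_def)
qed

lemma orbit_topology_homeomorphic: "top_of_set (K.orbit base) homeomorphic_space orbit_topology G V"
proof -
  let ?\<phi> = "\<lambda>W. (0 :: real^'d, proj_matrix W)"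
  have "homeomorphic_map (orbit_topology G V) (top_of_set (K.orbit base)) ?\<phi>"
  proof (rule bijective_open_imp_homeomorphic_map)
    show "continuous_map (orbit_topology G V) (top_of_set (K.orbit base)) ?\<phi>"
      unfolding continuous_map topspace_orbit_topology
    proof (intro conjI allI impI)
      show "?\<phi> ` Orb \<subseteq> topspace (top_of_set (K.orbit base))" by (simp add: orbit_eq)
      fix U assume "openin (top_of_set (K.orbit base)) U"
      then obtain T where T: "open T" "U = K.orbit base \<inter> T" by (auto simp: openin_open)
      have "open ((\<lambda>A. (0 :: real^'d, A)) -` T)" by (intro open_vimage T continuous_intros)
      moreover have "{W \<in> Orb. ?\<phi> W \<in> U} = {W \<in> Orb. proj_matrix W \<in> (\<lambda>A. (0 :: real^'d, A)) -` T}"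
        unfolding T(2) orbit_eq by auto
      ultimately show "openin (orbit_topology G V) {W \<in> Orb. ?\<phi> W \<in> U}" unfolding openin_orbit_topology by blast
    qed
    show "open_map (orbit_topology G V) (top_of_set (K.orbit base)) ?\<phi>"
      unfolding open_map_def
    proof (intro allI impI)
      fix X assume "openin (orbit_topology G V) X"
      then obtain U where U: "open U" "X = {W \<in> Orb. proj_matrix W \<in> U}" unfolding openin_orbit_topology by blast
      have "?\<phi> ` X = K.orbit base \<inter> (UNIV \<times> U)" unfolding orbit_eq U(2) by auto
      then show "openin (top_of_set (K.orbit base)) (?\<phi> ` X)"
        using open_Times[OF open_UNIV U(1)] by (auto simp: openin_open)
    qed
    show "?\<phi> ` topspace (orbit_topology G V) = topspace (top_of_set (K.orbit base))"
      by (simp add: topspace_orbit_topology orbit_eq)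
    show "inj_on ?\<phi> (topspace (orbit_topology G V))"
      unfolding topspace_orbit_topology by (intro inj_onI) (metis orbitD(1) proj_matrix_inj prod.inject)
  qed
  then show ?thesis using homeomorphic_map_imp_homeomorphic_space homeomorphic_space_sym by blast
qed

lemma manifold_dim_orbit: "manifold_dim (orbit_topology G V) = dim (K.tangent base)"
proof (rule manifold_dim_eq)
  show "locally_euclidean (dim (K.tangent base)) (orbit_topology G V)"
    by (rule locally_euclidean_homeomorphic[OF orbit_topology_homeomorphic K.locally_euclidean_orbit])
  show "topspace (orbit_topology G V) \<noteq> {}" using V_orbit topspace_orbit_topology by auto
qed

abbreviation "Dim \<equiv> manifold_dim (orbit_topology G V)"

text \<open>The Lipschitz lifting property at \<open>V\<close>, moved to an arbitrary pair of points by conjugation in \<open>G\<close>.\<close>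

lemma orbit_small_rotation:
  "\<exists>C\<ge>1. \<forall>W\<in>Orb. \<forall>W'\<in>Orb. \<exists>Q\<in>G. W' = rotate_set Q W \<and>
      (\<forall>x. norm (Q *v x - x) \<le> C * norm (proj_matrix W' - proj_matrix W) * norm x)"
proof -
  obtain C where C: "C > 0" "\<And>A. A \<in> K.orbit base \<Longrightarrow> \<exists>a\<in>conj_act ` G. app a base = A \<and> norm (a - 1) \<le> C * norm (A - base)"
    using K.orbit_lipschitz_lift[of base] by metis
  have "\<exists>Q\<in>G. W' = rotate_set Q W \<and> (\<forall>x. norm (Q *v x - x) \<le> max 1 C * norm (proj_matrix W' - proj_matrix W) * norm x)"
    if W: "W \<in> Orb" and W': "W' \<in> Orb" for W W'
  proof -
    obtain Q0 where Q0: "Q0 \<in> G" "W = rotate_set Q0 V" using W by (auto simp: orbit_of_def)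
    note Q0t = transpose_G[OF Q0(1)]
    let ?U = "rotate_set (transpose Q0) W'"
    have U: "?U \<in> Orb" by (rule rotate_orbit[OF W' Q0t])
    then have "(0, proj_matrix ?U) \<in> K.orbit base" unfolding orbit_eq by blast
    then obtain R where R: "R \<in> G" "app (conj_act R) base = (0, proj_matrix ?U)"
      "norm (conj_act R - 1) \<le> C * norm ((0, proj_matrix ?U) - base)" using C(2) by blast
    have "proj_matrix (rotate_set R V) = proj_matrix ?U"
      using R(2) by (simp add: app_conj_act proj_matrix_rotate_set[OF rotation[OF R(1)] subspace_V])
    then have RV: "rotate_set R V = ?U"
      using proj_matrix_inj subspace_rotate_set[OF subspace_V] orbitD(1)[OF U] by blast
    have dist: "norm ((0, proj_matrix ?U) - base) = norm (proj_matrix W' - proj_matrix W)"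
    proof -
      have "norm ((0, proj_matrix ?U) - base) = norm (proj_matrix ?U - proj_matrix V)"
        by (simp add: norm_Pair)
      also have "\<dots> = norm (proj_matrix W' - proj_matrix W)"
      proof -
        have "rotate_set (transpose Q0) W = V" unfolding Q0(2) by (rule rotate_inverse(1)[OF Q0(1)])
        then show ?thesis using proj_dist_rotate[OF Q0t orbitD(1)[OF W] orbitD(1)[OF W']] by simp
      qed
      finally show ?thesis .
    qed
    define Q where "Q = Q0 ** R ** transpose Q0"
    have QG: "Q \<in> G" unfolding Q_def by (intro mult_G Q0(1) R(1) Q0t)
    have "rotate_set Q W = rotate_set Q0 (rotate_set R (rotate_set (transpose Q0) W))"
      unfolding Q_def by (simp add: rotate_set_mult matrix_mul_assoc)
    also have "\<dots> = W'" unfolding Q0(2) rotate_inverse(1)[OF Q0(1)] RV by (rule rotate_inverse(2)[OF Q0(1)])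
    finally have QW: "W' = rotate_set Q W" by simp
    have "norm (Q *v x - x) \<le> max 1 C * norm (proj_matrix W' - proj_matrix W) * norm x" for x
    proof -
      let ?y = "transpose Q0 *v x"
      have ny: "norm ?y = norm x" by (rule rotation_norm[OF rotation[OF Q0t]])
      have "x = Q0 *v ?y" using rotation_transpose_mult(2)[OF rotation[OF Q0(1)]] by (metis matrix_vector_mul_assoc matrix_vector_mul_lid)
      then have "Q *v x - x = Q0 *v (R *v ?y - ?y)"
        unfolding Q_def by (metis matrix_vector_mul_assoc matrix_vector_mult_diff_distrib)
      then have "norm (Q *v x - x) = norm (R *v ?y - ?y)" by (simp add: rotation_norm[OF rotation[OF Q0(1)]])
      also have "\<dots> = norm (app (conj_act R - 1) (?y, 0))" by (simp add: app.diff_left app_conj_act norm_Pair matrix_mult_linear(6)[of _ 0, simplified])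
      also have "\<dots> \<le> norm (conj_act R - 1) * norm (?y, 0 :: real^'d^'d)" by (rule norm_app_le)
      also have "\<dots> \<le> (C * norm (proj_matrix W' - proj_matrix W)) * norm x"
        using R(3) C(1) ny unfolding dist by (intro mult_mono) (simp_all add: norm_Pair)
      also have "\<dots> \<le> max 1 C * norm (proj_matrix W' - proj_matrix W) * norm x"
        by (intro mult_right_mono) auto
      finally show ?thesis .
    qed
    then show ?thesis using QG QW by blast
  qed
  then show ?thesis by (intro exI[of _ "max 1 C"]) auto
qed

lemma orbit_covering:
  "\<exists>C>0. \<forall>\<eta>. 0 < \<eta> \<and> \<eta> \<le> 1 \<longrightarrow> (\<exists>F. finite F \<and> F \<subseteq> Orb \<and> real (card F) \<le> C * (1 / \<eta>) ^ Dim \<and>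
      (\<forall>W\<in>Orb. \<exists>W'\<in>F. norm (proj_matrix W - proj_matrix W') < \<eta>))"
proof -
  obtain C where C: "C > 0" "\<forall>\<eta>. 0 < \<eta> \<and> \<eta> \<le> 1 \<longrightarrow>
     (\<exists>F. finite F \<and> F \<subseteq> K.orbit base \<and> real (card F) \<le> C * (1 / \<eta>) ^ Dim \<and> K.orbit base \<subseteq> (\<Union>A\<in>F. ball A \<eta>))"
    using K.orbit_covering_number[of base, folded manifold_dim_orbit] by (elim exE conjE) (rule that)
  let ?\<phi> = "\<lambda>W. (0 :: real^'d, proj_matrix W)"
  have "\<exists>F. finite F \<and> F \<subseteq> Orb \<and> real (card F) \<le> C * (1 / \<eta>) ^ Dim \<and>
      (\<forall>W\<in>Orb. \<exists>W'\<in>F. norm (proj_matrix W - proj_matrix W') < \<eta>)" if \<eta>: "0 < \<eta>" "\<eta> \<le> 1" for \<eta>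
  proof -
    obtain F where F: "finite F" "F \<subseteq> K.orbit base" "real (card F) \<le> C * (1 / \<eta>) ^ Dim" "K.orbit base \<subseteq> (\<Union>A\<in>F. ball A \<eta>)"
      using C(2)[rule_format, OF conjI[OF \<eta>]] by (elim exE conjE) (rule that)
    obtain F' where F'1: "F' \<subseteq> Orb" "inj_on ?\<phi> F'" "F = ?\<phi> ` F'"
      using F(2) unfolding orbit_eq subset_image_inj by (elim exE conjE) (rule that)
    have F': "F' \<subseteq> Orb" "finite F'" "card F' \<le> card F" "F = ?\<phi> ` F'"
      using F'1 F(1) finite_imageD[of ?\<phi> F'] card_image[OF F'1(2)] by auto
    have "\<exists>W'\<in>F'. norm (proj_matrix W - proj_matrix W') < \<eta>" if "W \<in> Orb" for W
    proof -
      have "?\<phi> W \<in> K.orbit base" unfolding orbit_eq using that by blast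
      then obtain W' where "W' \<in> F'" "dist (?\<phi> W') (?\<phi> W) < \<eta>" using F(4) F'(4) by auto
      then show ?thesis by (auto simp: dist_Pair_Pair dist_norm norm_minus_commute)
    qed
    then show ?thesis using F' F(3) by (intro exI[of _ F']) (auto intro: order_trans[rotated])
  qed
  then show ?thesis using C(1) by blast
qed

end

section \<open>A supremum bound for band-limited functions on an orbit\<close>

locale orbit_measure = rotation_orbit G V + prob_space m
  for G :: "(real^'d^'d) set" and V :: "(real^'d) set" and m :: "(real^'d) set measure" +
  assumes inv: "invariant_prob G V m"
begin

lemma sets_m: "sets m = sigma_sets Orb {U. openin (orbit_topology G V) U}"
proof -
  have "{U. openin (orbit_topology G V) U} \<subseteq> Pow Orb"
    using openin_subset topspace_orbit_topology by blast
  then show ?thesis using inv by (simp add: invariant_prob_def)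
qed

lemma space_m: "space m = Orb"
proof -
  have "space m = space (sigma Orb {U. openin (orbit_topology G V) U})"
    using inv by (intro sets_eq_imp_space_eq) (simp add: invariant_prob_def)
  moreover have "{U. openin (orbit_topology G V) U} \<subseteq> Pow Orb"
    using openin_subset topspace_orbit_topology by blast
  ultimately show ?thesis by simp
qed

lemma open_in_sets: "openin (orbit_topology G V) U \<Longrightarrow> U \<in> sets m"
  unfolding sets_m by (rule sigma_sets.Basic) simp

lemma measurable_rotate:
  assumes Q: "Q \<in> G" shows "rotate_set Q \<in> m \<rightarrow>\<^sub>M m"
proof (rule measurable_sigma_sets[OF sets_m])
  show "{U. openin (orbit_topology G V) U} \<subseteq> Pow Orb"
    using openin_subset topspace_orbit_topology by blast
  show "rotate_set Q \<in> space m \<rightarrow> Orb" using rotate_orbit Q by (auto simp: space_m)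
  fix X assume "X \<in> {U. openin (orbit_topology G V) U}"
  then obtain U where U: "open U" "X = {W \<in> Orb. proj_matrix W \<in> U}" unfolding openin_orbit_topology by blast
  let ?c = "\<lambda>A. Q ** A ** transpose Q"
  have "isCont ?c A" for A unfolding isCont_def by (intro tendsto_matrix_mult tendsto_const tendsto_ident_at)
  then have "open (?c -` U)" using U(1) by (intro open_vimage) (auto simp: continuous_on_eq_continuous_at)
  then have "openin (orbit_topology G V) {W \<in> Orb. proj_matrix W \<in> ?c -` U}"
    unfolding openin_orbit_topology by (intro exI[of _ "?c -` U"] conjI refl)
  then have "{W \<in> Orb. proj_matrix W \<in> ?c -` U} \<in> sets m" by (rule open_in_sets)
  moreover have "rotate_set Q -` X \<inter> space m = {W \<in> Orb. proj_matrix W \<in> ?c -` U}"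
  proof -
    have "rotate_set Q W \<in> X \<longleftrightarrow> ?c (proj_matrix W) \<in> U" if "W \<in> Orb" for W
      using rotate_orbit[OF that Q] proj_matrix_rotate_set[OF rotation[OF Q] orbitD(1)[OF that]] unfolding U(2) by simp
    then show ?thesis unfolding space_m by blast
  qed
  ultimately show "rotate_set Q -` X \<inter> space m \<in> sets m" by simp
qed

lemma distr_rotate: "Q \<in> G \<Longrightarrow> distr m m (rotate_set Q) = m"
  using inv by (simp add: invariant_prob_def)

lemma integral_rotate:
  fixes f :: "(real^'d) set \<Rightarrow> 'b::{banach, second_countable_topology}"
  assumes "Q \<in> G" "f \<in> borel_measurable m"
  shows "(LINT W|m. f (rotate_set Q W)) = (LINT W|m. f W)"
  using integral_distr[OF measurable_rotate[OF assms(1)] assms(2)] distr_rotate[OF assms(1)] by simp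

definition orbit_ball :: "(real^'d) set \<Rightarrow> real \<Rightarrow> (real^'d) set set" where
  "orbit_ball W \<eta> = {W' \<in> Orb. norm (proj_matrix W' - proj_matrix W) < \<eta>}"

lemma orbit_ball_sets: "orbit_ball W \<eta> \<in> sets m"
proof (rule open_in_sets)
  have "orbit_ball W \<eta> = {W' \<in> Orb. proj_matrix W' \<in> ball (proj_matrix W) \<eta>}"
    by (auto simp: orbit_ball_def dist_norm norm_minus_commute)
  then show "openin (orbit_topology G V) (orbit_ball W \<eta>)" unfolding openin_orbit_topology by blast
qed

lemma orbit_ball_measure_eq:
  assumes "W \<in> Orb" "W' \<in> Orb" shows "prob (orbit_ball W \<eta>) = prob (orbit_ball W' \<eta>)"
proof -
  have *: "prob (orbit_ball (rotate_set Q V) \<eta>) = prob (orbit_ball V \<eta>)" if Q: "Q \<in> G" for Q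
  proof -
    have "orbit_ball V \<eta> = rotate_set Q -` orbit_ball (rotate_set Q V) \<eta> \<inter> space m"
      unfolding orbit_ball_def space_m using rotate_orbit[OF _ Q] orbitD(1) subspace_V
      by (auto simp: proj_dist_rotate[OF Q])
    then have "prob (orbit_ball V \<eta>) = measure (distr m m (rotate_set Q)) (orbit_ball (rotate_set Q V) \<eta>)"
      by (simp add: measure_distr[OF measurable_rotate[OF Q] orbit_ball_sets])
    then show ?thesis by (simp add: distr_rotate[OF Q])
  qed
  show ?thesis using assms * by (auto simp: orbit_of_def)
qed

text \<open>All balls of radius \<open>\<eta>\<close> have the same measure by invariance, and boundedly many times \<open>\<eta>\<close> to the power \<open>-Dim\<close> of them cover the orbit.\<close>

lemma orbit_ball_measure_ge:
  "\<exists>c>0. \<forall>W\<in>Orb. \<forall>\<eta>. 0 < \<eta> \<and> \<eta> \<le> 1 \<longrightarrow> c * \<eta> ^ Dim \<le> prob (orbit_ball W \<eta>)"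
proof -
  obtain C where C: "C > 0" "\<forall>\<eta>. 0 < \<eta> \<and> \<eta> \<le> 1 \<longrightarrow> (\<exists>F. finite F \<and> F \<subseteq> Orb \<and> real (card F) \<le> C * (1 / \<eta>) ^ Dim \<and>
      (\<forall>W\<in>Orb. \<exists>W'\<in>F. norm (proj_matrix W - proj_matrix W') < \<eta>))"
    using orbit_covering by (elim exE conjE) (rule that)
  show ?thesis
  proof (intro exI[of _ "1 / C"] conjI ballI allI impI)
    fix W and \<eta> :: real assume W: "W \<in> Orb" and \<eta>: "0 < \<eta> \<and> \<eta> \<le> 1"
    obtain F where F: "finite F" "F \<subseteq> Orb" "real (card F) \<le> C * (1 / \<eta>) ^ Dim"
      "\<forall>W\<in>Orb. \<exists>W'\<in>F. norm (proj_matrix W - proj_matrix W') < \<eta>"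
      using C(2)[rule_format, OF \<eta>] by (elim exE conjE) (rule that)
    have "space m \<subseteq> (\<Union>W'\<in>F. orbit_ball W' \<eta>)" unfolding space_m orbit_ball_def using F(4) by blast
    moreover have "(\<Union>W'\<in>F. orbit_ball W' \<eta>) \<in> events" using F(1) orbit_ball_sets by (intro sets.finite_UN)
    ultimately have "prob (space m) \<le> prob (\<Union>W'\<in>F. orbit_ball W' \<eta>)" by (rule finite_measure_mono)
    then have "1 \<le> prob (\<Union>W'\<in>F. orbit_ball W' \<eta>)" by (simp add: prob_space)
    also have "\<dots> \<le> (\<Sum>W'\<in>F. prob (orbit_ball W' \<eta>))"
      by (rule finite_measure_subadditive_finite[OF F(1)]) (auto simp: orbit_ball_sets)
    also have "\<dots> = (\<Sum>W'\<in>F. prob (orbit_ball W \<eta>))"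
      using F(2) W by (intro sum.cong orbit_ball_measure_eq) auto
    also have "\<dots> \<le> C * (1 / \<eta>) ^ Dim * prob (orbit_ball W \<eta>)" using F(3) by (simp add: mult_right_mono)
    finally have "\<eta> ^ Dim \<le> C * prob (orbit_ball W \<eta>)" using \<eta> by (simp add: power_divide field_simps)
    then show "1 / C * \<eta> ^ Dim \<le> prob (orbit_ball W \<eta>)" using C(1) by (simp add: field_simps)
  qed (use C in auto)
qed

text \<open>\<open>g\<close> behaves like a function of frequency at most \<open>Z\<close>: along every sequence \<open>W, QW, Q\<^sup>2W, \<dots>\<close> with step \<open>h \<le> 1/Z\<close> its \<open>J\<close>-th differences are \<open>O((Z h)\<^sup>J)\<close>, for all \<open>J\<close> with the same constants for all functions considered. The class is stable under rotations and convex combinations, hence under the averaging operators.\<close>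

definition orbit_smooth :: "real \<Rightarrow> ((real^'d) set \<Rightarrow> real) \<Rightarrow> bool" where
  "orbit_smooth Z g \<longleftrightarrow> (\<forall>J\<ge>1. \<forall>Q\<in>G. \<forall>h\<ge>0. \<forall>W\<in>Orb. \<forall>k. Z * h \<le> 1 \<longrightarrow>
     (\<forall>x. norm (Q *v x - x) \<le> h * norm x) \<longrightarrow>
     \<bar>fdiffs J (\<lambda>j. g ((rotate_set Q ^^ j) W)) k\<bar> \<le> cis_const J * (Z * h) ^ J)"

lemma orbit_smoothD:
  assumes "orbit_smooth Z g" "1 \<le> J" "Q \<in> G" "0 \<le> h" "W \<in> Orb" "Z * h \<le> 1" "\<And>x. norm (Q *v x - x) \<le> h * norm x"
  shows "\<bar>fdiffs J (\<lambda>j. g ((rotate_set Q ^^ j) W)) k\<bar> \<le> cis_const J * (Z * h) ^ J"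
  using assms unfolding orbit_smooth_def by blast

lemma orbit_smooth_diff_const:
  assumes "orbit_smooth Z g" shows "orbit_smooth Z (\<lambda>W. g W - c)"
  using assms unfolding orbit_smooth_def by (simp add: fdiffs_diff_const)

lemma orbit_smooth_rotate:
  assumes g: "orbit_smooth Z g" and R: "R \<in> G"
  shows "orbit_smooth Z (\<lambda>W. g (rotate_set R W))"
  unfolding orbit_smooth_def
proof (intro allI ballI impI)
  fix J :: nat and Q and h :: real and W k
  assume *: "1 \<le> J" "Q \<in> G" "0 \<le> h" "W \<in> Orb" "Z * h \<le> 1" "\<forall>x. norm (Q *v x - x) \<le> h * norm x"
  let ?Q = "R ** Q ** transpose R"
  have Rt: "transpose R \<in> G" by (rule transpose_G[OF R])
  have conj: "rotate_set R ((rotate_set Q ^^ j) W) = (rotate_set ?Q ^^ j) (rotate_set R W)" for j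
  proof (induction j)
    case (Suc j)
    have "rotate_set ?Q (rotate_set R X) = rotate_set R (rotate_set Q X)" for X
      using rotation_transpose_mult(1)[OF rotation[OF R]]
      by (simp add: rotate_set_mult) (metis matrix_mul_assoc matrix_mul_rid)
    then show ?case using Suc by (metis comp_apply funpow.simps(2))
  qed simp
  have "\<bar>fdiffs J (\<lambda>j. g ((rotate_set ?Q ^^ j) (rotate_set R W))) k\<bar> \<le> cis_const J * (Z * h) ^ J"
  proof (rule orbit_smoothD[OF g])
    show "?Q \<in> G" by (intro mult_G R Rt *)
    show "rotate_set R W \<in> Orb" by (rule rotate_orbit[OF *(4) R])
    fix x
    let ?y = "transpose R *v x"
    have "x = R *v ?y" using rotation_transpose_mult(2)[OF rotation[OF R]] by (metis matrix_vector_mul_assoc matrix_vector_mul_lid)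
    then have "?Q *v x - x = R *v (Q *v ?y - ?y)" by (metis matrix_vector_mul_assoc matrix_vector_mult_diff_distrib)
    then have "norm (?Q *v x - x) = norm (Q *v ?y - ?y)" by (simp add: rotation_norm[OF rotation[OF R]])
    also have "\<dots> \<le> h * norm ?y" using * by blast
    finally show "norm (?Q *v x - x) \<le> h * norm x" unfolding rotation_norm[OF rotation[OF Rt]] .
  qed (use * in auto)
  then show "\<bar>fdiffs J (\<lambda>j. g (rotate_set R ((rotate_set Q ^^ j) W))) k\<bar> \<le> cis_const J * (Z * h) ^ J"
    unfolding conj .
qed

lemma orbit_smooth_convex:
  assumes "finite I" "\<And>i. i \<in> I \<Longrightarrow> 0 \<le> p i" "(\<Sum>i\<in>I. p i) = 1" "\<And>i. i \<in> I \<Longrightarrow> orbit_smooth Z (g i)"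
  shows "orbit_smooth Z (\<lambda>W. \<Sum>i\<in>I. p i * g i W)"
  unfolding orbit_smooth_def
proof (intro allI ballI impI)
  fix J :: nat and Q and h :: real and W k
  assume *: "1 \<le> J" "Q \<in> G" "0 \<le> h" "W \<in> Orb" "Z * h \<le> 1" "\<forall>x. norm (Q *v x - x) \<le> h * norm x"
  have "\<bar>fdiffs J (\<lambda>j. \<Sum>i\<in>I. p i * g i ((rotate_set Q ^^ j) W)) k\<bar>
     = \<bar>\<Sum>i\<in>I. p i * fdiffs J (\<lambda>j. g i ((rotate_set Q ^^ j) W)) k\<bar>"
    by (simp add: fdiffs_sum fdiffs_mult_left)
  also have "\<dots> \<le> (\<Sum>i\<in>I. p i * (cis_const J * (Z * h) ^ J))"
    using assms * by (intro order_trans[OF sum_abs] sum_mono) (auto simp: abs_mult intro!: mult_left_mono orbit_smoothD)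
  also have "\<dots> = cis_const J * (Z * h) ^ J" using assms(3) by (simp add: sum_distrib_right[symmetric])
  finally show "\<bar>fdiffs J (\<lambda>j. \<Sum>i\<in>I. p i * g i ((rotate_set Q ^^ j) W)) k\<bar> \<le> cis_const J * (Z * h) ^ J" .
qed

text \<open>Already the differences of first order give continuity in the topology of the orbit.\<close>

lemma orbit_smooth_measurable:
  assumes g: "orbit_smooth Z g" and Z: "Z > 0"
  shows "g \<in> borel_measurable m"
proof (rule borel_measurableI)
  fix U :: "real set" assume U: "open U"
  obtain C where C1: "C \<ge> 1" and C2: "\<forall>W\<in>Orb. \<forall>W'\<in>Orb. \<exists>Q\<in>G. W' = rotate_set Q W \<and>
      (\<forall>x. norm (Q *v x - x) \<le> C * norm (proj_matrix W' - proj_matrix W) * norm x)"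
    using orbit_small_rotation by (elim exE conjE) (rule that)
  note C = C1 C2[THEN bspec, THEN bspec]
  have cont: "\<exists>\<delta>>0. \<forall>W'\<in>Orb. norm (proj_matrix W' - proj_matrix W) < \<delta> \<longrightarrow> g W' \<in> U" if W: "W \<in> Orb" "g W \<in> U" for W
  proof -
    obtain \<epsilon> where \<epsilon>: "\<epsilon> > 0" "ball (g W) \<epsilon> \<subseteq> U" using U W(2) open_contains_ball by blast
    define \<delta> where "\<delta> = min 1 (\<epsilon> / (cis_const 1)) / (Z * C)"
    have c1: "cis_const 1 > 0" using cis_const_ge_1[of 1] by linarith
    have "\<delta> > 0" using \<epsilon>(1) Z C(1) c1 by (simp add: \<delta>_def)
    moreover have "g W' \<in> U" if W': "W' \<in> Orb" "norm (proj_matrix W' - proj_matrix W) < \<delta>" for W'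
    proof -
      let ?h = "C * norm (proj_matrix W' - proj_matrix W)"
      obtain Q where Q: "Q \<in> G" "W' = rotate_set Q W" "\<forall>x. norm (Q *v x - x) \<le> ?h * norm x"
        using C(2)[OF W(1) W'(1)] by (elim bexE conjE) (rule that)
      have "Z * ?h < min 1 (\<epsilon> / cis_const 1)"
        using W'(2) Z C(1) unfolding \<delta>_def by (simp add: pos_less_divide_eq mult_ac)
      then have Zh: "Z * ?h \<le> 1" "cis_const 1 * (Z * ?h) < \<epsilon>" using c1 by (simp_all add: pos_less_divide_eq mult.commute)
      have "\<bar>fdiffs 1 (\<lambda>j. g ((rotate_set Q ^^ j) W)) 0\<bar> \<le> cis_const 1 * (Z * ?h) ^ 1"
        by (rule orbit_smoothD[OF g _ Q(1) _ W(1) Zh(1) Q(3)[rule_format]]) (use C(1) in auto)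
      then have "\<bar>g W' - g W\<bar> < \<epsilon>" using Zh(2) by (simp add: fdiff_def Q(2))
      then show ?thesis using \<epsilon>(2) by (auto simp: dist_real_def abs_minus_commute)
    qed
    ultimately show ?thesis by blast
  qed
  define S where "S = {W \<in> Orb. g W \<in> U}"
  have "\<forall>W\<in>S. \<exists>\<delta>>0. \<forall>W'\<in>Orb. norm (proj_matrix W' - proj_matrix W) < \<delta> \<longrightarrow> g W' \<in> U"
    using cont by (auto simp: S_def)
  then obtain \<delta> where \<delta>0: "\<forall>W\<in>S. \<delta> W > 0 \<and> (\<forall>W'\<in>Orb. norm (proj_matrix W' - proj_matrix W) < \<delta> W \<longrightarrow> g W' \<in> U)"
    unfolding bchoice_iff by (elim exE) (rule that)
  have \<delta>: "\<delta> W > 0" "W' \<in> Orb \<Longrightarrow> norm (proj_matrix W' - proj_matrix W) < \<delta> W \<Longrightarrow> g W' \<in> U" if "W \<in> S" for W W'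
    using \<delta>0 that by auto
  have "S = {W \<in> Orb. proj_matrix W \<in> (\<Union>W\<in>S. ball (proj_matrix W) (\<delta> W))}"
  proof (intro subset_antisym subsetI)
    fix W' assume "W' \<in> S"
    then show "W' \<in> {W \<in> Orb. proj_matrix W \<in> (\<Union>W\<in>S. ball (proj_matrix W) (\<delta> W))}"
      using \<delta>(1)[of W'] by (auto simp: S_def intro!: bexI[of _ W'])
  next
    fix W' assume "W' \<in> {W \<in> Orb. proj_matrix W \<in> (\<Union>W\<in>S. ball (proj_matrix W) (\<delta> W))}"
    then obtain W where "W' \<in> Orb" "W \<in> S" "dist (proj_matrix W) (proj_matrix W') < \<delta> W" by auto
    then show "W' \<in> S" using \<delta>(2)[of W W'] by (simp add: S_def dist_norm norm_minus_commute)
  qed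
  then have "openin (orbit_topology G V) S" unfolding openin_orbit_topology
    by (intro exI[of _ "\<Union>W\<in>S. ball (proj_matrix W) (\<delta> W)"]) auto
  moreover have "g -` U \<inter> space m = S" by (auto simp: S_def space_m)
  ultimately show "g -` U \<inter> space m \<in> sets m" using open_in_sets by simp
qed

text \<open>Let \<open>M\<close> be the supremum of \<open>\<bar>g\<bar>\<close> and suppose \<open>M > T\<^sup>-\<^sup>A\<close>. For a step \<open>h\<close> comparable to \<open>M\<^sup>1\<^sup>/\<^sup>J / T\<close> the \<open>J\<close>-th differences are at most \<open>\<kappa> M\<close>, so the first differences are at most \<open>M/2\<close> and \<open>\<bar>g\<bar> \<ge> M/4\<close> on a ball of radius comparable to \<open>h\<close> around a near-maximum. Its measure is at least a constant times \<open>h\<close> to the power \<open>Dim\<close>, which compares \<open>M\<close> with the \<open>L\<^sup>2\<close> norm. As \<open>M\<^sup>1\<^sup>/\<^sup>J \<ge> T\<^sup>-\<^sup>A\<^sup>/\<^sup>J\<close>, the loss against the exponent \<open>Dim/2\<close> is arbitrarily small for large \<open>J\<close>.\<close>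

lemma orbit_smooth_sup_bound:
  assumes \<sigma>: "\<sigma> > real Dim / 2" and A: "A \<ge> 0" and Z0: "Z0 \<ge> 1"
  shows "\<exists>C>0. \<forall>T\<ge>1. \<forall>g. orbit_smooth (Z0 * T) g \<longrightarrow> (\<forall>W\<in>Orb. \<bar>g W\<bar> \<le> 1) \<longrightarrow>
     (\<forall>W\<in>Orb. \<bar>g W\<bar> \<le> T powr (- A) + C * T powr \<sigma> * sqrt (LINT W|m. (g W)\<^sup>2))"
proof -
  obtain C1 where C11: "C1 \<ge> 1" and C12: "\<forall>W\<in>Orb. \<forall>W'\<in>Orb. \<exists>Q\<in>G. W' = rotate_set Q W \<and>
      (\<forall>x. norm (Q *v x - x) \<le> C1 * norm (proj_matrix W' - proj_matrix W) * norm x)"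
    using orbit_small_rotation by (elim exE conjE) (rule that)
  note C1 = C11 C12[THEN bspec, THEN bspec]
  obtain c where c: "c > 0" "\<And>W \<eta>. W \<in> Orb \<Longrightarrow> 0 < \<eta> \<Longrightarrow> \<eta> \<le> 1 \<Longrightarrow> c * \<eta> ^ Dim \<le> prob (orbit_ball W \<eta>)"
  proof -
    obtain c where c: "c > 0" "\<forall>W\<in>Orb. \<forall>\<eta>. 0 < \<eta> \<and> \<eta> \<le> 1 \<longrightarrow> c * \<eta> ^ Dim \<le> prob (orbit_ball W \<eta>)"
      using orbit_ball_measure_ge by (elim exE conjE) (rule that)
    show thesis by (rule that[OF c(1)]) (simp add: c(2))
  qed
  obtain J :: nat where J: "J \<ge> 1" "A * real Dim / (2 * \<sigma> - real Dim) \<le> real J"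
  proof -
    obtain J :: nat where "A * real Dim / (2 * \<sigma> - real Dim) \<le> real J" using real_arch_simple by blast
    then show ?thesis by (intro that[of "Suc J"]) auto
  qed
  have expo: "(1 + A / real J) * real Dim / 2 \<le> \<sigma>"
  proof -
    have "A * real Dim \<le> real J * (2 * \<sigma> - real Dim)" using J(2) \<sigma> by (simp add: pos_divide_le_eq)
    then show ?thesis using J(1) by (simp add: field_simps)
  qed
  obtain \<kappa> where \<kappa>: "\<kappa> > 0" "\<forall>f :: nat \<Rightarrow> real. \<forall>M>0. (\<forall>k. norm (f k) \<le> M) \<longrightarrow>
      (\<forall>k. norm (fdiffs J f k) \<le> \<kappa> * M) \<longrightarrow> (\<forall>k. norm (fdiff f k) \<le> M / 2)"
    using small_high_difference_imp_small_difference[OF J(1), where 'a = real] by (elim exE conjE) (rule that)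
  define q where "q = min 1 ((\<kappa> / cis_const J) powr (1 / real J))"
  have cJ: "cis_const J > 0" using cis_const_ge_1[of J] by linarith
  have q: "0 < q" "q \<le> 1" using \<kappa>(1) cJ by (auto simp: q_def)
  have qJ: "cis_const J * q ^ J \<le> \<kappa>"
  proof -
    have "q ^ J \<le> ((\<kappa> / cis_const J) powr (1 / real J)) ^ J" using q by (intro power_mono) (auto simp: q_def)
    also have "\<dots> = \<kappa> / cis_const J" using \<kappa>(1) cJ J(1) by (simp add: powr_realpow[symmetric] powr_powr)
    finally show ?thesis using cJ by (simp add: field_simps)
  qed
  define e where "e = q / (Z0 * C1)"
  have e: "e > 0" using q Z0 C1 by (simp add: e_def)
  define C where "C = 4 / sqrt (c * e ^ Dim)"
  have Cpos: "C > 0" using c(1) e by (simp add: C_def)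
  have "\<bar>g W\<bar> \<le> T powr (- A) + C * T powr \<sigma> * sqrt (LINT W|m. (g W)\<^sup>2)"
    if T: "T \<ge> 1" and g: "orbit_smooth (Z0 * T) g" and g1: "\<And>W. W \<in> Orb \<Longrightarrow> \<bar>g W\<bar> \<le> 1" and W: "W \<in> Orb" for T g W
  proof -
    have ZT: "Z0 * T > 0" using Z0 T by simp
    have gm[measurable]: "g \<in> borel_measurable m" by (rule orbit_smooth_measurable[OF g ZT])
    define M where "M = (SUP W\<in>Orb. \<bar>g W\<bar>)"
    have bdd: "bdd_above ((\<lambda>W. \<bar>g W\<bar>) ` Orb)" using g1 by (intro bdd_aboveI2[of _ _ 1]) auto
    have gM: "\<bar>g W\<bar> \<le> M" if "W \<in> Orb" for W unfolding M_def by (rule cSUP_upper[OF that bdd])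
    have M1: "M \<le> 1" unfolding M_def using g1 V_orbit by (intro cSUP_least) auto
    have nonneg: "0 \<le> C * T powr \<sigma> * sqrt (LINT W|m. (g W)\<^sup>2)" using Cpos by simp
    show ?thesis
    proof (cases "M \<le> T powr (- A)")
      case True
      then show ?thesis using gM[OF W] nonneg by linarith
    next
      case False
      then have Mge: "M > T powr (- A)" and M0: "M > 0" using T by (auto intro: less_trans[of 0 "T powr (- A)"])
      \<comment> \<open>chosen such that the bound \<open>cis_const J * (Z0 * T * h) ^ J\<close> for the differences is at most \<open>\<kappa> * M\<close>\<close>
      define h where "h = q * M powr (1 / real J) / (Z0 * T)"
      have MJ: "M powr (1 / real J) \<le> 1" using M0 M1 by (simp add: powr_le1)
      have h: "h > 0" using q M0 ZT by (simp add: h_def)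
      have Zh: "Z0 * T * h = q * M powr (1 / real J)" using Z0 T by (simp add: h_def)
      have Zh1: "Z0 * T * h \<le> 1" unfolding Zh using q MJ by (simp add: mult_le_one)
      have small: "cis_const J * (Z0 * T * h) ^ J \<le> \<kappa> * M"
      proof -
        have "(M powr (1 / real J)) ^ J = M" using M0 J(1) by (simp add: powr_realpow[symmetric] powr_powr)
        then have "(Z0 * T * h) ^ J = q ^ J * M" unfolding Zh by (simp add: power_mult_distrib)
        then show ?thesis using mult_right_mono[OF qJ, of M] M0 by (simp add: mult.assoc)
      qed
      have step: "\<bar>g (rotate_set Q W) - g W\<bar> \<le> M / 2"
        if Q: "Q \<in> G" and Qh: "\<And>x. norm (Q *v x - x) \<le> h * norm x" and W: "W \<in> Orb" for Q W
      proof -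
        have "norm (fdiff (\<lambda>j. g ((rotate_set Q ^^ j) W)) 0) \<le> M / 2"
        proof (rule \<kappa>(2)[rule_format, OF M0])
          show "norm (g ((rotate_set Q ^^ k) W)) \<le> M" for k using gM[OF rotate_pow_orbit[OF W Q]] by simp
          show "norm (fdiffs J (\<lambda>j. g ((rotate_set Q ^^ j) W)) k) \<le> \<kappa> * M" for k
            using orbit_smoothD[OF g J(1) Q _ W Zh1 Qh, of k] h small by simp
        qed
        then show ?thesis by (simp add: fdiff_def)
      qed
      obtain W0 where W0: "W0 \<in> Orb" "3 / 4 * M < \<bar>g W0\<bar>"
      proof -
        have "3 / 4 * M < M" using M0 by simp
        then have "3 / 4 * M < (SUP W\<in>Orb. \<bar>g W\<bar>)" by (simp only: M_def)
        then have "\<exists>W0\<in>Orb. 3 / 4 * M < \<bar>g W0\<bar>"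
          using V_orbit by (subst (asm) less_cSUP_iff[OF _ bdd]) auto
        then show ?thesis using that by blast
      qed
      define \<eta> where "\<eta> = h / C1"
      have \<eta>: "0 < \<eta>" "\<eta> \<le> 1"
      proof -
        show "0 < \<eta>" using h C1 by (simp add: \<eta>_def)
        have "1 * h \<le> Z0 * T * h" using Z0 T h mult_mono[of 1 Z0 1 T] by (intro mult_right_mono) auto
        then have "h \<le> C1" using Zh1 C1(1) by linarith
        then show "\<eta> \<le> 1" using C1(1) by (simp add: \<eta>_def)
      qed
      have big: "M / 4 \<le> \<bar>g W'\<bar>" if W': "W' \<in> orbit_ball W0 \<eta>" for W'
      proof -
        have W'O: "W' \<in> Orb" and d: "norm (proj_matrix W' - proj_matrix W0) < \<eta>" using W' by (auto simp: orbit_ball_def)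
        obtain Q where Q: "Q \<in> G" "W' = rotate_set Q W0" "\<forall>x. norm (Q *v x - x) \<le> C1 * norm (proj_matrix W' - proj_matrix W0) * norm x"
          using C1(2)[OF W0(1) W'O] by (elim bexE conjE) (rule that)
        have "C1 * norm (proj_matrix W' - proj_matrix W0) \<le> h" using d C1(1) by (simp add: \<eta>_def field_simps)
        then have "norm (Q *v x - x) \<le> h * norm x" for x using Q(3)[rule_format, of x] mult_right_mono[of _ h "norm x"] by (meson norm_ge_zero order_trans)
        from step[OF Q(1) this W0(1)] show ?thesis using W0(2) unfolding Q(2) by linarith
      qed
      have g2i: "integrable m (\<lambda>W. (g W)\<^sup>2)"
        using g1 by (intro integrable_const_bound[where B = 1]) (auto simp: space_m abs_square_le_1)
      have "(M / 4)\<^sup>2 * (c * \<eta> ^ Dim) \<le> (M / 4)\<^sup>2 * prob (orbit_ball W0 \<eta>)"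
        by (intro mult_left_mono c(2) W0 \<eta>) auto
      also have "\<dots> = (LINT W|m. (M / 4)\<^sup>2 * indicator (orbit_ball W0 \<eta>) W)"
        using orbit_ball_sets[of W0 \<eta>] by simp
      also have "\<dots> \<le> (LINT W|m. (g W)\<^sup>2)"
      proof (rule integral_mono)
        show "integrable m (\<lambda>W. (M / 4)\<^sup>2 * indicator (orbit_ball W0 \<eta>) W)"
          using orbit_ball_sets[of W0 \<eta>] by (intro integrable_mult_right) (simp add: less_top[symmetric])
        show "(M / 4)\<^sup>2 * indicator (orbit_ball W0 \<eta>) W \<le> (g W)\<^sup>2" for W
          using big[of W] M0 power_mono[of "M / 4" "\<bar>g W\<bar>" 2] by (auto simp: indicator_def)
      qed (rule g2i)
      finally have "sqrt ((M / 4)\<^sup>2 * (c * \<eta> ^ Dim)) \<le> sqrt (LINT W|m. (g W)\<^sup>2)" by simp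
      then have main: "M / 4 * sqrt (c * \<eta> ^ Dim) \<le> sqrt (LINT W|m. (g W)\<^sup>2)"
        using M0 by (simp add: real_sqrt_mult)
      have \<eta>_ge: "e * T powr (- (1 + A / real J)) \<le> \<eta>"
      proof -
        have "T powr (- (A / real J)) = (T powr (- A)) powr (1 / real J)" by (simp add: powr_powr)
        also have "\<dots> \<le> M powr (1 / real J)" using Mge T by (intro powr_mono2) auto
        finally have "T powr (- (A / real J)) * T powr (- 1) \<le> M powr (1 / real J) * T powr (- 1)" by (intro mult_right_mono) auto
        moreover have "T powr (- (1 + A / real J)) = T powr (- (A / real J)) * T powr (- 1)"
          unfolding powr_add[symmetric] by (simp add: algebra_simps)
        moreover have "M powr (1 / real J) * T powr (- 1) = M powr (1 / real J) / T" using T by (simp add: powr_minus_divide)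
        ultimately have "T powr (- (1 + A / real J)) \<le> M powr (1 / real J) / T" by metis
        then have "e * T powr (- (1 + A / real J)) \<le> e * (M powr (1 / real J) / T)" using e by (intro mult_left_mono) auto
        also have "\<dots> = \<eta>" by (simp add: e_def \<eta>_def h_def)
        finally show ?thesis .
      qed
      have "sqrt (c * e ^ Dim) * T powr (- \<sigma>) \<le> sqrt (c * \<eta> ^ Dim)"
      proof (rule real_le_rsqrt)
        have "(sqrt (c * e ^ Dim) * T powr (- \<sigma>))\<^sup>2 = c * e ^ Dim * T powr (- 2 * \<sigma>)"
          using c(1) e by (simp add: power_mult_distrib power2_eq_square[of "T powr (- \<sigma>)"] powr_add[symmetric])
        also have "\<dots> \<le> c * e ^ Dim * T powr (- (1 + A / real J) * real Dim)"
        proof (intro mult_left_mono powr_mono)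
          show "- 2 * \<sigma> \<le> - (1 + A / real J) * real Dim" using expo by (simp add: algebra_simps)
        qed (use c(1) e T in auto)
        also have "\<dots> = c * (e * T powr (- (1 + A / real J))) ^ Dim"
          using T by (simp add: power_mult_distrib powr_realpow[symmetric] powr_powr)
        also have "\<dots> \<le> c * \<eta> ^ Dim"
          using c(1) e \<eta>_ge by (intro mult_left_mono power_mono) auto
        finally show "(sqrt (c * e ^ Dim) * T powr (- \<sigma>))\<^sup>2 \<le> c * \<eta> ^ Dim" .
      qed
      then have "M / 4 * (sqrt (c * e ^ Dim) * T powr (- \<sigma>)) \<le> sqrt (LINT W|m. (g W)\<^sup>2)"
        using main M0 mult_left_mono[of _ _ "M / 4"] by (meson divide_nonneg_nonneg less_imp_le order_trans zero_le_numeral)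
      moreover have "sqrt (c * e ^ Dim) > 0" "T powr \<sigma> > 0" using c(1) e T by auto
      ultimately have "M \<le> C * T powr \<sigma> * sqrt (LINT W|m. (g W)\<^sup>2)"
        by (simp add: C_def powr_minus field_simps)
      then show ?thesis using gM[OF W] by (smt (verit) powr_ge_zero)
    qed
  qed
  then show ?thesis using Cpos by (intro exI[of _ C]) auto
qed

end

section \<open>Stopping the self-similar recursion\<close>

text \<open>The properties of \<open>W \<mapsto> F\<^sub>R(W)\<close> that the main estimate uses, abstracted from the self-similar measure: a recursion through the maps of the system, and frequency at most \<open>R\<close> in the sense of \<open>orbit_smooth\<close>.\<close>

locale orbit_recursion = orbit_measure G V m
  for G :: "(real^'d^'d) set" and V :: "(real^'d) set" and m :: "(real^'d) set measure" +
  fixes n :: nat and r p :: "nat \<Rightarrow> real" and Q :: "nat \<Rightarrow> real^'d^'d"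
    and e :: "real \<Rightarrow> (real^'d) set \<Rightarrow> real" and r_min r_max Z0 :: real
  assumes p: "\<And>i. i \<in> {1..n} \<Longrightarrow> 0 < p i" and p1: "(\<Sum>i=1..n. p i) = 1"
    and r: "\<And>i. i \<in> {1..n} \<Longrightarrow> r_min \<le> \<bar>r i\<bar> \<and> \<bar>r i\<bar> \<le> r_max"
    and r_min: "0 < r_min" and r_max: "r_max < 1"
    and Q: "\<And>i. i \<in> {1..n} \<Longrightarrow> Q i \<in> G"
    and e_bounds: "\<And>R W. W \<in> Orb \<Longrightarrow> 0 \<le> e R W \<and> e R W \<le> 1"
    and e_recursion: "\<And>R W. W \<in> Orb \<Longrightarrow> e R W \<le> (\<Sum>i=1..n. p i * e (\<bar>r i\<bar> * R) (rotate_set (transpose (Q i)) W))"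
    and Z0: "Z0 \<ge> 1"
    and e_smooth: "\<And>T R. 1 \<le> T \<Longrightarrow> 0 \<le> R \<Longrightarrow> R \<le> T \<Longrightarrow> orbit_smooth (Z0 * T) (e R)"
    and mean_measurable [measurable]: "(\<lambda>R. LINT W|m. e R W) \<in> borel_measurable borel"
    and e_measurable [measurable]: "(\<lambda>R. e R V) \<in> borel_measurable borel"
begin

abbreviation "turn i \<equiv> rotate_set (transpose (Q i))"

text \<open>The recursion for \<open>F\<^sub>R\<close> unfolded at most \<open>N\<close> times, and along each branch only until the frequency is at most \<open>T\<close>. Once \<open>R r_max\<^sup>N \<le> T\<close>, all branches have stopped.\<close>

primrec stopped :: "real \<Rightarrow> nat \<Rightarrow> real \<Rightarrow> (real^'d) set \<Rightarrow> real" where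
  "stopped T 0 = e"
| "stopped T (Suc N) = (\<lambda>R W. if R \<le> T then e R W else \<Sum>i=1..n. p i * stopped T N (\<bar>r i\<bar> * R) (turn i W))"

text \<open>The rotations preserve the measure and thus disappear from the recursion.\<close>

primrec stopped_mean :: "real \<Rightarrow> nat \<Rightarrow> real \<Rightarrow> real" where
  "stopped_mean T 0 = (\<lambda>R. LINT W|m. e R W)"
| "stopped_mean T (Suc N) = (\<lambda>R. if R \<le> T then LINT W|m. e R W else \<Sum>i=1..n. p i * stopped_mean T N (\<bar>r i\<bar> * R))"

lemma p_nonneg: "i \<in> {1..n} \<Longrightarrow> 0 \<le> p i" using p less_imp_le by blast

lemma turn_G: "i \<in> {1..n} \<Longrightarrow> transpose (Q i) \<in> G" by (intro transpose_G Q)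

lemma turn_orbit: "i \<in> {1..n} \<Longrightarrow> W \<in> Orb \<Longrightarrow> turn i W \<in> Orb" by (intro rotate_orbit turn_G)

lemma convex_bounds:
  assumes "\<And>i. i \<in> {1..n} \<Longrightarrow> 0 \<le> x i \<and> x i \<le> (1 :: real)"
  shows "0 \<le> (\<Sum>i=1..n. p i * x i)" "(\<Sum>i=1..n. p i * x i) \<le> 1"
proof -
  show "0 \<le> (\<Sum>i=1..n. p i * x i)" using assms p_nonneg by (intro sum_nonneg mult_nonneg_nonneg) auto
  have "(\<Sum>i=1..n. p i * x i) \<le> (\<Sum>i=1..n. p i * 1)" using assms p_nonneg by (intro sum_mono mult_left_mono) auto
  then show "(\<Sum>i=1..n. p i * x i) \<le> 1" using p1 by simp
qed

lemma stopped_bounds: "W \<in> Orb \<Longrightarrow> 0 \<le> stopped T N R W \<and> stopped T N R W \<le> 1"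
proof (induction N arbitrary: R W)
  case (Suc N)
  have "0 \<le> stopped T N (\<bar>r i\<bar> * R) (turn i W) \<and> stopped T N (\<bar>r i\<bar> * R) (turn i W) \<le> 1" if "i \<in> {1..n}" for i
    by (rule Suc.IH[OF turn_orbit[OF that Suc.prems]])
  from convex_bounds[OF this] show ?case using e_bounds[OF Suc.prems] by simp
qed (simp add: e_bounds)

lemma le_stopped: "W \<in> Orb \<Longrightarrow> e R W \<le> stopped T N R W"
proof (induction N arbitrary: R W)
  case (Suc N)
  have "(\<Sum>i=1..n. p i * e (\<bar>r i\<bar> * R) (turn i W)) \<le> (\<Sum>i=1..n. p i * stopped T N (\<bar>r i\<bar> * R) (turn i W))"
    using Suc p_nonneg turn_orbit by (intro sum_mono mult_left_mono) auto
  with e_recursion[OF Suc.prems, of R]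
  have "e R W \<le> (\<Sum>i=1..n. p i * stopped T N (\<bar>r i\<bar> * R) (turn i W))" by (rule order_trans)
  then show ?case by simp
qed simp

lemma scale_descend:
  assumes "i \<in> {1..n}" "0 < R" "R * r_max ^ Suc N \<le> T"
  shows "0 < \<bar>r i\<bar> * R" "(\<bar>r i\<bar> * R) * r_max ^ N \<le> T"
proof -
  have ri: "0 < \<bar>r i\<bar>" "\<bar>r i\<bar> \<le> r_max" using r[OF assms(1)] r_min by auto
  then show "0 < \<bar>r i\<bar> * R" using assms(2) by simp
  have "\<bar>r i\<bar> * (R * r_max ^ N) \<le> r_max * (R * r_max ^ N)" using ri assms(2) by (intro mult_right_mono) auto
  then show "(\<bar>r i\<bar> * R) * r_max ^ N \<le> T" using assms(3) by (simp add: mult_ac)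
qed

text \<open>All branches end in functions of frequency at most \<open>T\<close>, so the majorant is a convex combination of such functions although \<open>R\<close> may be much larger than \<open>T\<close>.\<close>

lemma stopped_smooth:
  assumes T: "1 \<le> T" shows "0 < R \<Longrightarrow> R * r_max ^ N \<le> T \<Longrightarrow> orbit_smooth (Z0 * T) (stopped T N R)"
proof (induction N arbitrary: R)
  case 0 then show ?case using e_smooth[OF T] by simp
next
  case (Suc N)
  have "orbit_smooth (Z0 * T) (\<lambda>W. \<Sum>i=1..n. p i * stopped T N (\<bar>r i\<bar> * R) (turn i W))"
    using p1 p_nonneg by (intro orbit_smooth_convex orbit_smooth_rotate Suc.IH scale_descend[OF _ Suc.prems] turn_G) auto
  moreover have "orbit_smooth (Z0 * T) (e R)" if "R \<le> T" using e_smooth[OF T _ that] Suc.prems by simp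
  ultimately show ?case by (cases "R \<le> T") simp_all
qed

lemma stopped_measurable:
  assumes "1 \<le> T" "0 < R" "R * r_max ^ N \<le> T" shows "stopped T N R \<in> borel_measurable m"
  using Z0 assms(1) by (intro orbit_smooth_measurable[OF stopped_smooth[OF assms]]) auto

lemma integrable_bounded:
  assumes "g \<in> borel_measurable m" "\<And>W. W \<in> Orb \<Longrightarrow> \<bar>g W\<bar> \<le> (B :: real)" shows "integrable m g"
  using assms by (intro integrable_const_bound[where B = B]) (auto simp: space_m)

lemma integrable_stopped:
  assumes "1 \<le> T" "0 < R" "R * r_max ^ N \<le> T" shows "integrable m (stopped T N R)"
  using stopped_bounds[of _ T N R] by (intro integrable_bounded[OF stopped_measurable[OF assms], of 1]) auto

lemma measurable_turn:
  assumes "g \<in> borel_measurable m" "i \<in> {1..n}" shows "(\<lambda>W. g (turn i W)) \<in> borel_measurable m"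
  using measurable_compose[OF measurable_rotate[OF turn_G[OF assms(2)]] assms(1)] .

lemma integral_turn:
  fixes g :: "_ \<Rightarrow> real"
  assumes "g \<in> borel_measurable m" "i \<in> {1..n}" shows "(LINT W|m. g (turn i W)) = (LINT W|m. g W)"
  by (rule integral_rotate[OF turn_G[OF assms(2)] assms(1)])

lemma integral_stopped:
  assumes T: "1 \<le> T" shows "0 < R \<Longrightarrow> R * r_max ^ N \<le> T \<Longrightarrow> (LINT W|m. stopped T N R W) = stopped_mean T N R"
proof (induction N arbitrary: R)
  case (Suc N)
  have meas: "stopped T N (\<bar>r i\<bar> * R) \<in> borel_measurable m" if "i \<in> {1..n}" for i
    by (rule stopped_measurable[OF T scale_descend[OF that Suc.prems]])
  have int: "integrable m (\<lambda>W. stopped T N (\<bar>r i\<bar> * R) (turn i W))" if "i \<in> {1..n}" for i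
    using stopped_bounds[OF turn_orbit[OF that], of _ T N] by (intro integrable_bounded[OF measurable_turn[OF meas[OF that] that], of 1]) auto
  have "(LINT W|m. (\<Sum>i=1..n. p i * stopped T N (\<bar>r i\<bar> * R) (turn i W)))
      = (\<Sum>i=1..n. p i * (LINT W|m. stopped T N (\<bar>r i\<bar> * R) (turn i W)))"
    using int by (subst Bochner_Integration.integral_sum) auto
  also have "\<dots> = (\<Sum>i=1..n. p i * stopped_mean T N (\<bar>r i\<bar> * R))"
    using Suc.IH[OF scale_descend[OF _ Suc.prems]] by (intro sum.cong refl) (simp add: integral_turn[OF meas])
  finally show ?case by simp
qed simp

lemma e_mean_bounds: "0 \<le> (LINT W|m. e R W)" "(LINT W|m. e R W) \<le> 1" if "0 \<le> R"
proof -
  have "orbit_smooth (Z0 * max 1 R) (e R)" using that by (intro e_smooth) auto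
  then have "e R \<in> borel_measurable m" using Z0 by (rule_tac orbit_smooth_measurable) (auto intro: mult_pos_pos)
  then have "integrable m (e R)" by (rule integrable_bounded[where B = 1]) (simp add: e_bounds)
  then have "(LINT W|m. e R W) \<le> (LINT W|m. 1)" by (intro integral_mono) (simp_all add: space_m e_bounds)
  then show "(LINT W|m. e R W) \<le> 1" by (simp add: prob_space)
  show "0 \<le> (LINT W|m. e R W)" by (intro integral_nonneg_AE AE_I2) (simp add: space_m e_bounds)
qed

lemma stopped_mean_nonneg: "0 \<le> R \<Longrightarrow> 0 \<le> stopped_mean T N R"
proof (induction N arbitrary: R)
  case (Suc N)
  have "0 \<le> (\<Sum>i=1..n. p i * stopped_mean T N (\<bar>r i\<bar> * R))"
    by (intro sum_nonneg mult_nonneg_nonneg p_nonneg Suc.IH) (use Suc.prems in auto)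
  then show ?case by (simp add: e_mean_bounds Suc.prems)
qed (simp add: e_mean_bounds)

lemma stopped_mean_measurable [measurable]: "stopped_mean T N \<in> borel_measurable borel"
proof (induction N)
  case (Suc N)
  note [measurable] = Suc
  show ?case unfolding stopped_mean.simps by measurable
qed simp

definition fluctuation :: "real \<Rightarrow> nat \<Rightarrow> real \<Rightarrow> real" where
  "fluctuation T N R = (LINT W|m. (stopped T N R W - stopped_mean T N R)\<^sup>2)"

abbreviation "moduli \<equiv> (\<lambda>i. \<bar>r i\<bar>) ` {1..n}"

lemma level_prob_pos: "a \<in> moduli \<Longrightarrow> 0 < level_prob n r p a"
  unfolding level_prob_def by (rule sum_pos) (auto simp: level_set_def p)

lemma sum_over_levels: "(\<Sum>i=1..n. g i) = (\<Sum>a\<in>moduli. \<Sum>i\<in>level_set n r a. (g i :: real))"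
  unfolding level_set_def by (rule sum.image_gen) simp

lemma sum_level_prob: "(\<Sum>a\<in>moduli. level_prob n r p a) = 1"
  using p1 sum_over_levels[of p] by (simp add: level_prob_def)

lemma l2norm_of_real: "(l2norm m (\<lambda>W. complex_of_real (g W)))\<^sup>2 = (LINT W|m. (g W)\<^sup>2)"
  by (simp add: l2norm_def)

text \<open>The hypothesis on the Markov operators, stated for complex square integrable functions, specialized to bounded real functions.\<close>

lemma level_average_bound:
  assumes a: "a \<in> moduli" and g: "g \<in> borel_measurable m" "\<And>W. W \<in> Orb \<Longrightarrow> \<bar>g W\<bar> \<le> 1" "(LINT W|m. g W) = 0"
    and c: "\<And>F. F \<in> L2_0 m \<Longrightarrow> l2norm m (markov_op n r p Q a F) \<le> c * l2norm m F"
  shows "(LINT W|m. (\<Sum>i\<in>level_set n r a. p i / level_prob n r p a * g (turn i W))\<^sup>2) \<le> c\<^sup>2 * (LINT W|m. (g W)\<^sup>2)"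
proof -
  let ?F = "\<lambda>W. complex_of_real (g W)"
  have g2: "integrable m (\<lambda>W. (g W)\<^sup>2)"
    using g by (intro integrable_bounded[of _ 1]) (auto simp: abs_square_le_1)
  have "?F \<in> L2_0 m" using g g2 by (simp add: L2_0_def square_integrable_def)
  then have "l2norm m (markov_op n r p Q a ?F) \<le> c * l2norm m ?F" by (rule c)
  moreover have "0 \<le> l2norm m (markov_op n r p Q a ?F)" by (simp add: l2norm_def)
  ultimately have "(l2norm m (markov_op n r p Q a ?F))\<^sup>2 \<le> (c * l2norm m ?F)\<^sup>2" by (rule power_mono)
  moreover have "markov_op n r p Q a ?F = (\<lambda>W. complex_of_real (\<Sum>i\<in>level_set n r a. p i / level_prob n r p a * g (turn i W)))"
  proof
    fix W
    have "matrix_inv (Q i) = transpose (Q i)" if "i \<in> level_set n r a" for i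
      using that Q by (intro rotation_transpose_mult rotation) (auto simp: level_set_def)
    then show "markov_op n r p Q a ?F W = complex_of_real (\<Sum>i\<in>level_set n r a. p i / level_prob n r p a * g (turn i W))"
      unfolding markov_op_def by simp
  qed
  ultimately show ?thesis by (simp only: l2norm_of_real power_mult_distrib)
qed

text \<open>A substitute for Minkowski's inequality: with weights \<open>w c\<close> in Jensen's inequality, integrating the right side gives \<open>\<parallel>\<Sum> w x\<parallel> \<le> (\<Sum> w c) B\<close> as soon as \<open>\<parallel>x\<parallel> \<le> c B\<close> for every index.\<close>

lemma sum_square_le:
  fixes w c x :: "'i \<Rightarrow> real"
  assumes A: "finite A" "\<And>a. a \<in> A \<Longrightarrow> 0 < w a \<and> 0 < c a" "A \<noteq> {}"
  shows "(\<Sum>a\<in>A. w a * x a)\<^sup>2 \<le> (\<Sum>a\<in>A. w a * c a) * (\<Sum>a\<in>A. w a / c a * (x a)\<^sup>2)"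
proof -
  define s where "s = (\<Sum>a\<in>A. w a * c a)"
  have s: "s > 0" unfolding s_def using A by (intro sum_pos) auto
  have "(\<Sum>a\<in>A. (w a * c a / s) * (x a / c a))\<^sup>2 \<le> (\<Sum>a\<in>A. (w a * c a / s) * (x a / c a)\<^sup>2)"
    using A s by (intro weighted_jensen_square) (auto simp: s_def sum_divide_distrib[symmetric] less_imp_le)
  moreover have "(\<Sum>a\<in>A. (w a * c a / s) * (x a / c a)) = (\<Sum>a\<in>A. w a * x a) / s"
    unfolding sum_divide_distrib
  proof (rule sum.cong[OF refl])
    fix a assume "a \<in> A"
    then have "c a \<noteq> 0" using A(2) by force
    then show "(w a * c a / s) * (x a / c a) = w a * x a / s" by simp
  qed
  moreover have "(\<Sum>a\<in>A. (w a * c a / s) * (x a / c a)\<^sup>2) = (\<Sum>a\<in>A. w a / c a * (x a)\<^sup>2) / s"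
    unfolding sum_divide_distrib
  proof (rule sum.cong[OF refl])
    fix a assume "a \<in> A"
    then have "c a \<noteq> 0" using A(2) by force
    then show "(w a * c a / s) * (x a / c a)\<^sup>2 = w a / c a * (x a)\<^sup>2 / s" by (simp add: power2_eq_square)
  qed
  ultimately have "(\<Sum>a\<in>A. w a * x a)\<^sup>2 / s\<^sup>2 \<le> (\<Sum>a\<in>A. w a / c a * (x a)\<^sup>2) / s" by (simp add: power_divide)
  then show ?thesis unfolding s_def[symmetric] using s by (simp add: field_simps power2_eq_square)
qed

text \<open>One step of the recursion groups the maps by modulus \<open>a\<close> and applies the averaging operators to the fluctuations at frequencies \<open>a R \<ge> r_min R\<close>, which by induction have norm at most \<open>(T/(r_min R))\<^sup>L\<close>. The factor \<open>r_min\<^sup>L\<close> gained from the operators compensates exactly for the decrease of the frequency.\<close>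

lemma fluctuation_decay:
  assumes T: "1 \<le> T" and L: "0 \<le> L"
    and c: "\<And>a F. a \<in> moduli \<Longrightarrow> F \<in> L2_0 m \<Longrightarrow> l2norm m (markov_op n r p Q a F) \<le> c a * l2norm m F"
    and c_pos: "\<And>a. a \<in> moduli \<Longrightarrow> 0 < c a"
    and gap: "(\<Sum>a\<in>moduli. level_prob n r p a * c a) \<le> r_min powr L"
  shows "0 < R \<Longrightarrow> R * r_max ^ N \<le> T \<Longrightarrow> fluctuation T N R \<le> 1 \<and> (T \<le> R \<longrightarrow> fluctuation T N R \<le> ((T / R) powr L)\<^sup>2)"
proof -
  have flat: "fluctuation T N R \<le> 1" if R: "0 < R" "R * r_max ^ N \<le> T" for N R
  proof -
    have int: "integrable m (stopped T N R)" by (rule integrable_stopped[OF T R])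
    have b: "0 \<le> stopped T N R W" "stopped T N R W \<le> 1" if "W \<in> Orb" for W using stopped_bounds[OF that] by auto
    have mean: "0 \<le> stopped_mean T N R" "stopped_mean T N R \<le> 1"
    proof -
      show "0 \<le> stopped_mean T N R" using R by (intro stopped_mean_nonneg) simp
      have "(LINT W|m. stopped T N R W) \<le> (LINT W|m. 1)" using int b by (intro integral_mono) (simp_all add: space_m)
      then show "stopped_mean T N R \<le> 1" unfolding integral_stopped[OF T R] by (simp add: prob_space)
    qed
    have sq: "(stopped T N R W - stopped_mean T N R)\<^sup>2 \<le> 1" if "W \<in> Orb" for W
      using b[OF that] mean by (intro abs_square_le_1[THEN iffD2]) (simp add: abs_le_iff)
    have "integrable m (\<lambda>W. (stopped T N R W - stopped_mean T N R)\<^sup>2)"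
      using sq stopped_measurable[OF T R] by (intro integrable_bounded[where B = 1]) auto
    then have "fluctuation T N R \<le> (LINT W|m. 1)" unfolding fluctuation_def
      using sq by (intro integral_mono) (simp_all add: space_m)
    then show ?thesis by (simp add: prob_space)
  qed
  have decay: "T \<le> R \<Longrightarrow> fluctuation T N R \<le> ((T / R) powr L)\<^sup>2" if R: "0 < R" "R * r_max ^ N \<le> T" for R
    using R
  proof (induction N arbitrary: R)
    case 0
    then have "T / R = 1" using T by simp
    then show ?case using flat[OF 0(2,3)] by simp
  next
    case (Suc N)
    show ?case
    proof (cases "R = T")
      case True
      then show ?thesis using flat[OF Suc.prems(2,3)] T by simp
    next
      case False
      then have RT: "T < R" using Suc.prems by simp
      define B where "B = (T / (r_min * R)) powr L"
      let ?D = "\<lambda>a W. stopped T N (a * R) W - stopped_mean T N (a * R)"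
      let ?P = "\<lambda>a W. \<Sum>i\<in>level_set n r a. p i / level_prob n r p a * ?D a (turn i W)"
      have scale: "0 < a * R" "(a * R) * r_max ^ N \<le> T" "r_min \<le> a" "a > 0" if "a \<in> moduli" for a
        using that scale_descend[OF _ Suc.prems(2,3)] r r_min by fastforce+
      have D_small: "fluctuation T N (a * R) \<le> B\<^sup>2" if a: "a \<in> moduli" for a
      proof -
        have mono: "x powr L \<le> B" if "0 \<le> x" "x \<le> T / (r_min * R)" for x
          unfolding B_def using that L by (intro powr_mono2) auto
        show ?thesis
        proof (cases "T \<le> a * R")
          case True
          have "T / (a * R) \<le> T / (r_min * R)"
            using scale[OF a] Suc.prems(2) r_min T by (intro divide_left_mono mult_right_mono) auto
          then have "((T / (a * R)) powr L)\<^sup>2 \<le> B\<^sup>2"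
            using T scale[OF a] by (intro power_mono mono) auto
          then show ?thesis using Suc.IH[OF True scale(1,2)[OF a]] by linarith
        next
          case F: False
          have "r_min * R \<le> a * R" using scale[OF a] Suc.prems(2) by (intro mult_right_mono) auto
          then have "r_min * R \<le> T" using F by linarith
          then have "1 \<le> T / (r_min * R)" using r_min Suc.prems(2) by (simp add: le_divide_eq)
          then have "1 \<le> B" using mono[of 1] by simp
          then have "1 \<le> B\<^sup>2" by (simp add: power2_eq_square mult_ge1_I)
          then show ?thesis using flat[OF scale(1,2)[OF a]] by linarith
        qed
      qed
      have D_meas: "?D a \<in> borel_measurable m" if "a \<in> moduli" for a
        using stopped_measurable[OF T scale(1,2)[OF that]] by simp
      have D_bound: "\<bar>?D a W\<bar> \<le> 1" if a: "a \<in> moduli" and W: "W \<in> Orb" for a W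
      proof -
        have int: "integrable m (stopped T N (a * R))" by (rule integrable_stopped[OF T scale(1,2)[OF a]])
        have "(LINT W|m. stopped T N (a * R) W) \<le> (LINT W|m. 1)"
          using int stopped_bounds by (intro integral_mono) (simp_all add: space_m)
        then have "stopped_mean T N (a * R) \<le> 1"
          unfolding integral_stopped[OF T scale(1,2)[OF a]] by (simp add: prob_space)
        moreover have "0 \<le> stopped_mean T N (a * R)" using scale[OF a] by (intro stopped_mean_nonneg) simp
        ultimately show ?thesis using stopped_bounds[OF W, of T N "a * R"] by (simp add: abs_le_iff)
      qed
      have D_mean: "(LINT W|m. ?D a W) = 0" if a: "a \<in> moduli" for a
        using integrable_stopped[OF T scale(1,2)[OF a]] integral_stopped[OF T scale(1,2)[OF a]]
        by (simp add: prob_space)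
      have P_small: "(LINT W|m. (?P a W)\<^sup>2) \<le> (c a)\<^sup>2 * B\<^sup>2" if a: "a \<in> moduli" for a
      proof -
        have "(LINT W|m. (?P a W)\<^sup>2) \<le> (c a)\<^sup>2 * (LINT W|m. (?D a W)\<^sup>2)"
          by (rule level_average_bound[OF a D_meas[OF a] D_bound[OF a] D_mean[OF a] c[OF a]])
        also have "\<dots> \<le> (c a)\<^sup>2 * B\<^sup>2"
          using D_small[OF a] by (intro mult_left_mono) (simp_all add: fluctuation_def)
        finally show ?thesis .
      qed
      have P_meas: "?P a \<in> borel_measurable m" if "a \<in> moduli" for a
        using measurable_turn[OF D_meas[OF that]]
        by (intro borel_measurable_sum borel_measurable_times borel_measurable_const) (auto simp: level_set_def)
      have P_int: "integrable m (\<lambda>W. (?P a W)\<^sup>2)" if a: "a \<in> moduli" for a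
      proof (rule integrable_bounded[where B = 1])
        show "(\<lambda>W. (?P a W)\<^sup>2) \<in> borel_measurable m" using P_meas[OF a] by measurable
        fix W assume W: "W \<in> Orb"
        have "\<bar>?P a W\<bar> \<le> (\<Sum>i\<in>level_set n r a. p i / level_prob n r p a * 1)"
          using level_prob_pos[OF a] p_nonneg D_bound[OF a turn_orbit[OF _ W]]
          by (intro order_trans[OF sum_abs] sum_mono) (auto simp: abs_mult level_set_def intro!: divide_right_mono mult_left_le)
        also have "\<dots> = 1" using level_prob_pos[OF a] by (simp add: sum_divide_distrib[symmetric] level_prob_def)
        finally show "\<bar>(?P a W)\<^sup>2\<bar> \<le> 1" by (simp add: abs_square_le_1)
      qed
      have split: "stopped T (Suc N) R W - stopped_mean T (Suc N) R = (\<Sum>a\<in>moduli. level_prob n r p a * ?P a W)" for W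
      proof -
        have "stopped T (Suc N) R W - stopped_mean T (Suc N) R = (\<Sum>i=1..n. p i * ?D \<bar>r i\<bar> (turn i W))"
          using RT by (simp add: sum_subtractf[symmetric] right_diff_distrib)
        also have "\<dots> = (\<Sum>a\<in>moduli. \<Sum>i\<in>level_set n r a. p i * ?D \<bar>r i\<bar> (turn i W))" by (rule sum_over_levels)
        also have "\<dots> = (\<Sum>a\<in>moduli. level_prob n r p a * ?P a W)"
        proof (rule sum.cong[OF refl])
          fix a assume "a \<in> moduli"
          then have "level_prob n r p a \<noteq> 0" using level_prob_pos by force
          then show "(\<Sum>i\<in>level_set n r a. p i * ?D \<bar>r i\<bar> (turn i W)) = level_prob n r p a * ?P a W"
            unfolding sum_distrib_left by (intro sum.cong refl) (simp add: level_set_def)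
        qed
        finally show ?thesis .
      qed
      let ?s = "\<Sum>a\<in>moduli. level_prob n r p a * c a"
      have ne: "moduli \<noteq> {}" using p1 by (cases n) auto
      have "fluctuation T (Suc N) R = (LINT W|m. (\<Sum>a\<in>moduli. level_prob n r p a * ?P a W)\<^sup>2)"
        unfolding fluctuation_def split ..
      also have "\<dots> \<le> (LINT W|m. ?s * (\<Sum>a\<in>moduli. level_prob n r p a / c a * (?P a W)\<^sup>2))"
      proof (rule integral_mono')
        show "integrable m (\<lambda>W. ?s * (\<Sum>a\<in>moduli. level_prob n r p a / c a * (?P a W)\<^sup>2))"
          by (intro integrable_mult_right Bochner_Integration.integrable_sum P_int)
        show "(\<Sum>a\<in>moduli. level_prob n r p a * ?P a W)\<^sup>2 \<le> ?s * (\<Sum>a\<in>moduli. level_prob n r p a / c a * (?P a W)\<^sup>2)" for W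
          using ne by (intro sum_square_le) (simp_all add: level_prob_pos c_pos)
        show "0 \<le> ?s * (\<Sum>a\<in>moduli. level_prob n r p a / c a * (?P a W)\<^sup>2)" for W
          by (intro mult_nonneg_nonneg sum_nonneg) (simp_all add: level_prob_pos c_pos less_imp_le)
      qed
      also have "\<dots> = ?s * (\<Sum>a\<in>moduli. level_prob n r p a / c a * (LINT W|m. (?P a W)\<^sup>2))"
        using P_int by (simp only: integral_mult_right_zero) (subst Bochner_Integration.integral_sum, simp_all)
      also have "\<dots> \<le> ?s * (\<Sum>a\<in>moduli. level_prob n r p a / c a * ((c a)\<^sup>2 * B\<^sup>2))"
        using P_small by (intro mult_left_mono sum_mono sum_nonneg) (simp_all add: level_prob_pos c_pos less_imp_le)
      also have "(\<Sum>a\<in>moduli. level_prob n r p a / c a * ((c a)\<^sup>2 * B\<^sup>2)) = (\<Sum>a\<in>moduli. level_prob n r p a * c a * B\<^sup>2)"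
      proof (rule sum.cong[OF refl])
        fix a assume "a \<in> moduli"
        then have "c a \<noteq> 0" using c_pos by force
        then show "level_prob n r p a / c a * ((c a)\<^sup>2 * B\<^sup>2) = level_prob n r p a * c a * B\<^sup>2" by (simp add: power2_eq_square)
      qed
      also have "\<dots> = ?s * B\<^sup>2" by (simp only: sum_distrib_right)
      also have "?s * (?s * B\<^sup>2) = (?s * B)\<^sup>2" by (simp add: power2_eq_square)
      also have "\<dots> \<le> (r_min powr L * B)\<^sup>2"
      proof -
        have "0 \<le> ?s" by (intro sum_nonneg) (simp add: level_prob_pos c_pos less_imp_le)
        then show ?thesis using gap by (intro power_mono mult_right_mono) (auto simp: B_def)
      qed
      also have "r_min powr L * B = (T / R) powr L"
        unfolding B_def using r_min T Suc.prems(2) by (simp add: powr_mult[symmetric])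
      finally show ?thesis .
    qed
  qed
  assume "0 < R" "R * r_max ^ N \<le> T"
  then show ?thesis using flat decay by blast
qed

end

section \<open>Means and fluctuations on dyadic blocks\<close>

text \<open>Sum a geometric series over \<open>A = 2\<^sup>j\<close>.\<close>

lemma dyadic_integral_finite:
  fixes h :: "real \<Rightarrow> ennreal"
  assumes h[measurable]: "h \<in> borel_measurable borel" and \<delta>: "\<delta> > 0" and K: "K \<ge> 0"
    and block: "\<And>A. A \<ge> 1 \<Longrightarrow> (\<integral>\<^sup>+R\<in>{A..2*A}. h R \<partial>lborel) \<le> ennreal (K * A powr (- \<delta>))"
  shows "(\<integral>\<^sup>+R\<in>{1..}. h R \<partial>lborel) < \<infinity>"
proof -
  let ?B = "\<lambda>j. {2 ^ j..2 * 2 ^ j :: real}"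
  have cover: "h R * indicator {1..} R \<le> (suminf (\<lambda>j. h R * indicator (?B j) R))" for R
  proof (cases "1 \<le> R")
    case True
    \<comment> \<open>the dyadic block containing \<open>R\<close>\<close>
    define j where "j = nat \<lfloor>log 2 R\<rfloor>"
    have l: "0 \<le> \<lfloor>log 2 R\<rfloor>" using True by (simp add: zero_le_floor)
    have "real j \<le> log 2 R" "log 2 R \<le> real j + 1" using l unfolding j_def by simp_all
    then have "2 powr real j \<le> R" "R \<le> 2 powr (real j + 1)" using True by (simp_all add: le_log_iff log_le_iff)
    then have "R \<in> ?B j" by (simp add: powr_realpow powr_add mult.commute)
    then have "h R * indicator {1..} R = (\<Sum>i\<in>{j}. h R * indicator (?B i) R)" using True by simp
    also have "\<dots> \<le> (suminf (\<lambda>j. h R * indicator (?B j) R))" by (rule sum_le_suminf) auto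
    finally show ?thesis .
  qed simp
  have "(\<integral>\<^sup>+R\<in>{1..}. h R \<partial>lborel) \<le> (\<integral>\<^sup>+R. (suminf (\<lambda>j. h R * indicator (?B j) R)) \<partial>lborel)"
    by (rule nn_integral_mono) (rule cover)
  also have "\<dots> = (suminf (\<lambda>j. \<integral>\<^sup>+R\<in>?B j. h R \<partial>lborel))" by (rule nn_integral_suminf) measurable
  also have "\<dots> \<le> (suminf (\<lambda>j. ennreal (K * (2 ^ j) powr (- \<delta>))))" by (intro suminf_le block) auto
  also have "\<dots> = (suminf (\<lambda>j. ennreal (K * (2 powr (- \<delta>)) ^ j)))"
    by (simp add: powr_realpow[symmetric] powr_powr mult.commute)
  also have "\<dots> < \<infinity>"
  proof -
    have "2 powr (- \<delta>) < (1 :: real)" using \<delta> by (simp add: powr_less_one)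
    then have "summable (\<lambda>j. K * (2 powr (- \<delta>)) ^ j)" by (intro summable_mult summable_geometric) simp
    then show ?thesis using K by (subst suminf_ennreal2) auto
  qed
  finally show ?thesis .
qed

context orbit_recursion
begin

lemma n_nonempty: "{1..n} \<noteq> {}" using p1 by (cases n) auto

lemma r_min_le_r_max: "r_min \<le> r_max" using n_nonempty r by fastforce

lemma r_max_pos: "0 < r_max" using r_min r_min_le_r_max by simp

lemma r_max_powr: "0 < \<beta> \<Longrightarrow> r_max powr \<beta> < 1"
  using powr_less_mono2[of \<beta> r_max 1] r_max r_max_pos by simp

lemma stopped_mean_le_1:
  assumes "1 \<le> T" "0 < R" "R * r_max ^ N \<le> T" shows "stopped_mean T N R \<le> 1"
proof -
  have "(LINT W|m. stopped T N R W) \<le> (LINT W|m. 1)"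
    using integrable_stopped[OF assms] stopped_bounds by (intro integral_mono) (simp_all add: space_m)
  then show ?thesis unfolding integral_stopped[OF assms] by (simp add: prob_space)
qed

text \<open>Weighted integral of the means over the frequencies for which all branches stop within \<open>N\<close> steps. The lower limit is a bound for the frequencies at which a branch starting above \<open>T\<close> can stop.\<close>

definition mean_integral :: "real \<Rightarrow> real \<Rightarrow> nat \<Rightarrow> ennreal" where
  "mean_integral \<beta> T N = (\<integral>\<^sup>+R\<in>{r_min * T<..T / r_max ^ N}. ennreal (R powr (- \<beta> - 1) * stopped_mean T N R) \<partial>lborel)"

text \<open>Substitute \<open>u = \<bar>r i\<bar> R\<close>; the upper limits match because \<open>\<bar>r i\<bar> \<le> r_max\<close>, and the weight produces the factor \<open>\<bar>r i\<bar>\<close> to the power \<open>\<beta>\<close>.\<close>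

lemma mean_integral_scaled:
  assumes T: "1 \<le> T" and i: "i \<in> {1..n}"
  shows "(\<integral>\<^sup>+R\<in>{T<..T / r_max ^ Suc N}. ennreal (R powr (- \<beta> - 1) * stopped_mean T N (\<bar>r i\<bar> * R)) \<partial>lborel)
    \<le> ennreal (\<bar>r i\<bar> powr \<beta>) * mean_integral \<beta> T N"
proof -
  define c where "c = \<bar>r i\<bar>"
  have c: "0 < c" "r_min \<le> c" "c \<le> r_max" using r[OF i] r_min by (auto simp: c_def)
  define g where "g R = ennreal (R powr (- \<beta> - 1) * stopped_mean T N R) * indicator {r_min * T<..T / r_max ^ N} R" for R
  have [measurable]: "g \<in> borel_measurable borel" unfolding g_def by measurable
  have "(\<integral>\<^sup>+R\<in>{T<..T / r_max ^ Suc N}. ennreal (R powr (- \<beta> - 1) * stopped_mean T N (c * R)) \<partial>lborel)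
     \<le> (\<integral>\<^sup>+R. ennreal (c powr (\<beta> + 1)) * g (0 + c * R) \<partial>lborel)"
  proof (rule nn_integral_mono)
    fix R
    show "ennreal (R powr (- \<beta> - 1) * stopped_mean T N (c * R)) * indicator {T<..T / r_max ^ Suc N} R \<le> ennreal (c powr (\<beta> + 1)) * g (0 + c * R)"
    proof (cases "R \<in> {T<..T / r_max ^ Suc N}")
      case True
      then have R: "0 < R" "T < R" "R * r_max ^ Suc N \<le> T" using T c by (auto simp: pos_le_divide_eq)
      have "r_min * T < c * R" using c R r_min T by (intro mult_le_less_imp_less) auto
      moreover have "(c * R) * r_max ^ N \<le> T" unfolding c_def by (rule scale_descend[OF i R(1,3)])
      ultimately have "c * R \<in> {r_min * T<..T / r_max ^ N}" using c by (simp add: pos_le_divide_eq)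
      moreover have "c powr (\<beta> + 1) * ((c * R) powr (- \<beta> - 1)) = R powr (- \<beta> - 1)"
        using c R by (simp add: powr_mult mult.assoc[symmetric] powr_add[symmetric])
      ultimately show ?thesis using True
        by (simp add: g_def ennreal_mult'[symmetric] mult.assoc[symmetric])
    qed simp
  qed
  also have "\<dots> = ennreal (c powr (\<beta> + 1)) * (\<integral>\<^sup>+R. g (0 + c * R) \<partial>lborel)" by (rule nn_integral_cmult) measurable
  also have "\<dots> = ennreal (c powr \<beta>) * (ennreal \<bar>c\<bar> * (\<integral>\<^sup>+R. g (0 + c * R) \<partial>lborel))"
    using c by (simp add: powr_add ennreal_mult mult.assoc)
  also have "ennreal \<bar>c\<bar> * (\<integral>\<^sup>+R. g (0 + c * R) \<partial>lborel) = (\<integral>\<^sup>+R. g R \<partial>lborel)"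
    using c by (intro nn_integral_real_affine[symmetric]) auto
  finally show ?thesis by (simp add: g_def mean_integral_def c_def)
qed

text \<open>Frequencies above \<open>T\<close> are reduced by one step of the recursion, which costs at most a factor \<open>r_max\<close> to the power \<open>\<beta>\<close>. So \<open>X\<^bsub>N+1\<^esub> \<le> Y + q X\<^sub>N\<close> with \<open>q < 1\<close>, whence \<open>X\<^sub>N \<le> Y/(1 - q)\<close>.\<close>

lemma mean_integral_le:
  assumes T: "1 \<le> T" and \<beta>: "\<beta> > 0"
  shows "mean_integral \<beta> T N \<le> ennreal (1 / (1 - r_max powr \<beta>)) *
    (\<integral>\<^sup>+R\<in>{r_min * T<..T}. ennreal (R powr (- \<beta> - 1) * (LINT W|m. e R W)) \<partial>lborel)"
    (is "_ \<le> ennreal ?K * ?Y")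
proof (induction N)
  define q where "q = r_max powr \<beta>"
  note rm = r_max_pos
  have q: "0 < q" "q < 1" unfolding q_def using rm r_max_powr[OF \<beta>] by auto
  have K: "?K \<ge> 1" "1 + q * ?K = ?K" using q unfolding q_def[symmetric] by (auto simp: field_simps)
  {
    case 0
    have "?Y = ennreal 1 * ?Y" by simp
    also have "\<dots> \<le> ennreal ?K * ?Y" using K by (intro mult_right_mono ennreal_leI) auto
    finally show ?case by (simp add: mean_integral_def)
  next
    case (Suc N)
    let ?g = "\<lambda>i R. ennreal (R powr (- \<beta> - 1) * stopped_mean T N (\<bar>r i\<bar> * R)) * indicator {T<..T / r_max ^ Suc N} R"
    have "mean_integral \<beta> T (Suc N) \<le> (\<integral>\<^sup>+R. ennreal (R powr (- \<beta> - 1) * (LINT W|m. e R W)) * indicator {r_min * T<..T} R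
        + (\<Sum>i=1..n. ennreal (p i) * ?g i R) \<partial>lborel)"
      unfolding mean_integral_def
    proof (rule nn_integral_mono)
      fix R
      show "ennreal (R powr (- \<beta> - 1) * stopped_mean T (Suc N) R) * indicator {r_min * T<..T / r_max ^ Suc N} R
        \<le> ennreal (R powr (- \<beta> - 1) * (LINT W|m. e R W)) * indicator {r_min * T<..T} R + (\<Sum>i=1..n. ennreal (p i) * ?g i R)"
      proof (cases "R \<le> T")
        case True
        then show ?thesis by (auto simp: indicator_def)
      next
        case False
        then have R: "0 < R" "T < R" using T by auto
        have "ennreal (R powr (- \<beta> - 1) * stopped_mean T (Suc N) R) = ennreal (\<Sum>i=1..n. p i * (R powr (- \<beta> - 1) * stopped_mean T N (\<bar>r i\<bar> * R)))"
          using False by (simp add: sum_distrib_left mult_ac)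
        also have "\<dots> = (\<Sum>i=1..n. ennreal (p i) * ennreal (R powr (- \<beta> - 1) * stopped_mean T N (\<bar>r i\<bar> * R)))"
          using R p_nonneg by (subst sum_ennreal[symmetric]) (auto simp: ennreal_mult stopped_mean_nonneg intro!: mult_nonneg_nonneg)
        finally show ?thesis using R by (auto simp: indicator_def)
      qed
    qed
    also have "\<dots> = ?Y + (\<integral>\<^sup>+R. (\<Sum>i=1..n. ennreal (p i) * ?g i R) \<partial>lborel)"
      by (intro nn_integral_add) measurable
    also have "(\<integral>\<^sup>+R. (\<Sum>i=1..n. ennreal (p i) * ?g i R) \<partial>lborel) = (\<Sum>i=1..n. ennreal (p i) * (\<integral>\<^sup>+R. ?g i R \<partial>lborel))"
      by (subst nn_integral_sum) (auto intro!: sum.cong nn_integral_cmult)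
    also have "\<dots> \<le> (\<Sum>i=1..n. ennreal (p i) * (ennreal q * mean_integral \<beta> T N))"
    proof (intro sum_mono mult_left_mono)
      fix i assume i: "i \<in> {1..n}"
      have "\<bar>r i\<bar> powr \<beta> \<le> q" unfolding q_def using r[OF i] \<beta> by (intro powr_mono2) auto
      then show "(\<integral>\<^sup>+R. ?g i R \<partial>lborel) \<le> ennreal q * mean_integral \<beta> T N"
        by (intro order_trans[OF mean_integral_scaled[OF T i]] mult_right_mono ennreal_leI) auto
    qed auto
    also have "\<dots> = ennreal q * mean_integral \<beta> T N"
    proof -
      have "(\<Sum>i=1..n. ennreal (p i)) = 1" using p1 p_nonneg by (subst sum_ennreal) auto
      then show ?thesis by (simp add: sum_distrib_right[symmetric])
    qed
    also have "?Y + ennreal q * mean_integral \<beta> T N \<le> ennreal 1 * ?Y + ennreal q * (ennreal ?K * ?Y)"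
      using Suc.IH by (intro add_mono mult_left_mono) auto
    also have "\<dots> = ennreal (1 + q * ?K) * ?Y"
    proof -
      have gen: "ennreal 1 * Y + ennreal q * (ennreal \<kappa> * Y) = ennreal (1 + q * \<kappa>) * Y" if "0 \<le> \<kappa>" for \<kappa> Y
        using that q by (simp add: ennreal_plus ennreal_mult distrib_right mult.assoc)
      show ?thesis by (rule gen) (use K(1) in linarith)
    qed
    finally show ?case unfolding K(2) by (simp add: add_left_mono)
  }
qed

lemma mean_integral_bound:
  assumes T: "1 \<le> T" and \<beta>: "\<beta> > 0" and t: "t \<ge> 0"
  shows "mean_integral \<beta> T N \<le> ennreal (1 / (1 - r_max powr \<beta>) * r_min powr (- \<beta> - t) * T powr (- \<beta> - t)) *
    (\<integral>\<^sup>+R\<in>{r_min..}. ennreal (R powr (t - 1) * (LINT W|m. e R W)) \<partial>lborel)"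
proof -
  note rm = r_max_pos
  have q: "r_max powr \<beta> < 1" by (rule r_max_powr[OF \<beta>])
  have "(\<integral>\<^sup>+R\<in>{r_min * T<..T}. ennreal (R powr (- \<beta> - 1) * (LINT W|m. e R W)) \<partial>lborel)
     \<le> (\<integral>\<^sup>+R. ennreal ((r_min * T) powr (- \<beta> - t)) * (ennreal (R powr (t - 1) * (LINT W|m. e R W)) * indicator {r_min..} R) \<partial>lborel)"
  proof (rule nn_integral_mono)
    fix R
    show "ennreal (R powr (- \<beta> - 1) * (LINT W|m. e R W)) * indicator {r_min * T<..T} R
       \<le> ennreal ((r_min * T) powr (- \<beta> - t)) * (ennreal (R powr (t - 1) * (LINT W|m. e R W)) * indicator {r_min..} R)"
    proof (cases "R \<in> {r_min * T<..T}")
      case True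
      have "r_min * 1 \<le> r_min * T" using T r_min by (intro mult_left_mono) auto
      moreover have "r_min * T < R" using True by simp
      ultimately have R: "r_min * T < R" "r_min \<le> R" "0 < R" using r_min by linarith+
      have "R powr (- \<beta> - 1) = R powr (- \<beta> - t) * R powr (t - 1)" by (simp add: powr_add[symmetric])
      also have "\<dots> \<le> (r_min * T) powr (- \<beta> - t) * R powr (t - 1)"
        using R r_min T \<beta> t by (intro mult_right_mono powr_mono2') auto
      finally have "R powr (- \<beta> - 1) * (LINT W|m. e R W) \<le> (r_min * T) powr (- \<beta> - t) * (R powr (t - 1) * (LINT W|m. e R W))"
        using e_mean_bounds(1)[of R] R by (simp add: mult_right_mono mult.assoc[symmetric])
      then show ?thesis using True R by (simp add: ennreal_mult'[symmetric] ennreal_leI)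
    qed simp
  qed
  also have "\<dots> = ennreal ((r_min * T) powr (- \<beta> - t)) * (\<integral>\<^sup>+R\<in>{r_min..}. ennreal (R powr (t - 1) * (LINT W|m. e R W)) \<partial>lborel)"
    by (rule nn_integral_cmult) measurable
  finally have "mean_integral \<beta> T N \<le> ennreal (1 / (1 - r_max powr \<beta>)) * (ennreal ((r_min * T) powr (- \<beta> - t)) *
     (\<integral>\<^sup>+R\<in>{r_min..}. ennreal (R powr (t - 1) * (LINT W|m. e R W)) \<partial>lborel))"
    by (intro order_trans[OF mean_integral_le[OF T \<beta>]] mult_left_mono) auto
  also have "\<dots> = ennreal (1 / (1 - r_max powr \<beta>) * r_min powr (- \<beta> - t) * T powr (- \<beta> - t)) *
    (\<integral>\<^sup>+R\<in>{r_min..}. ennreal (R powr (t - 1) * (LINT W|m. e R W)) \<partial>lborel)"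
    using q r_min T by (simp add: ennreal_mult'[symmetric] mult.assoc[symmetric] powr_mult)
  finally show ?thesis .
qed

text \<open>On a dyadic block take \<open>T = A\<^sup>y\<close> and split the majorant into its mean and its fluctuation. The weight exponent \<open>\<beta> = (yt - s)/2\<close> uses half of the room in \<open>s < yt\<close>, and \<open>A' = (s + 1)/y\<close> makes the error term \<open>T\<^sup>-\<^sup>A\<^sup>'\<close> of the supremum bound summable.\<close>

lemma energy_block:
  assumes L: "0 \<le> L"
    and c: "\<And>a F. a \<in> moduli \<Longrightarrow> F \<in> L2_0 m \<Longrightarrow> l2norm m (markov_op n r p Q a F) \<le> c a * l2norm m F"
    and c_pos: "\<And>a. a \<in> moduli \<Longrightarrow> 0 < c a"
    and gap: "(\<Sum>a\<in>moduli. level_prob n r p a * c a) \<le> r_min powr L"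
    and \<sigma>: "\<sigma> > real Dim / 2" and s: "1 \<le> s" and y: "0 < y" "y < 1" and t: "0 \<le> t"
    and st: "s < y * t" and sL: "y * (\<sigma> + L) < L - s"
    and fin: "(\<integral>\<^sup>+R\<in>{r_min..}. ennreal (R powr (t - 1) * (LINT W|m. e R W)) \<partial>lborel) = ennreal E" and E: "E \<ge> 0"
  shows "\<exists>K \<delta>. \<delta> > 0 \<and> K \<ge> 0 \<and> (\<forall>A\<ge>1. (\<integral>\<^sup>+R\<in>{A..2*A}. ennreal (R powr (s - 1) * e R V) \<partial>lborel) \<le> ennreal (K * A powr (- \<delta>)))"
proof -
  note rm = r_max_pos
  define A' where "A' = (s + 1) / y"
  have A': "A' \<ge> 0" "y * A' = s + 1" using s y by (auto simp: A'_def)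
  obtain C where C: "C > 0" "\<forall>T\<ge>1. \<forall>g. orbit_smooth (Z0 * T) g \<longrightarrow> (\<forall>W\<in>Orb. \<bar>g W\<bar> \<le> 1) \<longrightarrow>
     (\<forall>W\<in>Orb. \<bar>g W\<bar> \<le> T powr (- A') + C * T powr \<sigma> * sqrt (LINT W|m. (g W)\<^sup>2))"
    using orbit_smooth_sup_bound[OF \<sigma> A'(1) Z0] by (elim exE conjE) (rule that)
  define \<beta> where "\<beta> = (y * t - s) / 2"
  have \<beta>: "\<beta> > 0" using st by (simp add: \<beta>_def)
  \<comment> \<open>the decay exponents of the mean, of the error term and of the fluctuation\<close>
  define \<delta> where "\<delta> = min \<beta> (min 1 (L - s - y * (\<sigma> + L)))"
  have \<delta>: "\<delta> > 0" "\<delta> \<le> \<beta>" "\<delta> \<le> 1" "\<delta> \<le> L - s - y * (\<sigma> + L)" using \<beta> sL by (auto simp: \<delta>_def)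
  define K0 where "K0 = 1 / (1 - r_max powr \<beta>) * r_min powr (- \<beta> - t)"
  have K0: "K0 \<ge> 0" using r_max_powr[OF \<beta>] by (simp add: K0_def)
  define K where "K = 2 powr (s + \<beta>) * K0 * E + 2 powr (s - 1) * (1 + C)"
  have K: "K \<ge> 0" using K0 E C(1) by (simp add: K_def)
  have "(\<integral>\<^sup>+R\<in>{A..2*A}. ennreal (R powr (s - 1) * e R V) \<partial>lborel) \<le> ennreal (K * A powr (- \<delta>))" if A: "A \<ge> 1" for A
  proof -
    define T where "T = A powr y"
    have T: "T \<ge> 1" "T \<le> A"
    proof -
      show "T \<ge> 1" unfolding T_def using A y by (intro ge_one_powr_ge_zero) auto
      have "T \<le> A powr 1" unfolding T_def using A y by (intro powr_mono) auto
      then show "T \<le> A" using A by simp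
    qed
    obtain N where "r_max ^ N < T / (2 * A)" using real_arch_pow_inv[of "T / (2 * A)" r_max] T A r_max by auto
    then have N: "2 * A * r_max ^ N \<le> T" using A by (simp add: field_simps)
    define F where "F = A powr (- (s + 1)) + C * A powr (y * \<sigma> + (y - 1) * L)"
    have F0: "F \<ge> 0" using C(1) by (simp add: F_def)
    have pointwise: "e R V \<le> stopped_mean T N R + F" if R: "A \<le> R" "R \<le> 2 * A" for R
    proof -
      have R0: "0 < R" "T \<le> R" using R A T by auto
      have "R * r_max ^ N \<le> 2 * A * r_max ^ N" using R rm by (intro mult_right_mono) auto
      then have RN: "R * r_max ^ N \<le> T" using N by linarith
      let ?g = "\<lambda>W. stopped T N R W - stopped_mean T N R"
      have "orbit_smooth (Z0 * T) ?g" by (intro orbit_smooth_diff_const stopped_smooth T(1) R0(1) RN)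
      moreover have "\<bar>?g W\<bar> \<le> 1" if "W \<in> Orb" for W
        using stopped_bounds[OF that, of T N R] stopped_mean_le_1[OF T(1) R0(1) RN] stopped_mean_nonneg[of R T N] R0 by (simp add: abs_le_iff)
      ultimately have "\<bar>?g V\<bar> \<le> T powr (- A') + C * T powr \<sigma> * sqrt (fluctuation T N R)"
        unfolding fluctuation_def using C(2)[rule_format, OF T(1), of ?g V] V_orbit by blast
      also have "\<dots> \<le> T powr (- A') + C * T powr \<sigma> * (T / A) powr L"
      proof -
        have "sqrt (fluctuation T N R) \<le> (T / R) powr L"
          using fluctuation_decay[OF T(1) L c c_pos gap R0(1) RN] R0(2) by (intro real_le_lsqrt) auto
        also have "\<dots> \<le> (T / A) powr L" using T A R L by (intro powr_mono2 divide_left_mono) auto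
        finally show ?thesis using C(1) by (intro add_left_mono mult_left_mono) auto
      qed
      also have "T powr (- A') = A powr (- (s + 1))" using A' by (simp add: T_def powr_powr)
      also have "C * T powr \<sigma> * (T / A) powr L = C * A powr (y * \<sigma> + (y - 1) * L)"
      proof -
        have "T / A = A powr (y - 1)" using A by (simp add: T_def powr_diff)
        then show ?thesis by (simp add: T_def powr_powr powr_add)
      qed
      finally have "\<bar>?g V\<bar> \<le> F" unfolding F_def .
      then show ?thesis using le_stopped[OF V_orbit, of R T N] by linarith
    qed
    have "(\<integral>\<^sup>+R\<in>{A..2*A}. ennreal (R powr (s - 1) * e R V) \<partial>lborel)
       \<le> (\<integral>\<^sup>+R. ennreal ((2 * A) powr (s + \<beta>)) * (ennreal (R powr (- \<beta> - 1) * stopped_mean T N R) * indicator {r_min * T<..T / r_max ^ N} R)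
            + ennreal ((2 * A) powr (s - 1) * F) * indicator {A..2*A} R \<partial>lborel)"
    proof (rule nn_integral_mono)
      fix R
      show "ennreal (R powr (s - 1) * e R V) * indicator {A..2*A} R
        \<le> ennreal ((2 * A) powr (s + \<beta>)) * (ennreal (R powr (- \<beta> - 1) * stopped_mean T N R) * indicator {r_min * T<..T / r_max ^ N} R)
            + ennreal ((2 * A) powr (s - 1) * F) * indicator {A..2*A} R"
      proof (cases "R \<in> {A..2*A}")
        case True
        then have R: "A \<le> R" "R \<le> 2 * A" "0 < R" using A by auto
        have "r_min * T < 1 * T" using r_min_le_r_max r_max T by (intro mult_strict_right_mono) auto
        moreover have "R * r_max ^ N \<le> 2 * A * r_max ^ N" using R rm by (intro mult_right_mono) auto
        ultimately have "r_min * T < R" "R * r_max ^ N \<le> T" using R T N by linarith+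
        then have ind: "R \<in> {r_min * T<..T / r_max ^ N}" using rm by (simp add: pos_le_divide_eq)
        have mean0: "0 \<le> stopped_mean T N R" using R by (intro stopped_mean_nonneg) simp
        have "R powr (s - 1) = R powr (s + \<beta>) * R powr (- \<beta> - 1)" by (simp add: powr_add[symmetric])
        also have "\<dots> \<le> (2 * A) powr (s + \<beta>) * R powr (- \<beta> - 1)" using R s \<beta> by (intro mult_right_mono powr_mono2) auto
        finally have "R powr (s - 1) * stopped_mean T N R \<le> (2 * A) powr (s + \<beta>) * (R powr (- \<beta> - 1) * stopped_mean T N R)"
          using mean0 by (simp add: mult_right_mono mult.assoc[symmetric])
        moreover have "R powr (s - 1) * F \<le> (2 * A) powr (s - 1) * F" using R s F0 by (intro mult_right_mono powr_mono2) auto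
        moreover have "R powr (s - 1) * e R V \<le> R powr (s - 1) * (stopped_mean T N R + F)"
          using pointwise[OF R(1,2)] by (intro mult_left_mono) auto
        ultimately have "R powr (s - 1) * e R V \<le> (2 * A) powr (s + \<beta>) * (R powr (- \<beta> - 1) * stopped_mean T N R) + (2 * A) powr (s - 1) * F"
          by (simp add: distrib_left)
        then have "ennreal (R powr (s - 1) * e R V) \<le> ennreal ((2 * A) powr (s + \<beta>) * (R powr (- \<beta> - 1) * stopped_mean T N R) + (2 * A) powr (s - 1) * F)"
          by (rule ennreal_leI)
        also have "\<dots> = ennreal ((2 * A) powr (s + \<beta>) * (R powr (- \<beta> - 1) * stopped_mean T N R)) + ennreal ((2 * A) powr (s - 1) * F)"
          using mean0 F0 by (intro ennreal_plus) auto
        finally have "ennreal (R powr (s - 1) * e R V) \<le> ennreal ((2 * A) powr (s + \<beta>) * (R powr (- \<beta> - 1) * stopped_mean T N R)) + ennreal ((2 * A) powr (s - 1) * F)" .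
        then show ?thesis using True ind mean0 by (simp add: ennreal_mult)
      qed simp
    qed
    also have "\<dots> = ennreal ((2 * A) powr (s + \<beta>)) * mean_integral \<beta> T N + ennreal ((2 * A) powr (s - 1) * F) * ennreal A"
    proof -
      have "emeasure lborel {A..2*A} = ennreal A" using A by simp
      then show ?thesis unfolding mean_integral_def
        by (subst nn_integral_add) (auto simp: nn_integral_cmult nn_integral_cmult_indicator)
    qed
    also have "\<dots> \<le> ennreal ((2 * A) powr (s + \<beta>)) * (ennreal (K0 * T powr (- \<beta> - t)) * ennreal E) + ennreal ((2 * A) powr (s - 1) * F) * ennreal A"
      using mean_integral_bound[OF T(1) \<beta> t, of N] unfolding fin K0_def
      by (intro add_right_mono mult_left_mono) auto
    also have "\<dots> = ennreal ((2 * A) powr (s + \<beta>) * (K0 * T powr (- \<beta> - t) * E) + (2 * A) powr (s - 1) * F * A)"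
      using K0 E F0 A by (subst ennreal_plus) (auto simp: ennreal_mult)
    also have "\<dots> \<le> ennreal (K * A powr (- \<delta>))"
    proof (rule ennreal_leI)
      have mono: "A powr x \<le> A powr (- \<delta>)" if "x \<le> - \<delta>" for x using that A by (intro powr_mono) auto
      have "(2 * A) powr (s + \<beta>) * (K0 * T powr (- \<beta> - t) * E) = 2 powr (s + \<beta>) * K0 * E * A powr (s + \<beta> + y * (- \<beta> - t))"
        using A by (simp add: powr_mult T_def powr_powr powr_add mult_ac)
      also have "\<dots> \<le> 2 powr (s + \<beta>) * K0 * E * A powr (- \<delta>)"
      proof (intro mult_left_mono mono)
        have "s + \<beta> + y * (- \<beta> - t) = - \<beta> - y * \<beta>" by (simp add: \<beta>_def field_simps)
        moreover have "0 < y * \<beta>" using y \<beta> by simp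
        ultimately show "s + \<beta> + y * (- \<beta> - t) \<le> - \<delta>" using \<delta>(2) by linarith
      qed (use K0 E in auto)
      finally have 1: "(2 * A) powr (s + \<beta>) * (K0 * T powr (- \<beta> - t) * E) \<le> 2 powr (s + \<beta>) * K0 * E * A powr (- \<delta>)" .
      have "(2 * A) powr (s - 1) * F * A = 2 powr (s - 1) * (F * (A powr (s - 1) * A powr 1))"
        using A by (simp add: powr_mult)
      also have "A powr (s - 1) * A powr 1 = A powr s" unfolding powr_add[symmetric] by simp
      also have "F * A powr s = A powr (- 1) + C * A powr (s + y * \<sigma> + (y - 1) * L)"
        by (simp add: F_def distrib_right powr_add[symmetric] add_ac mult.assoc)
      also have "\<dots> \<le> A powr (- \<delta>) + C * A powr (- \<delta>)"
        using C(1) \<delta> by (intro add_mono mult_left_mono mono) (auto simp: algebra_simps)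
      finally have 2: "(2 * A) powr (s - 1) * F * A \<le> 2 powr (s - 1) * (1 + C) * A powr (- \<delta>)"
        by (simp add: distrib_right mult.assoc)
      show "(2 * A) powr (s + \<beta>) * (K0 * T powr (- \<beta> - t) * E) + (2 * A) powr (s - 1) * F * A \<le> K * A powr (- \<delta>)"
        using 1 2 unfolding K_def by (simp add: distrib_right)
    qed
    finally show ?thesis .
  qed
  then show ?thesis using \<delta>(1) K by blast
qed

end

section \<open>Choice of the exponents\<close>

text \<open>The two conditions on \<open>y\<close> say \<open>s/t < y < (L - s)/(L + \<sigma>)\<close>. This interval is nonempty iff \<open>t > s(\<sigma> + L)/(L - s)\<close>, and the hypothesis on \<open>L\<close> is equivalent to this bound being less than \<open>D\<close>.\<close>

lemma obtain_exponents:
  fixes D \<sigma> s \<Lambda> :: real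
  assumes s: "1 \<le> s" "s < D" and \<sigma>: "0 \<le> \<sigma>" and L: "s * (D + \<sigma>) / (D - s) < L"
  shows "s < L" and "\<exists>t0<D. \<forall>t. t0 < t \<longrightarrow> 0 \<le> t \<and> (\<exists>y. 0 < y \<and> y < 1 \<and> s < y * t \<and> y * (\<sigma> + L) < L - s)"
proof -
  have gap: "s * (D + \<sigma>) < L * (D - s)" using L s by (simp add: pos_divide_less_eq)
  have "s * (D - s) \<le> s * (D + \<sigma>)" using s \<sigma> by (intro mult_left_mono) auto
  then have "s * (D - s) < L * (D - s)" using gap by linarith
  then show sL: "s < L" using s by simp
  show "\<exists>t0<D. \<forall>t. t0 < t \<longrightarrow> 0 \<le> t \<and> (\<exists>y. 0 < y \<and> y < 1 \<and> s < y * t \<and> y * (\<sigma> + L) < L - s)"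
  proof (rule exI[of _ "s * (\<sigma> + L) / (L - s)"], intro conjI allI impI)
    show "s * (\<sigma> + L) / (L - s) < D" using gap sL by (simp add: pos_divide_less_eq algebra_simps)
    fix t assume "s * (\<sigma> + L) / (L - s) < t"
    then have t: "s * (\<sigma> + L) < t * (L - s)" using sL by (simp add: pos_divide_less_eq)
    have "0 < s * (\<sigma> + L)" using s \<sigma> sL by simp
    then have "0 < t * (L - s)" using t by linarith
    then have t0: "0 < t" using sL by (simp add: zero_less_mult_iff)
    then show "0 \<le> t" by simp
    have "s / t < (L - s) / (L + \<sigma>)" using t t0 s \<sigma> sL by (simp add: divide_less_eq less_divide_eq mult_ac add_ac)
    then obtain y where y: "s / t < y" "y < (L - s) / (L + \<sigma>)" using dense by blast
    show "\<exists>y. 0 < y \<and> y < 1 \<and> s < y * t \<and> y * (\<sigma> + L) < L - s"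
    proof (intro exI[of _ y] conjI)
      have "0 < s / t" using s t0 by simp
      then show "0 < y" using y by linarith
      have "(L - s) / (L + \<sigma>) < 1" using s \<sigma> sL by (simp add: divide_less_eq)
      then show "y < 1" using y by linarith
      show "s < y * t" using y t0 by (simp add: pos_divide_less_eq)
      show "y * (\<sigma> + L) < L - s" using y s \<sigma> sL by (simp add: less_divide_eq add_ac)
    qed
  qed
qed

context orbit_recursion
begin

text \<open>The infimum need not be attained a priori, hence the strict inequality. The set of admissible constants is nonempty because averaging operators are contractions.\<close>

lemma opnorm_le:
  assumes a: "a \<in> moduli" and b: "opnorm_L2_0 m (markov_op n r p Q a) < b" and F: "F \<in> L2_0 m"
  shows "l2norm m (markov_op n r p Q a F) \<le> b * l2norm m F"
proof -
  let ?S = "{C. 0 \<le> C \<and> (\<forall>F\<in>L2_0 m. l2norm m (markov_op n r p Q a F) \<le> C * l2norm m F)}"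
  let ?w = "\<lambda>i. p i / level_prob n r p a"
  have one: "(\<Sum>i\<in>level_set n r a. ?w i) = 1"
    using level_prob_pos[OF a] by (simp add: sum_divide_distrib[symmetric] level_prob_def)
  have w0: "0 \<le> ?w i" if "i \<in> level_set n r a" for i
    using level_prob_pos[OF a] that p_nonneg by (auto simp: level_set_def intro!: divide_nonneg_pos)
  have contract: "l2norm m (markov_op n r p Q a F) \<le> 1 * l2norm m F" if "F \<in> L2_0 m" for F
  proof -
    have F: "F \<in> borel_measurable m" "integrable m (\<lambda>W. (cmod (F W))\<^sup>2)"
      using that by (auto simp: L2_0_def square_integrable_def)
    have int: "integrable m (\<lambda>W. (cmod (F (turn i W)))\<^sup>2)" "(LINT W|m. (cmod (F (turn i W)))\<^sup>2) = (LINT W|m. (cmod (F W))\<^sup>2)"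
      if "i \<in> level_set n r a" for i
    proof -
      have i: "transpose (Q i) \<in> G" using that by (intro turn_G) (simp add: level_set_def)
      show "integrable m (\<lambda>W. (cmod (F (turn i W)))\<^sup>2)"
        using integrable_distr[OF measurable_rotate[OF i], of "\<lambda>W. (cmod (F W))\<^sup>2"] F(2) distr_rotate[OF i] by simp
      show "(LINT W|m. (cmod (F (turn i W)))\<^sup>2) = (LINT W|m. (cmod (F W))\<^sup>2)"
        using F(1) by (intro integral_rotate[OF i]) simp
    qed
    have "(LINT W|m. (cmod (markov_op n r p Q a F W))\<^sup>2) \<le> (LINT W|m. (\<Sum>i\<in>level_set n r a. ?w i * (cmod (F (turn i W)))\<^sup>2))"
    proof (rule integral_mono')
      show "integrable m (\<lambda>W. \<Sum>i\<in>level_set n r a. ?w i * (cmod (F (turn i W)))\<^sup>2)"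
        using int by (intro Bochner_Integration.integrable_sum integrable_mult_right)
      fix W
      have inv: "matrix_inv (Q i) = transpose (Q i)" if "i \<in> level_set n r a" for i
        using that Q by (intro rotation_transpose_mult rotation) (auto simp: level_set_def)
      have "cmod (markov_op n r p Q a F W) \<le> (\<Sum>i\<in>level_set n r a. cmod (complex_of_real (?w i) * F (rotate_set (matrix_inv (Q i)) W)))"
        unfolding markov_op_def by (rule norm_sum)
      also have "\<dots> = (\<Sum>i\<in>level_set n r a. ?w i * cmod (F (turn i W)))"
      proof (rule sum.cong[OF refl])
        fix i assume i: "i \<in> level_set n r a"
        have "\<bar>?w i\<bar> = ?w i" using w0[OF i] by (rule abs_of_nonneg)
        then show "cmod (complex_of_real (?w i) * F (rotate_set (matrix_inv (Q i)) W)) = ?w i * cmod (F (turn i W))"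
          by (simp only: norm_mult norm_of_real inv[OF i])
      qed
      finally have "(cmod (markov_op n r p Q a F W))\<^sup>2 \<le> (\<Sum>i\<in>level_set n r a. ?w i * cmod (F (turn i W)))\<^sup>2"
        by (intro power_mono) auto
      also have "\<dots> \<le> (\<Sum>i\<in>level_set n r a. ?w i * (cmod (F (turn i W)))\<^sup>2)"
        by (rule weighted_jensen_square[OF _ w0 one]) (simp add: level_set_def)
      finally show "(cmod (markov_op n r p Q a F W))\<^sup>2 \<le> (\<Sum>i\<in>level_set n r a. ?w i * (cmod (F (turn i W)))\<^sup>2)" .
      show "0 \<le> (\<Sum>i\<in>level_set n r a. ?w i * (cmod (F (turn i W)))\<^sup>2)" using w0 by (intro sum_nonneg mult_nonneg_nonneg) auto
    qed
    also have "\<dots> = (\<Sum>i\<in>level_set n r a. ?w i * (LINT W|m. (cmod (F (turn i W)))\<^sup>2))"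
      using int(1) by (subst Bochner_Integration.integral_sum) auto
    also have "\<dots> = (\<Sum>i\<in>level_set n r a. ?w i * (LINT W|m. (cmod (F W))\<^sup>2))"
      using int(2) by (intro sum.cong refl) simp
    also have "\<dots> = (LINT W|m. (cmod (F W))\<^sup>2)" unfolding sum_distrib_right[symmetric] one by simp
    finally show ?thesis by (simp add: l2norm_def)
  qed
  have "?S \<noteq> {}" using contract by (intro ex_in_conv[THEN iffD1] exI[of _ 1]) simp
  then obtain C where C: "C \<in> ?S" "C < b" using b unfolding opnorm_L2_0_def by (elim cInf_lessD[THEN bexE]) auto
  have "l2norm m (markov_op n r p Q a F) \<le> C * l2norm m F" using C(1) F by simp
  also have "\<dots> \<le> b * l2norm m F" using C(2) by (intro mult_right_mono) (auto simp: l2norm_def)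
  finally show ?thesis .
qed

lemma opnorm_nonneg: "a \<in> moduli \<Longrightarrow> 0 \<le> opnorm_L2_0 m (markov_op n r p Q a)"
proof (rule ccontr)
  assume a: "a \<in> moduli" and neg: "\<not> 0 \<le> opnorm_L2_0 m (markov_op n r p Q a)"
  let ?S = "{C. 0 \<le> C \<and> (\<forall>F\<in>L2_0 m. l2norm m (markov_op n r p Q a F) \<le> C * l2norm m F)}"
  obtain b where "opnorm_L2_0 m (markov_op n r p Q a) < b" "0 \<le> b"
    using neg by (metis less_eq_real_def linorder_not_le)
  then have "b \<in> ?S" using opnorm_le[OF a] by simp
  then have "0 \<le> Inf ?S" by (intro cInf_greatest) auto
  then show False using neg by (simp add: opnorm_L2_0_def)
qed

text \<open>Strictness of the spectral hypothesis leaves room to replace each operator norm by a slightly larger positive constant that is valid for all functions. As \<open>t \<ge> 1\<close>, lowering the lower limit of integration from \<open>1\<close> to \<open>r_min\<close> does not affect finiteness.\<close>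

theorem energy_integral_finite:
  assumes rate: "(\<Sum>a\<in>moduli. level_prob n r p a * opnorm_L2_0 m (markov_op n r p Q a)) < r_min powr L"
    and L: "s * (D + \<sigma>) / (D - s) < L" and s: "1 \<le> s" "s < D" and \<sigma>: "\<sigma> > real Dim / 2"
    and D: "\<And>t0. t0 < D \<Longrightarrow> \<exists>t>t0. (\<integral>\<^sup>+R\<in>{1..}. ennreal (R powr (t - 1) * (LINT W|m. e R W)) \<partial>lborel) < \<infinity>"
  shows "(\<integral>\<^sup>+R\<in>{1..}. ennreal (R powr (s - 1) * e R V) \<partial>lborel) < \<infinity>"
proof -
  have \<sigma>0: "0 \<le> \<sigma>" using \<sigma> by (smt (verit) of_nat_0_le_iff divide_nonneg_pos)
  note ex = obtain_exponents[OF s \<sigma>0 L]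
  obtain t0 where t0: "t0 < D" "\<forall>t. t0 < t \<longrightarrow> 0 \<le> t \<and> (\<exists>y. 0 < y \<and> y < 1 \<and> s < y * t \<and> y * (\<sigma> + L) < L - s)"
    using ex(2) by (elim exE conjE) (rule that)
  obtain t where t: "t0 < t" "(\<integral>\<^sup>+R\<in>{1..}. ennreal (R powr (t - 1) * (LINT W|m. e R W)) \<partial>lborel) < \<infinity>"
    using D[OF t0(1)] by (elim exE conjE) (rule that)
  have "0 \<le> t \<and> (\<exists>y. 0 < y \<and> y < 1 \<and> s < y * t \<and> y * (\<sigma> + L) < L - s)" using t0(2) t(1) by (elim allE impE)
  then obtain y where tn: "0 \<le> t" and y: "0 < y" "y < 1" "s < y * t" "y * (\<sigma> + L) < L - s"
    by (elim exE conjE) (rule that)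
  have t1: "1 \<le> t"
  proof -
    have "y * t \<le> 1 * t" using y tn by (intro mult_right_mono) auto
    then show ?thesis using y s by linarith
  qed
  let ?f = "\<lambda>R. ennreal (R powr (t - 1) * (LINT W|m. e R W))"
  have "(\<integral>\<^sup>+R\<in>{r_min..}. ?f R \<partial>lborel) \<le> (\<integral>\<^sup>+R. ?f R * indicator {1..} R + indicator {0..1} R \<partial>lborel)"
  proof (rule nn_integral_mono)
    fix R :: real
    have "?f R \<le> 1" if "r_min \<le> R" "R < 1"
    proof -
      have R: "0 \<le> R" using that r_min by simp
      have "R powr (t - 1) \<le> 1" using R that t1 by (intro powr_le1) auto
      then have "R powr (t - 1) * (LINT W|m. e R W) \<le> 1" using e_mean_bounds[OF R] by (intro mult_le_one) auto
      then show ?thesis using ennreal_leI by fastforce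
    qed
    then show "?f R * indicator {r_min..} R \<le> ?f R * indicator {1..} R + indicator {0..1} R"
      using r_min by (auto simp: indicator_def)
  qed
  also have "\<dots> = (\<integral>\<^sup>+R\<in>{1..}. ?f R \<partial>lborel) + 1" by (subst nn_integral_add) auto
  also have "\<dots> < \<infinity>" using t(2) by (simp add: ennreal_add_less_top)
  finally obtain E where E: "(\<integral>\<^sup>+R\<in>{r_min..}. ?f R \<partial>lborel) = ennreal E" "0 \<le> E"
    by (cases "\<integral>\<^sup>+R\<in>{r_min..}. ?f R \<partial>lborel") auto
  let ?op = "\<lambda>a. opnorm_L2_0 m (markov_op n r p Q a)"
  define \<delta> where "\<delta> = r_min powr L - (\<Sum>a\<in>moduli. level_prob n r p a * ?op a)"
  have \<delta>: "\<delta> > 0" using rate by (simp add: \<delta>_def)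
  have gap: "(\<Sum>a\<in>moduli. level_prob n r p a * (?op a + \<delta>)) \<le> r_min powr L"
    unfolding distrib_left sum.distrib sum_distrib_right[symmetric] sum_level_prob by (simp add: \<delta>_def)
  have Lnn: "0 \<le> L" using ex(1) s by simp
  have "\<exists>K \<delta>. \<delta> > 0 \<and> K \<ge> 0 \<and> (\<forall>A\<ge>1. (\<integral>\<^sup>+R\<in>{A..2*A}. ennreal (R powr (s - 1) * e R V) \<partial>lborel) \<le> ennreal (K * A powr (- \<delta>)))"
    by (rule energy_block[OF Lnn _ _ gap \<sigma> s(1) y(1,2) tn y(3,4) E])
       (use \<delta> opnorm_le opnorm_nonneg in \<open>simp_all add: add_nonneg_pos\<close>)
  then obtain K \<delta>' where K: "\<delta>' > 0" "K \<ge> 0" "\<forall>A\<ge>1. (\<integral>\<^sup>+R\<in>{A..2*A}. ennreal (R powr (s - 1) * e R V) \<partial>lborel) \<le> ennreal (K * A powr (- \<delta>'))"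
    by (elim exE conjE) (rule that)
  have "(\<lambda>R. ennreal (R powr (s - 1) * e R V)) \<in> borel_measurable borel" by measurable
  then show ?thesis by (rule dyadic_integral_finite[OF _ K(1,2) K(3)[rule_format]])
qed

end

section \<open>Absolute continuity of projections\<close>

lemma tendsto_integral_bounded:
  fixes f :: "nat \<Rightarrow> 'b \<Rightarrow> 'c::{banach, second_countable_topology}"
  assumes P: "prob_space M" and f: "\<And>n. f n \<in> borel_measurable M" and g: "g \<in> borel_measurable M"
    and lim: "\<And>x. x \<in> space M \<Longrightarrow> (\<lambda>n. f n x) \<longlonglongrightarrow> g x" and b: "\<And>n x. x \<in> space M \<Longrightarrow> norm (f n x) \<le> 1"
  shows "(\<lambda>n. LINT x|M. f n x) \<longlonglongrightarrow> (LINT x|M. g x)"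
proof -
  interpret prob_space M by (rule P)
  show ?thesis
    by (rule integral_dominated_convergence[where w = "\<lambda>_. 1", OF g f]) (auto intro!: AE_I2 lim b)
qed

context borel_prob
begin

lemma tendsto_fourier:
  assumes "X \<longlonglongrightarrow> \<xi>" shows "(\<lambda>n. fourier \<nu> (X n)) \<longlonglongrightarrow> fourier \<nu> \<xi>"
  unfolding fourier_cis
proof (rule tendsto_integral_bounded[OF prob_space_axioms])
  note [measurable_cong] = sets_borel
  show "(\<lambda>x. cis (- (2 * pi * (x \<bullet> X n)))) \<in> borel_measurable \<nu>" for n by measurable
  show "(\<lambda>x. cis (- (2 * pi * (x \<bullet> \<xi>)))) \<in> borel_measurable \<nu>" by measurable
  show "(\<lambda>n. cis (- (2 * pi * (x \<bullet> X n)))) \<longlonglongrightarrow> cis (- (2 * pi * (x \<bullet> \<xi>)))" for x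
    unfolding cis_conv_exp by (intro tendsto_intros assms)
qed simp

lemma tendsto_sphere_energy:
  assumes W: "subspace W" and X: "X \<longlonglongrightarrow> R"
  shows "(\<lambda>n. sphere_energy \<nu> (X n) W) \<longlonglongrightarrow> sphere_energy \<nu> R W"
  unfolding sphere_energy_def
proof (rule tendsto_integral_bounded[OF prob_space_sphere_measure[OF W]])
  show "(\<lambda>n. (cmod (fourier \<nu> (X n *\<^sub>R \<theta>)))\<^sup>2) \<longlonglongrightarrow> (cmod (fourier \<nu> (R *\<^sub>R \<theta>)))\<^sup>2" for \<theta>
    by (intro tendsto_power tendsto_norm tendsto_fourier tendsto_scaleR X tendsto_const)
qed (auto simp: fourier_sq_le_1)

lemma sphere_energy_measurable_radius:
  assumes "subspace W" shows "(\<lambda>R. sphere_energy \<nu> R W) \<in> borel_measurable borel"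
  by (intro borel_measurable_continuous_onI continuous_at_imp_continuous_on)
     (auto simp: continuous_at_sequentially o_def tendsto_sphere_energy[OF assms])

lemma mean_energy_measurable:
  assumes m: "prob_space m" and sub: "\<And>W. W \<in> space m \<Longrightarrow> subspace W"
    and e: "\<And>R. sphere_energy \<nu> R \<in> borel_measurable m"
  shows "(\<lambda>R. LINT W|m. sphere_energy \<nu> R W) \<in> borel_measurable borel"
proof (intro borel_measurable_continuous_onI continuous_at_imp_continuous_on ballI)
  fix R
  show "isCont (\<lambda>R. LINT W|m. sphere_energy \<nu> R W) R"
    unfolding continuous_at_sequentially o_def
  proof (intro allI impI)
    fix X :: "nat \<Rightarrow> real" assume X: "X \<longlonglongrightarrow> R"
    show "(\<lambda>n. LINT W|m. sphere_energy \<nu> (X n) W) \<longlonglongrightarrow> (LINT W|m. sphere_energy \<nu> R W)"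
      by (rule tendsto_integral_bounded[OF m e e tendsto_sphere_energy[OF sub X]])
         (simp_all add: sphere_energy_bounds[OF sub])
  qed
qed

text \<open>Polar coordinates; for \<open>R \<ge> 1\<close> the Sobolev weight is comparable to \<open>R\<close> to the power \<open>s - dim V\<close>, which the Jacobian turns into \<open>R\<^sup>s\<^sup>-\<^sup>1\<close>.\<close>

lemma sobolev_integral_finite:
  assumes V: "subspace V" "1 \<le> dim V" and s: "real (dim V) \<le> s"
    and fin: "(\<integral>\<^sup>+R\<in>{1..}. ennreal (R powr (s - 1) * sphere_energy \<nu> R V) \<partial>lborel) < \<infinity>"
  shows "(\<integral>\<^sup>+\<xi>. ennreal ((1 + (norm \<xi>)\<^sup>2) powr ((s - real (dim V)) / 2) * (cmod (fourier \<nu> \<xi>))\<^sup>2) \<partial>leb_on V) < \<infinity>"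
proof -
  let ?k = "dim V"
  define u where "u = (s - real ?k) / 2"
  have u: "u \<ge> 0" using s by (simp add: u_def)
  interpret S: prob_space "sphere_measure V" by (rule prob_space_sphere_measure[OF V(1)])
  note [measurable] = sphere_energy_measurable_radius[OF V(1)]
  obtain c where c: "c > 0" "\<forall>h\<in>borel_measurable borel. (\<integral>\<^sup>+x. h x \<partial>leb_on V)
      = (\<integral>\<^sup>+R. ennreal (c * R ^ (?k - 1)) * indicator {0..} R * (\<integral>\<^sup>+\<theta>. h (R *\<^sub>R \<theta>) \<partial>sphere_measure V) \<partial>lborel)"
    using polar_coordinates[OF V] by (elim exE conjE) (rule that)
  let ?h = "\<lambda>\<xi>. ennreal ((1 + (norm \<xi>)\<^sup>2) powr u * (cmod (fourier \<nu> \<xi>))\<^sup>2)"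
  have inner: "(\<integral>\<^sup>+\<theta>. ?h (R *\<^sub>R \<theta>) \<partial>sphere_measure V) = ennreal ((1 + R\<^sup>2) powr u * sphere_energy \<nu> R V)" for R
  proof -
    have "(\<integral>\<^sup>+\<theta>. ?h (R *\<^sub>R \<theta>) \<partial>sphere_measure V) = (\<integral>\<^sup>+\<theta>. ennreal ((1 + R\<^sup>2) powr u * (cmod (fourier \<nu> (R *\<^sub>R \<theta>)))\<^sup>2) \<partial>sphere_measure V)"
      by (rule nn_integral_cong_AE, rule eventually_mono[OF AE_sphere_measure[OF V]]) simp
    also have "\<dots> = ennreal (LINT \<theta>|sphere_measure V. (1 + R\<^sup>2) powr u * (cmod (fourier \<nu> (R *\<^sub>R \<theta>)))\<^sup>2)"
      by (intro nn_integral_eq_integral integrable_mult_right integrable_energy[OF V(1)]) auto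
    finally show ?thesis by (simp add: sphere_energy_def)
  qed
  let ?K = "c * 2 powr u"
  have "?h \<in> borel_measurable borel" by measurable
  then have "(\<integral>\<^sup>+\<xi>. ?h \<xi> \<partial>leb_on V) = (\<integral>\<^sup>+R. ennreal (c * R ^ (?k - 1)) * indicator {0..} R * ennreal ((1 + R\<^sup>2) powr u * sphere_energy \<nu> R V) \<partial>lborel)"
    by (simp only: c(2)[rule_format] inner)
  also have "\<dots> \<le> (\<integral>\<^sup>+R. ennreal ?K * (indicator {0..1} R + ennreal (R powr (s - 1) * sphere_energy \<nu> R V) * indicator {1..} R) \<partial>lborel)"
  proof (rule nn_integral_mono)
    fix R :: real
    note b = sphere_energy_bounds[OF V(1), of R]
    consider "R < 0" | "0 \<le> R" "R < 1" | "1 \<le> R" by linarith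
    then show "ennreal (c * R ^ (?k - 1)) * indicator {0..} R * ennreal ((1 + R\<^sup>2) powr u * sphere_energy \<nu> R V)
      \<le> ennreal ?K * (indicator {0..1} R + ennreal (R powr (s - 1) * sphere_energy \<nu> R V) * indicator {1..} R)"
    proof cases
      case 2
      have "R ^ (?k - 1) * ((1 + R\<^sup>2) powr u * sphere_energy \<nu> R V) \<le> 1 * (2 powr u * 1)"
      proof (intro mult_mono)
        have "1 + R\<^sup>2 \<le> 2" using 2 by (simp add: power_le_one)
        then show "(1 + R\<^sup>2) powr u \<le> 2 powr u" using u by (intro powr_mono2) auto
      qed (use 2 b in \<open>auto simp: power_le_one\<close>)
      then have "c * R ^ (?k - 1) * ((1 + R\<^sup>2) powr u * sphere_energy \<nu> R V) \<le> ?K"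
        using c(1) by (simp add: mult.assoc mult_left_mono)
      then show ?thesis using 2 b c(1) by (simp add: ennreal_mult'[symmetric] ennreal_leI)
    next
      case 3
      have "1 + R\<^sup>2 \<le> 2 * R powr 2" using 3 by (simp add: powr_realpow)
      then have "(1 + R\<^sup>2) powr u \<le> (2 * R powr 2) powr u" using u by (intro powr_mono2) auto
      also have "\<dots> = 2 powr u * R powr (s - real ?k)"
      proof -
        have "2 * u = s - real ?k" by (simp add: u_def)
        then have "(R powr 2) powr u = R powr (s - real ?k)" by (simp only: powr_powr)
        moreover have "(2 * x) powr u = 2 powr u * x powr u" if "0 \<le> x" for x by (simp add: powr_mult that)
        ultimately show ?thesis by (simp only: powr_ge_zero)
      qed
      finally have "R ^ (?k - 1) * (1 + R\<^sup>2) powr u \<le> R ^ (?k - 1) * (2 powr u * R powr (s - real ?k))"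
        using 3 by (intro mult_left_mono) auto
      also have "R ^ (?k - 1) = R powr (real ?k - 1)"
        using 3 V(2) powr_realpow[of R "?k - 1"] by (simp add: of_nat_diff)
      also have "R powr (real ?k - 1) * (2 powr u * R powr (s - real ?k)) = 2 powr u * R powr (s - 1)"
        by (simp add: powr_add[symmetric])
      finally have "R ^ (?k - 1) * (1 + R\<^sup>2) powr u \<le> 2 powr u * R powr (s - 1)"
        by (simp only: \<open>R ^ (?k - 1) = R powr (real ?k - 1)\<close>)
      then have "c * (R ^ (?k - 1) * (1 + R\<^sup>2) powr u) * sphere_energy \<nu> R V \<le> c * (2 powr u * R powr (s - 1)) * sphere_energy \<nu> R V"
        using b c(1) by (intro mult_right_mono mult_left_mono) auto
      then have "ennreal (c * R ^ (?k - 1) * ((1 + R\<^sup>2) powr u * sphere_energy \<nu> R V)) \<le> ennreal (?K * (R powr (s - 1) * sphere_energy \<nu> R V))"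
        by (intro ennreal_leI) (simp add: mult_ac)
      then have "ennreal (c * R ^ (?k - 1) * ((1 + R\<^sup>2) powr u * sphere_energy \<nu> R V)) \<le> ennreal ?K * ennreal (R powr (s - 1) * sphere_energy \<nu> R V)"
        using b c(1) by (simp add: ennreal_mult)
      also have "\<dots> \<le> ennreal ?K * (indicator {0..1} R + ennreal (R powr (s - 1) * sphere_energy \<nu> R V))"
        by (intro mult_left_mono) auto
      finally show ?thesis using 3 b c(1) by (simp add: ennreal_mult'[symmetric])
    qed simp
  qed
  also have "\<dots> = ennreal ?K * (1 + (\<integral>\<^sup>+R\<in>{1..}. ennreal (R powr (s - 1) * sphere_energy \<nu> R V) \<partial>lborel))"
    by (simp add: nn_integral_cmult nn_integral_add)
  also have "\<dots> < \<infinity>" using fin by (simp add: ennreal_mult_less_top ennreal_add_less_top)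
  finally show ?thesis unfolding u_def .
qed

text \<open>On \<open>V\<close> the transform of the projected measure is the restriction of the transform of \<open>\<nu>\<close>.\<close>

lemma projection_in_sobolev:
  assumes V: "subspace V" and C: "AE x in \<nu>. norm x < C" and t: "t \<ge> 0"
    and fin: "(\<integral>\<^sup>+\<xi>. ennreal ((1 + (norm \<xi>)\<^sup>2) powr t * (cmod (fourier \<nu> \<xi>))\<^sup>2) \<partial>leb_on V) < \<infinity>"
  shows "absolutely_continuous (leb_on V) (distr \<nu> borel (orth_proj V)) \<and> measure_in_sobolev t V (distr \<nu> borel (orth_proj V))"
proof -
  have pm: "orth_proj V \<in> borel \<rightarrow>\<^sub>M borel"
    by (intro borel_measurable_continuous_onI linear_continuous_on bounded_linear_orth_proj V)
  then have pn: "orth_proj V \<in> \<nu> \<rightarrow>\<^sub>M borel" by (simp only: measurable_cong_sets[OF sets_borel refl])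
  let ?\<mu> = "distr \<nu> borel (orth_proj V)"
  have four: "fourier ?\<mu> \<xi> = fourier \<nu> \<xi>" if "\<xi> \<in> V" for \<xi>
    unfolding fourier_cis by (subst integral_distr[OF pn]) (simp_all add: orth_proj_inner[OF V that])
  have "(\<integral>\<^sup>+\<xi>. ennreal ((1 + (norm \<xi>)\<^sup>2) powr t * (cmod (fourier ?\<mu> \<xi>))\<^sup>2) \<partial>leb_on V)
     = (\<integral>\<^sup>+\<xi>. ennreal ((1 + (norm \<xi>)\<^sup>2) powr t * (cmod (fourier \<nu> \<xi>))\<^sup>2) \<partial>leb_on V)"
    by (rule nn_integral_cong_AE, rule eventually_mono[OF AE_leb_on[OF V]]) (simp add: four)
  then have fin': "(\<integral>\<^sup>+\<xi>. ennreal ((1 + (norm \<xi>)\<^sup>2) powr t * (cmod (fourier ?\<mu> \<xi>))\<^sup>2) \<partial>leb_on V) < \<infinity>"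
    using fin by simp
  have "AE y in ?\<mu>. y \<in> V \<and> norm y < C"
  proof (subst AE_distr_iff[OF pn])
    have "closed V" by (rule closed_subspace[OF V])
    then have "V \<in> sets borel" by (rule borel_closed)
    moreover have "open {y :: 'a. norm y < C}" by (intro open_Collect_less continuous_intros)
    then have "{y :: 'a. norm y < C} \<in> sets borel" by (rule borel_open)
    ultimately have "V \<inter> {y. norm y < C} \<in> sets borel" by (rule sets.Int)
    then show "{y \<in> space borel. y \<in> V \<and> norm y < C} \<in> sets borel" by (simp add: Int_def)
    show "AE x in \<nu>. orth_proj V x \<in> V \<and> norm (orth_proj V x) < C"
      by (rule eventually_mono[OF C]) (use orth_proj_mem[OF V] norm_orth_proj_le[OF V] le_less_trans in blast)
  qed
  then show ?thesis
    by (intro measure_in_sobolev_criterion[OF prob_space_distr[OF pn] _ V _ t fin']) auto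
qed

end

lemma (in orbit_measure) sphere_energy_smooth:
  assumes \<nu>: "borel_prob \<nu>" and supp: "AE x in \<nu>. norm x < C" and C: "C \<ge> 1" and V: "1 \<le> dim V"
    and T: "1 \<le> T" "0 \<le> R" "R \<le> T"
  shows "orbit_smooth (4 * pi * C * T) (sphere_energy \<nu> R)"
  unfolding orbit_smooth_def
proof (intro allI ballI impI)
  fix J :: nat and Q and h :: real and W k
  assume *: "1 \<le> J" "Q \<in> G" "0 \<le> h" "W \<in> Orb" "4 * pi * C * T * h \<le> 1" "\<forall>x. norm (Q *v x - x) \<le> h * norm x"
  have eq: "rotate_set Q = (`) ((*v) Q)" by (intro ext) (simp add: rotate_set_def)
  show "\<bar>fdiffs J (\<lambda>j. sphere_energy \<nu> R ((rotate_set Q ^^ j) W)) k\<bar> \<le> cis_const J * (4 * pi * C * T * h) ^ J"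
    unfolding eq
    by (rule borel_prob.sphere_energy_differences[OF \<nu> supp C T orbitD(1)[OF *(4)] _ matrix_vector_mul_linear
          rotation_norm[OF rotation[OF *(2)]] *(6)[rule_format] *(3,5,1)])
       (use V in \<open>simp add: orbitD(2)[OF *(4)]\<close>)
qed

text \<open>The number \<open>L\<close> is chosen strictly between the two sides of the spectral hypothesis, so that \<open>\<Sum>\<^sub>a p\<^sub>a \<parallel>P\<^sub>a\<parallel> < r_min\<^sup>L\<close>; if the sum vanishes, any \<open>L\<close> beyond the right side will do.\<close>

theorem theorem1p8:
  fixes n k :: nat
    and r p :: "nat \<Rightarrow> real"
    and Q :: "nat \<Rightarrow> real^'d^'d"
    and t :: "nat \<Rightarrow> real^'d"
    and V :: "(real^'d) set"
    and G :: "(real^'d^'d) set"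
    and \<nu> :: "(real^'d) measure"
    and m :: "(real^'d) set measure"
    and \<sigma> s :: real
  assumes "CARD('d) \<ge> 3"
    and "\<And>i. i \<in> {1..n} \<Longrightarrow> 0 < \<bar>r i\<bar> \<and> \<bar>r i\<bar> < 1"
    and "\<And>i. i \<in> {1..n} \<Longrightarrow> rotation_matrix (Q i)"
    and "\<And>i. i \<in> {1..n} \<Longrightarrow> 0 < p i"
    and "(\<Sum>i=1..n. p i) = 1"
    and "self_similar_measure n p (\<lambda>i x. r i *\<^sub>R (Q i *v x) + t i) \<nu>"
    and "1 \<le> k" and "k < CARD('d)"
    and "subspace V" and "dim V = k"
    and "G = closed_group (Q ` {1..n})"
    and "invariant_prob G V m"
    and "dim2 \<nu> m > real k"
    and "\<sigma> > real (manifold_dim (orbit_topology G V)) / 2"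
    and "real k \<le> s" and "s < dim2 \<nu> m"
    and "neg_log (\<Sum>a\<in>(\<lambda>i. \<bar>r i\<bar>) ` {1..n}.
                    level_prob n r p a * opnorm_L2_0 m (markov_op n r p Q a))
           / ereal (Max ((\<lambda>i. - ln \<bar>r i\<bar>) ` {1..n}))
         > ereal (s * (dim2 \<nu> m + \<sigma>) / (dim2 \<nu> m - s))"
  shows "absolutely_continuous (leb_on V) (distr \<nu> borel (orth_proj V))
       \<and> measure_in_sobolev ((s - real k) / 2) V (distr \<nu> borel (orth_proj V))"
proof -
  note r = assms(2) and rot = assms(3) and p = assms(4,5) and k = assms(7) and V = assms(9,10) and G = assms(11)
    and inv = assms(12) and dim = assms(13) and \<sigma> = assms(14) and s = assms(15,16) and rate = assms(17)
  interpret S: self_similar n r p Q t \<nu> by unfold_locales (use assms in auto)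
  have \<nu>: "borel_prob \<nu>" by (rule S.borel_prob_axioms)
  have rots: "rotation_matrix A" if "A \<in> Q ` {1..n}" for A using that rot by auto
  have rg: "rotation_group G" unfolding G by (rule rotation_group_closed_group(1)[OF rots])
  have QG: "Q i \<in> G" if "i \<in> {1..n}" for i
    using rotation_group_closed_group(2)[OF rots] that unfolding G by blast
  have m: "prob_space m" using inv by (simp add: invariant_prob_def)
  interpret O: orbit_measure G V m
    by (intro orbit_measure.intro rotation_orbit.intro rotation_orbit_axioms.intro orbit_measure_axioms.intro rg m inv V)
  obtain C where C: "C \<ge> 1" "AE x in \<nu>. norm x < C" using S.bounded_support by (elim exE conjE) (rule that)
  have dimV: "1 \<le> dim V" using V k by simp
  have smooth: "O.orbit_smooth (4 * pi * C * T) (sphere_energy \<nu> R)" if "1 \<le> T" "0 \<le> R" "R \<le> T" for T R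
    by (rule O.sphere_energy_smooth[OF \<nu> C(2,1) dimV that])
  have Z0: "1 \<le> 4 * pi * C" using mult_mono[of 1 "4 * pi" 1 C] C(1) pi_ge_two by simp
  have meas_pos: "sphere_energy \<nu> R \<in> borel_measurable m" if "0 \<le> R" for R
    using C(1) by (intro O.orbit_smooth_measurable[OF smooth[of "max 1 R"]] mult_pos_pos) (use that in auto)
  have meas: "sphere_energy \<nu> R \<in> borel_measurable m" for R
  proof -
    have "sphere_energy \<nu> R W = sphere_energy \<nu> \<bar>R\<bar> W" if "W \<in> space m" for W
      using S.sphere_energy_uminus[OF O.orbitD(1), of W R] that by (cases "R \<ge> 0") (auto simp: O.space_m)
    then show ?thesis using meas_pos[of "\<bar>R\<bar>"] by (subst measurable_cong) auto
  qed
  interpret E: orbit_recursion G V m n r p Q "sphere_energy \<nu>" S.rmin S.rmax "4 * pi * C"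
  proof unfold_locales
    show "\<And>i. i \<in> {1..n} \<Longrightarrow> 0 < p i" "(\<Sum>i=1..n. p i) = 1" by (fact p)+
    show "\<And>i. i \<in> {1..n} \<Longrightarrow> S.rmin \<le> \<bar>r i\<bar> \<and> \<bar>r i\<bar> \<le> S.rmax" "0 < S.rmin" "S.rmax < 1" by (fact S.rmin_rmax)+
    show "0 \<le> sphere_energy \<nu> R W \<and> sphere_energy \<nu> R W \<le> 1" if "W \<in> orbit_of G V" for R W
      using S.sphere_energy_bounds[OF O.orbitD(1)[OF that]] by simp
    show "sphere_energy \<nu> R W \<le> (\<Sum>i=1..n. p i * sphere_energy \<nu> (\<bar>r i\<bar> * R) (rotate_set (transpose (Q i)) W))"
      if "W \<in> orbit_of G V" for R W by (rule S.sphere_energy_recursion[OF O.orbitD(1)[OF that]])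
    show "(\<lambda>R. LINT W|m. sphere_energy \<nu> R W) \<in> borel_measurable borel"
      by (rule S.mean_energy_measurable[OF m _ meas]) (simp add: O.space_m O.orbitD)
    show "(\<lambda>R. sphere_energy \<nu> R V) \<in> borel_measurable borel" by (rule S.sphere_energy_measurable_radius[OF V(1)])
  qed (use QG Z0 smooth in auto)
  let ?lam = "\<Sum>a\<in>(\<lambda>i. \<bar>r i\<bar>) ` {1..n}. level_prob n r p a * opnorm_L2_0 m (markov_op n r p Q a)"
  let ?X = "s * (dim2 \<nu> m + \<sigma>) / (dim2 \<nu> m - s)"
  have Max: "Max ((\<lambda>i. - ln \<bar>r i\<bar>) ` {1..n}) = - ln S.rmin"
  proof (rule Max_eqI)
    show "y \<le> - ln S.rmin" if "y \<in> (\<lambda>i. - ln \<bar>r i\<bar>) ` {1..n}" for y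
    proof -
      obtain i where i: "i \<in> {1..n}" "y = - ln \<bar>r i\<bar>" using \<open>y \<in> _\<close> by blast
      have "0 < S.rmin" "S.rmin \<le> \<bar>r i\<bar>" using S.rmin_rmax(1) S.rmin_rmax(4)[OF i(1)] by auto
      then have "ln S.rmin \<le> ln \<bar>r i\<bar>" by (subst ln_le_cancel_iff) linarith+
      then show ?thesis unfolding i(2) by simp
    qed
    have "S.rmin \<in> (\<lambda>i. \<bar>r i\<bar>) ` {1..n}" unfolding S.rmin_def using S.n_pos by (intro Min_in) auto
    then show "- ln S.rmin \<in> (\<lambda>i. - ln \<bar>r i\<bar>) ` {1..n}" by auto
  qed simp
  have ln_pos: "- ln S.rmin > 0" using S.rmin_rmax(1) S.rmin_less_1 by simp
  have lam0: "0 \<le> ?lam" using E.level_prob_pos E.opnorm_nonneg by (intro sum_nonneg mult_nonneg_nonneg) (auto simp: less_imp_le)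
  obtain L where L: "?X < L" "?lam < S.rmin powr L"
  proof (cases "?lam = 0")
    case True
    show thesis by (rule that[of "?X + 1"]) (use True S.rmin_rmax(1) in auto)
  next
    case False
    then have "ereal ?X < ereal (- ln ?lam / - ln S.rmin)" using rate ln_pos unfolding Max neg_log_def by simp
    then have "?X < - ln ?lam / - ln S.rmin" by simp
    then obtain L where L: "?X < L" "L < - ln ?lam / - ln S.rmin" using dense by blast
    have "ln ?lam < L * ln S.rmin" using L(2) ln_pos by (simp only: pos_less_divide_eq)
    moreover have "0 < ?lam" using False lam0 by simp
    ultimately have "?lam < exp (L * ln S.rmin)" by (metis exp_less_cancel_iff exp_ln)
    then show thesis using L(1) S.rmin_rmax(1) by (intro that) (auto simp: powr_def)
  qed
  have "(\<integral>\<^sup>+R\<in>{1..}. ennreal (R powr (s - 1) * sphere_energy \<nu> R V) \<partial>lborel) < \<infinity>"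
  proof (rule E.energy_integral_finite[OF L(2,1) _ s(2) \<sigma>])
    show "1 \<le> s" using s(1) k by simp
    fix t0 assume t0: "t0 < dim2 \<nu> m"
    let ?A = "{t. 0 \<le> t \<and> t \<le> real CARD('d) \<and> (\<integral>\<^sup>+R\<in>{1..}. ennreal (R powr (t - 1) * sphere_average \<nu> m R) \<partial>lborel) < \<infinity>}"
    \<comment> \<open>the maximum with \<open>0\<close> excludes the default element \<open>0\<close> of the set\<close>
    have "max t0 0 < Sup (insert 0 ?A)" using t0 dim k unfolding dim2_def by simp
    moreover have "bdd_above (insert 0 ?A)" by (rule bdd_aboveI[of _ "real CARD('d)"]) auto
    ultimately have "\<exists>x\<in>insert 0 ?A. max t0 0 < x" using less_cSup_iff[of "insert 0 ?A" "max t0 0"] by blast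
    then obtain x where "x \<in> insert 0 ?A" "max t0 0 < x" by (elim bexE) (rule that)
    then show "\<exists>t>t0. (\<integral>\<^sup>+R\<in>{1..}. ennreal (R powr (t - 1) * (LINT W|m. sphere_energy \<nu> R W)) \<partial>lborel) < \<infinity>"
      by (auto simp: sphere_average_eq)
  qed
  then have "(\<integral>\<^sup>+\<xi>. ennreal ((1 + (norm \<xi>)\<^sup>2) powr ((s - real k) / 2) * (cmod (fourier \<nu> \<xi>))\<^sup>2) \<partial>leb_on V) < \<infinity>"
    using S.sobolev_integral_finite[OF V(1) dimV, of s] s(1) V(2) by simp
  then show ?thesis using s(1) by (intro S.projection_in_sobolev[OF V(1) C(2)]) auto
qed

end
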